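(* Consider the polynomial control-affine system $\dot x=f(x)+g(x)u$, $y=h(x)$ with $f(x)=Ax+\sum_{p=2}^{\ell}F_p x^{\otimes p}$, $g(x)=B+\sum_{p=1}^{\ell}G_p(x^{\otimes p}\otimes I_m)$, $h(x)=Cx+\sum_{p=2}^{\ell}H_p x^{\otimes p}$, where $x\in\mathbb{R}^n$, $u\in\mathbb{R}^m$, $y\in\mathbb{R}^r$. Let $\gamma>\gamma_0\ge 0$ and $\eta=1-\gamma^{-2}$, where $\gamma_0$ denotes the smallest $\tilde\gamma$ such that a stabilizing controller exists for which the $\mathcal{H}_\infty$ norm of the closed-loop system is less than $\tilde\gamma$. Let the future energy function $\mathcal{E}_\gamma^+(x)$, which solves the Hamilton-Jacobi-Bellman equation $$0=\frac{\partial \mathcal{E}_\gamma^+(x)}{\partial x}f(x)-\frac{\eta}{2}\frac{\partial \mathcal{E}_\gamma^+(x)}{\partial x}g(x)g(x)^\top\frac{\partial^\top \mathcal{E}_\gamma^+(x)}{\partial x}+\frac12h(x)^\top h(x),$$ be of the form $\mathcal{E}_\gamma^+(x)\approx\frac12\sum_{i=2}^{d}w_i^\top x^{\otimes i}$ (degree-$d$ Taylor expansion) with coefficients $w_i\in\mathbb{R}^{n^i}$, $i=2,\dots,d$. Then $w_2=\mathrm{vec}[W_2]$, where $W_2$ is the symmetric positive semidefinite solution of the $\mathcal{H}_\infty$ algebraic Riccati equation $$0=A^\top W_2+W_2A+C^\top C-\eta W_2BB^\top W_2 .$$ For $3\le k\le d$, let $\tilde w_k\in\mathbb{R}^{n^k}$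 solve the linear system $$\begin{aligned} \mathcal{L}_k(A-\eta BB^\top W_2)^\top\tilde w_k={}&-\sum_{\substack{i,p\ge2\\ i+p=k+1}}\mathcal{L}_i(F_p)^\top w_i+\frac{\eta}{4}\sum_{\substack{i,j>2\\ i+j=k+2}}ij\,\mathrm{vec}\big[W_i^\top BB^\top W_j\big]-\sum_{\substack{p,q\ge1\\ p+q=k}}\mathrm{vec}\big[H_p^\top H_q\big]\\ &+\frac{\eta}{4}\sum_{o=1}^{2\ell}\ \sum_{\substack{p,q\ge0\\ p+q=o}}\ \sum_{\substack{i,j\ge2\\ i+j=k-o+2}}ij\,\mathrm{vec}\Big[\big(I_{n^p}\otimes\mathrm{vec}[I_m]^\top\big)\Big(\mathrm{vec}[G_q^\top W_j]^\top\otimes\big(G_p^\top W_i\otimes I_m\big)\Big)\\ &\qquad\qquad\times\big(I_{n^{j-1}}\otimes S_{n^{i-1}\times n^qm}\otimes I_m\big)\big(I_{n^{k-p}}\otimes\mathrm{vec}[I_m]\big)\Big], \end{aligned}$$ where $H_1:=C$ and $G_0:=B$. Then, for $3\le k\le d$, the coefficient $w_k\in\mathbb{R}^{n^k}$ is obtained by symmetrization of $\tilde w_k$.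
   Context: Notation. $x^{\otimes k}=x\otimes\cdots\otimes x$ ($k$ factors), $\otimes$ is the Kronecker product; $\mathrm{vec}[\cdot]$ stacks the columns of a matrix. Matrices: $A\in\mathbb{R}^{n\times n}$, $F_p\in\mathbb{R}^{n\times n^p}$, $B\in\mathbb{R}^{n\times m}$, $G_p\in\mathbb{R}^{n\times mn^p}$, $C\in\mathbb{R}^{r\times n}$, $H_p\in\mathbb{R}^{r\times n^p}$; coefficient matrices $F_p,G_p,H_p$ with $p>\ell$ are zero. The perfect shuffle matrix $S_{q\times p}$ is the permutation matrix with $\mathrm{vec}[M^\top]=S_{q\times p}\mathrm{vec}[M]$ for every $M\in\mathbb{R}^{p\times q}$. For $M\in\mathbb{R}^{p\times q}$, the $k$-way Lyapunov matrix is $\mathcal{L}_k(M)=\sum_{i=1}^k I_p\otimes\cdots\otimes M\otimes\cdots\otimes I_p\in\mathbb{R}^{p^k\times p^{k-1}q}$ ($k$ factors, $M$ in position $i$). A coefficient $w\in\mathbb{R}^{n^k}$ is symmetric if $w^\top(a_1\otimes\cdots\otimes a_k)=w^\top(a_{\sigma(1)}\otimes\cdots\otimes a_{\sigma(k)})$ for all $a_i\in\mathbb{R}^n$ and all permutations $\sigma$; the symmetrization of $\tilde w\in\mathbb{R}^{n^k}$ is the unique symmetric $w$ with $w^\top x^{\otimes k}=\tilde w^\top x^{\otimes k}$ for all $x$ (the average over permutations of the tensor factors). The coefficients $w_i$ are the symmetric representatives of the homogeneous parts of the expansion; $W_i\in\mathbb{R}^{n\times n^{i-1}}$ is the reshaping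 of $w_i$ with $w_i=\mathrm{vec}[W_i]$. Energy function. For $\gamma>0$, $\gamma\ne1$, the $\mathcal{H}_\infty$ future energy is $$\mathcal{E}_\gamma^+(x_0)=\min/\max_{u\in L_2[0,\infty),\,x(0)=x_0,\,x(\infty)=0}\frac12\int_0^{\infty}\|y(t)\|^2+\frac{\|u(t)\|^2}{\eta}\,dt,$$ with the minimum for $\gamma>1$ and the maximum for $\gamma<1$. Standing assumption: the displayed HJB equation has a solution with $\mathcal{E}_\gamma^+(0)=0$ such that $f(x)-\eta g(x)g(x)^\top\,\partial^\top\mathcal{E}_\gamma^+(x)/\partial x$ is asymptotically stable; this solution is the future energy function, and it is analytic near the origin.
   Formalization: W_2 is shown to be a symmetric PSD Riccati solution, and the only one just for γ>1 (for γ<1 uniqueness fails, e.g. A=-1, B=C=1); γ_0 is the infimum of levels over linear output-feedback controllers for the linear part (A,B,C), as mere nonlinear stability makes the claim false. *)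

theory Defs
  imports
    "HOL-Analysis.Analysis"
    "Jordan_Normal_Form.Char_Poly"
    "Jordan_Normal_Form.Gauss_Jordan_Elimination"
begin

text \<open>
  Vectors and matrices are those of \<open>Jordan_Normal_Form.Matrix\<close>, because the dimensions
  \<open>n ^ k\<close> vary inside one statement. The notation of the type-indexed vectors of
  \<open>HOL-Analysis\<close> is switched off.
\<close>

unbundle no vec_syntax
no_notation inner (infix "\<bullet>" 70)
hide_const (open) Finite_Cartesian_Product.vec Finite_Cartesian_Product.mat
  Finite_Cartesian_Product.row Finite_Cartesian_Product.column Determinants.det
hide_type (open) Finite_Cartesian_Product.vec


section \<open>Linear algebra\<close>

definition vnorm :: "'a::real_normed_vector vec \<Rightarrow> real" where
  "vnorm v = L2_set (\<lambda>i. norm (v $ i)) {..<dim_vec v}"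

definition ball0 :: "nat \<Rightarrow> real \<Rightarrow> real vec set" where
  "ball0 n \<rho> = {x \<in> carrier_vec n. vnorm x < \<rho>}"

definition vec_sum :: "nat \<Rightarrow> ('i \<Rightarrow> real vec) \<Rightarrow> 'i set \<Rightarrow> real vec" where
  "vec_sum N a S = vec N (\<lambda>j. \<Sum>s\<in>S. a s $ j)"

definition mat_sum :: "nat \<Rightarrow> nat \<Rightarrow> ('i \<Rightarrow> real mat) \<Rightarrow> 'i set \<Rightarrow> real mat" where
  "mat_sum nr nc M S = mat nr nc (\<lambda>(i, j). \<Sum>s\<in>S. M s $$ (i, j))"

definition symmetric_matrix :: "real mat \<Rightarrow> bool" where
  "symmetric_matrix M \<longleftrightarrow> M\<^sup>T = M"

definition pos_semidef :: "nat \<Rightarrow> real mat \<Rightarrow> bool" where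
  "pos_semidef n M \<longleftrightarrow> M \<in> carrier_mat n n \<and> (\<forall>x\<in>carrier_vec n. 0 \<le> x \<bullet> (M *\<^sub>v x))"

definition kron :: "real mat \<Rightarrow> real mat \<Rightarrow> real mat" (infixl "\<otimes>\<^sub>m" 72) where
  "M \<otimes>\<^sub>m N = mat (dim_row M * dim_row N) (dim_col M * dim_col N)
     (\<lambda>(i, j). M $$ (i div dim_row N, j div dim_col N) * N $$ (i mod dim_row N, j mod dim_col N))"

definition kron_vec :: "real vec \<Rightarrow> real vec \<Rightarrow> real vec" where
  "kron_vec v w = vec (dim_vec v * dim_vec w) (\<lambda>i. v $ (i div dim_vec w) * w $ (i mod dim_vec w))"

definition kron_mats :: "real mat list \<Rightarrow> real mat" where
  "kron_mats Ms = foldr (\<otimes>\<^sub>m) Ms (1\<^sub>m 1)"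

definition kron_vecs :: "real vec list \<Rightarrow> real vec" where
  "kron_vecs vs = foldr kron_vec vs (vec 1 (\<lambda>_. 1))"

definition xpow :: "nat \<Rightarrow> real vec \<Rightarrow> real vec" where
  "xpow k x = kron_vecs (replicate k x)"

definition col_mat :: "real vec \<Rightarrow> real mat" where
  "col_mat v = mat (dim_vec v) 1 (\<lambda>(i, _). v $ i)"

definition vec_of_mat :: "real mat \<Rightarrow> real vec" where
  "vec_of_mat M = vec (dim_row M * dim_col M) (\<lambda>i. M $$ (i mod dim_row M, i div dim_row M))"

text \<open>
  Entry \<open>k\<close> of \<open>vec[M\<^sup>T]\<close> is the entry of \<open>M\<close> in row \<open>k div q\<close> and column
  \<open>k mod q\<close>; the two lemmas show that the matrix below is the only one with the
  defining property of the perfect shuffle.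
\<close>

definition perfect_shuffle :: "nat \<Rightarrow> nat \<Rightarrow> real mat" where
  "perfect_shuffle q p = mat (p * q) (p * q) (\<lambda>(k, l). if l = k div q + p * (k mod q) then 1 else 0)"

lemma shuffle_index:
  fixes k p q :: nat
  assumes "k < p * q"
  shows "k div q < p" "k mod q < q" "k div q + p * (k mod q) < p * q"
proof -
  show 1: "k div q < p" using assms by (simp add: less_mult_imp_div_less)
  show 2: "k mod q < q" using assms by (cases "q = 0") auto
  have "k div q + p * (k mod q) < p * (k mod q + 1)" using 1 by simp
  also have "\<dots> \<le> p * q" using 2 by (intro mult_le_mono2) simp
  finally show "k div q + p * (k mod q) < p * q" .
qed

lemma perfect_shuffle_vec:
  assumes M: "M \<in> carrier_mat p q"
  shows "vec_of_mat (M\<^sup>T) = perfect_shuffle q p *\<^sub>v vec_of_mat M"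
proof (rule eq_vecI)
  show "dim_vec (vec_of_mat (M\<^sup>T)) = dim_vec (perfect_shuffle q p *\<^sub>v vec_of_mat M)"
    using M by (auto simp: vec_of_mat_def perfect_shuffle_def)
next
  fix k assume "k < dim_vec (perfect_shuffle q p *\<^sub>v vec_of_mat M)"
  then have k: "k < p * q" by (simp add: perfect_shuffle_def)
  note kk = shuffle_index[OF k]
  have "(perfect_shuffle q p *\<^sub>v vec_of_mat M) $ k
      = (\<Sum>l\<in>{0..<p * q}. (if l = k div q + p * (k mod q) then 1 else 0) * vec_of_mat M $ l)"
    using k M by (simp add: perfect_shuffle_def scalar_prod_def vec_of_mat_def)
  also have "\<dots> = (\<Sum>l\<in>{0..<p * q}. if l = k div q + p * (k mod q) then vec_of_mat M $ l else 0)"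
    by (rule sum.cong) auto
  also have "\<dots> = vec_of_mat M $ (k div q + p * (k mod q))"
    using kk(3) by (simp add: sum.delta)
  also have "\<dots> = M $$ (k div q, k mod q)"
    using kk M by (simp add: vec_of_mat_def)
  also have "\<dots> = vec_of_mat (M\<^sup>T) $ k"
    using kk k M by (simp add: vec_of_mat_def mult.commute)
  finally show "vec_of_mat (M\<^sup>T) $ k = (perfect_shuffle q p *\<^sub>v vec_of_mat M) $ k" by simp
qed

lemma perfect_shuffle_unique:
  assumes S: "S \<in> carrier_mat (p * q) (p * q)"
    and vec: "\<And>M. M \<in> carrier_mat p q \<Longrightarrow> vec_of_mat (M\<^sup>T) = S *\<^sub>v vec_of_mat M"
  shows "S = perfect_shuffle q p"
proof (rule eq_matI)
  have P: "perfect_shuffle q p \<in> carrier_mat (p * q) (p * q)" by (simp add: perfect_shuffle_def)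
  show "dim_row S = dim_row (perfect_shuffle q p)" "dim_col S = dim_col (perfect_shuffle q p)"
    using S P by auto
  fix k l assume "k < dim_row (perfect_shuffle q p)" "l < dim_col (perfect_shuffle q p)"
  then have k: "k < p * q" and l: "l < p * q" using P by auto
  define M :: "real mat" where "M = mat p q (\<lambda>(i, j). if j * p + i = l then 1 else 0)"
  have M: "M \<in> carrier_mat p q" by (simp add: M_def)
  have "vec_of_mat M = unit_vec (p * q) l"
  proof (rule eq_vecI)
    fix i assume "i < dim_vec (unit_vec (p * q) l :: real vec)"
    then have i: "i < q * p" by (simp add: mult.commute)
    then show "vec_of_mat M $ i = unit_vec (p * q) l $ i"
      using shuffle_index(1,2)[OF i] l by (auto simp: vec_of_mat_def M_def mult.commute)
  qed (simp add: vec_of_mat_def M_def)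
  then have "S *\<^sub>v unit_vec (p * q) l = perfect_shuffle q p *\<^sub>v unit_vec (p * q) l"
    using vec[OF M] perfect_shuffle_vec[OF M] by simp
  then have "(S *\<^sub>v unit_vec (p * q) l) $ k = (perfect_shuffle q p *\<^sub>v unit_vec (p * q) l) $ k"
    by simp
  then show "S $$ (k, l) = perfect_shuffle q p $$ (k, l)"
    using S P k l by simp
qed

definition lyap :: "nat \<Rightarrow> real mat \<Rightarrow> real mat" where
  "lyap k M = mat_sum (dim_row M ^ k) (dim_row M ^ (k - 1) * dim_col M)
     (\<lambda>i. kron_mats (map (\<lambda>j. if j = i then M else 1\<^sub>m (dim_row M)) [1..<k + 1])) {1..k}"

definition symmetric_coeff :: "nat \<Rightarrow> nat \<Rightarrow> real vec \<Rightarrow> bool" where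
  "symmetric_coeff n k w \<longleftrightarrow> w \<in> carrier_vec (n ^ k) \<and>
     (\<forall>a \<sigma>. (\<forall>i<k. a i \<in> carrier_vec n) \<and> \<sigma> permutes {..<k} \<longrightarrow>
        w \<bullet> kron_vecs (map a [0..<k]) = w \<bullet> kron_vecs (map (\<lambda>i. a (\<sigma> i)) [0..<k]))"

definition is_symmetrization :: "nat \<Rightarrow> nat \<Rightarrow> real vec \<Rightarrow> real vec \<Rightarrow> bool" where
  "is_symmetrization n k wt w \<longleftrightarrow> symmetric_coeff n k w \<and>
     (\<forall>x\<in>carrier_vec n. w \<bullet> xpow k x = wt \<bullet> xpow k x)"


section \<open>The polynomial control-affine system\<close>

definition poly_f :: "nat \<Rightarrow> nat \<Rightarrow> real mat \<Rightarrow> (nat \<Rightarrow> real mat) \<Rightarrow> real vec \<Rightarrow> real vec" where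
  "poly_f n l A F x = A *\<^sub>v x + vec_sum n (\<lambda>p. F p *\<^sub>v xpow p x) {2..l}"

definition poly_g :: "nat \<Rightarrow> nat \<Rightarrow> nat \<Rightarrow> real mat \<Rightarrow> (nat \<Rightarrow> real mat) \<Rightarrow> real vec \<Rightarrow> real mat" where
  "poly_g n m l B G x = B + mat_sum n m (\<lambda>p. G p * (col_mat (xpow p x) \<otimes>\<^sub>m 1\<^sub>m m)) {1..l}"

definition poly_h :: "nat \<Rightarrow> nat \<Rightarrow> real mat \<Rightarrow> (nat \<Rightarrow> real mat) \<Rightarrow> real vec \<Rightarrow> real vec" where
  "poly_h r l C H x = C *\<^sub>v x + vec_sum r (\<lambda>p. H p *\<^sub>v xpow p x) {2..l}"

definition system_dims :: "nat \<Rightarrow> nat \<Rightarrow> nat \<Rightarrow> nat \<Rightarrow> real mat \<Rightarrow> real mat \<Rightarrow> real mat \<Rightarrow>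
    (nat \<Rightarrow> real mat) \<Rightarrow> (nat \<Rightarrow> real mat) \<Rightarrow> (nat \<Rightarrow> real mat) \<Rightarrow> bool" where
  "system_dims n m r l A B C F G H \<longleftrightarrow>
     A \<in> carrier_mat n n \<and> B \<in> carrier_mat n m \<and> C \<in> carrier_mat r n \<and>
     (\<forall>p\<ge>2. F p \<in> carrier_mat n (n ^ p) \<and> H p \<in> carrier_mat r (n ^ p)) \<and>
     (\<forall>p\<ge>1. G p \<in> carrier_mat n (m * n ^ p)) \<and>
     (\<forall>p\<ge>2. p > l \<longrightarrow> F p = 0\<^sub>m n (n ^ p) \<and> H p = 0\<^sub>m r (n ^ p)) \<and>
     (\<forall>p\<ge>1. p > l \<longrightarrow> G p = 0\<^sub>m n (m * n ^ p))"


section \<open>The future energy function\<close>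

definition L2_input :: "nat \<Rightarrow> (real \<Rightarrow> real vec) \<Rightarrow> bool" where
  "L2_input m u \<longleftrightarrow> (\<forall>t\<ge>0. u t \<in> carrier_vec m) \<and>
     (\<forall>i<m. set_borel_measurable lborel {0..} (\<lambda>t. u t $ i) \<and>
            set_integrable lborel {0..} (\<lambda>t. (u t $ i)\<^sup>2))"

text \<open>
  Inputs are only square integrable, so trajectories of the controlled system are
  Caratheodory solutions, stated through the integral equation.
\<close>

definition controlled_trajectory :: "nat \<Rightarrow> (real vec \<Rightarrow> real vec) \<Rightarrow> (real vec \<Rightarrow> real mat) \<Rightarrow>
    (real \<Rightarrow> real vec) \<Rightarrow> real vec \<Rightarrow> (real \<Rightarrow> real vec) \<Rightarrow> bool" where
  "controlled_trajectory n f g u x0 x \<longleftrightarrow> (\<forall>t\<ge>0. x t \<in> carrier_vec n) \<and> x 0 = x0 \<and>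
     (\<forall>i<n. \<forall>t\<ge>0. set_integrable lborel {0..t} (\<lambda>s. (f (x s) + g (x s) *\<^sub>v u s) $ i) \<and>
        x t $ i = x0 $ i + set_lebesgue_integral lborel {0..t} (\<lambda>s. (f (x s) + g (x s) *\<^sub>v u s) $ i))"

text \<open>
  For an \<open>L2\<close> input the input part of the cost is finite, whereas the output part is a
  nonnegative extended real; keeping them apart makes the integral meaningful also for a negative
  \<open>\<eta>\<close> and an output of infinite energy.
\<close>

definition cost :: "real \<Rightarrow> (real vec \<Rightarrow> real vec) \<Rightarrow> (real \<Rightarrow> real vec) \<Rightarrow> (real \<Rightarrow> real vec) \<Rightarrow> ereal" where
  "cost \<eta> h u x = ereal (1/2) *
     (enn2ereal (\<integral>\<^sup>+ t. ennreal ((vnorm (h (x t)))\<^sup>2) * indicator {0..} t \<partial>lborel)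
      + ereal (set_lebesgue_integral lborel {0..} (\<lambda>t. (vnorm (u t))\<^sup>2 / \<eta>)))"

definition admissible_costs :: "nat \<Rightarrow> nat \<Rightarrow> real \<Rightarrow> (real vec \<Rightarrow> real vec) \<Rightarrow> (real vec \<Rightarrow> real mat) \<Rightarrow>
    (real vec \<Rightarrow> real vec) \<Rightarrow> real vec \<Rightarrow> ereal set" where
  "admissible_costs n m \<eta> f g h x0 = {cost \<eta> h u x | u x. L2_input m u \<and>
     controlled_trajectory n f g u x0 x \<and> (\<forall>i<n. ((\<lambda>t. x t $ i) \<longlongrightarrow> 0) at_top)}"

definition is_future_energy :: "nat \<Rightarrow> nat \<Rightarrow> real \<Rightarrow> real \<Rightarrow> (real vec \<Rightarrow> real vec) \<Rightarrow>
    (real vec \<Rightarrow> real mat) \<Rightarrow> (real vec \<Rightarrow> real vec) \<Rightarrow> real vec set \<Rightarrow> (real vec \<Rightarrow> real) \<Rightarrow> bool" where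
  "is_future_energy n m \<gamma> \<eta> f g h D E \<longleftrightarrow> (\<forall>x0\<in>D.
     ereal (E x0) \<in> admissible_costs n m \<eta> f g h x0 \<and>
     (\<forall>J\<in>admissible_costs n m \<eta> f g h x0. if \<gamma> > 1 then ereal (E x0) \<le> J else J \<le> ereal (E x0)))"

definition grad :: "nat \<Rightarrow> (real vec \<Rightarrow> real) \<Rightarrow> real vec \<Rightarrow> real vec" where
  "grad n E x = vec n (\<lambda>i. deriv (\<lambda>s. E (x + s \<cdot>\<^sub>v unit_vec n i)) 0)"

definition HJB :: "nat \<Rightarrow> real \<Rightarrow> (real vec \<Rightarrow> real vec) \<Rightarrow> (real vec \<Rightarrow> real mat) \<Rightarrow>
    (real vec \<Rightarrow> real vec) \<Rightarrow> (real vec \<Rightarrow> real) \<Rightarrow> real vec \<Rightarrow> bool" where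
  "HJB n \<eta> f g h E x \<longleftrightarrow>
     0 = grad n E x \<bullet> f x - \<eta> / 2 * (grad n E x \<bullet> (g x *\<^sub>v ((g x)\<^sup>T *\<^sub>v grad n E x))) + 1/2 * (h x \<bullet> h x)"

definition closed_loop_field :: "nat \<Rightarrow> real \<Rightarrow> (real vec \<Rightarrow> real vec) \<Rightarrow> (real vec \<Rightarrow> real mat) \<Rightarrow>
    (real vec \<Rightarrow> real) \<Rightarrow> real vec \<Rightarrow> real vec" where
  "closed_loop_field n \<eta> f g E x = f x - \<eta> \<cdot>\<^sub>v (g x *\<^sub>v ((g x)\<^sup>T *\<^sub>v grad n E x))"

definition solves_ode :: "nat \<Rightarrow> (real vec \<Rightarrow> real vec) \<Rightarrow> real vec \<Rightarrow> (real \<Rightarrow> real vec) \<Rightarrow> bool" where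
  "solves_ode n \<phi> x0 x \<longleftrightarrow> (\<forall>t\<ge>0. x t \<in> carrier_vec n) \<and> x 0 = x0 \<and>
     (\<forall>t\<ge>0. \<forall>i<n. ((\<lambda>s. x s $ i) has_real_derivative \<phi> (x t) $ i) (at t within {0..}))"

text \<open>Lyapunov stability and local attractivity of the origin, with forward completeness nearby.\<close>

definition asymptotically_stable :: "nat \<Rightarrow> (real vec \<Rightarrow> real vec) \<Rightarrow> bool" where
  "asymptotically_stable n \<phi> \<longleftrightarrow>
     (\<forall>\<epsilon>>0. \<exists>\<delta>>0. \<forall>x0\<in>ball0 n \<delta>. (\<exists>x. solves_ode n \<phi> x0 x) \<and>
        (\<forall>x. solves_ode n \<phi> x0 x \<longrightarrow> (\<forall>t\<ge>0. vnorm (x t) < \<epsilon>))) \<and>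
     (\<exists>\<delta>>0. \<forall>x0\<in>ball0 n \<delta>. \<forall>x. solves_ode n \<phi> x0 x \<longrightarrow> ((\<lambda>t. vnorm (x t)) \<longlongrightarrow> 0) at_top)"

text \<open>
  Analyticity at the origin: an expansion \<open>E(x) = 1/2 (\<Sum>i. c\<^sub>i\<^sup>T x\<^sup>\<otimes>\<^sup>i)\<close> converging absolutely, monomial
  by monomial, on a cube. The coefficients need not be symmetric.
\<close>

definition power_series_at_0 :: "nat \<Rightarrow> (real vec \<Rightarrow> real) \<Rightarrow> (nat \<Rightarrow> real vec) \<Rightarrow> bool" where
  "power_series_at_0 n E c \<longleftrightarrow> (\<forall>i. c i \<in> carrier_vec (n ^ i)) \<and>
     (\<exists>R>0. summable (\<lambda>i. (\<Sum>j<n ^ i. \<bar>c i $ j\<bar>) * R ^ i) \<and>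
        (\<forall>x\<in>carrier_vec n. (\<forall>j<n. \<bar>x $ j\<bar> < R) \<longrightarrow> (\<lambda>i. 1/2 * (c i \<bullet> xpow i x)) sums E x))"

text \<open>
  \<open>E\<close> is analytic near the origin, starts in degree two, and \<open>w i\<close> is the symmetric representative
  of its homogeneous part of degree \<open>i\<close> for \<open>2 \<le> i \<le> d\<close>.
\<close>

definition degree_d_expansion :: "nat \<Rightarrow> nat \<Rightarrow> (real vec \<Rightarrow> real) \<Rightarrow> (nat \<Rightarrow> real vec) \<Rightarrow> bool" where
  "degree_d_expansion n d E w \<longleftrightarrow> (\<exists>c. power_series_at_0 n E c \<and> c 0 = 0\<^sub>v 1 \<and> c 1 = 0\<^sub>v n \<and>
     (\<forall>i\<in>{2..d}. is_symmetrization n i (c i) (w i)))"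


section \<open>The optimal attenuation level\<close>

definition hurwitz :: "real mat \<Rightarrow> bool" where
  "hurwitz M \<longleftrightarrow> (\<forall>z. eigenvalue (map_mat complex_of_real M) z \<longrightarrow> Re z < 0)"

definition spectral_norm :: "complex mat \<Rightarrow> real" where
  "spectral_norm M = (SUP v\<in>{v \<in> carrier_vec (dim_col M). vnorm v \<le> 1}. vnorm (M *\<^sub>v v))"

definition transfer_matrix :: "real mat \<Rightarrow> real mat \<Rightarrow> real mat \<Rightarrow> real mat \<Rightarrow> complex \<Rightarrow> complex mat" where
  "transfer_matrix P Q R S s = map_mat complex_of_real R *
     the (mat_inverse (s \<cdot>\<^sub>m 1\<^sub>m (dim_row P) - map_mat complex_of_real P)) *
     map_mat complex_of_real Q + map_mat complex_of_real S"

definition hinf_norm :: "real mat \<Rightarrow> real mat \<Rightarrow> real mat \<Rightarrow> real mat \<Rightarrow> ereal" where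
  "hinf_norm P Q R S = (SUP s\<in>{s. 0 < Re s}. ereal (spectral_norm (transfer_matrix P Q R S s)))"

text \<open>
  The normalized \<open>H\<^sub>\<infinity>\<close> output feedback problem of Mustafa and Glover for the linear part of the
  system: the plant \<open>x' = A x + B w\<^sub>1 + B u\<close> with measurement \<open>C x + w\<^sub>2\<close> and performance output
  \<open>(C x, u)\<close>, under the dynamic controller \<open>\<xi>' = K\<^sub>A \<xi> + K\<^sub>B (C x + w\<^sub>2)\<close>,
  \<open>u = K\<^sub>C \<xi> + K\<^sub>D (C x + w\<^sub>2)\<close>. The four matrices realize the closed loop from \<open>(w\<^sub>1, w\<^sub>2)\<close> to
  \<open>(C x, u)\<close> with state \<open>(x, \<xi>)\<close>.
\<close>

definition cl_A :: "real mat \<Rightarrow> real mat \<Rightarrow> real mat \<Rightarrow> real mat \<Rightarrow> real mat \<Rightarrow> real mat \<Rightarrow> real mat \<Rightarrow> real mat" where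
  "cl_A A B C KA KB KC KD = four_block_mat (A + B * KD * C) (B * KC) (KB * C) KA"

definition cl_B :: "nat \<Rightarrow> nat \<Rightarrow> real mat \<Rightarrow> real mat \<Rightarrow> real mat \<Rightarrow> real mat" where
  "cl_B m q B KB KD = four_block_mat B (B * KD) (0\<^sub>m q m) KB"

definition cl_C :: "nat \<Rightarrow> nat \<Rightarrow> real mat \<Rightarrow> real mat \<Rightarrow> real mat \<Rightarrow> real mat" where
  "cl_C r q C KC KD = four_block_mat C (0\<^sub>m r q) (KD * C) KC"

definition cl_D :: "nat \<Rightarrow> nat \<Rightarrow> real mat \<Rightarrow> real mat" where
  "cl_D m r KD = four_block_mat (0\<^sub>m r m) (0\<^sub>m r r) (0\<^sub>m m m) KD"

definition attenuation_levels :: "nat \<Rightarrow> nat \<Rightarrow> nat \<Rightarrow> real mat \<Rightarrow> real mat \<Rightarrow> real mat \<Rightarrow> real set" where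
  "attenuation_levels n m r A B C = {\<gamma>. \<exists>q KA KB KC KD.
     KA \<in> carrier_mat q q \<and> KB \<in> carrier_mat q r \<and> KC \<in> carrier_mat m q \<and> KD \<in> carrier_mat m r \<and>
     hurwitz (cl_A A B C KA KB KC KD) \<and>
     hinf_norm (cl_A A B C KA KB KC KD) (cl_B m q B KB KD) (cl_C r q C KC KD) (cl_D m r KD) < ereal \<gamma>}"

text \<open>
  The set of levels is upward closed without a least element, so "the smallest level" is its
  infimum. It is taken in \<open>ereal\<close>: without a stabilizing controller it is infinite.
\<close>

definition optimal_level :: "nat \<Rightarrow> nat \<Rightarrow> nat \<Rightarrow> real mat \<Rightarrow> real mat \<Rightarrow> real mat \<Rightarrow> ereal" where
  "optimal_level n m r A B C = (INF \<gamma>\<in>attenuation_levels n m r A B C. ereal \<gamma>)"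


section \<open>Riccati equation and linear systems for the coefficients\<close>

definition hinf_ARE :: "nat \<Rightarrow> real \<Rightarrow> real mat \<Rightarrow> real mat \<Rightarrow> real mat \<Rightarrow> real mat \<Rightarrow> bool" where
  "hinf_ARE n \<eta> A B C X \<longleftrightarrow>
     0\<^sub>m n n = A\<^sup>T * X + X * A + C\<^sup>T * C - \<eta> \<cdot>\<^sub>m (X * B * B\<^sup>T * X)"

text \<open>
  In \<open>rhs_h\<close> and \<open>rhs_g\<close> the families \<open>H\<close> and \<open>G\<close> are meant to be extended by \<open>H\<^sub>1 = C\<close> and
  \<open>G\<^sub>0 = B\<close>. The total degree \<open>p + q\<close> is called \<open>s\<close>, and \<open>i + j = k - s + 2\<close> is written without subtraction.
\<close>

definition rhs_f :: "nat \<Rightarrow> (nat \<Rightarrow> real mat) \<Rightarrow> (nat \<Rightarrow> real vec) \<Rightarrow> nat \<Rightarrow> real vec" where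
  "rhs_f n F w k = vec_sum (n ^ k) (\<lambda>(i, p). (lyap i (F p))\<^sup>T *\<^sub>v w i)
     {(i, p). 2 \<le> i \<and> 2 \<le> p \<and> i + p = k + 1}"

definition rhs_b :: "nat \<Rightarrow> real mat \<Rightarrow> (nat \<Rightarrow> real mat) \<Rightarrow> nat \<Rightarrow> real vec" where
  "rhs_b n B W k = vec_sum (n ^ k)
     (\<lambda>(i, j). real (i * j) \<cdot>\<^sub>v vec_of_mat ((W i)\<^sup>T * B * B\<^sup>T * W j))
     {(i, j). 2 < i \<and> 2 < j \<and> i + j = k + 2}"

definition rhs_h :: "nat \<Rightarrow> (nat \<Rightarrow> real mat) \<Rightarrow> nat \<Rightarrow> real vec" where
  "rhs_h n H k = vec_sum (n ^ k) (\<lambda>(p, q). vec_of_mat ((H p)\<^sup>T * H q))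
     {(p, q). 1 \<le> p \<and> 1 \<le> q \<and> p + q = k}"

definition rhs_g_mat :: "nat \<Rightarrow> nat \<Rightarrow> (nat \<Rightarrow> real mat) \<Rightarrow> (nat \<Rightarrow> real mat) \<Rightarrow>
    nat \<Rightarrow> nat \<Rightarrow> nat \<Rightarrow> nat \<Rightarrow> nat \<Rightarrow> real mat" where
  "rhs_g_mat n m G W k p q i j =
     (1\<^sub>m (n ^ p) \<otimes>\<^sub>m (col_mat (vec_of_mat (1\<^sub>m m)))\<^sup>T)
     * ((col_mat (vec_of_mat ((G q)\<^sup>T * W j)))\<^sup>T \<otimes>\<^sub>m (((G p)\<^sup>T * W i) \<otimes>\<^sub>m 1\<^sub>m m))
     * (1\<^sub>m (n ^ (j - 1)) \<otimes>\<^sub>m perfect_shuffle (n ^ (i - 1)) (n ^ q * m) \<otimes>\<^sub>m 1\<^sub>m m)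
     * (1\<^sub>m (n ^ (k - p)) \<otimes>\<^sub>m col_mat (vec_of_mat (1\<^sub>m m)))"

definition rhs_g :: "nat \<Rightarrow> nat \<Rightarrow> nat \<Rightarrow> (nat \<Rightarrow> real mat) \<Rightarrow> (nat \<Rightarrow> real mat) \<Rightarrow> nat \<Rightarrow> real vec" where
  "rhs_g n m l G W k = vec_sum (n ^ k) (\<lambda>s. vec_sum (n ^ k) (\<lambda>(p, q). vec_sum (n ^ k)
       (\<lambda>(i, j). real (i * j) \<cdot>\<^sub>v vec_of_mat (rhs_g_mat n m G W k p q i j))
       {(i, j). 2 \<le> i \<and> 2 \<le> j \<and> i + j + s = k + 2})
     {(p, q). p + q = s}) {1..2 * l}"

definition coeff_system :: "nat \<Rightarrow> nat \<Rightarrow> nat \<Rightarrow> real \<Rightarrow> real mat \<Rightarrow> real mat \<Rightarrow> real mat \<Rightarrow>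
    (nat \<Rightarrow> real mat) \<Rightarrow> (nat \<Rightarrow> real mat) \<Rightarrow> (nat \<Rightarrow> real mat) \<Rightarrow>
    (nat \<Rightarrow> real vec) \<Rightarrow> (nat \<Rightarrow> real mat) \<Rightarrow> nat \<Rightarrow> real vec \<Rightarrow> bool" where
  "coeff_system n m l \<eta> A B C F G H w W k wt \<longleftrightarrow> wt \<in> carrier_vec (n ^ k) \<and>
     (lyap k (A - \<eta> \<cdot>\<^sub>m (B * B\<^sup>T * W 2)))\<^sup>T *\<^sub>v wt =
       - rhs_f n F w k + (\<eta> / 4) \<cdot>\<^sub>v rhs_b n B W k - rhs_h n (H(1 := C)) k
       + (\<eta> / 4) \<cdot>\<^sub>v rhs_g n m l (G(0 := B)) W k"

end

theory Submission
  imports Defs "Jordan_Normal_Form.Spectral_Radius" "HOL-Library.Landau_Symbols"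
begin

text \<open>
  Along a ray \<open>x = t y\<close> the gradient of the energy is \<open>\<Sum>i. (i / 2) t\<^sup>i\<^sup>-\<^sup>1 W\<^sub>i y\<^sup>\<otimes>\<^sup>i\<^sup>-\<^sup>1\<close> up to \<open>O(t\<^sup>d)\<close>, so the
  coefficient of \<open>t\<^sup>k\<close> in the Hamilton-Jacobi-Bellman equation is the Riccati equation for \<open>k = 2\<close>; for
  \<open>k \<ge> 3\<close> it says that \<open>w\<^sub>k\<close> satisfies the linear system after contraction with \<open>y\<^sup>\<otimes>\<^sup>k\<close>. If the closed loop
  matrix \<open>M = A - \<eta> B B\<^sup>T W\<^sub>2\<close> is Hurwitz and \<open>X' = M X\<close>, then \<open>(z\<^sup>T X\<^sup>\<otimes>\<^sup>k)' = z\<^sup>T L\<^sub>k(M) X\<^sup>\<otimes>\<^sup>k\<close> while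
  \<open>X\<close> decays, so \<open>L\<^sub>k(M)\<^sup>T z\<close> determines the polynomial \<open>z\<^sup>T x\<^sup>\<otimes>\<^sup>k\<close>.

  That \<open>M\<close> is Hurwitz comes from the attenuation level. For \<open>\<gamma> > 1\<close> the energy is nonnegative, hence so is
  \<open>W\<^sub>2\<close>, and a finite level makes the plant detectable. For \<open>\<gamma> < 1\<close> a small gain argument shows that
  \<open>A\<close> itself is Hurwitz and that \<open>M\<close> has no imaginary eigenvalue; an eigenvalue in the open right half
  plane would contradict the asymptotic stability of the nonlinear closed loop.
\<close>

section \<open>Kronecker products\<close>

text \<open>Asymptotic stability of the nonlinear closed loop does not exclude imaginary eigenvalues
  of \<open>M\<close>; these have to come from the attenuation level. It enters through one
  inequality: if \<mu> v = A v + B u with Re \<mu> \<ge> 0, then |C v|^2 \<le> g^2 (|u|^2 + |C v|^2)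
  for some level g < \<gamma>. It is applied to eigenvectors v of the closed loop with the feedback
  input u = - \<eta> B^T W_2 v, for which the Riccati equation ties |u| to |C v|. On the imaginary
  axis with \<eta> < 0 the tie is |C v|^2 = |u|^2 / |\<eta>|, and 1 - \<eta> = 1 / \<gamma>^2 turns
  the inequality into \<gamma> \<le> g. The linear system is an identity of vectors, a coefficient
  of the Hamilton-Jacobi-Bellman equation only one of polynomials. Comparing \<open>wt\<close> with
  \<open>w k\<close> therefore stays on Kronecker powers, which a flow carries to Kronecker powers;
  solvability is what requires testing on all Kronecker products. Truncation at degree d is harmless
  up to k = d: the gradient error of order t^d always meets a factor of order t.\<close>

lemma sum_div_mod:
  fixes h :: "nat \<Rightarrow> nat \<Rightarrow> 'b::comm_monoid_add"
  shows "(\<Sum>i<a * b. h (i div b) (i mod b)) = (\<Sum>i<a. \<Sum>j<b. h i j)"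
proof -
  have "(\<Sum>i<a * b. h (i div b) (i mod b))
      = (\<Sum>m<a. \<Sum>i\<in>{m * b..<m * b + b}. h (i div b) (i mod b))"
    by (rule sum.nat_group[symmetric])
  also have "\<dots> = (\<Sum>m<a. \<Sum>j<b. h m j)"
  proof (rule sum.cong[OF refl])
    fix m
    have "(\<Sum>i\<in>{m * b..<m * b + b}. h (i div b) (i mod b))
        = (\<Sum>j\<in>{0..<b}. h ((j + m * b) div b) ((j + m * b) mod b))"
      using sum.shift_bounds_nat_ivl[of "\<lambda>i. h (i div b) (i mod b)" 0 "m * b" b]
      by (simp add: add.commute)
    also have "\<dots> = (\<Sum>j<b. h m j)"
      by (rule sum.cong) auto
    finally show "(\<Sum>i\<in>{m * b..<m * b + b}. h (i div b) (i mod b)) = (\<Sum>j<b. h m j)" .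
  qed
  finally show ?thesis .
qed

lemma scalar_prod_lessThan: "v \<bullet> w = (\<Sum>i<dim_vec w. v $ i * w $ i)"
  by (simp add: scalar_prod_def atLeast0LessThan)

lemma dim_kron_vec [simp]: "dim_vec (kron_vec v w) = dim_vec v * dim_vec w"
  by (simp add: kron_vec_def)

lemma kron_vec_carrier [intro]:
  "v \<in> carrier_vec a \<Longrightarrow> w \<in> carrier_vec b \<Longrightarrow> kron_vec v w \<in> carrier_vec (a * b)"
  by (intro carrier_vecI) simp

lemma index_kron_vec:
  "i < dim_vec v * dim_vec w \<Longrightarrow> kron_vec v w $ i = v $ (i div dim_vec w) * w $ (i mod dim_vec w)"
  by (simp add: kron_vec_def)

lemma kron_vec_assoc: "kron_vec (kron_vec u v) w = kron_vec u (kron_vec v w)"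
proof (rule eq_vecI)
  fix i assume "i < dim_vec (kron_vec u (kron_vec v w))"
  then have i: "i < dim_vec u * dim_vec v * dim_vec w" by (simp add: mult.assoc)
  let ?b = "dim_vec v" and ?c = "dim_vec w"
  have c: "0 < ?c" and b: "0 < ?b" using i by (auto intro: gr0I)
  have "i div ?c < dim_vec u * ?b" using i by (simp add: less_mult_imp_div_less)
  moreover have "i mod (?b * ?c) < ?b * ?c" using b c by simp
  moreover have "i mod (?b * ?c) div ?c = i div ?c mod ?b"
    using c by (subst mult.commute, subst mod_mult2_eq) (simp only: div_mult_self4 mod_div_trivial add_0_right)
  moreover have "i mod (?b * ?c) mod ?c = i mod ?c"
    by (simp add: mod_mod_cancel)
  moreover have "i div ?c div ?b = i div (?b * ?c)"
    using div_mult2_eq[of i ?c ?b] by (simp add: mult.commute)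
  ultimately show "kron_vec (kron_vec u v) w $ i = kron_vec u (kron_vec v w) $ i"
    using i by (simp add: index_kron_vec mult.assoc)
qed (simp add: mult.assoc)

text \<open>A row vector applied to a vector yields a vector with one entry; a general
  \<open>c\<close> lets this entry come out as a scalar factor.\<close>

lemma kron_vec_one_left: "kron_vec (vec (Suc 0) (\<lambda>_. c)) v = c \<cdot>\<^sub>v v"
  by (rule eq_vecI) (auto simp: index_kron_vec less_imp_le_nat)

lemma kron_vec_one_right [simp]: "kron_vec v (vec (Suc 0) (\<lambda>_. 1)) = v"
  by (rule eq_vecI) (auto simp: index_kron_vec)

lemma kron_vec_smult_left: "kron_vec (c \<cdot>\<^sub>v v) w = c \<cdot>\<^sub>v kron_vec v w"
  by (rule eq_vecI) (auto simp: index_kron_vec less_mult_imp_div_less)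

lemma mod_less_of_less_mult: "i < a * (b :: nat) \<Longrightarrow> i mod b < b"
  by (cases "b = 0") auto

lemma kron_vec_smult_right: "kron_vec v (c \<cdot>\<^sub>v w) = c \<cdot>\<^sub>v kron_vec v w"
  by (rule eq_vecI) (auto simp: index_kron_vec mod_less_of_less_mult)

lemma scalar_prod_kron_vec:
  assumes "dim_vec a = dim_vec c" "dim_vec b = dim_vec d"
  shows "kron_vec a b \<bullet> kron_vec c d = (a \<bullet> c) * (b \<bullet> d)"
proof -
  have "kron_vec a b \<bullet> kron_vec c d = (\<Sum>i<dim_vec c * dim_vec d.
      (\<lambda>p q. (a $ p * c $ p) * (b $ q * d $ q)) (i div dim_vec d) (i mod dim_vec d))"
    unfolding scalar_prod_lessThan using assms
    by (intro sum.cong) (auto simp: index_kron_vec)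
  also have "\<dots> = (\<Sum>p<dim_vec c. \<Sum>q<dim_vec d. (a $ p * c $ p) * (b $ q * d $ q))"
    by (rule sum_div_mod)
  also have "\<dots> = (a \<bullet> c) * (b \<bullet> d)"
    by (simp add: scalar_prod_lessThan sum_product)
  finally show ?thesis .
qed

lemma dim_kron [simp]:
  "dim_row (M \<otimes>\<^sub>m N) = dim_row M * dim_row N" "dim_col (M \<otimes>\<^sub>m N) = dim_col M * dim_col N"
  by (simp_all add: kron_def)

lemma row_kron:
  assumes "i < dim_row M * dim_row N"
  shows "row (M \<otimes>\<^sub>m N) i = kron_vec (row M (i div dim_row N)) (row N (i mod dim_row N))"
proof -
  have "i div dim_row N < dim_row M" "i mod dim_row N < dim_row N"
    using assms by (auto simp: less_mult_imp_div_less mod_less_of_less_mult)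
  then show ?thesis using assms
    by (intro eq_vecI) (auto simp: kron_def index_kron_vec less_mult_imp_div_less mod_less_of_less_mult)
qed

lemma kron_mult_kron_vec:
  assumes "dim_vec a = dim_col M" "dim_vec b = dim_col N"
  shows "(M \<otimes>\<^sub>m N) *\<^sub>v kron_vec a b = kron_vec (M *\<^sub>v a) (N *\<^sub>v b)"
  using assms
  by (intro eq_vecI) (auto simp: index_kron_vec row_kron scalar_prod_kron_vec
      less_mult_imp_div_less mod_less_of_less_mult)

lemma transpose_kron: "(M \<otimes>\<^sub>m N)\<^sup>T = M\<^sup>T \<otimes>\<^sub>m N\<^sup>T"
  by (rule eq_matI) (auto simp: kron_def less_mult_imp_div_less mod_less_of_less_mult)

lemma kron_vecs_Nil [simp]: "kron_vecs [] = vec 1 (\<lambda>_. 1)"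
  by (simp add: kron_vecs_def)

lemma kron_vecs_Cons [simp]: "kron_vecs (v # vs) = kron_vec v (kron_vecs vs)"
  by (simp add: kron_vecs_def)

lemma kron_mats_Nil [simp]: "kron_mats [] = 1\<^sub>m 1"
  by (simp add: kron_mats_def)

lemma kron_mats_Cons [simp]: "kron_mats (v # vs) = v \<otimes>\<^sub>m kron_mats vs"
  by (simp add: kron_mats_def)

lemma kron_vecs_append: "kron_vecs (us @ vs) = kron_vec (kron_vecs us) (kron_vecs vs)"
  by (induction us) (simp_all add: kron_vec_assoc kron_vec_one_left)

lemma dim_row_kron_mats: "dim_row (kron_mats Ms) = prod_list (map dim_row Ms)"
  by (induction Ms) auto

lemma dim_col_kron_mats: "dim_col (kron_mats Ms) = prod_list (map dim_col Ms)"
  by (induction Ms) auto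

lemma kron_vecs_carrier:
  "(\<And>v. v \<in> set vs \<Longrightarrow> v \<in> carrier_vec n) \<Longrightarrow> kron_vecs vs \<in> carrier_vec (n ^ length vs)"
  by (induction vs) auto

text \<open>The mixed product rule, factor by factor. The factors may be rectangular, as
  \<open>F p\<close> is.\<close>

lemma kron_mats_mult_kron_vecs:
  assumes "list_all2 (\<lambda>M v. dim_vec v = dim_col M) Ms vs"
  shows "kron_mats Ms *\<^sub>v kron_vecs vs = kron_vecs (map2 (*\<^sub>v) Ms vs)"
  using assms
proof (induction rule: list_all2_induct)
  case Nil
  show ?case by simp
next
  case (Cons M Ms v vs)
  have "dim_vec (kron_vecs vs) = dim_col (kron_mats Ms)"
    using Cons(2) by (induction rule: list_all2_induct) auto
  with Cons show ?case by (simp add: kron_mult_kron_vec)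
qed

lemma xpow_0 [simp]: "xpow 0 x = vec 1 (\<lambda>_. 1)"
  by (simp add: xpow_def)

lemma xpow_Suc: "xpow (Suc k) x = kron_vec x (xpow k x)"
  by (simp add: xpow_def)

lemma xpow_1 [simp]: "xpow 1 x = x" "xpow (Suc 0) x = x"
  by (simp_all add: xpow_def)

lemma xpow_add: "xpow (a + b) x = kron_vec (xpow a x) (xpow b x)"
  by (simp add: xpow_def replicate_add kron_vecs_append)

lemma xpow_carrier [intro, simp]: "x \<in> carrier_vec n \<Longrightarrow> xpow k x \<in> carrier_vec (n ^ k)"
  using kron_vecs_carrier[of "replicate k x" n] by (auto simp: xpow_def)

lemma dim_xpow [simp]: "dim_vec (xpow k x) = dim_vec x ^ k"
  by (induction k) (auto simp: xpow_Suc)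

lemma xpow_smult: "xpow k (c \<cdot>\<^sub>v x) = c ^ k \<cdot>\<^sub>v xpow k x"
  by (induction k) (simp_all add: xpow_Suc kron_vec_smult_left kron_vec_smult_right smult_smult_assoc mult.commute)

lemma dim_vec_of_mat [simp]: "dim_vec (vec_of_mat M) = dim_row M * dim_col M"
  by (simp add: vec_of_mat_def)

text \<open>Column stacking makes the column index the slow one, so the left Kronecker factor is the
  vector that \<open>M\<close> is applied to. This order governs every later evaluation of a
  coefficient.\<close>

lemma vec_of_mat_scalar_kron_vec:
  assumes "dim_vec a = dim_col M" "dim_vec b = dim_row M"
  shows "vec_of_mat M \<bullet> kron_vec a b = b \<bullet> (M *\<^sub>v a)"
proof -
  have "vec_of_mat M \<bullet> kron_vec a b = (\<Sum>i<dim_col M * dim_row M.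
      (\<lambda>p q. M $$ (q, p) * (a $ p * b $ q)) (i div dim_row M) (i mod dim_row M))"
    unfolding scalar_prod_lessThan using assms
    by (intro sum.cong) (auto simp: index_kron_vec vec_of_mat_def mult.commute)
  also have "\<dots> = (\<Sum>p<dim_col M. \<Sum>q<dim_row M. M $$ (q, p) * (a $ p * b $ q))"
    by (rule sum_div_mod)
  also have "\<dots> = (\<Sum>q<dim_row M. \<Sum>p<dim_col M. b $ q * (M $$ (q, p) * a $ p))"
    by (subst sum.swap) (simp add: mult_ac)
  also have "\<dots> = b \<bullet> (M *\<^sub>v a)"
    using assms by (simp add: scalar_prod_lessThan sum_distrib_left)
  finally show ?thesis .
qed

lemma scalar_prod_comm_real:
  fixes v w :: "real vec"
  shows "dim_vec v = dim_vec w \<Longrightarrow> v \<bullet> w = w \<bullet> v"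
  by (simp add: scalar_prod_lessThan mult.commute)

lemma dim_vec_sum [simp]: "dim_vec (vec_sum N a S) = N"
  by (simp add: vec_sum_def)

lemma vec_sum_carrier [intro, simp]: "vec_sum N a S \<in> carrier_vec N"
  by (simp add: vec_sum_def)

lemma vec_sum_scalar_left:
  "dim_vec y = N \<Longrightarrow> vec_sum N a S \<bullet> y = (\<Sum>s\<in>S. a s \<bullet> y)"
  unfolding scalar_prod_lessThan vec_sum_def
  by (simp add: sum_distrib_right) (rule sum.swap)

lemma vec_sum_scalar_right:
  assumes "\<And>s. s \<in> S \<Longrightarrow> dim_vec (a s) = N"
  shows "y \<bullet> vec_sum N a S = (\<Sum>s\<in>S. y \<bullet> a s)"
proof -
  have "y \<bullet> vec_sum N a S = (\<Sum>i<N. \<Sum>s\<in>S. y $ i * a s $ i)"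
    unfolding scalar_prod_lessThan vec_sum_def by (simp add: sum_distrib_left)
  also have "\<dots> = (\<Sum>s\<in>S. \<Sum>i<N. y $ i * a s $ i)" by (rule sum.swap)
  finally show ?thesis using assms by (simp add: scalar_prod_lessThan)
qed

lemma mult_vec_sum:
  assumes "\<And>s. s \<in> S \<Longrightarrow> dim_vec (a s) = N"
  shows "M *\<^sub>v vec_sum N a S = vec_sum (dim_row M) (\<lambda>s. M *\<^sub>v a s) S"
  using assms by (intro eq_vecI) (simp_all add: vec_sum_def[of "dim_row M"] vec_sum_scalar_right)

lemma kron_vec_vec_sum:
  assumes "\<And>s. s \<in> S \<Longrightarrow> dim_vec (a s) = N"
  shows "kron_vec v (vec_sum N a S) = vec_sum (dim_vec v * N) (\<lambda>s. kron_vec v (a s)) S"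
  using assms
  by (intro eq_vecI) (simp_all add: vec_sum_def index_kron_vec sum_distrib_left mod_less_of_less_mult)

lemma dim_mat_sum [simp]: "dim_row (mat_sum a b M S) = a" "dim_col (mat_sum a b M S) = b"
  by (simp_all add: mat_sum_def)

lemma mat_sum_carrier [intro, simp]: "mat_sum a b M S \<in> carrier_mat a b"
  by (simp add: mat_sum_def)

lemma mat_sum_mult_vec:
  assumes "\<And>s. s \<in> S \<Longrightarrow> M s \<in> carrier_mat a b" "dim_vec v = b"
  shows "mat_sum a b M S *\<^sub>v v = vec_sum a (\<lambda>s. M s *\<^sub>v v) S"
proof (rule eq_vecI)
  fix i assume "i < dim_vec (vec_sum a (\<lambda>s. M s *\<^sub>v v) S)"
  then have i: "i < a" by simp
  have M: "dim_row (M s) = a" "dim_col (M s) = b" if "s \<in> S" for s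
    using assms(1)[OF that] by auto
  have "(mat_sum a b M S *\<^sub>v v) $ i = (\<Sum>j<b. \<Sum>s\<in>S. M s $$ (i, j) * v $ j)"
    using i assms(2) by (simp add: mat_sum_def scalar_prod_lessThan sum_distrib_right)
  also have "\<dots> = (\<Sum>s\<in>S. \<Sum>j<b. M s $$ (i, j) * v $ j)" by (rule sum.swap)
  also have "\<dots> = vec_sum a (\<lambda>s. M s *\<^sub>v v) S $ i"
    using i assms(2) M by (simp add: vec_sum_def scalar_prod_lessThan)
  finally show "(mat_sum a b M S *\<^sub>v v) $ i = vec_sum a (\<lambda>s. M s *\<^sub>v v) S $ i" .
qed simp

lemma transpose_mult_scalar_prod:
  fixes M :: "real mat"
  assumes "M \<in> carrier_mat a b" "dim_vec u = a" "dim_vec v = b"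
  shows "(M\<^sup>T *\<^sub>v u) \<bullet> v = u \<bullet> (M *\<^sub>v v)"
  using assms by (intro transpose_vec_mult_scalar) (auto intro: carrier_vecI)

section \<open>The Kronecker sum and multilinear derivatives\<close>

lemma vec_sum_cong: "(\<And>s. s \<in> S \<Longrightarrow> a s = b s) \<Longrightarrow> vec_sum N a S = vec_sum N b S"
  by (simp add: vec_sum_def cong: sum.cong)

lemma map_upt_if_eq:
  assumes "i < k"
  shows "map (\<lambda>j. if j = Suc i then a else b) [1..<k + 1]
    = replicate i b @ a # replicate (k - Suc i) b"
  by (rule nth_equalityI) (use assms in \<open>auto simp: nth_append nth_Cons'\<close>)

lemma dim_kron_mats_slot:
  assumes "M \<in> carrier_mat n q" "i < k"
  shows "kron_mats (replicate i (1\<^sub>m n) @ M # replicate (k - Suc i) (1\<^sub>m n)) \<in> carrier_mat (n ^ k) (n ^ (k - 1) * q)"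
proof (intro carrier_matI)
  have "n ^ i * n ^ (k - Suc i) = n ^ (k - 1)"
    using assms(2) by (simp flip: power_add)
  moreover have "n ^ k = n * n ^ (k - 1)"
    using assms(2) by (cases k) auto
  ultimately show "dim_row (kron_mats (replicate i (1\<^sub>m n) @ M # replicate (k - Suc i) (1\<^sub>m n))) = n ^ k"
    and "dim_col (kron_mats (replicate i (1\<^sub>m n) @ M # replicate (k - Suc i) (1\<^sub>m n))) = n ^ (k - 1) * q"
    using assms(1) by (auto simp: dim_row_kron_mats dim_col_kron_mats mult_ac)
qed

lemma lyap_carrier:
  assumes "M \<in> carrier_mat n q"
  shows "lyap k M \<in> carrier_mat (n ^ k) (n ^ (k - 1) * q)"
  using assms by (auto simp: lyap_def)

text \<open>Positions are shifted from 1..k, as in the definition, to 0..k-1, where they agree with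
  list indices.\<close>

lemma lyap_mult_vec:
  assumes M: "M \<in> carrier_mat n q" and v: "dim_vec v = n ^ (k - 1) * q"
  shows "lyap k M *\<^sub>v v = vec_sum (n ^ k)
    (\<lambda>i. kron_mats (replicate i (1\<^sub>m n) @ M # replicate (k - Suc i) (1\<^sub>m n)) *\<^sub>v v) {..<k}"
proof -
  have dM: "dim_row M = n" "dim_col M = q" using M by auto
  have eq: "lyap k M = mat_sum (n ^ k) (n ^ (k - 1) * q)
     (\<lambda>i. kron_mats (replicate i (1\<^sub>m n) @ M # replicate (k - Suc i) (1\<^sub>m n))) {..<k}"
  proof -
    have "(\<Sum>s\<in>{1..k}. kron_mats (map (\<lambda>j. if j = s then M else 1\<^sub>m n) [1..<k + 1]) $$ ij)
       = (\<Sum>i<k. kron_mats (replicate i (1\<^sub>m n) @ M # replicate (k - Suc i) (1\<^sub>m n)) $$ ij)" for ij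
    proof (rule sum.reindex_bij_witness[of _ Suc "\<lambda>s. s - 1"])
      fix s assume s: "s \<in> {1..k}"
      show "kron_mats (replicate (s - 1) (1\<^sub>m n) @ M # replicate (k - Suc (s - 1)) (1\<^sub>m n)) $$ ij
        = kron_mats (map (\<lambda>j. if j = s then M else 1\<^sub>m n) [1..<k + 1]) $$ ij"
      proof -
        have "Suc (s - 1) = s" "s - 1 < k" using s by auto
        then show ?thesis using map_upt_if_eq[of "s - 1" k M "1\<^sub>m n"] by (simp only:)
      qed
    qed auto
    then show ?thesis unfolding lyap_def mat_sum_def dM
      by (simp only:)
  qed
  show ?thesis unfolding eq
    by (rule mat_sum_mult_vec) (use v in \<open>auto intro!: dim_kron_mats_slot[OF M] simp del: One_nat_def\<close>)
qed

text \<open>Only the vector in the slot of \<open>M\<close> has dimension \<open>q\<close>, the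
  others have dimension \<open>n\<close>; with \<open>q = n ^ p\<close> this covers the coefficients
  of the drift.\<close>

lemma kron_mats_slot_mult:
  assumes "M \<in> carrier_mat n q" "i < k" "length us = i" "length vs = k - Suc i"
    "\<And>u. u \<in> set us \<Longrightarrow> u \<in> carrier_vec n" "\<And>u. u \<in> set vs \<Longrightarrow> u \<in> carrier_vec n"
    "b \<in> carrier_vec q"
  shows "kron_mats (replicate i (1\<^sub>m n) @ M # replicate (k - Suc i) (1\<^sub>m n)) *\<^sub>v kron_vecs (us @ b # vs)
    = kron_vecs (us @ (M *\<^sub>v b) # vs)"
proof -
  have id: "map2 (*\<^sub>v) (replicate (length us) (1\<^sub>m n)) us = us"
    if "\<And>u. u \<in> set us \<Longrightarrow> u \<in> carrier_vec n" for us :: "real vec list"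
    using that by (induction us) auto
  have ids: "list_all2 (\<lambda>M v. dim_vec v = dim_col M) (replicate (length us) (1\<^sub>m n)) us"
    if "\<And>u. u \<in> set us \<Longrightarrow> u \<in> carrier_vec n" for us :: "real vec list"
    using that by (induction us) auto
  have "map2 (*\<^sub>v) (replicate i (1\<^sub>m n) @ M # replicate (k - Suc i) (1\<^sub>m n)) (us @ b # vs)
      = us @ (M *\<^sub>v b) # vs"
    using id[of us] id[of vs] assms by auto
  moreover have "list_all2 (\<lambda>M v. dim_vec v = dim_col M)
      (replicate i (1\<^sub>m n) @ M # replicate (k - Suc i) (1\<^sub>m n)) (us @ b # vs)"
    using ids[of us] ids[of vs] assms by (intro list_all2_appendI) auto
  ultimately show ?thesis by (simp add: kron_mats_mult_kron_vecs)
qed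

text \<open>For a square matrix the Kronecker sum acts as a derivation, one summand per slot, which
  is the shape of the Leibniz rule for a product of solutions of X' = M X.\<close>

lemma lyap_mult_kron_vecs:
  assumes M: "M \<in> carrier_mat n n" and vs: "\<And>v. v \<in> set vs \<Longrightarrow> v \<in> carrier_vec n" and ne: "vs \<noteq> []"
  shows "lyap (length vs) M *\<^sub>v kron_vecs vs
    = vec_sum (n ^ length vs) (\<lambda>i. kron_vecs (vs[i := M *\<^sub>v (vs ! i)])) {..<length vs}"
proof -
  have v: "dim_vec (kron_vecs vs) = n ^ (length vs - 1) * n"
  proof -
    have "dim_vec (kron_vecs vs) = n ^ length vs" using kron_vecs_carrier[of vs n] vs by auto
    also have "\<dots> = n ^ (length vs - 1) * n" using ne by (cases vs) auto
    finally show ?thesis .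
  qed
  have "kron_mats (replicate i (1\<^sub>m n) @ M # replicate (length vs - Suc i) (1\<^sub>m n)) *\<^sub>v kron_vecs vs
      = kron_vecs (vs[i := M *\<^sub>v (vs ! i)])" if i: "i < length vs" for i
  proof -
    have "kron_mats (replicate i (1\<^sub>m n) @ M # replicate (length vs - Suc i) (1\<^sub>m n))
        *\<^sub>v kron_vecs (take i vs @ (vs ! i) # drop (Suc i) vs)
      = kron_vecs (take i vs @ (M *\<^sub>v (vs ! i)) # drop (Suc i) vs)"
      using i vs by (intro kron_mats_slot_mult[OF M i]) (auto dest: in_set_takeD in_set_dropD)
    then show ?thesis using i by (simp add: id_take_nth_drop[symmetric] upd_conv_take_nth_drop)
  qed
  then show ?thesis
    unfolding lyap_mult_vec[OF M v] by (intro vec_sum_cong) auto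
qed

text \<open>The power of degree \<open>m\<close> is regrouped into \<open>k\<close> slots, one of
  which holds a block of \<open>p\<close> copies of \<open>x\<close> for an n by n^p matrix to act
  on.\<close>

lemma xpow_slot:
  assumes "i < k" "k + p = Suc m"
  shows "xpow m x = kron_vecs (replicate i x @ xpow p x # replicate (k - Suc i) x)"
proof -
  have "m = i + (p + (k - Suc i))" using assms by simp
  then show ?thesis
    by (simp only: xpow_add kron_vecs_append kron_vecs_Cons) (simp add: xpow_def)
qed

lemma lyap_mult_xpow:
  assumes M: "M \<in> carrier_mat n (n ^ p)" and x: "x \<in> carrier_vec n" and m: "k + p = Suc m" "k \<ge> 1"
  shows "lyap k M *\<^sub>v xpow m x = vec_sum (n ^ k)
    (\<lambda>i. kron_vecs (replicate i x @ (M *\<^sub>v xpow p x) # replicate (k - Suc i) x)) {..<k}"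
proof -
  have "k - 1 + p = m" using m by simp
  then have "dim_vec (xpow m x) = n ^ (k - 1) * n ^ p"
    using x by (auto simp flip: power_add)
  note * = lyap_mult_vec[OF M this]
  have "kron_mats (replicate i (1\<^sub>m n) @ M # replicate (k - Suc i) (1\<^sub>m n)) *\<^sub>v xpow m x
      = kron_vecs (replicate i x @ (M *\<^sub>v xpow p x) # replicate (k - Suc i) x)" if i: "i < k" for i
    unfolding xpow_slot[OF i m(1)] using x by (intro kron_mats_slot_mult[OF M i]) auto
  then show ?thesis unfolding * by (intro vec_sum_cong) auto
qed

text \<open>The transposition of positions \<open>i\<close> and \<open>k - 1\<close> moves
  \<open>b\<close> into the last slot. This is where symmetry collapses the k terms of a derivative
  into k equal ones.\<close>

lemma symmetric_coeff_slot:
  assumes w: "symmetric_coeff n k w" and i: "i < k" and x: "x \<in> carrier_vec n" and b: "b \<in> carrier_vec n"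
  shows "w \<bullet> kron_vecs (replicate i x @ b # replicate (k - Suc i) x) = w \<bullet> kron_vec (xpow (k - 1) x) b"
proof -
  let ?a = "\<lambda>j. if j = i then b else x"
  let ?s = "Transposition.transpose i (k - 1)"
  have "map ?a [0..<k] = replicate i x @ b # replicate (k - Suc i) x"
    by (rule nth_equalityI) (use i in \<open>auto simp: nth_append nth_Cons'\<close>)
  moreover have "map (\<lambda>j. ?a (?s j)) [0..<k] = replicate (k - 1) x @ [b]"
  proof (rule nth_equalityI)
    fix j assume "j < length (map (\<lambda>j. ?a (?s j)) [0..<k])"
    then have j: "j < k" by simp
    show "map (\<lambda>j. ?a (?s j)) [0..<k] ! j = (replicate (k - 1) x @ [b]) ! j"
    proof (cases "j = k - 1")
      case True
      then show ?thesis using j by (simp add: nth_append)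
    next
      case False
      then have "?s j \<noteq> i" by (auto simp: transpose_eq_iff)
      moreover have "j < k - 1" using j False by linarith
      ultimately show ?thesis using j by (simp add: nth_append)
    qed
  qed (use i in simp)
  moreover have "?s permutes {..<k}" using i by (intro permutes_swap_id) auto
  moreover have "\<forall>j<k. ?a j \<in> carrier_vec n" using x b by auto
  ultimately have "w \<bullet> kron_vecs (replicate i x @ b # replicate (k - Suc i) x)
      = w \<bullet> kron_vecs (replicate (k - 1) x @ [b])"
    using w[unfolded symmetric_coeff_def, THEN conjunct2, rule_format, of ?a ?s] by (simp only:)
  then show ?thesis by (simp add: kron_vecs_append xpow_def)
qed

lemma symmetric_coeff_2:
  assumes w: "symmetric_coeff n 2 w" and x: "x \<in> carrier_vec n" and b: "b \<in> carrier_vec n"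
  shows "w \<bullet> kron_vec x b = w \<bullet> kron_vec b x"
  using symmetric_coeff_slot[OF w, of 0 x b] x b by (simp add: numeral_2_eq_2)

section \<open>Componentwise calculus of vector-valued curves and bounds on Kronecker
  products\<close>

definition has_vderiv :: "nat \<Rightarrow> (real \<Rightarrow> real vec) \<Rightarrow> real vec \<Rightarrow> real \<Rightarrow> bool" where
  "has_vderiv n X X' t \<longleftrightarrow> (\<forall>s. X s \<in> carrier_vec n) \<and> X' \<in> carrier_vec n \<and>
     (\<forall>i<n. ((\<lambda>s. X s $ i) has_real_derivative X' $ i) (at t))"

lemma has_vderiv_scalar_prod:
  assumes "has_vderiv n X X' t" "dim_vec c = n"
  shows "((\<lambda>s. c \<bullet> X s) has_real_derivative c \<bullet> X') (at t)"
proof -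
  have d: "dim_vec (X s) = n" "dim_vec X' = n" for s
    using assms(1) unfolding has_vderiv_def by auto
  have "c \<bullet> X s = (\<Sum>i<n. c $ i * X s $ i)" "c \<bullet> X' = (\<Sum>i<n. c $ i * X' $ i)" for s
    using d by (simp_all add: scalar_prod_lessThan)
  moreover have "((\<lambda>s. \<Sum>i<n. c $ i * X s $ i) has_real_derivative (\<Sum>i<n. c $ i * X' $ i)) (at t)"
    using assms(1) unfolding has_vderiv_def by (intro DERIV_sum DERIV_cmult) auto
  ultimately show ?thesis by simp
qed

lemma has_vderiv_kron_vec:
  assumes u: "has_vderiv a U U' t" and v: "has_vderiv b V V' t"
  shows "has_vderiv (a * b) (\<lambda>s. kron_vec (U s) (V s)) (kron_vec U' (V t) + kron_vec (U t) V') t"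
  unfolding has_vderiv_def
proof (intro conjI allI impI)
  have d: "dim_vec (U s) = a" "dim_vec (V s) = b" "dim_vec U' = a" "dim_vec V' = b" for s
    using assms unfolding has_vderiv_def by auto
  show "kron_vec (U s) (V s) \<in> carrier_vec (a * b)" for s
    by (intro carrier_vecI) (simp add: d)
  show "kron_vec U' (V t) + kron_vec (U t) V' \<in> carrier_vec (a * b)"
    by (intro carrier_vecI) (simp add: d)
  fix i assume i: "i < a * b"
  then have 1: "i div b < a" "i mod b < b" by (auto simp: less_mult_imp_div_less mod_less_of_less_mult)
  have "((\<lambda>s. U s $ (i div b) * V s $ (i mod b)) has_real_derivative
      U' $ (i div b) * V t $ (i mod b) + V' $ (i mod b) * U t $ (i div b)) (at t)"
    using assms 1 unfolding has_vderiv_def by (intro DERIV_mult) auto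
  then show "((\<lambda>s. kron_vec (U s) (V s) $ i) has_real_derivative
      (kron_vec U' (V t) + kron_vec (U t) V') $ i) (at t)"
    using i by (simp add: index_kron_vec d mult.commute)
qed

text \<open>Leibniz rule by induction on the list: differentiating the head gives the summand 0, and
  the summands of the tail move up by one.\<close>

lemma has_vderiv_kron_vecs:
  assumes "\<And>X. X \<in> set Xs \<Longrightarrow> has_vderiv n (fst X) (snd X) t"
  shows "has_vderiv (n ^ length Xs) (\<lambda>s. kron_vecs (map (\<lambda>X. fst X s) Xs))
    (vec_sum (n ^ length Xs) (\<lambda>i. kron_vecs ((map (\<lambda>X. fst X t) Xs)[i := snd (Xs ! i)])) {..<length Xs}) t"
  using assms
proof (induction Xs)
  case Nil
  show ?case by (simp add: has_vderiv_def vec_sum_def)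
next
  case (Cons X Xs)
  let ?L = "map (\<lambda>X. fst X t) Xs"
  let ?D = "\<lambda>i. kron_vecs (?L[i := snd (Xs ! i)])"
  have IH: "has_vderiv (n ^ length Xs) (\<lambda>s. kron_vecs (map (\<lambda>X. fst X s) Xs))
      (vec_sum (n ^ length Xs) ?D {..<length Xs}) t"
    using Cons by auto
  have X: "has_vderiv n (fst X) (snd X) t" using Cons(2) by auto
  have c: "fst Y s \<in> carrier_vec n" "snd Y \<in> carrier_vec n" if "Y \<in> set Xs" for Y s
    using Cons(2)[of Y] that unfolding has_vderiv_def by auto
  have dX: "dim_vec (snd X) = n" "dim_vec (fst X t) = n"
    using X unfolding has_vderiv_def by auto
  have cD: "?D i \<in> carrier_vec (n ^ length Xs)" if "i < length Xs" for i
  proof -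
    have "?D i \<in> carrier_vec (n ^ length (?L[i := snd (Xs ! i)]))"
      using c(1) c(2)[OF nth_mem[OF that]]
      by (intro kron_vecs_carrier) (auto dest!: set_update_subset_insert[THEN subsetD])
    then show ?thesis by simp
  qed
  have cL: "kron_vecs ?L \<in> carrier_vec (n ^ length Xs)"
    using kron_vecs_carrier[of ?L n] c(1) by fastforce
  have "kron_vec (snd X) (kron_vecs ?L) + kron_vec (fst X t) (vec_sum (n ^ length Xs) ?D {..<length Xs})
    = vec_sum (n ^ length (X # Xs))
        (\<lambda>i. kron_vecs ((map (\<lambda>X. fst X t) (X # Xs))[i := snd ((X # Xs) ! i)])) {..<length (X # Xs)}"
  proof (rule eq_vecI)
    show "dim_vec (kron_vec (snd X) (kron_vecs ?L) + kron_vec (fst X t) (vec_sum (n ^ length Xs) ?D {..<length Xs}))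
      = dim_vec (vec_sum (n ^ length (X # Xs))
        (\<lambda>i. kron_vecs ((map (\<lambda>X. fst X t) (X # Xs))[i := snd ((X # Xs) ! i)])) {..<length (X # Xs)})"
      using dX by simp
    fix j assume "j < dim_vec (vec_sum (n ^ length (X # Xs))
        (\<lambda>i. kron_vecs ((map (\<lambda>X. fst X t) (X # Xs))[i := snd ((X # Xs) ! i)])) {..<length (X # Xs)})"
    then have j: "j < n * n ^ length Xs" by simp
    have "kron_vec (fst X t) (vec_sum (n ^ length Xs) ?D {..<length Xs}) $ j
        = (\<Sum>i<length Xs. kron_vec (fst X t) (?D i) $ j)"
      using j dX cD by (subst kron_vec_vec_sum) (auto simp: vec_sum_def)
    then show "(kron_vec (snd X) (kron_vecs ?L) + kron_vec (fst X t) (vec_sum (n ^ length Xs) ?D {..<length Xs})) $ j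
      = vec_sum (n ^ length (X # Xs))
        (\<lambda>i. kron_vecs ((map (\<lambda>X. fst X t) (X # Xs))[i := snd ((X # Xs) ! i)])) {..<length (X # Xs)} $ j"
      using j dX by (simp add: vec_sum_def sum.lessThan_Suc_shift del: sum.lessThan_Suc)
  qed
  then show ?case using has_vderiv_kron_vec[OF X IH] by simp
qed

text \<open>The maximum norm is chosen because it passes through Kronecker products without
  dimension factors, and because it is dual to the sums of absolute values of coefficients in
  \<open>power_series_at_0\<close>.\<close>

definition entries_le :: "real \<Rightarrow> real vec \<Rightarrow> bool" where
  "entries_le r v \<longleftrightarrow> (\<forall>i<dim_vec v. \<bar>v $ i\<bar> \<le> r)"

lemma entries_le_kron_vec:
  assumes "entries_le r u" "entries_le s v" "0 \<le> r" "0 \<le> s"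
  shows "entries_le (r * s) (kron_vec u v)"
  using assms unfolding entries_le_def
  by (auto simp: index_kron_vec abs_mult less_mult_imp_div_less mod_less_of_less_mult intro!: mult_mono)

lemma entries_le_kron_vecs:
  assumes "\<And>v. v \<in> set vs \<Longrightarrow> entries_le r v" "0 \<le> r"
  shows "entries_le (r ^ length vs) (kron_vecs vs)"
  using assms by (induction vs) (auto simp: entries_le_def[of 1] intro!: entries_le_kron_vec)

lemma entries_le_xpow: "entries_le r x \<Longrightarrow> 0 \<le> r \<Longrightarrow> entries_le (r ^ k) (xpow k x)"
  using entries_le_kron_vecs[of "replicate k x" r] by (auto simp: xpow_def)

lemma entries_le_slot:
  assumes "entries_le r x" "entries_le s b" "0 \<le> r" "0 \<le> s" "i < k"
  shows "entries_le (r ^ (k - 1) * s) (kron_vecs (replicate i x @ b # replicate (k - Suc i) x))"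
proof -
  have "entries_le (r ^ i * (s * r ^ (k - Suc i))) (kron_vecs (replicate i x @ b # replicate (k - Suc i) x))"
    using assms entries_le_xpow[of r x] unfolding kron_vecs_append kron_vecs_Cons xpow_def
    by (intro entries_le_kron_vec) auto
  moreover have "r ^ i * (s * r ^ (k - Suc i)) = r ^ (k - 1) * s"
    using assms(5) by (simp add: mult_ac flip: power_add)
  ultimately show ?thesis by simp
qed

lemma abs_scalar_prod_le:
  fixes c v :: "real vec"
  assumes "entries_le r v" "dim_vec v = n"
  shows "\<bar>c \<bullet> v\<bar> \<le> (\<Sum>j<n. \<bar>c $ j\<bar>) * r"
proof -
  have "\<bar>c \<bullet> v\<bar> \<le> (\<Sum>j<n. \<bar>c $ j * v $ j\<bar>)"
    unfolding scalar_prod_lessThan assms(2) by (rule sum_abs)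
  also have "\<dots> \<le> (\<Sum>j<n. \<bar>c $ j\<bar> * r)"
    using assms by (intro sum_mono) (auto simp: abs_mult entries_le_def intro!: mult_left_mono)
  finally show ?thesis by (simp add: sum_distrib_right)
qed

section \<open>Decaying linear flows\<close>

text \<open>A complex eigenvector is split into a + i b, so that the Lyapunov and Riccati arguments
  can be carried out over the reals.\<close>

lemma eigenvalue_real_pair:
  assumes M: "M \<in> carrier_mat n n"
  shows "eigenvalue (map_mat complex_of_real M) z \<longleftrightarrow>
    (\<exists>a b. a \<in> carrier_vec n \<and> b \<in> carrier_vec n \<and> (a \<noteq> 0\<^sub>v n \<or> b \<noteq> 0\<^sub>v n) \<and>
       M *\<^sub>v a = Re z \<cdot>\<^sub>v a - Im z \<cdot>\<^sub>v b \<and> M *\<^sub>v b = Re z \<cdot>\<^sub>v b + Im z \<cdot>\<^sub>v a)" (is "?L \<longleftrightarrow> ?R")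
proof -
  let ?M = "map_mat complex_of_real M"
  have dM: "dim_row M = n" "dim_col M = n" using M by auto
  have entry: "(?M *\<^sub>v vec n (\<lambda>i. Complex (a $ i) (b $ i))) $ i = Complex ((M *\<^sub>v a) $ i) ((M *\<^sub>v b) $ i)"
    if "a \<in> carrier_vec n" "b \<in> carrier_vec n" "i < n" for a b i
    using that dM by (simp add: scalar_prod_lessThan complex_eq_iff)
  show ?thesis
  proof
    assume ?L
    then obtain v where v: "v \<in> carrier_vec n" "v \<noteq> 0\<^sub>v n" and ev: "?M *\<^sub>v v = z \<cdot>\<^sub>v v"
      unfolding eigenvalue_def eigenvector_def using dM by auto
    let ?a = "map_vec Re v" and ?b = "map_vec Im v"
    have vab: "v = vec n (\<lambda>i. Complex (?a $ i) (?b $ i))"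
      using v by (intro eq_vecI) auto
    have ab: "?a \<in> carrier_vec n" "?b \<in> carrier_vec n" using v by auto
    have e: "Complex ((M *\<^sub>v ?a) $ i) ((M *\<^sub>v ?b) $ i) = z * v $ i" if "i < n" for i
    proof -
      have "(?M *\<^sub>v v) $ i = Complex ((M *\<^sub>v ?a) $ i) ((M *\<^sub>v ?b) $ i)"
        using entry[OF ab that] by (simp flip: vab)
      then show ?thesis using ev v(1) that by simp
    qed
    have "?a \<noteq> 0\<^sub>v n \<or> ?b \<noteq> 0\<^sub>v n"
    proof (rule ccontr)
      assume z: "\<not> ?thesis"
      have "v $ i = 0" if "i < n" for i
      proof -
        have "?a $ i = 0" "?b $ i = 0" using z that by auto
        then show ?thesis using v(1) that by (simp add: complex_eq_iff)
      qed
      then show False using v by (metis eq_vecI carrier_vecD index_zero_vec)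
    qed
    moreover have "M *\<^sub>v ?a = Re z \<cdot>\<^sub>v ?a - Im z \<cdot>\<^sub>v ?b" "M *\<^sub>v ?b = Re z \<cdot>\<^sub>v ?b + Im z \<cdot>\<^sub>v ?a"
      using e v(1) dM by (auto intro!: eq_vecI simp: complex_eq_iff simp del: index_mult_mat_vec)
    ultimately show ?R using ab by blast
  next
    assume ?R
    then obtain a b where ab: "a \<in> carrier_vec n" "b \<in> carrier_vec n" and nz: "a \<noteq> 0\<^sub>v n \<or> b \<noteq> 0\<^sub>v n"
      and e: "M *\<^sub>v a = Re z \<cdot>\<^sub>v a - Im z \<cdot>\<^sub>v b" "M *\<^sub>v b = Re z \<cdot>\<^sub>v b + Im z \<cdot>\<^sub>v a" by blast
    let ?v = "vec n (\<lambda>i. Complex (a $ i) (b $ i))"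
    have "?M *\<^sub>v ?v = z \<cdot>\<^sub>v ?v"
    proof (rule eq_vecI)
      fix i assume "i < dim_vec (z \<cdot>\<^sub>v ?v)"
      then have i: "i < n" by simp
      show "(?M *\<^sub>v ?v) $ i = (z \<cdot>\<^sub>v ?v) $ i"
        unfolding entry[OF ab i] e using i ab by (simp add: complex_eq_iff)
    qed (use dM in simp)
    moreover have "?v \<noteq> 0\<^sub>v n"
    proof
      assume "?v = 0\<^sub>v n"
      then have "?v $ i = 0" if "i < n" for i using that by simp
      then have "a $ i = 0 \<and> b $ i = 0" if "i < n" for i using that by (simp add: complex_eq_iff)
      then have "a = 0\<^sub>v n" "b = 0\<^sub>v n" using ab by (auto intro!: eq_vecI)
      with nz show False by simp
    qed
    ultimately show ?L unfolding eigenvalue_def eigenvector_def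
      using dM by (intro exI[of _ ?v]) simp
  qed
qed

text \<open>Since |z + c|^2 = c^2 + 2 c Re z + |z|^2, the inequality |z + c| < c holds as soon as c
  > |z|^2 / (- 2 Re z); finiteness of \<open>S\<close> gives a common c.\<close>

lemma hurwitz_scaling:
  assumes "finite S" "\<And>z. z \<in> S \<Longrightarrow> Re z < 0"
  shows "\<exists>c \<mu>. 0 < \<mu> \<and> \<mu> < c \<and> (\<forall>z\<in>S. cmod (z + of_real c) < \<mu>)"
proof -
  have ev: "\<forall>\<^sub>F c in at_top. cmod (z + of_real c) < c" if z: "z \<in> S" for z
  proof -
    have "\<forall>\<^sub>F c in at_top. c > 0 \<and> c > (cmod z)\<^sup>2 / (- 2 * Re z)"
      by (intro eventually_conj eventually_gt_at_top)
    then show ?thesis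
    proof eventually_elim
      case (elim c)
      have "(cmod z)\<^sup>2 < c * (- 2 * Re z)"
      proof (rule pos_divide_less_eq[THEN iffD1])
        show "0 < - 2 * Re z" using assms(2)[OF z] by simp
      qed (use elim in blast)
      then have "(cmod (z + of_real c))\<^sup>2 < c\<^sup>2"
        unfolding cmod_power2 by (simp add: power2_eq_square algebra_simps)
      then show ?case using elim power2_less_imp_less[of _ c] by auto
    qed
  qed
  have "\<forall>\<^sub>F c in at_top. c > 0 \<and> (\<forall>z\<in>S. cmod (z + of_real c) < (c::real))"
    using ev assms(1) by (intro eventually_conj eventually_gt_at_top eventually_ball_finite) auto
  then obtain c where c: "c > 0" "\<forall>z\<in>S. cmod (z + of_real c) < c"
    by (auto dest: eventually_happens)
  \<comment> \<open>Inserting 0 covers an empty \<open>S\<close> and makes \<open>?m\<close>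
    nonnegative, so the midpoint of \<open>?m\<close> and c is positive and lies strictly above all
    the moduli and below c.\<close>
  let ?m = "Max (insert 0 ((\<lambda>z. cmod (z + of_real c)) ` S))"
  have m: "?m < c" using assms(1) c by auto
  have "cmod (z + of_real c) \<le> ?m" if "z \<in> S" for z
    using assms(1) that by (intro Max_ge) auto
  moreover have "0 \<le> ?m" using assms(1) by (intro Max_ge) auto
  ultimately show ?thesis using m c(1)
    by (intro exI[of _ c] exI[of _ "(?m + c) / 2"]) force
qed

text \<open>The shift by \<open>c\<close> moves the spectrum of a Hurwitz matrix into the disc of radius \<open>\<mu> < c\<close>
  around the origin, where powers grow at most like \<open>\<mu> ^ k\<close>.\<close>

lemma hurwitz_shift_power_bound:
  assumes M: "M \<in> carrier_mat n n" and h: "hurwitz M" and n: "n > 0"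
  shows "\<exists>c \<mu> b. 0 < \<mu> \<and> \<mu> < c \<and> (\<forall>k. norm_bound (((1 / \<mu>) \<cdot>\<^sub>m (M + c \<cdot>\<^sub>m 1\<^sub>m n)) ^\<^sub>m k) b)"
proof -
  let ?C = "map_mat complex_of_real"
  have CM: "?C M \<in> carrier_mat n n" using M by simp
  have sp0: "Re z < 0" if "z \<in> spectrum (?C M)" for z
    using that h by (simp add: hurwitz_def spectrum_def)
  obtain c \<mu> where c\<mu>: "0 < \<mu>" "\<mu> < c"
    and sp: "\<forall>z\<in>spectrum (?C M). cmod (z + of_real c) < \<mu>"
    using hurwitz_scaling[OF card_finite_spectrum(1)[OF CM] sp0] by blast
  define N where "N = (1 / \<mu>) \<cdot>\<^sub>m (M + c \<cdot>\<^sub>m 1\<^sub>m n)"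
  have N: "N \<in> carrier_mat n n" using M by (simp add: N_def)
  have CN: "?C N \<in> carrier_mat n n" using N by simp
  have "spectral_radius (?C N) < 1"
  proof -
    \<comment> \<open>An eigenvalue z of \<open>N\<close> corresponds to the eigenvalue \<mu> z - c
      of \<open>M\<close>, whose distance \<mu> |z| from - c is less than \<mu>.\<close>
    obtain z where z: "z \<in> spectrum (?C N)" "spectral_radius (?C N) = cmod z"
      using spectral_radius_mem_max(1)[OF CN n] by auto
    then obtain v where v: "v \<in> carrier_vec n" "v \<noteq> 0\<^sub>v n" "?C N *\<^sub>v v = z \<cdot>\<^sub>v v"
      unfolding spectrum_def eigenvalue_def eigenvector_def using N by auto
    have "?C M *\<^sub>v v = (of_real \<mu> * z - of_real c) \<cdot>\<^sub>v v"
    proof (rule eq_vecI)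
      fix i assume "i < dim_vec ((of_real \<mu> * z - of_real c) \<cdot>\<^sub>v v)"
      then have i: "i < n" using v by simp
      have "(?C N *\<^sub>v v) $ i = (\<Sum>j<n. (of_real (1 / \<mu>) * (of_real (M $$ (i, j)) + of_real c * (if i = j then 1 else 0))) * v $ j)"
        using i v(1) M by (auto simp: scalar_prod_lessThan N_def intro!: sum.cong)
      also have "\<dots> = (\<Sum>j<n. of_real (1 / \<mu>) * (of_real (M $$ (i, j)) * v $ j)
          + of_real (1 / \<mu>) * (of_real c * (if i = j then v $ j else 0)))"
        by (intro sum.cong) (auto simp: algebra_simps)
      also have "\<dots> = of_real (1 / \<mu>) * ((\<Sum>j<n. of_real (M $$ (i, j)) * v $ j)
          + of_real c * (\<Sum>j<n. if i = j then v $ j else 0))"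
        by (simp only: sum.distrib sum_distrib_left[symmetric] distrib_left)
      also have "\<dots> = of_real (1 / \<mu>) * ((?C M *\<^sub>v v) $ i + of_real c * v $ i)"
        using i v(1) M by (simp add: scalar_prod_lessThan sum.delta')
      finally have "(?C M *\<^sub>v v) $ i + of_real c * v $ i = of_real \<mu> * (z \<cdot>\<^sub>v v) $ i"
        using v(3) c\<mu>(1) by (simp add: field_simps)
      then show "(?C M *\<^sub>v v) $ i = ((of_real \<mu> * z - of_real c) \<cdot>\<^sub>v v) $ i"
        using i v(1) by (simp add: algebra_simps)
    qed (use M v in auto)
    then have "of_real \<mu> * z - of_real c \<in> spectrum (?C M)"
      unfolding spectrum_def eigenvalue_def eigenvector_def using M v by auto
    from bspec[OF sp this] have "\<mu> * cmod z < \<mu>" using c\<mu> by (simp add: norm_mult)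
    then show ?thesis using z(2) c\<mu>(1) by simp
  qed
  then obtain b where b: "\<And>k. norm_bound (?C N ^\<^sub>m k) b"
    using spectral_radius_jnf_norm_bound_less_1_upper_triangular[OF CN] by blast
  have "norm_bound (N ^\<^sub>m k) b" for k
  proof (intro norm_boundI)
    fix i j assume ij: "i < dim_row (N ^\<^sub>m k)" "j < dim_col (N ^\<^sub>m k)"
    have "?C N ^\<^sub>m k = ?C (N ^\<^sub>m k)" using of_real_hom.mat_hom_pow[OF N, of k] by (rule sym)
    then show "norm ((N ^\<^sub>m k) $$ (i, j)) \<le> b"
      using b[of k] ij unfolding norm_bound_def by auto
  qed
  then show ?thesis using c\<mu> unfolding N_def by blast
qed

text \<open>The exponential series applied to a single vector. Boundedness of the iterates by
  \<open>K\<close> is all that enters: comparison with the series of K exp |t| gives convergence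
  everywhere and the growth bound.\<close>

lemma exp_vector_series:
  fixes v :: "nat \<Rightarrow> real vec"
  assumes N: "N \<in> carrier_mat n n" and v: "\<And>k. v k \<in> carrier_vec n" "\<And>k. v (Suc k) = N *\<^sub>v v k"
    and bd: "\<And>k i. i < n \<Longrightarrow> \<bar>v k $ i\<bar> \<le> K"
  defines "Y \<equiv> \<lambda>t. vec n (\<lambda>i. \<Sum>k. v k $ i / fact k * t ^ k)"
  shows "has_vderiv n Y (N *\<^sub>v Y t) t" "Y 0 = v 0" "\<And>i. i < n \<Longrightarrow> \<bar>Y t $ i\<bar> \<le> K * exp \<bar>t\<bar>"
proof -
  have se: "(\<lambda>k. K * (\<bar>t\<bar> ^ k / fact k)) sums (K * exp \<bar>t\<bar>)" for t :: real
    using exp_converges[of "\<bar>t\<bar>"] by (intro sums_mult) (simp add: scaleR_conv_of_real field_simps)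
  have le: "norm (v k $ i / fact k * t ^ k) \<le> K * (\<bar>t\<bar> ^ k / fact k)" if "i < n" for i k and t :: real
    using mult_right_mono[OF bd[OF that, of k], of "\<bar>t\<bar> ^ k / fact k"]
    by (simp add: abs_mult power_abs)
  have sa: "summable (\<lambda>k. norm (v k $ i / fact k * t ^ k))" if "i < n" for i and t :: real
  proof (rule summable_comparison_test'[OF sums_summable[OF se], of 0])
    show "norm (norm (v k $ i / fact k * t ^ k)) \<le> K * (\<bar>t\<bar> ^ k / fact k)" for k
      using le[OF that, of k] by simp
  qed
  have sm: "summable (\<lambda>k. v k $ i / fact k * t ^ k)" if "i < n" for i and t :: real
    using sa[OF that] by (rule summable_norm_cancel)
  show "Y 0 = v 0"
    using v(1)[of 0] powser_zero[of "\<lambda>k. v k $ i / fact k" for i]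
    by (intro eq_vecI) (auto simp: Y_def simp del: times_divide_eq_left)
  show "\<bar>Y t $ i\<bar> \<le> K * exp \<bar>t\<bar>" if i: "i < n" for i
  proof -
    have "\<bar>Y t $ i\<bar> \<le> (\<Sum>k. norm (v k $ i / fact k * t ^ k))"
      using i summable_norm[OF sa[OF i]] by (simp add: Y_def)
    also have "\<dots> \<le> (\<Sum>k. K * (\<bar>t\<bar> ^ k / fact k))"
      using le[OF i] sa[OF i] sums_summable[OF se] by (intro suminf_le) auto
    also have "\<dots> = K * exp \<bar>t\<bar>" using se by (rule sums_unique[symmetric])
    finally show ?thesis .
  qed
  show "has_vderiv n Y (N *\<^sub>v Y t) t"
    unfolding has_vderiv_def
  proof (intro conjI allI impI)
    show "Y s \<in> carrier_vec n" for s by (simp add: Y_def)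
    show "N *\<^sub>v Y t \<in> carrier_vec n" using N by (intro mult_mat_vec_carrier) (auto simp: Y_def)
    fix i assume i: "i < n"
    have "((\<lambda>x. \<Sum>k. v k $ i / fact k * x ^ k) has_real_derivative
        (\<Sum>k. diffs (\<lambda>k. v k $ i / fact k) k * t ^ k)) (at t)"
      using sm[OF i] by (rule termdiffs_strong_converges_everywhere)
    moreover have "(\<Sum>k. diffs (\<lambda>k. v k $ i / fact k) k * t ^ k) = (N *\<^sub>v Y t) $ i"
    proof -
      \<comment> \<open>The differentiated coefficient (k + 1) v_(k+1) / (k + 1)! is v_(k+1) / k!,
        and v_(k+1) = N v_k.\<close>
      have "diffs (\<lambda>k. v k $ i / fact k) k * t ^ k
          = (\<Sum>j<n. N $$ (i, j) * (v k $ j / fact k * t ^ k))" for k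
      proof -
        have "diffs (\<lambda>k. v k $ i / fact k) k = v (Suc k) $ i / fact k"
          by (simp add: diffs_def field_simps del: of_nat_Suc)
        also have "v (Suc k) $ i = (\<Sum>j<n. N $$ (i, j) * v k $ j)"
          unfolding v(2) using N v(1)[of k] i by (auto simp: scalar_prod_lessThan)
        finally show ?thesis by (simp add: sum_distrib_right sum_divide_distrib mult.assoc)
      qed
      then have "(\<Sum>k. diffs (\<lambda>k. v k $ i / fact k) k * t ^ k)
          = (\<Sum>k. \<Sum>j<n. N $$ (i, j) * (v k $ j / fact k * t ^ k))" by simp
      also have "\<dots> = (\<Sum>j<n. \<Sum>k. N $$ (i, j) * (v k $ j / fact k * t ^ k))"
        using sm by (intro suminf_sum summable_mult) auto
      also have "\<dots> = (\<Sum>j<n. N $$ (i, j) * Y t $ j)"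
      proof (rule sum.cong[OF refl])
        fix j assume "j \<in> {..<n}"
        then have j: "j < n" by simp
        show "(\<Sum>k. N $$ (i, j) * (v k $ j / fact k * t ^ k)) = N $$ (i, j) * Y t $ j"
          unfolding suminf_mult[OF sm[OF j]] using j by (simp only: Y_def index_vec)
      qed
      also have "\<dots> = (N *\<^sub>v Y t) $ i"
        using N i by (auto simp: scalar_prod_lessThan Y_def)
      finally show ?thesis .
    qed
    ultimately show "((\<lambda>s. Y s $ i) has_real_derivative (N *\<^sub>v Y t) $ i) (at t)"
      using i by (simp add: Y_def)
  qed
qed

lemma hurwitz_flow:
  assumes M: "M \<in> carrier_mat n n" and h: "hurwitz M" and x: "x \<in> carrier_vec n"
  obtains X where "X 0 = x" "\<And>t. has_vderiv n X (M *\<^sub>v X t) t"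
    "\<And>i. i < n \<Longrightarrow> ((\<lambda>t. X t $ i) \<longlongrightarrow> 0) at_top"
proof (cases "n = 0")
  case True
  then show ?thesis using M x by (intro that[of "\<lambda>_. x"]) (auto simp: has_vderiv_def)
next
  case False
  then obtain c \<mu> b where c: "0 < \<mu>" "\<mu> < c"
    and b: "\<forall>k. norm_bound (((1 / \<mu>) \<cdot>\<^sub>m (M + c \<cdot>\<^sub>m 1\<^sub>m n)) ^\<^sub>m k) b"
    using hurwitz_shift_power_bound[OF M h] by auto
  define N where "N = (1 / \<mu>) \<cdot>\<^sub>m (M + c \<cdot>\<^sub>m 1\<^sub>m n)"
  have N: "N \<in> carrier_mat n n" using M by (simp add: N_def)
  define v where "v k = ((*\<^sub>v) N ^^ k) x" for k
  have v: "v k \<in> carrier_vec n" "v (Suc k) = N *\<^sub>v v k" for k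
    using N x by (induction k) (auto simp: v_def)
  have "((*\<^sub>v) N ^^ k) y = N ^\<^sub>m k *\<^sub>v y" if "y \<in> carrier_vec n" for k y
    using that
  proof (induction k arbitrary: y)
    case 0
    then show ?case using N by simp
  next
    case (Suc k)
    then show ?case using N
      by (simp add: funpow_Suc_right del: funpow.simps) (simp add: assoc_mult_mat_vec[OF pow_carrier_mat[OF N] N])
  qed
  then have vp: "v k = N ^\<^sub>m k *\<^sub>v x" for k using x by (simp add: v_def)
  define K where "K = (\<Sum>j<n. b * \<bar>x $ j\<bar>)"
  have bd: "\<bar>v k $ i\<bar> \<le> K" if "i < n" for k i
  proof -
    have "\<bar>v k $ i\<bar> = \<bar>\<Sum>j<n. (N ^\<^sub>m k) $$ (i, j) * x $ j\<bar>"
      unfolding vp using N x that by (simp add: scalar_prod_lessThan)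
    also have "\<dots> \<le> (\<Sum>j<n. \<bar>(N ^\<^sub>m k) $$ (i, j) * x $ j\<bar>)" by (rule sum_abs)
    also have "\<dots> \<le> K"
      unfolding K_def using b[rule_format, of k, folded N_def] that N
      by (intro sum_mono) (auto simp: abs_mult norm_bound_def intro!: mult_right_mono)
    finally show ?thesis .
  qed
  define Y where "Y t = vec n (\<lambda>i. \<Sum>k. v k $ i / fact k * t ^ k)" for t
  note Y = exp_vector_series[where v = v and K = K, OF N v bd, folded Y_def]
  \<comment> \<open>Because \<mu> N = M + c I, the solution exp (t M) x equals exp (- c t) exp
    (\<mu> t N) x. The second factor grows at most like exp (\<mu> t), which leaves the decay rate c
    - \<mu>.\<close>
  define X where "X t = exp (- c * t) \<cdot>\<^sub>v Y (\<mu> * t)" for t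
  have dY: "Y t \<in> carrier_vec n" for t by (simp add: Y_def)
  show ?thesis
  proof (rule that[of X])
    show "X 0 = x" using Y(2) by (simp add: X_def v_def)
    show "has_vderiv n X (M *\<^sub>v X t) t" for t
      unfolding has_vderiv_def
    proof (intro conjI allI impI)
      show "X s \<in> carrier_vec n" for s using dY by (simp add: X_def)
      show "M *\<^sub>v X t \<in> carrier_vec n" using M dY by (auto simp: X_def)
      fix i assume i: "i < n"
      have 1: "((\<lambda>t. Y t $ i) has_real_derivative (N *\<^sub>v Y (\<mu> * t)) $ i) (at (\<mu> * t))"
        using Y(1)[of "\<mu> * t"] i unfolding has_vderiv_def by simp
      have 2: "((\<lambda>t. Y (\<mu> * t) $ i) has_real_derivative (N *\<^sub>v Y (\<mu> * t)) $ i * \<mu>) (at t)"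
        using DERIV_chain2[where f = "\<lambda>t. Y t $ i", OF 1 DERIV_cmult_Id] by simp
      have "((\<lambda>t. exp (- c * t) * Y (\<mu> * t) $ i) has_real_derivative
          exp (- c * t) * (- c) * Y (\<mu> * t) $ i + (N *\<^sub>v Y (\<mu> * t)) $ i * \<mu> * exp (- c * t)) (at t)"
        by (rule derivative_eq_intros 2 | rule refl | simp)+
      moreover have "\<mu> * (N *\<^sub>v Y (\<mu> * t)) $ i = (M *\<^sub>v Y (\<mu> * t)) $ i + c * Y (\<mu> * t) $ i"
      proof -
        have "\<mu> * (N *\<^sub>v Y (\<mu> * t)) $ i = (\<Sum>j<n. \<mu> * (1 / \<mu> * (M $$ (i, j) + c * (if i = j then 1 else 0)) * Y (\<mu> * t) $ j))"
          using i M dY by (auto simp: scalar_prod_lessThan N_def Y_def sum_distrib_left intro!: sum.cong)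
        also have "\<dots> = (\<Sum>j<n. M $$ (i, j) * Y (\<mu> * t) $ j + c * (if i = j then Y (\<mu> * t) $ j else 0))"
          using c(1) by (intro sum.cong) (auto simp: algebra_simps)
        also have "\<dots> = (\<Sum>j<n. M $$ (i, j) * Y (\<mu> * t) $ j) + c * (\<Sum>j<n. if i = j then Y (\<mu> * t) $ j else 0)"
          by (simp only: sum.distrib sum_distrib_left[symmetric])
        also have "\<dots> = (M *\<^sub>v Y (\<mu> * t)) $ i + c * Y (\<mu> * t) $ i"
          using i M dY[of "\<mu> * t"] by (simp add: scalar_prod_lessThan sum.delta')
        finally show ?thesis .
      qed
      ultimately have "((\<lambda>t. exp (- c * t) * Y (\<mu> * t) $ i) has_real_derivative
          exp (- c * t) * (M *\<^sub>v Y (\<mu> * t)) $ i) (at t)"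
        by (auto elim!: DERIV_cong simp: algebra_simps)
      moreover have "(M *\<^sub>v X t) $ i = exp (- c * t) * (M *\<^sub>v Y (\<mu> * t)) $ i"
        unfolding X_def mult_mat_vec[OF M dY] using i M by simp
      moreover have "(\<lambda>s. X s $ i) = (\<lambda>s. exp (- c * s) * Y (\<mu> * s) $ i)"
        using i dY by (auto simp: X_def carrier_vecD[OF dY])
      ultimately show "((\<lambda>s. X s $ i) has_real_derivative (M *\<^sub>v X t) $ i) (at t)"
        by (simp only:)
    qed
    fix i assume i: "i < n"
    have "((\<lambda>t. K * exp (- (c - \<mu>) * t)) \<longlongrightarrow> K * 0) at_top" (is "(?b \<longlongrightarrow> _) _")
    proof (intro tendsto_mult tendsto_const filterlim_compose[OF exp_at_bot])
      show "filterlim (\<lambda>t. - (c - \<mu>) * t) at_bot at_top"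
        using c by (intro filterlim_tendsto_neg_mult_at_bot[OF tendsto_const]) (auto intro: filterlim_ident)
    qed
    then have lim: "(?b \<longlongrightarrow> 0) at_top" by simp
    have "\<forall>\<^sub>F t in at_top. norm (X t $ i) \<le> K * exp (- (c - \<mu>) * t)"
      using eventually_ge_at_top[of 0]
    proof eventually_elim
      case (elim t)
      have "norm (X t $ i) = exp (- c * t) * \<bar>Y (\<mu> * t) $ i\<bar>"
        using i dY[of "\<mu> * t"] by (simp add: X_def abs_mult)
      also have "\<dots> \<le> exp (- c * t) * (K * exp \<bar>\<mu> * t\<bar>)"
        using Y(3)[OF _ i] by (intro mult_left_mono) auto
      also have "\<dots> = K * exp (- (c - \<mu>) * t)"
        using elim c by (simp add: algebra_simps flip: exp_add)
      finally show ?case .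
    qed
    then show "((\<lambda>t. X t $ i) \<longlongrightarrow> 0) at_top"
      using lim by (rule Lim_null_comparison)
  qed
qed

text \<open>A nonincreasing function stays above its limit at infinity. This replaces the
  representation of solutions of Lyapunov equations by integrals over the half line.\<close>

lemma nonneg_of_decay:
  fixes f :: "real \<Rightarrow> real"
  assumes "\<And>t. (f has_real_derivative f' t) (at t)" "\<And>t. f' t \<le> 0" "(f \<longlongrightarrow> 0) at_top"
  shows "0 \<le> f 0"
proof -
  have "f t \<le> f 0" if "t \<ge> 0" for t
    using DERIV_nonpos_imp_nonincreasing[OF that] assms(1,2) by blast
  then have "\<forall>\<^sub>F t in at_top. f t \<le> f 0"
    by (rule eventually_mono[OF eventually_ge_at_top[of 0]])
  then show ?thesis using tendsto_upperbound[OF assms(3)] by simp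
qed

lemma zero_of_decay:
  fixes f :: "real \<Rightarrow> real"
  assumes "\<And>t. (f has_real_derivative 0) (at t)" "(f \<longlongrightarrow> 0) at_top"
  shows "f 0 = 0"
proof -
  have "0 \<le> f 0" using nonneg_of_decay[of f "\<lambda>_. 0"] assms by simp
  moreover have "0 \<le> - f 0"
  proof (rule nonneg_of_decay[of "\<lambda>t. - f t" "\<lambda>_. 0"])
    show "((\<lambda>t. - f t) has_real_derivative 0) (at t)" for t
      using DERIV_minus[OF assms(1)[of t]] by simp
    show "((\<lambda>t. - f t) \<longlongrightarrow> 0) at_top" using tendsto_minus[OF assms(2)] by simp
  qed simp
  ultimately show ?thesis by simp
qed

lemma tendsto_scalar_prod_zero:
  fixes X :: "'a \<Rightarrow> real vec"
  assumes "\<And>t. dim_vec (X t) = n" "\<And>i. i < n \<Longrightarrow> ((\<lambda>t. X t $ i) \<longlongrightarrow> 0) F"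
  shows "((\<lambda>t. c \<bullet> X t) \<longlongrightarrow> 0) F"
proof -
  have "((\<lambda>t. \<Sum>i<n. c $ i * X t $ i) \<longlongrightarrow> (\<Sum>i<n. c $ i * 0)) F"
    using assms(2) by (intro tendsto_sum tendsto_mult tendsto_const) auto
  then show ?thesis using assms(1) by (simp add: scalar_prod_lessThan)
qed

lemma tendsto_kron_vec_zero:
  fixes U V :: "'a \<Rightarrow> real vec"
  assumes "\<And>t. dim_vec (U t) = a" "\<And>t. dim_vec (V t) = b"
    and "\<And>i. i < a \<Longrightarrow> ((\<lambda>t. U t $ i) \<longlongrightarrow> 0) F" "\<And>i. i < b \<Longrightarrow> ((\<lambda>t. V t $ i) \<longlongrightarrow> L) F"
    and "j < a * b"
  shows "((\<lambda>t. kron_vec (U t) (V t) $ j) \<longlongrightarrow> 0) F"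
proof -
  have "((\<lambda>t. U t $ (j div b) * V t $ (j mod b)) \<longlongrightarrow> 0 * L) F"
    using assms by (intro tendsto_mult) (auto simp: less_mult_imp_div_less mod_less_of_less_mult)
  then show ?thesis using assms by (simp add: index_kron_vec)
qed

lemma tendsto_kron_vecs_zero:
  assumes "\<And>X t. X \<in> set Xs \<Longrightarrow> dim_vec (X t) = n"
    and "\<And>X i. X \<in> set Xs \<Longrightarrow> i < n \<Longrightarrow> ((\<lambda>t. X t $ i) \<longlongrightarrow> 0) F"
    and "Xs \<noteq> []" "j < n ^ length Xs"
  shows "((\<lambda>t. kron_vecs (map (\<lambda>X. X t) Xs) $ j) \<longlongrightarrow> 0) F"
  using assms
proof (induction Xs arbitrary: j)
  case (Cons X Xs)
  have d: "dim_vec (kron_vecs (map (\<lambda>X. X t) Xs)) = n ^ length Xs" for t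
    using kron_vecs_carrier[of "map (\<lambda>X. X t) Xs" n] Cons.prems(1)
    by (fastforce intro: carrier_vecI)
  have X: "\<And>t. dim_vec (X t) = n" "\<And>i. i < n \<Longrightarrow> ((\<lambda>t. X t $ i) \<longlongrightarrow> 0) F"
    using Cons.prems by auto
  have j: "j < n * n ^ length Xs" using Cons.prems by simp
  show ?case
  proof (cases "Xs = []")
    case True
    then show ?thesis using X j by simp
  next
    case False
    have "((\<lambda>t. kron_vecs (map (\<lambda>X. X t) Xs) $ i) \<longlongrightarrow> 0) F" if "i < n ^ length Xs" for i
      using Cons.IH[OF _ _ False that] Cons.prems by auto
    then have "((\<lambda>t. kron_vec (X t) (kron_vecs (map (\<lambda>X. X t) Xs)) $ j) \<longlongrightarrow> 0) F"
      using X d j by (intro tendsto_kron_vec_zero[where a = n and b = "n ^ length Xs" and L = 0]) auto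
    then show ?thesis by simp
  qed
qed simp

section \<open>The Kronecker sum along decaying flows\<close>

definition decaying_flow :: "nat \<Rightarrow> real mat \<Rightarrow> (real \<Rightarrow> real vec) \<Rightarrow> bool" where
  "decaying_flow n M X \<longleftrightarrow> (\<forall>t. has_vderiv n X (M *\<^sub>v X t) t) \<and> (\<forall>i<n. ((\<lambda>t. X t $ i) \<longlongrightarrow> 0) at_top)"

lemma decaying_flow_exists:
  "M \<in> carrier_mat n n \<Longrightarrow> hurwitz M \<Longrightarrow> x \<in> carrier_vec n \<Longrightarrow> \<exists>X. X 0 = x \<and> decaying_flow n M X"
  unfolding decaying_flow_def by (metis hurwitz_flow)

lemma decaying_flow_carrier: "decaying_flow n M X \<Longrightarrow> X t \<in> carrier_vec n"
  unfolding decaying_flow_def has_vderiv_def by blast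

text \<open>By the Leibniz rule the hypothesis \<open>zero\<close> says that the contraction has
  derivative 0; being constant, it equals its limit 0. An empty list is excluded because its product
  is constantly 1. Different flows in different slots are allowed, which serves both powers and
  general products.\<close>

lemma lyap_flow_conserved:
  assumes M: "M \<in> carrier_mat n n" and Xs: "\<And>X. X \<in> set Xs \<Longrightarrow> decaying_flow n M X" and ne: "Xs \<noteq> []"
    and z: "dim_vec z = n ^ length Xs"
    and zero: "\<And>t. z \<bullet> (lyap (length Xs) M *\<^sub>v kron_vecs (map (\<lambda>X. X t) Xs)) = 0"
  shows "z \<bullet> kron_vecs (map (\<lambda>X. X 0) Xs) = 0"
proof (rule zero_of_decay)
  have c: "X t \<in> carrier_vec n" if "X \<in> set Xs" for X t
    using decaying_flow_carrier[OF Xs[OF that]] .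
  show "((\<lambda>t. z \<bullet> kron_vecs (map (\<lambda>X. X t) Xs)) \<longlongrightarrow> 0) at_top"
  proof (rule tendsto_scalar_prod_zero)
    show "dim_vec (kron_vecs (map (\<lambda>X. X t) Xs)) = n ^ length Xs" for t
      using kron_vecs_carrier[of "map (\<lambda>X. X t) Xs" n] c by fastforce
    show "((\<lambda>t. kron_vecs (map (\<lambda>X. X t) Xs) $ j) \<longlongrightarrow> 0) at_top" if "j < n ^ length Xs" for j
      using tendsto_kron_vecs_zero[of Xs n at_top j] c Xs ne that
      unfolding decaying_flow_def by fastforce
  qed
  fix t
  let ?Ys = "map (\<lambda>X. (X, M *\<^sub>v X t)) Xs"
  have "has_vderiv (n ^ length ?Ys) (\<lambda>s. kron_vecs (map (\<lambda>Y. fst Y s) ?Ys))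
      (vec_sum (n ^ length ?Ys) (\<lambda>i. kron_vecs ((map (\<lambda>Y. fst Y t) ?Ys)[i := snd (?Ys ! i)])) {..<length ?Ys}) t"
    using Xs by (intro has_vderiv_kron_vecs) (auto simp: decaying_flow_def)
  moreover have "vec_sum (n ^ length ?Ys) (\<lambda>i. kron_vecs ((map (\<lambda>Y. fst Y t) ?Ys)[i := snd (?Ys ! i)])) {..<length ?Ys}
      = lyap (length Xs) M *\<^sub>v kron_vecs (map (\<lambda>X. X t) Xs)"
  proof -
    have "lyap (length Xs) M *\<^sub>v kron_vecs (map (\<lambda>X. X t) Xs) = vec_sum (n ^ length Xs)
        (\<lambda>i. kron_vecs ((map (\<lambda>X. X t) Xs)[i := M *\<^sub>v (map (\<lambda>X. X t) Xs ! i)])) {..<length Xs}"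
      using lyap_mult_kron_vecs[OF M, of "map (\<lambda>X. X t) Xs"] c ne by fastforce
    then show ?thesis by (auto simp: comp_def intro!: vec_sum_cong)
  qed
  ultimately have "has_vderiv (n ^ length Xs) (\<lambda>s. kron_vecs (map (\<lambda>X. X s) Xs))
      (lyap (length Xs) M *\<^sub>v kron_vecs (map (\<lambda>X. X t) Xs)) t"
    by (simp add: comp_def)
  from has_vderiv_scalar_prod[OF this z]
  show "((\<lambda>t. z \<bullet> kron_vecs (map (\<lambda>X. X t) Xs)) has_real_derivative 0) (at t)"
    using zero by simp
qed

text \<open>With one and the same flow in every slot the product remains a Kronecker power, so
  knowledge on powers is enough to propagate.\<close>

lemma lyap_xpow_zero:
  assumes M: "M \<in> carrier_mat n n" "hurwitz M" and k: "k > 0" and z: "dim_vec z = n ^ k"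
    and zero: "\<And>x. x \<in> carrier_vec n \<Longrightarrow> z \<bullet> (lyap k M *\<^sub>v xpow k x) = 0"
    and x: "x \<in> carrier_vec n"
  shows "z \<bullet> xpow k x = 0"
proof -
  obtain X where X: "X 0 = x" "decaying_flow n M X" using decaying_flow_exists[OF M x] by blast
  have "z \<bullet> kron_vecs (map (\<lambda>X. X 0) (replicate k X)) = 0"
    using X decaying_flow_carrier[OF X(2)] zero z k
    by (intro lyap_flow_conserved[OF M(1)]) (auto simp: xpow_def)
  then show ?thesis using X by (simp add: xpow_def)
qed

text \<open>Each factor moves along the flow that starts at it, so the products met on the way have
  arbitrary factors.\<close>

lemma lyap_kron_vecs_zero:
  assumes M: "M \<in> carrier_mat n n" "hurwitz M" and ne: "vs \<noteq> []" and z: "dim_vec z = n ^ length vs"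
    and zero: "\<And>us. length us = length vs \<Longrightarrow> set us \<subseteq> carrier_vec n \<Longrightarrow> z \<bullet> (lyap (length vs) M *\<^sub>v kron_vecs us) = 0"
    and vs: "set vs \<subseteq> carrier_vec n"
  shows "z \<bullet> kron_vecs vs = 0"
proof -
  obtain \<Phi> where \<Phi>: "\<And>x. x \<in> carrier_vec n \<Longrightarrow> \<Phi> x 0 = x \<and> decaying_flow n M (\<Phi> x)"
    using decaying_flow_exists[OF M] by metis
  have "z \<bullet> kron_vecs (map (\<lambda>X. X 0) (map \<Phi> vs)) = 0"
  proof (rule lyap_flow_conserved[OF M(1)])
    show "decaying_flow n M X" if "X \<in> set (map \<Phi> vs)" for X
      using that \<Phi> vs by auto
    then have "set (map (\<lambda>X. X t) (map \<Phi> vs)) \<subseteq> carrier_vec n" for t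
      using decaying_flow_carrier[of n M] by auto
    then show "z \<bullet> (lyap (length (map \<Phi> vs)) M *\<^sub>v kron_vecs (map (\<lambda>X. X t) (map \<Phi> vs))) = 0" for t
      using zero[of "map (\<lambda>X. X t) (map \<Phi> vs)"] by simp
  qed (use ne z in auto)
  moreover have "map (\<lambda>X. X 0) (map \<Phi> vs) = vs"
    unfolding map_map by (rule map_idI) (use \<Phi> vs in auto)
  ultimately show ?thesis by simp
qed

text \<open>The factors are the unit vectors at the base-n digits of \<open>j\<close>, most
  significant digit first.\<close>

lemma unit_vec_as_kron_vecs:
  assumes "j < n ^ k"
  shows "\<exists>vs. length vs = k \<and> set vs \<subseteq> carrier_vec n \<and> kron_vecs vs = unit_vec (n ^ k) j"
  using assms
proof (induction k arbitrary: j)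
  case 0
  have "vec (Suc 0) (\<lambda>_. 1) = (unit_vec (Suc 0) 0 :: real vec)"
    by (intro eq_vecI) auto
  then show ?case using 0 by simp
next
  case (Suc k)
  have 1: "j div n ^ k < n" "j mod n ^ k < n ^ k"
    using Suc.prems by (auto simp: less_mult_imp_div_less mod_less_of_less_mult)
  obtain vs where vs: "length vs = k" "set vs \<subseteq> carrier_vec n" "kron_vecs vs = unit_vec (n ^ k) (j mod n ^ k)"
    using Suc.IH[OF 1(2)] by blast
  have "kron_vec (unit_vec n (j div n ^ k)) (unit_vec (n ^ k) (j mod n ^ k)) = unit_vec (n * n ^ k) j"
  proof (rule eq_vecI)
    fix i assume "i < dim_vec (unit_vec (n * n ^ k) j :: real vec)"
    then have i: "i < n * n ^ k" by simp
    then have 2: "i div n ^ k < n" "i mod n ^ k < n ^ k"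
      by (auto simp: less_mult_imp_div_less mod_less_of_less_mult)
    have "i = j \<longleftrightarrow> i div n ^ k = j div n ^ k \<and> i mod n ^ k = j mod n ^ k"
      by (metis div_mult_mod_eq)
    then show "kron_vec (unit_vec n (j div n ^ k)) (unit_vec (n ^ k) (j mod n ^ k)) $ i = unit_vec (n * n ^ k) j $ i"
      using i 1 2 Suc.prems by (auto simp: index_kron_vec index_unit_vec)
  qed simp
  then show ?case using vs by (intro exI[of _ "unit_vec n (j div n ^ k) # vs"]) auto
qed

lemma zero_of_kron_vecs_zero:
  assumes z: "z \<in> carrier_vec (n ^ k)"
    and "\<And>vs. length vs = k \<Longrightarrow> set vs \<subseteq> carrier_vec n \<Longrightarrow> z \<bullet> kron_vecs vs = 0"
  shows "z = 0\<^sub>v (n ^ k)"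
proof (rule eq_vecI)
  fix j assume "j < dim_vec (0\<^sub>v (n ^ k) :: real vec)"
  then have j: "j < n ^ k" by simp
  then obtain vs where "length vs = k" "set vs \<subseteq> carrier_vec n" "kron_vecs vs = unit_vec (n ^ k) j"
    using unit_vec_as_kron_vecs by blast
  then have "z \<bullet> unit_vec (n ^ k) j = 0" using assms(2) by metis
  then show "z $ j = 0\<^sub>v (n ^ k) $ j" using z j by simp
qed (use z in simp)

lemma det_nonzero_solvable:
  fixes L :: "'a::field mat"
  assumes L: "L \<in> carrier_mat N N" "det L \<noteq> 0" and b: "b \<in> carrier_vec N"
  shows "\<exists>x\<in>carrier_vec N. L *\<^sub>v x = b"
proof -
  from det_non_zero_imp_unit[OF L, of "()"] obtain K where K: "K \<in> carrier_mat N N" "L * K = 1\<^sub>m N"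
    unfolding Units_def ring_mat_simps by blast
  have "L *\<^sub>v (K *\<^sub>v b) = b"
    using assoc_mult_mat_vec[OF L(1) K(1) b] K b by simp
  then show ?thesis using K b by (intro bexI[of _ "K *\<^sub>v b"]) auto
qed

text \<open>A kernel vector of the transposed Kronecker sum is conserved along all products of
  decaying flows, hence vanishes on all Kronecker products and so on the unit vectors. This shows
  invertibility without describing the spectrum of the Kronecker sum.\<close>

lemma lyap_transpose_solvable:
  assumes M: "M \<in> carrier_mat n n" "hurwitz M" and k: "k > 0" and b: "b \<in> carrier_vec (n ^ k)"
  shows "\<exists>z\<in>carrier_vec (n ^ k). (lyap k M)\<^sup>T *\<^sub>v z = b"
proof -
  have L: "lyap k M \<in> carrier_mat (n ^ k) (n ^ k)"
    using lyap_carrier[OF M(1), of k] k by (cases k) (simp_all add: mult.commute)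
  have "det (lyap k M)\<^sup>T \<noteq> 0"
  proof
    assume "det (lyap k M)\<^sup>T = 0"
    then obtain z where z: "z \<in> carrier_vec (n ^ k)" "z \<noteq> 0\<^sub>v (n ^ k)" "(lyap k M)\<^sup>T *\<^sub>v z = 0\<^sub>v (n ^ k)"
      using det_0_iff_vec_prod_zero_field[of "(lyap k M)\<^sup>T" "n ^ k"] L by auto
    have "z = 0\<^sub>v (n ^ k)"
    proof (rule zero_of_kron_vecs_zero[OF z(1)])
      fix vs :: "real vec list" assume vs: "length vs = k" "set vs \<subseteq> carrier_vec n"
      show "z \<bullet> kron_vecs vs = 0"
      proof (rule lyap_kron_vecs_zero[OF M])
        fix us :: "real vec list" assume us: "length us = length vs" "set us \<subseteq> carrier_vec n"
        have cus: "kron_vecs us \<in> carrier_vec (n ^ k)"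
          using kron_vecs_carrier[of us n] us vs by auto
        then have "((lyap k M)\<^sup>T *\<^sub>v z) \<bullet> kron_vecs us = z \<bullet> (lyap k M *\<^sub>v kron_vecs us)"
          using z(1) by (intro transpose_mult_scalar_prod[OF L]) auto
        then show "z \<bullet> (lyap (length vs) M *\<^sub>v kron_vecs us) = 0"
          using z(3) cus vs(1) scalar_prod_left_zero[OF cus] by metis
      qed (use vs k z in auto)
    qed
    then show False using z(2) by simp
  qed
  then show ?thesis using det_nonzero_solvable[of "(lyap k M)\<^sup>T" "n ^ k" b] L b by simp
qed

section \<open>Bilinear forms along decaying flows\<close>

lemma has_vderiv_bilinear:
  assumes W: "W \<in> carrier_mat n m" and X: "has_vderiv n X X' t" and Y: "has_vderiv m Y Y' t"
  shows "((\<lambda>s. X s \<bullet> (W *\<^sub>v Y s)) has_real_derivative X' \<bullet> (W *\<^sub>v Y t) + X t \<bullet> (W *\<^sub>v Y')) (at t)"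
proof -
  have d: "dim_vec (X s) = n" "dim_vec (Y s) = m" "dim_vec X' = n" "dim_vec Y' = m" for s
    using X Y unfolding has_vderiv_def by auto
  \<comment> \<open>A bilinear form in X and Y is a linear form in their Kronecker product, whose
    derivative is known.\<close>
  have "((\<lambda>s. vec_of_mat W \<bullet> kron_vec (Y s) (X s)) has_real_derivative
      vec_of_mat W \<bullet> (kron_vec Y' (X t) + kron_vec (Y t) X')) (at t)"
    by (intro has_vderiv_scalar_prod[OF has_vderiv_kron_vec[OF Y X]]) (use W in auto)
  moreover have "vec_of_mat W \<bullet> (kron_vec Y' (X t) + kron_vec (Y t) X')
      = vec_of_mat W \<bullet> kron_vec Y' (X t) + vec_of_mat W \<bullet> kron_vec (Y t) X'"
    by (intro scalar_prod_add_distrib[of _ "m * n"]) (use W d in \<open>auto intro!: carrier_vecI\<close>)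
  ultimately show ?thesis
    using W d by (simp add: vec_of_mat_scalar_kron_vec add.commute)
qed

lemma tendsto_bilinear_zero:
  fixes X Y :: "'a \<Rightarrow> real vec"
  assumes W: "W \<in> carrier_mat n m" and "\<And>t. dim_vec (X t) = n" "\<And>t. dim_vec (Y t) = m"
    and "\<And>i. i < n \<Longrightarrow> ((\<lambda>t. X t $ i) \<longlongrightarrow> 0) F" "\<And>i. i < m \<Longrightarrow> ((\<lambda>t. Y t $ i) \<longlongrightarrow> 0) F"
  shows "((\<lambda>t. X t \<bullet> (W *\<^sub>v Y t)) \<longlongrightarrow> 0) F"
proof -
  have "((\<lambda>t. vec_of_mat W \<bullet> kron_vec (Y t) (X t)) \<longlongrightarrow> 0) F"
    using assms by (intro tendsto_scalar_prod_zero[of _ "m * n"] tendsto_kron_vec_zero[of _ m _ n]) auto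
  then show ?thesis using assms by (simp add: vec_of_mat_scalar_kron_vec)
qed

text \<open>The hypothesis is the derivative of x . D y when x follows the flow of \<open>A\<close>
  and y that of \<open>B\<close>. The form is therefore constant, and it tends to 0.\<close>

lemma sylvester_zero:
  assumes A: "A \<in> carrier_mat n n" "hurwitz A" and B: "B \<in> carrier_mat n n" "hurwitz B"
    and D: "D \<in> carrier_mat n n"
    and zero: "\<And>x y. x \<in> carrier_vec n \<Longrightarrow> y \<in> carrier_vec n \<Longrightarrow>
      (A *\<^sub>v x) \<bullet> (D *\<^sub>v y) + x \<bullet> (D *\<^sub>v (B *\<^sub>v y)) = 0"
    and x: "x \<in> carrier_vec n" and y: "y \<in> carrier_vec n"
  shows "x \<bullet> (D *\<^sub>v y) = 0"
proof -
  obtain X where X: "X 0 = x" "decaying_flow n A X" using decaying_flow_exists[OF A x] by blast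
  obtain Y where Y: "Y 0 = y" "decaying_flow n B Y" using decaying_flow_exists[OF B y] by blast
  note c = decaying_flow_carrier[OF X(2)] decaying_flow_carrier[OF Y(2)]
  have "X 0 \<bullet> (D *\<^sub>v Y 0) = 0"
  proof (rule zero_of_decay)
    show "((\<lambda>t. X t \<bullet> (D *\<^sub>v Y t)) has_real_derivative 0) (at t)" for t
      using has_vderiv_bilinear[OF D, of X "A *\<^sub>v X t" t Y "B *\<^sub>v Y t"] X(2) Y(2) zero c
      unfolding decaying_flow_def by simp
    show "((\<lambda>t. X t \<bullet> (D *\<^sub>v Y t)) \<longlongrightarrow> 0) at_top"
      using X(2) Y(2) c[THEN carrier_vecD] unfolding decaying_flow_def
      by (intro tendsto_bilinear_zero[OF D]) auto
  qed
  then show ?thesis using X Y by simp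
qed

text \<open>The quadratic form does not increase along the flow of \<open>A\<close> and tends to 0,
  so it starts nonnegative.\<close>

lemma lyapunov_nonneg:
  assumes A: "A \<in> carrier_mat n n" "hurwitz A" and W: "W \<in> carrier_mat n n"
    and le: "\<And>x. x \<in> carrier_vec n \<Longrightarrow> (A *\<^sub>v x) \<bullet> (W *\<^sub>v x) + x \<bullet> (W *\<^sub>v (A *\<^sub>v x)) \<le> 0"
    and x: "x \<in> carrier_vec n"
  shows "0 \<le> x \<bullet> (W *\<^sub>v x)"
proof -
  obtain X where X: "X 0 = x" "decaying_flow n A X" using decaying_flow_exists[OF A x] by blast
  note c = decaying_flow_carrier[OF X(2)]
  have "0 \<le> X 0 \<bullet> (W *\<^sub>v X 0)"
  proof (rule nonneg_of_decay)
    show "((\<lambda>t. X t \<bullet> (W *\<^sub>v X t)) has_real_derivative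
        (A *\<^sub>v X t) \<bullet> (W *\<^sub>v X t) + X t \<bullet> (W *\<^sub>v (A *\<^sub>v X t))) (at t)" for t
      using X(2) unfolding decaying_flow_def by (intro has_vderiv_bilinear[OF W]) auto
    show "((\<lambda>t. X t \<bullet> (W *\<^sub>v X t)) \<longlongrightarrow> 0) at_top"
      using X(2) c[THEN carrier_vecD] unfolding decaying_flow_def
      by (intro tendsto_bilinear_zero[OF W]) auto
  qed (use le c in auto)
  then show ?thesis using X by simp
qed

section \<open>Evaluation of the coefficient systems on Kronecker powers\<close>

lemma dim_col_mat [simp]: "dim_row (col_mat v) = dim_vec v" "dim_col (col_mat v) = 1"
  by (simp_all add: col_mat_def)

lemma col_mat_mult_vec: "col_mat v *\<^sub>v vec (Suc 0) (\<lambda>_. c) = c \<cdot>\<^sub>v v"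
  by (rule eq_vecI) (auto simp: col_mat_def scalar_prod_lessThan)

lemma col_mat_transpose_mult_vec:
  assumes "dim_vec u = dim_vec v"
  shows "(col_mat v)\<^sup>T *\<^sub>v u = vec (Suc 0) (\<lambda>_. v \<bullet> u)"
  by (rule eq_vecI) (use assms in \<open>auto simp: col_mat_def scalar_prod_lessThan\<close>)

lemma col_mat_kron_mult_vec:
  assumes "dim_vec u = m"
  shows "(col_mat v \<otimes>\<^sub>m 1\<^sub>m m) *\<^sub>v u = kron_vec v u"
proof -
  have "(col_mat v \<otimes>\<^sub>m 1\<^sub>m m) *\<^sub>v kron_vec (vec (Suc 0) (\<lambda>_. 1)) u
      = kron_vec (col_mat v *\<^sub>v vec (Suc 0) (\<lambda>_. 1)) (1\<^sub>m m *\<^sub>v u)"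
    using assms by (intro kron_mult_kron_vec) auto
  moreover have "1\<^sub>m m *\<^sub>v u = u" using assms by (intro one_mult_mat_vec carrier_vecI)
  ultimately show ?thesis by (simp add: kron_vec_one_left col_mat_mult_vec)
qed

lemma vec_of_mat_outer_prod:
  "vec_of_mat (mat (dim_vec b) (dim_vec a) (\<lambda>(r, c). b $ r * a $ c)) = kron_vec a b"
  by (rule eq_vecI) (auto simp: vec_of_mat_def index_kron_vec mult.commute less_mult_imp_div_less
      mod_less_of_less_mult)

text \<open>The product of a and b, in this order, is vec of the outer product b a^T. Transposing
  the outer product exchanges the factors, and the shuffle realizes transposition.\<close>

lemma perfect_shuffle_kron_vec:
  "perfect_shuffle (dim_vec a) (dim_vec b) *\<^sub>v kron_vec a b = kron_vec b a"
proof -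
  let ?M = "mat (dim_vec b) (dim_vec a) (\<lambda>(r, c). b $ r * a $ c)"
  have "?M\<^sup>T = mat (dim_vec a) (dim_vec b) (\<lambda>(r, c). a $ r * b $ c)"
    by (rule eq_matI) auto
  then show ?thesis
    using perfect_shuffle_vec[of ?M "dim_vec b" "dim_vec a"] by (simp add: vec_of_mat_outer_prod)
qed

text \<open>In this form a contraction with vec[I_m] becomes a sum over the m inputs.\<close>

lemma vec_of_identity:
  "vec_of_mat (1\<^sub>m m) = vec_sum (m * m) (\<lambda>a. kron_vec (unit_vec m a) (unit_vec m a)) {..<m}"
proof (rule eq_vecI)
  fix i assume "i < dim_vec (vec_sum (m * m) (\<lambda>a. kron_vec (unit_vec m a) (unit_vec m a)) {..<m} :: real vec)"
  then have i: "i < m * m" by simp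
  then have 1: "i div m < m" "i mod m < m" by (auto simp: less_mult_imp_div_less mod_less_of_less_mult)
  have "vec_sum (m * m) (\<lambda>a. kron_vec (unit_vec m a) (unit_vec m a)) {..<m} $ i
      = (\<Sum>a<m. kron_vec (unit_vec m a) (unit_vec m a) $ i)"
    using i by (simp add: vec_sum_def)
  also have "\<dots> = (\<Sum>a<m. if i div m = a then (if i mod m = a then 1 else 0) else 0)"
    by (intro sum.cong refl) (use i 1 in \<open>simp add: index_kron_vec\<close>)
  also have "\<dots> = vec_of_mat (1\<^sub>m m) $ i"
    using i 1 by (simp add: vec_of_mat_def sum.delta')
  finally show "vec_of_mat (1\<^sub>m m) $ i
      = vec_sum (m * m) (\<lambda>a. kron_vec (unit_vec m a) (unit_vec m a)) {..<m} $ i" by simp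
qed simp

lemma kron_vec_vec_of_identity:
  "kron_vec v (vec_of_mat (1\<^sub>m m))
    = vec_sum (dim_vec v * (m * m)) (\<lambda>a. kron_vec (kron_vec v (unit_vec m a)) (unit_vec m a)) {..<m}"
  unfolding vec_of_identity by (subst kron_vec_vec_sum) (auto simp: kron_vec_assoc)

text \<open>Entry \<open>a\<close> of (G_p (x^p tensor I_m))^T W_i x^(i-1), powers being Kronecker
  powers. Up to the factor i / 2 it is the contribution of \<open>G p\<close> and \<open>W i\<close>
  to g^T times the gradient of the energy, in input \<open>a\<close>.\<close>

definition gain :: "nat \<Rightarrow> (nat \<Rightarrow> real mat) \<Rightarrow> (nat \<Rightarrow> real mat) \<Rightarrow> real vec \<Rightarrow> nat \<Rightarrow> nat \<Rightarrow> nat \<Rightarrow> real" where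
  "gain m G W x p i a = (G p *\<^sub>v kron_vec (xpow p x) (unit_vec m a)) \<bullet> (W i *\<^sub>v xpow (i - 1) x)"

text \<open>The matrix is read from right to left on \<open>xpow (k - p) x\<close>. The last factor
  appends vec[I_m], a sum of e_a tensor e_a; the shuffle exchanges x^(i-1) with x^q tensor e_a; the
  row vector contracts x^(j-1) and x^q tensor e_a to the gain of \<open>G q\<close> and
  \<open>W j\<close>; the first factor feeds the e_a that is left into the input slot of
  \<open>G p\<close>. The p missing copies of x come from the row index.\<close>

lemma vec_of_mat_rhs_g_mat:
  assumes x: "x \<in> carrier_vec n" and G: "G p \<in> carrier_mat n (m * n ^ p)" "G q \<in> carrier_mat n (m * n ^ q)"
    and W: "W i \<in> carrier_mat n (n ^ (i - 1))" "W j \<in> carrier_mat n (n ^ (j - 1))"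
    and k: "i \<ge> 1" "j \<ge> 1" "i + j + (p + q) = k + 2"
  shows "vec_of_mat (rhs_g_mat n m G W k p q i j) \<bullet> xpow k x
    = (\<Sum>a<m. gain m G W x p i a * gain m G W x q j a)"
proof -
  let ?e = "unit_vec m :: nat \<Rightarrow> real vec"
  let ?x = "\<lambda>k. xpow k x"
  let ?V = "vec_of_mat (1\<^sub>m m)"
  let ?M1 = "1\<^sub>m (n ^ p) \<otimes>\<^sub>m (col_mat ?V)\<^sup>T"
  let ?Vq = "vec_of_mat ((G q)\<^sup>T * W j)"
  let ?M2 = "(col_mat ?Vq)\<^sup>T \<otimes>\<^sub>m (((G p)\<^sup>T * W i) \<otimes>\<^sub>m 1\<^sub>m m)"
  let ?M3 = "1\<^sub>m (n ^ (j - 1)) \<otimes>\<^sub>m perfect_shuffle (n ^ (i - 1)) (n ^ q * m) \<otimes>\<^sub>m 1\<^sub>m m"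
  let ?M4 = "1\<^sub>m (n ^ (k - p)) \<otimes>\<^sub>m col_mat ?V"
  have dx: "dim_vec x = n" using x by simp
  have dG: "dim_row (G p) = n" "dim_col (G p) = m * n ^ p" "dim_row (G q) = n" "dim_col (G q) = m * n ^ q"
    using G by auto
  have dW: "dim_row (W i) = n" "dim_col (W i) = n ^ (i - 1)" "dim_row (W j) = n" "dim_col (W j) = n ^ (j - 1)"
    using W by auto
  \<comment> \<open>This count of Kronecker factors makes the four matrices composable; it is where
    i + j + p + q = k + 2 enters.\<close>
  have kp: "k - p = (j - 1) + ((i - 1) + q)" "k = (k - p) + p" using k by auto
  have pw: "n ^ (k - p) = n ^ (j - 1) * (n ^ (i - 1) * n ^ q)"
    unfolding kp(1) by (simp add: power_add)
  have c1: "?M1 \<in> carrier_mat (n ^ p) (n ^ p * (m * m))"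
    by (intro carrier_matI) auto
  have c2: "?M2 \<in> carrier_mat (n ^ p * (m * m)) ((m * n ^ q) * n ^ (j - 1) * (n ^ (i - 1) * m))"
    by (intro carrier_matI) (simp_all add: dG dW mult_ac)
  have c3: "?M3 \<in> carrier_mat ((m * n ^ q) * n ^ (j - 1) * (n ^ (i - 1) * m)) (n ^ (k - p) * (m * m))"
    by (intro carrier_matI) (simp_all add: perfect_shuffle_def pw mult_ac)
  have c4: "?M4 \<in> carrier_mat (n ^ (k - p) * (m * m)) (n ^ (k - p))"
    by (intro carrier_matI) auto
  have cx: "?x k \<in> carrier_vec (n ^ k)" for k using x by simp
  have "vec_of_mat (rhs_g_mat n m G W k p q i j) \<bullet> ?x k
      = vec_of_mat (?M1 * ?M2 * ?M3 * ?M4) \<bullet> kron_vec (?x (k - p)) (?x p)"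
    unfolding rhs_g_mat_def by (subst kp(2), subst xpow_add) (rule refl)
  also have "\<dots> = ?x p \<bullet> ((?M1 * ?M2 * ?M3 * ?M4) *\<^sub>v ?x (k - p))"
    using c1 c4 dx by (intro vec_of_mat_scalar_kron_vec) auto
  also have "(?M1 * ?M2 * ?M3 * ?M4) *\<^sub>v ?x (k - p) = ?M1 *\<^sub>v (?M2 *\<^sub>v (?M3 *\<^sub>v (?M4 *\<^sub>v ?x (k - p))))"
  proof -
    have c12: "?M1 * ?M2 \<in> carrier_mat (n ^ p) ((m * n ^ q) * n ^ (j - 1) * (n ^ (i - 1) * m))"
      using c1 c2 by (rule mult_carrier_mat)
    have c123: "?M1 * ?M2 * ?M3 \<in> carrier_mat (n ^ p) (n ^ (k - p) * (m * m))"
      using c12 c3 by (rule mult_carrier_mat)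
    have y4: "?M4 *\<^sub>v ?x (k - p) \<in> carrier_vec (n ^ (k - p) * (m * m))"
      using c4 cx by (rule mult_mat_vec_carrier)
    have y3: "?M3 *\<^sub>v (?M4 *\<^sub>v ?x (k - p)) \<in> carrier_vec ((m * n ^ q) * n ^ (j - 1) * (n ^ (i - 1) * m))"
      using c3 y4 by (rule mult_mat_vec_carrier)
    show ?thesis
      by (simp only: assoc_mult_mat_vec[OF c123 c4 cx] assoc_mult_mat_vec[OF c12 c3 y4]
          assoc_mult_mat_vec[OF c1 c2 y3])
  qed
  also have "?M4 *\<^sub>v ?x (k - p) = kron_vec (?x (k - p)) ?V"
  proof -
    have "?M4 *\<^sub>v kron_vec (?x (k - p)) (vec (Suc 0) (\<lambda>_. 1))
        = kron_vec (1\<^sub>m (n ^ (k - p)) *\<^sub>v ?x (k - p)) (col_mat ?V *\<^sub>v vec (Suc 0) (\<lambda>_. 1))"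
      using dx by (intro kron_mult_kron_vec) auto
    then show ?thesis using cx[of "k - p"] by (simp add: col_mat_mult_vec)
  qed
  also have "\<dots> = vec_sum (n ^ (k - p) * (m * m)) (\<lambda>a. kron_vec (kron_vec (?x (k - p)) (?e a)) (?e a)) {..<m}"
    using dx by (simp add: kron_vec_vec_of_identity)
  also have "?M3 *\<^sub>v \<dots> = vec_sum (dim_row ?M3)
      (\<lambda>a. kron_vec (kron_vec (?x (j - 1)) (kron_vec (kron_vec (?x q) (?e a)) (?x (i - 1)))) (?e a)) {..<m}"
  proof (subst mult_vec_sum)
    fix a assume "a \<in> {..<m}"
    show "dim_vec (kron_vec (kron_vec (?x (k - p)) (?e a)) (?e a)) = n ^ (k - p) * (m * m)"
      using dx by simp
  next
    have "?M3 *\<^sub>v kron_vec (kron_vec (?x (k - p)) (?e a)) (?e a)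
        = kron_vec (kron_vec (?x (j - 1)) (kron_vec (kron_vec (?x q) (?e a)) (?x (i - 1)))) (?e a)" for a
    proof -
      have "kron_vec (kron_vec (?x (k - p)) (?e a)) (?e a)
          = kron_vec (kron_vec (?x (j - 1)) (kron_vec (?x (i - 1)) (kron_vec (?x q) (?e a)))) (?e a)"
        unfolding kp(1) by (simp only: xpow_add kron_vec_assoc)
      also have "?M3 *\<^sub>v \<dots> = kron_vec (kron_vec (1\<^sub>m (n ^ (j - 1)) *\<^sub>v ?x (j - 1))
          (perfect_shuffle (n ^ (i - 1)) (n ^ q * m) *\<^sub>v (kron_vec (?x (i - 1)) (kron_vec (?x q) (?e a)))))
          (1\<^sub>m m *\<^sub>v ?e a)"
        using dx by (simp add: kron_mult_kron_vec perfect_shuffle_def mult_ac)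
      \<comment> \<open>The exchange puts x^q tensor e_a, the argument of \<open>G q\<close>, next
        to x^(j-1).\<close>
      also have "perfect_shuffle (n ^ (i - 1)) (n ^ q * m) *\<^sub>v (kron_vec (?x (i - 1)) (kron_vec (?x q) (?e a)))
          = kron_vec (kron_vec (?x q) (?e a)) (?x (i - 1))"
        using perfect_shuffle_kron_vec[of "?x (i - 1)" "kron_vec (?x q) (?e a)"] dx by simp
      finally show ?thesis using cx[of "j - 1"] by simp
    qed
    then show "vec_sum (dim_row ?M3) (\<lambda>a. ?M3 *\<^sub>v kron_vec (kron_vec (?x (k - p)) (?e a)) (?e a)) {..<m}
       = vec_sum (dim_row ?M3)
      (\<lambda>a. kron_vec (kron_vec (?x (j - 1)) (kron_vec (kron_vec (?x q) (?e a)) (?x (i - 1)))) (?e a)) {..<m}"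
      by simp
  qed
  also have "?M2 *\<^sub>v \<dots> = vec_sum (dim_row ?M2)
      (\<lambda>a. gain m G W x q j a \<cdot>\<^sub>v kron_vec (((G p)\<^sup>T * W i) *\<^sub>v ?x (i - 1)) (?e a)) {..<m}"
  proof (subst mult_vec_sum)
    fix a assume "a \<in> {..<m}"
    show "dim_vec (kron_vec (kron_vec (?x (j - 1)) (kron_vec (kron_vec (?x q) (?e a)) (?x (i - 1)))) (?e a)) = dim_row ?M3"
      using dx by (simp add: perfect_shuffle_def mult_ac)
  next
    have "?M2 *\<^sub>v kron_vec (kron_vec (?x (j - 1)) (kron_vec (kron_vec (?x q) (?e a)) (?x (i - 1)))) (?e a)
       = gain m G W x q j a \<cdot>\<^sub>v kron_vec (((G p)\<^sup>T * W i) *\<^sub>v ?x (i - 1)) (?e a)" for a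
    proof -
      \<comment> \<open>The product is regrouped into the block for the row vector and the block
        x^(i-1) tensor e_a on which \<open>G p\<close> and \<open>W i\<close> act.\<close>
      have "?M2 *\<^sub>v kron_vec (kron_vec (?x (j - 1)) (kron_vec (?x q) (?e a))) (kron_vec (?x (i - 1)) (?e a))
        = kron_vec ((col_mat ?Vq)\<^sup>T *\<^sub>v kron_vec (?x (j - 1)) (kron_vec (?x q) (?e a)))
            ((((G p)\<^sup>T * W i) \<otimes>\<^sub>m 1\<^sub>m m) *\<^sub>v kron_vec (?x (i - 1)) (?e a))"
        using dx dG dW by (intro kron_mult_kron_vec) (simp_all add: mult_ac)
      also have "(((G p)\<^sup>T * W i) \<otimes>\<^sub>m 1\<^sub>m m) *\<^sub>v kron_vec (?x (i - 1)) (?e a)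
          = kron_vec (((G p)\<^sup>T * W i) *\<^sub>v ?x (i - 1)) (1\<^sub>m m *\<^sub>v ?e a)"
        using dx dW by (intro kron_mult_kron_vec) auto
      also have "(col_mat ?Vq)\<^sup>T *\<^sub>v kron_vec (?x (j - 1)) (kron_vec (?x q) (?e a))
          = vec (Suc 0) (\<lambda>_. ?Vq \<bullet> kron_vec (?x (j - 1)) (kron_vec (?x q) (?e a)))"
        using dx dG dW by (intro col_mat_transpose_mult_vec) (simp add: mult_ac)
      also have "?Vq \<bullet> kron_vec (?x (j - 1)) (kron_vec (?x q) (?e a))
          = kron_vec (?x q) (?e a) \<bullet> (((G q)\<^sup>T * W j) *\<^sub>v ?x (j - 1))"
        using dx dG dW by (intro vec_of_mat_scalar_kron_vec) (simp_all add: mult_ac)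
      also have "((G q)\<^sup>T * W j) *\<^sub>v ?x (j - 1) = (G q)\<^sup>T *\<^sub>v (W j *\<^sub>v ?x (j - 1))"
        using G W cx by (intro assoc_mult_mat_vec) auto
      also have "kron_vec (?x q) (?e a) \<bullet> \<dots> = (G q *\<^sub>v kron_vec (?x q) (?e a)) \<bullet> (W j *\<^sub>v ?x (j - 1))"
        using transpose_mult_scalar_prod[OF G(2), of "W j *\<^sub>v ?x (j - 1)" "kron_vec (?x q) (?e a)"] dx dW dG
        by (simp add: scalar_prod_comm_real mult_ac)
      finally show ?thesis
        by (simp add: kron_vec_assoc kron_vec_one_left gain_def)
    qed
    then show "vec_sum (dim_row ?M2) (\<lambda>a. ?M2 *\<^sub>v kron_vec (kron_vec (?x (j - 1)) (kron_vec (kron_vec (?x q) (?e a)) (?x (i - 1)))) (?e a)) {..<m}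
      = vec_sum (dim_row ?M2)
      (\<lambda>a. gain m G W x q j a \<cdot>\<^sub>v kron_vec (((G p)\<^sup>T * W i) *\<^sub>v ?x (i - 1)) (?e a)) {..<m}"
      by simp
  qed
  also have "?x p \<bullet> (?M1 *\<^sub>v \<dots>) = (?M1\<^sup>T *\<^sub>v ?x p) \<bullet> \<dots>"
    using dx by (intro transpose_mult_scalar_prod[symmetric, OF c1]) (simp_all add: dG dW mult_ac)
  also have "?M1\<^sup>T *\<^sub>v ?x p = kron_vec (?x p) ?V"
  proof -
    have "(1\<^sub>m (n ^ p) \<otimes>\<^sub>m col_mat ?V) *\<^sub>v kron_vec (?x p) (vec (Suc 0) (\<lambda>_. 1))
        = kron_vec (1\<^sub>m (n ^ p) *\<^sub>v ?x p) (col_mat ?V *\<^sub>v vec (Suc 0) (\<lambda>_. 1))"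
      using dx by (intro kron_mult_kron_vec) auto
    then show ?thesis using cx[of p] by (simp add: col_mat_mult_vec transpose_kron)
  qed
  also have "kron_vec (?x p) ?V \<bullet> vec_sum (dim_row ?M2)
      (\<lambda>a. gain m G W x q j a \<cdot>\<^sub>v kron_vec (((G p)\<^sup>T * W i) *\<^sub>v ?x (i - 1)) (?e a)) {..<m}
      = (\<Sum>a<m. gain m G W x q j a * (kron_vec (?x p) ?V \<bullet> kron_vec (((G p)\<^sup>T * W i) *\<^sub>v ?x (i - 1)) (?e a)))"
    by (subst vec_sum_scalar_right) (simp_all add: dx dG dW mult_ac)
  also have "\<dots> = (\<Sum>a<m. gain m G W x p i a * gain m G W x q j a)"
  proof (intro sum.cong refl)
    fix a assume a: "a \<in> {..<m}"
    let ?Q = "((G p)\<^sup>T * W i) *\<^sub>v ?x (i - 1)"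
    have Q: "?Q = (G p)\<^sup>T *\<^sub>v (W i *\<^sub>v ?x (i - 1))"
      using G W cx by (intro assoc_mult_mat_vec) auto
    have "kron_vec (?x p) ?V \<bullet> kron_vec ?Q (?e a)
        = (\<Sum>b<m. kron_vec (kron_vec (?x p) (?e b)) (?e b) \<bullet> kron_vec ?Q (?e a))"
      unfolding kron_vec_vec_of_identity by (rule vec_sum_scalar_left) (simp add: dx dG mult_ac)
    also have "\<dots> = (\<Sum>b<m. (kron_vec (?x p) (?e b) \<bullet> ?Q) * (?e b \<bullet> ?e a))"
      by (intro sum.cong refl scalar_prod_kron_vec) (simp_all add: dx dG mult_ac)
    \<comment> \<open>The first factor contributes a second sum over inputs; orthonormality of the
      unit vectors leaves its diagonal.\<close>
    also have "\<dots> = (\<Sum>b<m. if b = a then kron_vec (?x p) (?e b) \<bullet> ?Q else 0)"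
      using a by (intro sum.cong refl) (auto simp: scalar_prod_left_unit)
    also have "\<dots> = kron_vec (?x p) (?e a) \<bullet> ?Q" using a by simp
    also have "\<dots> = gain m G W x p i a"
      unfolding Q using transpose_mult_scalar_prod[OF G(1), of "W i *\<^sub>v ?x (i - 1)" "kron_vec (?x p) (?e a)"] dx dW dG
      by (simp add: scalar_prod_comm_real mult_ac gain_def)
    finally show "gain m G W x q j a * (kron_vec (?x p) ?V \<bullet> kron_vec ?Q (?e a))
        = gain m G W x p i a * gain m G W x q j a" by (simp only: mult.commute)
  qed
  finally show ?thesis .
qed

text \<open>Transposition moves the Kronecker sum onto the power. Its i summands differ only in the
  slot that holds M x^p, so by symmetry they are equal, whence the factor i.\<close>

lemma lyap_transpose_scalar_xpow:
  assumes M: "M \<in> carrier_mat n (n ^ p)" and x: "x \<in> carrier_vec n"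
    and W: "W \<in> carrier_mat n (n ^ (i - 1))" "symmetric_coeff n i (vec_of_mat W)"
    and k: "i \<ge> 1" "i + p = k + 1"
  shows "((lyap i M)\<^sup>T *\<^sub>v vec_of_mat W) \<bullet> xpow k x = real i * ((M *\<^sub>v xpow p x) \<bullet> (W *\<^sub>v xpow (i - 1) x))"
proof -
  let ?w = "vec_of_mat W"
  let ?b = "M *\<^sub>v xpow p x"
  have dx: "dim_vec x = n" using x by simp
  have b: "?b \<in> carrier_vec n" using M x by auto
  have "?w \<in> carrier_vec (n ^ i)"
    using W(2) unfolding symmetric_coeff_def by (rule conjunct1)
  then have dw: "dim_vec ?w = n ^ i" by (rule carrier_vecD)
  have "k = i - 1 + p" using k by simp
  then have dk: "dim_vec (xpow k x) = n ^ (i - 1) * n ^ p" using dx by (simp add: power_add)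
  have "((lyap i M)\<^sup>T *\<^sub>v ?w) \<bullet> xpow k x = ?w \<bullet> (lyap i M *\<^sub>v xpow k x)"
    using lyap_carrier[OF M] dw dk by (rule transpose_mult_scalar_prod)
  also have "lyap i M *\<^sub>v xpow k x = vec_sum (n ^ i)
      (\<lambda>j. kron_vecs (replicate j x @ ?b # replicate (i - Suc j) x)) {..<i}"
    using k by (intro lyap_mult_xpow[OF M x]) auto
  also have "?w \<bullet> \<dots> = (\<Sum>j<i. ?w \<bullet> kron_vecs (replicate j x @ ?b # replicate (i - Suc j) x))"
  proof (rule vec_sum_scalar_right)
    fix j assume "j \<in> {..<i}"
    then have "length (replicate j x @ ?b # replicate (i - Suc j) x) = i" by simp
    moreover have "kron_vecs (replicate j x @ ?b # replicate (i - Suc j) x)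
        \<in> carrier_vec (n ^ length (replicate j x @ ?b # replicate (i - Suc j) x))"
      using x b by (intro kron_vecs_carrier) auto
    ultimately show "dim_vec (kron_vecs (replicate j x @ ?b # replicate (i - Suc j) x)) = n ^ i"
      by (metis carrier_vecD)
  qed
  also have "\<dots> = (\<Sum>j<i. ?w \<bullet> kron_vec (xpow (i - 1) x) ?b)"
    by (intro sum.cong refl symmetric_coeff_slot[OF W(2) _ x b]) auto
  also have "\<dots> = real i * (?b \<bullet> (W *\<^sub>v xpow (i - 1) x))"
    using W(1) M dx by (simp add: vec_of_mat_scalar_kron_vec)
  finally show ?thesis .
qed

lemma vec_of_mat_product_xpow:
  assumes P: "P \<in> carrier_mat r (n ^ a)" and Q: "Q \<in> carrier_mat r (n ^ b)" and x: "x \<in> carrier_vec n"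
  shows "vec_of_mat (P\<^sup>T * Q) \<bullet> xpow (b + a) x = (P *\<^sub>v xpow a x) \<bullet> (Q *\<^sub>v xpow b x)"
proof -
  have dx: "dim_vec x = n" using x by simp
  have "vec_of_mat (P\<^sup>T * Q) \<bullet> xpow (b + a) x = xpow a x \<bullet> ((P\<^sup>T * Q) *\<^sub>v xpow b x)"
    unfolding xpow_add using P Q dx by (intro vec_of_mat_scalar_kron_vec) auto
  also have "(P\<^sup>T * Q) *\<^sub>v xpow b x = P\<^sup>T *\<^sub>v (Q *\<^sub>v xpow b x)"
    using P Q x by (intro assoc_mult_mat_vec) auto
  also have "xpow a x \<bullet> \<dots> = (P *\<^sub>v xpow a x) \<bullet> (Q *\<^sub>v xpow b x)"
    using transpose_mult_scalar_prod[OF P, of "Q *\<^sub>v xpow b x" "xpow a x"] P Q dx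
    by (simp add: scalar_prod_comm_real)
  finally show ?thesis .
qed

lemma gain_0:
  assumes B: "B \<in> carrier_mat n m" and W: "W i \<in> carrier_mat n (n ^ (i - 1))" and x: "x \<in> carrier_vec n" and a: "a < m"
  shows "gain m (G(0 := B)) W x 0 i a = (B\<^sup>T *\<^sub>v (W i *\<^sub>v xpow (i - 1) x)) $ a"
proof -
  have dx: "dim_vec x = n" using x by simp
  have u: "dim_vec (W i *\<^sub>v xpow (i - 1) x) = n" using W by simp
  have "gain m (G(0 := B)) W x 0 i a = (B *\<^sub>v unit_vec m a) \<bullet> (W i *\<^sub>v xpow (i - 1) x)"
    by (simp add: gain_def kron_vec_one_left)
  also have "\<dots> = (B\<^sup>T *\<^sub>v (W i *\<^sub>v xpow (i - 1) x)) \<bullet> unit_vec m a"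
    using transpose_mult_scalar_prod[OF B u, of "unit_vec m a"] B u by (simp add: scalar_prod_comm_real)
  also have "\<dots> = (B\<^sup>T *\<^sub>v (W i *\<^sub>v xpow (i - 1) x)) $ a"
    using a B by (intro scalar_prod_right_unit) auto
  finally show ?thesis .
qed

lemma sum_gain_0:
  assumes B: "B \<in> carrier_mat n m" and W: "W i \<in> carrier_mat n (n ^ (i - 1))" "W j \<in> carrier_mat n (n ^ (j - 1))"
    and x: "x \<in> carrier_vec n"
  shows "(\<Sum>a<m. gain m (G(0 := B)) W x 0 i a * gain m (G(0 := B)) W x 0 j a)
    = (B\<^sup>T *\<^sub>v (W i *\<^sub>v xpow (i - 1) x)) \<bullet> (B\<^sup>T *\<^sub>v (W j *\<^sub>v xpow (j - 1) x))"
  using B by (simp add: scalar_prod_lessThan gain_0[of B n m W i x, OF B W(1) x] gain_0[of B n m W j x, OF B W(2) x])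

lemma vec_of_mat_rhs_b_xpow:
  assumes B: "B \<in> carrier_mat n m" and W: "W i \<in> carrier_mat n (n ^ (i - 1))" "W j \<in> carrier_mat n (n ^ (j - 1))"
    and x: "x \<in> carrier_vec n" and k: "i \<ge> 1" "j \<ge> 1" "i + j = k + 2"
  shows "vec_of_mat ((W i)\<^sup>T * B * B\<^sup>T * W j) \<bullet> xpow k x
    = (\<Sum>a<m. gain m (G(0 := B)) W x 0 i a * gain m (G(0 := B)) W x 0 j a)"
proof -
  have "(W i)\<^sup>T * B * B\<^sup>T * W j = (B\<^sup>T * W i)\<^sup>T * (B\<^sup>T * W j)"
  proof -
    have "(B\<^sup>T * W i)\<^sup>T = (W i)\<^sup>T * B"
      using B W(1) by (subst transpose_mult[of _ m n]) auto
    moreover have "(W i)\<^sup>T * B * B\<^sup>T * W j = (W i)\<^sup>T * B * (B\<^sup>T * W j)"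
      using B W by (intro assoc_mult_mat) auto
    ultimately show ?thesis by simp
  qed
  moreover have "k = (j - 1) + (i - 1)" using k by simp
  ultimately have "vec_of_mat ((W i)\<^sup>T * B * B\<^sup>T * W j) \<bullet> xpow k x
      = ((B\<^sup>T * W i) *\<^sub>v xpow (i - 1) x) \<bullet> ((B\<^sup>T * W j) *\<^sub>v xpow (j - 1) x)"
    using vec_of_mat_product_xpow[of "B\<^sup>T * W i" m n "i - 1" "B\<^sup>T * W j" "j - 1" x] B W x by simp
  also have "(B\<^sup>T * W i) *\<^sub>v xpow (i - 1) x = B\<^sup>T *\<^sub>v (W i *\<^sub>v xpow (i - 1) x)"
    using B W x by (intro assoc_mult_mat_vec) auto
  also have "(B\<^sup>T * W j) *\<^sub>v xpow (j - 1) x = B\<^sup>T *\<^sub>v (W j *\<^sub>v xpow (j - 1) x)"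
    using B W x by (intro assoc_mult_mat_vec) auto
  finally show ?thesis using sum_gain_0[OF B W x] by simp
qed

section \<open>Expansion of the gradient\<close>

lemma replicate_update:
  "l < i \<Longrightarrow> (replicate i x)[l := b] = replicate l x @ b # replicate (i - Suc l) x"
  by (simp add: upd_conv_take_nth_drop min_def)

lemma kron_vecs_slot_carrier:
  assumes "x \<in> carrier_vec n" "b \<in> carrier_vec n" "l < i"
  shows "kron_vecs (replicate l x @ b # replicate (i - Suc l) x) \<in> carrier_vec (n ^ i)"
proof -
  have "length (replicate l x @ b # replicate (i - Suc l) x) = i" using assms by simp
  moreover have "kron_vecs (replicate l x @ b # replicate (i - Suc l) x)
      \<in> carrier_vec (n ^ length (replicate l x @ b # replicate (i - Suc l) x))"
    using assms by (intro kron_vecs_carrier) auto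
  ultimately show ?thesis by metis
qed

definition xpow_deriv :: "nat \<Rightarrow> nat \<Rightarrow> real vec \<Rightarrow> real vec \<Rightarrow> real vec" where
  "xpow_deriv n i x b = vec_sum (n ^ i) (\<lambda>l. kron_vecs (replicate l x @ b # replicate (i - Suc l) x)) {..<i}"

lemma has_vderiv_xpow:
  assumes "has_vderiv n X X' t"
  shows "has_vderiv (n ^ i) (\<lambda>s. xpow i (X s)) (xpow_deriv n i (X t) X') t"
proof -
  let ?Xs = "replicate i (X, X')"
  have "has_vderiv (n ^ length ?Xs) (\<lambda>s. kron_vecs (map (\<lambda>X. fst X s) ?Xs))
    (vec_sum (n ^ length ?Xs) (\<lambda>i. kron_vecs ((map (\<lambda>X. fst X t) ?Xs)[i := snd (?Xs ! i)])) {..<length ?Xs}) t"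
    using assms by (intro has_vderiv_kron_vecs) auto
  moreover have "vec_sum (n ^ length ?Xs) (\<lambda>i. kron_vecs ((map (\<lambda>X. fst X t) ?Xs)[i := snd (?Xs ! i)])) {..<length ?Xs}
      = xpow_deriv n i (X t) X'"
    unfolding xpow_deriv_def by (simp add: map_replicate) (rule vec_sum_cong, simp add: replicate_update)
  ultimately show ?thesis by (simp add: xpow_def map_replicate)
qed

lemma entries_le_xpow_deriv:
  assumes x: "x \<in> carrier_vec n" "entries_le r x" and b: "b \<in> carrier_vec n" "entries_le 1 b" and r: "0 \<le> r"
  shows "entries_le (real i * r ^ (i - 1)) (xpow_deriv n i x b)"
  unfolding entries_le_def
proof (intro allI impI)
  fix j assume "j < dim_vec (xpow_deriv n i x b)"
  then have j: "j < n ^ i" by (simp add: xpow_deriv_def)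
  let ?k = "\<lambda>l. kron_vecs (replicate l x @ b # replicate (i - Suc l) x)"
  have "\<bar>?k l $ j\<bar> \<le> r ^ (i - 1)" if l: "l < i" for l
    using entries_le_slot[OF x(2) b(2) r _ l] kron_vecs_slot_carrier[OF x(1) b(1) l] j
    by (simp add: entries_le_def)
  then have "(\<Sum>l<i. \<bar>?k l $ j\<bar>) \<le> (\<Sum>l<i. r ^ (i - 1))" by (intro sum_mono) auto
  moreover have "\<bar>xpow_deriv n i x b $ j\<bar> \<le> (\<Sum>l<i. \<bar>?k l $ j\<bar>)"
    using j by (simp add: xpow_deriv_def vec_sum_def)
  ultimately show "\<bar>xpow_deriv n i x b $ j\<bar> \<le> real i * r ^ (i - 1)" by simp
qed

lemma symmetric_coeff_xpow_deriv:
  assumes w: "symmetric_coeff n i (vec_of_mat W)" and W: "W \<in> carrier_mat n (n ^ (i - 1))"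
    and x: "x \<in> carrier_vec n" and b: "b \<in> carrier_vec n"
  shows "vec_of_mat W \<bullet> xpow_deriv n i x b = real i * (b \<bullet> (W *\<^sub>v xpow (i - 1) x))"
proof -
  have "vec_of_mat W \<bullet> xpow_deriv n i x b
      = (\<Sum>l<i. vec_of_mat W \<bullet> kron_vecs (replicate l x @ b # replicate (i - Suc l) x))"
    unfolding xpow_deriv_def
    by (intro vec_sum_scalar_right) (use kron_vecs_slot_carrier[OF x b] in auto)
  also have "\<dots> = (\<Sum>l<i. vec_of_mat W \<bullet> kron_vec (xpow (i - 1) x) b)"
    by (intro sum.cong refl symmetric_coeff_slot[OF w _ x b]) auto
  also have "\<dots> = real i * (b \<bullet> (W *\<^sub>v xpow (i - 1) x))"
    using W x b by (simp add: vec_of_mat_scalar_kron_vec)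
  finally show ?thesis .
qed

lemma has_vderiv_line:
  assumes "x \<in> carrier_vec n" "e \<in> carrier_vec n"
  shows "has_vderiv n (\<lambda>s. x + s \<cdot>\<^sub>v e) e t"
  unfolding has_vderiv_def
proof (intro conjI allI impI)
  fix i assume i: "i < n"
  have "((\<lambda>s. x $ i + s * e $ i) has_real_derivative e $ i) (at t)"
    by (auto intro!: derivative_eq_intros)
  then show "((\<lambda>s. (x + s \<cdot>\<^sub>v e) $ i) has_real_derivative e $ i) (at t)"
    using i assms by simp
qed (use assms in auto)

definition taylor_grad :: "nat \<Rightarrow> nat \<Rightarrow> (nat \<Rightarrow> real mat) \<Rightarrow> real vec \<Rightarrow> real vec" where
  "taylor_grad n d W x = vec_sum n (\<lambda>i. (real i / 2) \<cdot>\<^sub>v (W i *\<^sub>v xpow (i - 1) x)) {2..d}"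

lemma entries_le_unit_vec: "j < n \<Longrightarrow> entries_le 1 (unit_vec n j)"
  by (auto simp: entries_le_def index_unit_vec)

text \<open>Absorbs the factor i that arises when a term of degree i is differentiated, at the price
  of halving the radius.\<close>

lemma nat_le_two_power: "real i \<le> 2 ^ i"
  by (metis less_imp_le of_nat_less_two_power)

text \<open>Termwise differentiation along the line x + s e_j. With entries of x at most R / 4 and
  |s| < R / 4 the line stays in the cube of half-width R / 2, where i (R / 2)^(i-1) \<le> (2 / R)
  R^i makes the given summable series a uniform majorant of the derivatives.\<close>

lemma power_series_grad:
  assumes c: "\<And>i. c i \<in> carrier_vec (n ^ i)" and R: "R > 0"
    and sm: "summable (\<lambda>i. (\<Sum>j<n ^ i. \<bar>c i $ j\<bar>) * R ^ i)"
    and E: "\<And>x. x \<in> carrier_vec n \<Longrightarrow> (\<forall>j<n. \<bar>x $ j\<bar> < R) \<Longrightarrow> (\<lambda>i. 1/2 * (c i \<bullet> xpow i x)) sums E x"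
    and x: "x \<in> carrier_vec n" "entries_le r x" and r: "0 < r" "r \<le> R / 4" and j: "j < n"
  shows "summable (\<lambda>i. 1/2 * (c i \<bullet> xpow_deriv n i x (unit_vec n j)))"
    "grad n E x $ j = (\<Sum>i. 1/2 * (c i \<bullet> xpow_deriv n i x (unit_vec n j)))"
proof -
  let ?e = "unit_vec n j :: real vec"
  define X where "X s = x + s \<cdot>\<^sub>v ?e" for s
  have Xc: "X s \<in> carrier_vec n" for s using x by (simp add: X_def)
  have vX: "has_vderiv n X ?e s" for s
    using x(1) unfolding X_def[abs_def] by (rule has_vderiv_line) simp
  have Xb: "entries_le (R / 2) (X s)" if "s \<in> {- (R / 4)<..<R / 4}" for s
    unfolding entries_le_def
  proof (intro allI impI)
    fix i assume "i < dim_vec (X s)"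
    then have i: "i < n" using Xc[of s] by simp
    have "\<bar>x $ i\<bar> \<le> R / 4" using x i r unfolding entries_le_def by fastforce
    moreover have "\<bar>s * ?e $ i\<bar> \<le> R / 4" using that i j R by (auto simp: abs_if)
    ultimately have "\<bar>x $ i + s * ?e $ i\<bar> \<le> R / 2" by linarith
    then show "\<bar>X s $ i\<bar> \<le> R / 2" using i x(1) by (simp add: X_def)
  qed
  have e1: "entries_le 1 ?e" using j by (simp add: entries_le_unit_vec)
  let ?f = "\<lambda>i s. 1/2 * (c i \<bullet> xpow i (X s))"
  let ?f' = "\<lambda>i s. 1/2 * (c i \<bullet> xpow_deriv n i (X s) ?e)"
  let ?M = "\<lambda>i. (2 / R) * ((\<Sum>j<n ^ i. \<bar>c i $ j\<bar>) * R ^ i)"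
  let ?S = "{- (R / 4)<..<R / 4}"
  have d: "(?f i has_field_derivative ?f' i s) (at s within ?S)" for i s
    using has_vderiv_scalar_prod[OF has_vderiv_xpow[OF vX], of "c i" i s] c[of i]
    by (intro DERIV_cmult) (auto intro: has_field_derivative_at_within)
  have bd: "norm (?f' i s) \<le> ?M i" if s: "s \<in> ?S" for i s
  proof -
    have "entries_le (real i * (R / 2) ^ (i - 1)) (xpow_deriv n i (X s) ?e)"
      using Xc Xb[OF s] e1 R by (intro entries_le_xpow_deriv) auto
    then have "\<bar>c i \<bullet> xpow_deriv n i (X s) ?e\<bar> \<le> (\<Sum>j<n ^ i. \<bar>c i $ j\<bar>) * (real i * (R / 2) ^ (i - 1))"
      by (rule abs_scalar_prod_le) (simp add: xpow_deriv_def)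
    also have "real i * (R / 2) ^ (i - 1) \<le> (2 / R) * R ^ i"
    proof (cases i)
      case (Suc k)
      have "real i * (R / 2) ^ k \<le> 2 ^ i * (R / 2) ^ k"
        using R nat_le_two_power by (intro mult_right_mono) auto
      also have "\<dots> = (2 / R) * R ^ i" using R Suc by (simp add: power_divide)
      finally show ?thesis using Suc by simp
    qed (use R in simp)
    finally have "\<bar>c i \<bullet> xpow_deriv n i (X s) ?e\<bar> \<le> ?M i"
      by (simp add: sum_nonneg mult_left_mono mult.left_commute)
    then show ?thesis by simp
  qed
  have sM: "summable ?M" using sm by (rule summable_mult)
  have uc: "uniformly_convergent_on ?S (\<lambda>n s. \<Sum>i<n. ?f' i s)"
    using bd sM by (intro Weierstrass_m_test'[of _ _ ?M]) auto
  have Es: "(\<lambda>i. ?f i s) sums E (X s)" if "s \<in> ?S" for s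
  proof (rule E[OF Xc])
    show "\<forall>j<n. \<bar>X s $ j\<bar> < R"
      using Xb[OF that] Xc[of s] R unfolding entries_le_def by fastforce
  qed
  have 0: "0 \<in> ?S" using R by simp
  have "((\<lambda>s. \<Sum>i. ?f i s) has_field_derivative (\<Sum>i. ?f' i 0)) (at 0)"
    by (rule has_field_derivative_series'(2)[OF _ d uc 0 sums_summable[OF Es[OF 0]]]) (use 0 in auto)
  then have "((\<lambda>s. E (X s)) has_field_derivative (\<Sum>i. ?f' i 0)) (at 0)"
    by (rule has_field_derivative_transform_within_open[where S = ?S])
      (use 0 Es in \<open>auto intro: sums_unique[symmetric]\<close>)
  then have "deriv (\<lambda>s. E (X s)) 0 = (\<Sum>i. ?f' i 0)" by (rule DERIV_imp_deriv)
  moreover have X0: "X 0 = x" using x by (intro eq_vecI) (auto simp: X_def)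
  ultimately show "grad n E x $ j = (\<Sum>i. 1/2 * (c i \<bullet> xpow_deriv n i x ?e))"
    using j by (simp add: grad_def X_def)
  have "summable (\<lambda>i. ?f' i 0)"
    by (rule summable_comparison_test'[OF sM, of 0]) (use bd[OF 0] in simp)
  then show "summable (\<lambda>i. 1/2 * (c i \<bullet> xpow_deriv n i x ?e))" using X0 by simp
qed

text \<open>Neglected terms have degree at least d + 1 in the energy, hence degree at least d in the
  gradient; this is why the error is of order r^d.\<close>

lemma grad_taylor:
  assumes exp: "degree_d_expansion n d E w"
    and W: "\<forall>i\<in>{2..d}. W i \<in> carrier_mat n (n ^ (i - 1)) \<and> w i = vec_of_mat (W i)"
  shows "\<exists>K \<delta>. 0 \<le> K \<and> 0 < \<delta> \<and> (\<forall>x\<in>carrier_vec n. \<forall>r. 0 < r \<and> r \<le> \<delta> \<and> entries_le r x \<longrightarrow>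
    (\<forall>j<n. \<bar>grad n E x $ j - taylor_grad n d W x $ j\<bar> \<le> K * r ^ d))"
proof -
  from exp obtain c where ps: "power_series_at_0 n E c" and c0: "c 0 = 0\<^sub>v 1" "c 1 = 0\<^sub>v n"
    and sym: "\<And>i. i \<in> {2..d} \<Longrightarrow> is_symmetrization n i (c i) (w i)"
    unfolding degree_d_expansion_def by blast
  from ps obtain R where c: "\<And>i. c i \<in> carrier_vec (n ^ i)" and R: "R > 0"
    and sm: "summable (\<lambda>i. (\<Sum>j<n ^ i. \<bar>c i $ j\<bar>) * R ^ i)"
    and E: "\<And>x. x \<in> carrier_vec n \<Longrightarrow> (\<forall>j<n. \<bar>x $ j\<bar> < R) \<Longrightarrow> (\<lambda>i. 1/2 * (c i \<bullet> xpow i x)) sums E x"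
    unfolding power_series_at_0_def by blast
  let ?M = "\<lambda>i. (\<Sum>j<n ^ i. \<bar>c i $ j\<bar>) * R ^ i"
  \<comment> \<open>For i > d and r \<le> R / 4 one has i r^(i-1) \<le> 2^i r^d (R / 2)^(i-1-d) = (2
    / R)^(d+1) r^d R^i, which bounds the tail by r^d times the summable majorant.\<close>
  define K where "K = (\<Sum>i. ?M i) * (2 / R) * (2 / R) ^ d"
  have M0: "0 \<le> ?M i" for i using R by (intro mult_nonneg_nonneg sum_nonneg) auto
  have "\<bar>grad n E x $ j - taylor_grad n d W x $ j\<bar> \<le> K * r ^ d"
    if x: "x \<in> carrier_vec n" "entries_le r x" and r: "0 < r" "r \<le> R / 4" and j: "j < n" for x r j
  proof -
    let ?e = "unit_vec n j :: real vec"
    let ?f = "\<lambda>i. 1/2 * (c i \<bullet> xpow_deriv n i x ?e)"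
    have g: "summable ?f" "grad n E x $ j = suminf ?f"
      by (rule power_series_grad[OF c R sm _ x r j], rule E, assumption+)+
    have f01: "?f 0 = 0" "?f 1 = 0"
      by (simp_all add: c0 xpow_deriv_def scalar_prod_lessThan)
        (simp add: vec_sum_def c0(2)[unfolded One_nat_def])
    have f: "?f i = (real i / 2) * (W i *\<^sub>v xpow (i - 1) x) $ j" if i: "i \<in> {2..d}" for i
    proof -
      define X where "X s = x + s \<cdot>\<^sub>v ?e" for s
      have Xc: "X s \<in> carrier_vec n" for s using x by (simp add: X_def)
      have vX: "has_vderiv n X ?e s" for s
        using x(1) unfolding X_def[abs_def] by (rule has_vderiv_line) simp
      have X0: "X 0 = x" using x by (intro eq_vecI) (auto simp: X_def)
      have s: "symmetric_coeff n i (w i)" and eq: "\<And>x. x \<in> carrier_vec n \<Longrightarrow> w i \<bullet> xpow i x = c i \<bullet> xpow i x"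
        using sym[OF i] unfolding is_symmetrization_def by auto
      have dw: "dim_vec (w i) = n ^ i" "dim_vec (c i) = n ^ i"
        using s c[of i] unfolding symmetric_coeff_def by auto
      have "((\<lambda>s. c i \<bullet> xpow i (X s)) has_real_derivative c i \<bullet> xpow_deriv n i (X 0) ?e) (at 0)"
        by (rule has_vderiv_scalar_prod[OF has_vderiv_xpow[OF vX] dw(2)])
      moreover have "((\<lambda>s. w i \<bullet> xpow i (X s)) has_real_derivative w i \<bullet> xpow_deriv n i (X 0) ?e) (at 0)"
        by (rule has_vderiv_scalar_prod[OF has_vderiv_xpow[OF vX] dw(1)])
      moreover have "(\<lambda>s. w i \<bullet> xpow i (X s)) = (\<lambda>s. c i \<bullet> xpow i (X s))" using eq Xc by auto
      \<comment> \<open>The coefficients \<open>c i\<close> and \<open>w i\<close> agree only as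
        polynomials. Uniqueness of the derivative passes from one to the other, after which the
        symmetry of \<open>w i\<close> can be used.\<close>
      ultimately have "c i \<bullet> xpow_deriv n i x ?e = w i \<bullet> xpow_deriv n i x ?e"
        using DERIV_unique X0 by metis
      also have "\<dots> = real i * (?e \<bullet> (W i *\<^sub>v xpow (i - 1) x))"
        using s W i x(1) by (metis symmetric_coeff_xpow_deriv unit_vec_carrier)
      also have "?e \<bullet> (W i *\<^sub>v xpow (i - 1) x) = (W i *\<^sub>v xpow (i - 1) x) $ j"
        using W i j xpow_carrier[OF x(1), of "i - 1"]
        by (intro scalar_prod_left_unit mult_mat_vec_carrier) blast+
      finally show ?thesis by simp
    qed
    \<comment> \<open>The expansion starts in degree two, so the partial sum up to degree d is
      exactly the Taylor gradient.\<close>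
    have "(\<Sum>i<Suc d. ?f i) = (\<Sum>i\<in>{2..d}. ?f i)"
    proof (rule sum.mono_neutral_right)
      have "i = 0 \<or> i = 1" if "i \<in> {..<Suc d} - {2..d}" for i using that by auto
      then show "\<forall>i\<in>{..<Suc d} - {2..d}. ?f i = 0" using f01 by blast
    qed auto
    also have "\<dots> = taylor_grad n d W x $ j"
      unfolding taylor_grad_def vec_sum_def using j f W
      by (auto intro!: sum.cong)
    finally have eq: "grad n E x $ j - taylor_grad n d W x $ j = (\<Sum>i. ?f (i + Suc d))"
      using suminf_split_initial_segment[OF g(1), of "Suc d"] g(2) by linarith
    have "\<bar>\<Sum>i. ?f (i + Suc d)\<bar> \<le> (\<Sum>i. (2 / R) * (2 / R) ^ d * r ^ d * ?M (i + Suc d))"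
    proof -
      have le: "norm (?f i) \<le> (2 / R) * (2 / R) ^ d * r ^ d * ?M i" if i: "i \<ge> Suc d" for i
      proof -
        have "entries_le (real i * r ^ (i - 1)) (xpow_deriv n i x ?e)"
          using x r j by (intro entries_le_xpow_deriv) (auto simp: entries_le_unit_vec)
        then have "\<bar>c i \<bullet> xpow_deriv n i x ?e\<bar> \<le> (\<Sum>j<n ^ i. \<bar>c i $ j\<bar>) * (real i * r ^ (i - 1))"
          by (rule abs_scalar_prod_le) (simp add: xpow_deriv_def)
        also have "real i * r ^ (i - 1) \<le> (2 / R) * (2 / R) ^ d * r ^ d * R ^ i"
        proof -
          obtain k where k: "i = Suc (d + k)" using i by (metis add_Suc le_Suc_ex)
          have "real i * r ^ (i - 1) = r ^ d * (real i * r ^ k)"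
            by (simp add: k power_add)
          also have "\<dots> \<le> r ^ d * (2 ^ i * (R / 2) ^ k)"
            using r R nat_le_two_power by (intro mult_left_mono mult_mono power_mono) auto
          also have "\<dots> = (2 / R) * (2 / R) ^ d * r ^ d * R ^ i"
            using R by (simp add: k power_add power_divide)
          finally show ?thesis .
        qed
        finally have "\<bar>c i \<bullet> xpow_deriv n i x ?e\<bar> \<le> (2 / R) * (2 / R) ^ d * r ^ d * ?M i"
          by (simp add: sum_nonneg mult_left_mono mult.left_commute)
        then show ?thesis by simp
      qed
      have s2: "summable (\<lambda>i. (2 / R) * (2 / R) ^ d * r ^ d * ?M (i + Suc d))"
        using sm by (intro summable_mult summable_ignore_initial_segment)
      have "summable (\<lambda>i. norm (?f (i + Suc d)))"
      proof (rule summable_comparison_test'[OF s2, of 0])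
        show "norm (norm (?f (k + Suc d))) \<le> (2 / R) * (2 / R) ^ d * r ^ d * ?M (k + Suc d)" for k
          using le[of "k + Suc d"] by (simp only: real_norm_def abs_abs le_add2)
      qed
      from summable_norm[OF this]
      have "\<bar>\<Sum>i. ?f (i + Suc d)\<bar> \<le> (\<Sum>i. norm (?f (i + Suc d)))"
        by (simp only: real_norm_def)
      moreover have "(\<Sum>i. norm (?f (i + Suc d))) \<le> (\<Sum>i. (2 / R) * (2 / R) ^ d * r ^ d * ?M (i + Suc d))"
        by (rule suminf_le[OF le \<open>summable (\<lambda>i. norm (?f (i + Suc d)))\<close> s2]) simp
      ultimately show ?thesis by (rule order_trans)
    qed
    also have "\<dots> = (2 / R) * (2 / R) ^ d * r ^ d * (\<Sum>i. ?M (i + Suc d))"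
      using sm by (intro suminf_mult summable_ignore_initial_segment)
    also have "\<dots> \<le> (2 / R) * (2 / R) ^ d * r ^ d * (\<Sum>i. ?M i)"
    proof (rule mult_left_mono)
      show "(\<Sum>i. ?M (i + Suc d)) \<le> (\<Sum>i. ?M i)"
        using suminf_split_initial_segment[OF sm, of "Suc d"] sum_nonneg[of "{..<Suc d}" ?M] M0 by auto
    qed (use R r in auto)
    finally show ?thesis unfolding eq by (simp add: K_def mult_ac)
  qed
  moreover have "0 \<le> K" using suminf_nonneg[OF sm M0] R by (simp add: K_def)
  ultimately show ?thesis using R by (intro exI[of _ K] exI[of _ "R / 4"]) auto
qed

section \<open>Coefficients of the Hamilton--Jacobi--Bellman equation\<close>

text \<open>Strong induction: once the lower coefficients vanish, division by t^k leaves a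
  polynomial with limit c_k, bounded by a multiple of t^(d+1-k), and k \<le> d makes this exponent
  positive.\<close>

lemma polynomial_coeff_zero:
  fixes c :: "nat \<Rightarrow> real"
  assumes O: "(\<lambda>t. \<Sum>k\<le>N. c k * t ^ k) \<in> O[at_right 0](\<lambda>t. t ^ Suc d)" and k: "k \<le> d" "k \<le> N"
  shows "c k = 0"
  using k
proof (induction k rule: less_induct)
  case (less k)
  obtain C where C: "\<forall>\<^sub>F t in at_right 0. norm (\<Sum>k\<le>N. c k * t ^ k) \<le> C * norm (t ^ Suc d)"
    using landau_o.bigE[OF O] by blast
  have z: "c j = 0" if "j < k" for j using less.IH[of j] less.prems that by simp
  have f: "(\<Sum>j\<le>N. c j * t ^ j) = t ^ k * (\<Sum>j\<in>{k..N}. c j * t ^ (j - k))" for t :: real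
  proof -
    have "(\<Sum>j\<le>N. c j * t ^ j) = (\<Sum>j\<in>{k..N}. c j * t ^ j)"
      using z by (intro sum.mono_neutral_right) auto
    also have "\<dots> = (\<Sum>j\<in>{k..N}. t ^ k * (c j * t ^ (j - k)))"
      by (intro sum.cong refl) (simp flip: power_add add: mult.left_commute)
    finally show ?thesis by (simp add: sum_distrib_left)
  qed
  have "\<forall>\<^sub>F t in at_right 0. norm (\<Sum>j\<in>{k..N}. c j * t ^ (j - k)) \<le> C * t ^ (Suc d - k)"
    using C eventually_at_right_less[of 0]
  proof eventually_elim
    case (elim t)
    have "t ^ k * \<bar>\<Sum>j\<in>{k..N}. c j * t ^ (j - k)\<bar> \<le> C * t ^ Suc d"
      using elim by (simp add: f abs_mult)
    also have "t ^ Suc d = t ^ k * t ^ (Suc d - k)"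
      using less.prems by (simp flip: power_add)
    finally show ?case using elim by (simp add: mult.left_commute)
  qed
  moreover have "((\<lambda>t. C * t ^ (Suc d - k)) \<longlongrightarrow> C * 0 ^ (Suc d - k)) (at_right 0)"
    by (intro tendsto_intros)
  then have "((\<lambda>t. C * t ^ (Suc d - k)) \<longlongrightarrow> 0) (at_right 0)"
    using less.prems by (simp add: power_0_left)
  ultimately have lim0: "((\<lambda>t. \<Sum>j\<in>{k..N}. c j * t ^ (j - k)) \<longlongrightarrow> 0) (at_right 0)"
    by (rule Lim_null_comparison)
  have lim1: "((\<lambda>t. \<Sum>j\<in>{k..N}. c j * t ^ (j - k)) \<longlongrightarrow> (\<Sum>j\<in>{k..N}. c j * 0 ^ (j - k))) (at_right 0)"
    by (intro tendsto_intros)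
  have "(\<Sum>j\<in>{k..N}. c j * 0 ^ (j - k)) = 0"
    by (rule tendsto_unique[OF trivial_limit_at_right_real lim1 lim0])
  moreover have "(\<Sum>j\<in>{k..N}. c j * 0 ^ (j - k)) = (\<Sum>j\<in>{k..N}. if j = k then c j else 0)"
    by (intro sum.cong refl) (auto simp: power_0_left)
  ultimately show ?case using less.prems by simp
qed

lemma sum_group_degree:
  fixes \<alpha> :: "'i \<Rightarrow> real"
  assumes "finite I" "\<And>s. s \<in> I \<Longrightarrow> e s \<le> N"
  shows "(\<Sum>s\<in>I. \<alpha> s * t ^ e s) = (\<Sum>k\<le>N. (\<Sum>s\<in>{s \<in> I. e s = k}. \<alpha> s) * t ^ k)"
proof -
  have "(\<Sum>s\<in>I. \<alpha> s * t ^ e s) = (\<Sum>k\<le>N. \<Sum>s\<in>{s \<in> I. e s = k}. \<alpha> s * t ^ e s)"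
    using assms by (intro sum.group[symmetric]) auto
  also have "\<dots> = (\<Sum>k\<le>N. (\<Sum>s\<in>{s \<in> I. e s = k}. \<alpha> s) * t ^ k)"
    by (intro sum.cong refl) (simp add: sum_distrib_right)
  finally show ?thesis .
qed

section \<open>Expansion of the system and of the residual along rays\<close>

lemma power_bigo_at_right: "m \<le> e \<Longrightarrow> (\<lambda>t::real. t ^ e) \<in> O[at_right 0](\<lambda>t. t ^ m)"
proof (rule bigoI[of _ 1])
  assume me: "m \<le> e"
  have "\<forall>\<^sub>F t::real in at_right 0. t < 1" by (rule eventually_at_right_field[THEN iffD2]) (auto intro: exI[of _ 1])
  then show "\<forall>\<^sub>F t::real in at_right 0. norm (t ^ e) \<le> 1 * norm (t ^ m)"
    using eventually_at_right_less[of 0]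
    by eventually_elim (use me in \<open>auto intro!: power_decreasing\<close>)
qed

lemma vec_sum_power_bigo:
  assumes "\<And>s. s \<in> S \<Longrightarrow> dim_vec (a s) = N" "\<And>s. s \<in> S \<Longrightarrow> m \<le> e s" "j < N"
  shows "(\<lambda>t. vec_sum N (\<lambda>s. (\<alpha> s * t ^ e s) \<cdot>\<^sub>v a s) S $ j) \<in> O[at_right 0](\<lambda>t::real. t ^ m)"
proof -
  have "(\<lambda>t. \<Sum>s\<in>S. \<alpha> s * t ^ e s * a s $ j) \<in> O[at_right 0](\<lambda>t::real. t ^ m)"
  proof (rule big_sum_in_bigo)
    fix s assume "s \<in> S"
    then have "(\<lambda>t. (\<alpha> s * a s $ j) * t ^ e s) \<in> O[at_right 0](\<lambda>t::real. 1 * t ^ m)"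
      using assms by (intro landau_o.big.mult power_bigo_at_right bigo_const)
    then show "(\<lambda>t. \<alpha> s * t ^ e s * a s $ j) \<in> O[at_right 0](\<lambda>t::real. t ^ m)"
      by (simp add: mult_ac)
  qed
  then show ?thesis using assms by (simp add: vec_sum_def)
qed

lemma scalar_prod_bigo:
  fixes U V :: "real \<Rightarrow> real vec"
  assumes "\<And>t. dim_vec (V t) = n"
    and "\<And>j. j < n \<Longrightarrow> (\<lambda>t. U t $ j) \<in> O[F](f)" "\<And>j. j < n \<Longrightarrow> (\<lambda>t. V t $ j) \<in> O[F](g)"
  shows "(\<lambda>t. U t \<bullet> V t) \<in> O[F](\<lambda>t. f t * g t)"
  unfolding scalar_prod_lessThan assms(1)
  by (intro big_sum_in_bigo landau_o.big.mult) (use assms in auto)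

text \<open>Vanishing terms extend the range to a common bound \<open>L\<close>, so that later index
  sets do not involve \<open>l\<close>. The output dimension is free because \<open>poly_h\<close>
  has the same shape.\<close>

lemma poly_f_ray:
  assumes A: "A \<in> carrier_mat r n" and F: "\<And>p. p \<ge> 2 \<Longrightarrow> F p \<in> carrier_mat r (n ^ p)"
    and F0: "\<And>p. p \<ge> 2 \<Longrightarrow> p > l \<Longrightarrow> F p = 0\<^sub>m r (n ^ p)"
    and y: "y \<in> carrier_vec n" and L: "l \<le> L" "1 \<le> L"
  shows "poly_f r l A F (t \<cdot>\<^sub>v y) = vec_sum r (\<lambda>p. (1 * t ^ p) \<cdot>\<^sub>v ((F(1 := A)) p *\<^sub>v xpow p y)) {1..L}"
proof (rule eq_vecI)
  fix j assume "j < dim_vec (vec_sum r (\<lambda>p. (1 * t ^ p) \<cdot>\<^sub>v ((F(1 := A)) p *\<^sub>v xpow p y)) {1..L})"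
  then have j: "j < r" by simp
  let ?t = "\<lambda>p. t ^ p * ((F(1 := A)) p *\<^sub>v xpow p y) $ j"
  have dF: "(F(1 := A)) p \<in> carrier_mat r (n ^ p)" if "p \<ge> 1" for p
    using A F[of p] that by (cases "p = 1") auto
  have "poly_f r l A F (t \<cdot>\<^sub>v y) $ j = ?t 1 + (\<Sum>p\<in>{2..l}. ?t p)"
  proof -
    have "(A *\<^sub>v (t \<cdot>\<^sub>v y)) $ j = ?t 1"
      using mult_mat_vec[OF A y, of t] A j by simp
    moreover have "(F p *\<^sub>v xpow p (t \<cdot>\<^sub>v y)) $ j = ?t p" if "p \<in> {2..l}" for p
    proof -
      have "F p \<in> carrier_mat r (n ^ p)" using F that by simp
      then show ?thesis
        using mult_mat_vec[of "F p" r "n ^ p" "xpow p y" "t ^ p"] y j that by (simp add: xpow_smult)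
    qed
    ultimately show ?thesis using A j by (simp add: poly_f_def vec_sum_def)
  qed
  also have "(\<Sum>p\<in>{2..l}. ?t p) = (\<Sum>p\<in>{2..L}. ?t p)"
  proof (rule sum.mono_neutral_left)
    show "\<forall>p\<in>{2..L} - {2..l}. ?t p = 0"
      using F0 y j by (auto simp: scalar_prod_lessThan)
  qed (use L in auto)
  also have "?t 1 + (\<Sum>p\<in>{2..L}. ?t p) = (\<Sum>p\<in>{1..L}. ?t p)"
    using L(2) sum.atLeast_Suc_atMost[of 1 L ?t] by (simp add: numeral_2_eq_2)
  also have "\<dots> = vec_sum r (\<lambda>p. (1 * t ^ p) \<cdot>\<^sub>v ((F(1 := A)) p *\<^sub>v xpow p y)) {1..L} $ j"
    using j dF[THEN carrier_matD(1)] by (auto simp: vec_sum_def intro!: sum.cong)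
  finally show "poly_f r l A F (t \<cdot>\<^sub>v y) $ j
    = vec_sum r (\<lambda>p. (1 * t ^ p) \<cdot>\<^sub>v ((F(1 := A)) p *\<^sub>v xpow p y)) {1..L} $ j" .
qed (simp add: poly_f_def)

lemma poly_h_eq_poly_f: "poly_h r l C H = poly_f r l C H"
  by (simp add: fun_eq_iff poly_h_def poly_f_def)

lemma poly_g_ray:
  assumes dims: "system_dims n m r l A B C F G H" and y: "y \<in> carrier_vec n" and L: "l \<le> L" and a: "a < m"
  shows "poly_g n m l B G (t \<cdot>\<^sub>v y) *\<^sub>v unit_vec m a
    = vec_sum n (\<lambda>p. (1 * t ^ p) \<cdot>\<^sub>v ((G(0 := B)) p *\<^sub>v kron_vec (xpow p y) (unit_vec m a))) {..L}"
proof (rule eq_vecI)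
  let ?e = "unit_vec m a :: real vec"
  fix j assume "j < dim_vec (vec_sum n (\<lambda>p. (1 * t ^ p) \<cdot>\<^sub>v ((G(0 := B)) p *\<^sub>v kron_vec (xpow p y) ?e)) {..L})"
  then have j: "j < n" by simp
  let ?t = "\<lambda>p. t ^ p * ((G(0 := B)) p *\<^sub>v kron_vec (xpow p y) ?e) $ j"
  have B: "B \<in> carrier_mat n m" and G: "\<And>p. p \<ge> 1 \<Longrightarrow> G p \<in> carrier_mat n (m * n ^ p)"
    and G0: "\<And>p. p \<ge> 1 \<Longrightarrow> p > l \<Longrightarrow> G p = 0\<^sub>m n (m * n ^ p)"
    using dims unfolding system_dims_def by auto
  have dG: "dim_row ((G(0 := B)) p) = n" for p
    using B G[of p] by (cases "p = 0") auto
  have dy: "dim_vec y = n" using y by simp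
  let ?x = "t \<cdot>\<^sub>v y"
  have M: "G p * (col_mat (xpow p ?x) \<otimes>\<^sub>m 1\<^sub>m m) \<in> carrier_mat n m" if "p \<ge> 1" for p
  proof (rule mult_carrier_mat[OF G[OF that]])
    show "col_mat (xpow p ?x) \<otimes>\<^sub>m 1\<^sub>m m \<in> carrier_mat (m * n ^ p) m"
      by (intro carrier_matI) (simp_all add: dy mult.commute)
  qed
  have summand: "(G p * (col_mat (xpow p ?x) \<otimes>\<^sub>m 1\<^sub>m m)) *\<^sub>v ?e = t ^ p \<cdot>\<^sub>v (G p *\<^sub>v kron_vec (xpow p y) ?e)"
    if p: "p \<ge> 1" for p
  proof -
    have "(G p * (col_mat (xpow p ?x) \<otimes>\<^sub>m 1\<^sub>m m)) *\<^sub>v ?e = G p *\<^sub>v ((col_mat (xpow p ?x) \<otimes>\<^sub>m 1\<^sub>m m) *\<^sub>v ?e)"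
    proof (rule assoc_mult_mat_vec[OF G[OF p]])
      show "col_mat (xpow p ?x) \<otimes>\<^sub>m 1\<^sub>m m \<in> carrier_mat (m * n ^ p) m"
        by (intro carrier_matI) (simp_all add: dy mult.commute)
    qed simp
    also have "(col_mat (xpow p ?x) \<otimes>\<^sub>m 1\<^sub>m m) *\<^sub>v ?e = t ^ p \<cdot>\<^sub>v kron_vec (xpow p y) ?e"
      by (simp add: col_mat_kron_mult_vec xpow_smult kron_vec_smult_left)
    also have "G p *\<^sub>v \<dots> = t ^ p \<cdot>\<^sub>v (G p *\<^sub>v kron_vec (xpow p y) ?e)"
      by (rule mult_mat_vec[OF G[OF p]]) (intro carrier_vecI, simp add: dy mult.commute)
    finally show ?thesis .
  qed
  have "poly_g n m l B G ?x *\<^sub>v ?e = B *\<^sub>v ?e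
      + mat_sum n m (\<lambda>p. G p * (col_mat (xpow p ?x) \<otimes>\<^sub>m 1\<^sub>m m)) {1..l} *\<^sub>v ?e"
    unfolding poly_g_def using B by (intro add_mult_distrib_mat_vec) auto
  also have "mat_sum n m (\<lambda>p. G p * (col_mat (xpow p ?x) \<otimes>\<^sub>m 1\<^sub>m m)) {1..l} *\<^sub>v ?e
      = vec_sum n (\<lambda>p. (G p * (col_mat (xpow p ?x) \<otimes>\<^sub>m 1\<^sub>m m)) *\<^sub>v ?e) {1..l}"
    using M by (intro mat_sum_mult_vec) auto
  also have "\<dots> = vec_sum n (\<lambda>p. t ^ p \<cdot>\<^sub>v (G p *\<^sub>v kron_vec (xpow p y) ?e)) {1..l}"
    by (intro vec_sum_cong summand) auto
  also have "(B *\<^sub>v ?e + \<dots>) $ j = ?t 0 + (\<Sum>p\<in>{1..l}. ?t p)"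
    using j dG G[THEN carrier_matD(1)] by (auto simp: vec_sum_def kron_vec_one_left intro!: sum.cong)
  also have "(\<Sum>p\<in>{1..l}. ?t p) = (\<Sum>p\<in>{1..L}. ?t p)"
  proof (rule sum.mono_neutral_left)
    show "\<forall>p\<in>{1..L} - {1..l}. ?t p = 0"
      using G0 dy j by (auto simp: scalar_prod_lessThan mult.commute)
  qed (use L in auto)
  also have "?t 0 + (\<Sum>p\<in>{1..L}. ?t p) = (\<Sum>p\<le>L. ?t p)"
    using sum.atLeast_Suc_atMost[of 0 L ?t] by (simp add: atLeast0AtMost)
  also have "\<dots> = vec_sum n (\<lambda>p. (1 * t ^ p) \<cdot>\<^sub>v ((G(0 := B)) p *\<^sub>v kron_vec (xpow p y) ?e)) {..L} $ j"
    using j dG by (simp add: vec_sum_def)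
  finally show "(poly_g n m l B G ?x *\<^sub>v ?e) $ j
    = vec_sum n (\<lambda>p. (1 * t ^ p) \<cdot>\<^sub>v ((G(0 := B)) p *\<^sub>v kron_vec (xpow p y) ?e)) {..L} $ j" .
qed (simp add: poly_g_def)

lemma taylor_grad_ray:
  assumes W: "\<And>i. i \<in> {2..d} \<Longrightarrow> W i \<in> carrier_mat n (n ^ (i - 1))" and y: "y \<in> carrier_vec n"
  shows "taylor_grad n d W (t \<cdot>\<^sub>v y) = vec_sum n (\<lambda>i. (real i / 2 * t ^ (i - 1)) \<cdot>\<^sub>v (W i *\<^sub>v xpow (i - 1) y)) {2..d}"
  unfolding taylor_grad_def
proof (rule vec_sum_cong)
  fix i assume i: "i \<in> {2..d}"
  show "(real i / 2) \<cdot>\<^sub>v (W i *\<^sub>v xpow (i - 1) (t \<cdot>\<^sub>v y)) = (real i / 2 * t ^ (i - 1)) \<cdot>\<^sub>v (W i *\<^sub>v xpow (i - 1) y)"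
    unfolding xpow_smult mult_mat_vec[OF W[OF i] xpow_carrier[OF y]] by (rule smult_smult_assoc)
qed

lemma vec_sum_scalar_vec_sum:
  assumes "\<And>s. s \<in> S \<Longrightarrow> dim_vec (a s) = N" "\<And>s. s \<in> T \<Longrightarrow> dim_vec (b s) = N"
  shows "vec_sum N (\<lambda>s. \<alpha> s \<cdot>\<^sub>v a s) S \<bullet> vec_sum N (\<lambda>s. \<beta> s \<cdot>\<^sub>v b s) T
    = (\<Sum>(s, s')\<in>S \<times> T. (\<alpha> s * \<beta> s') * (a s \<bullet> b s'))"
proof -
  have "vec_sum N (\<lambda>s. \<alpha> s \<cdot>\<^sub>v a s) S \<bullet> vec_sum N (\<lambda>s. \<beta> s \<cdot>\<^sub>v b s) T
      = (\<Sum>s\<in>S. (\<alpha> s \<cdot>\<^sub>v a s) \<bullet> vec_sum N (\<lambda>s. \<beta> s \<cdot>\<^sub>v b s) T)"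
    by (rule vec_sum_scalar_left) simp
  also have "\<dots> = (\<Sum>s\<in>S. \<Sum>s'\<in>T. (\<alpha> s \<cdot>\<^sub>v a s) \<bullet> (\<beta> s' \<cdot>\<^sub>v b s'))"
    by (intro sum.cong refl vec_sum_scalar_right) (use assms in auto)
  also have "\<dots> = (\<Sum>s\<in>S. \<Sum>s'\<in>T. (\<alpha> s * \<beta> s') * (a s \<bullet> b s'))"
  proof (intro sum.cong refl)
    fix s s' assume "s \<in> S" "s' \<in> T"
    then have "a s \<in> carrier_vec N" "b s' \<in> carrier_vec N" using assms by (auto intro: carrier_vecI)
    then show "(\<alpha> s \<cdot>\<^sub>v a s) \<bullet> (\<beta> s' \<cdot>\<^sub>v b s') = (\<alpha> s * \<beta> s') * (a s \<bullet> b s')"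
      by (simp add: mult_ac)
  qed
  finally show ?thesis by (simp add: sum.cartesian_product)
qed

text \<open>Applied to g(x), this replaces the matrix product g g^T by squares of scalar expansions,
  one for each input.\<close>

lemma quadratic_form_columns:
  fixes M :: "real mat"
  assumes M: "M \<in> carrier_mat n m" and v: "v \<in> carrier_vec n"
  shows "v \<bullet> (M *\<^sub>v (M\<^sup>T *\<^sub>v v)) = (\<Sum>a<m. (v \<bullet> (M *\<^sub>v unit_vec m a))\<^sup>2)"
proof -
  have "v \<bullet> (M *\<^sub>v (M\<^sup>T *\<^sub>v v)) = (M\<^sup>T *\<^sub>v v) \<bullet> (M\<^sup>T *\<^sub>v v)"
    using transpose_mult_scalar_prod[OF M, of v "M\<^sup>T *\<^sub>v v"] M v by simp
  also have "\<dots> = (\<Sum>a<m. ((M\<^sup>T *\<^sub>v v) \<bullet> unit_vec m a)\<^sup>2)"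
    using M by (auto simp: scalar_prod_lessThan[of "M\<^sup>T *\<^sub>v v" "M\<^sup>T *\<^sub>v v"] power2_eq_square
        scalar_prod_right_unit[of _ m] intro!: sum.cong)
  also have "\<dots> = (\<Sum>a<m. (v \<bullet> (M *\<^sub>v unit_vec m a))\<^sup>2)"
    using transpose_mult_scalar_prod[OF M, of v "unit_vec m _"] v by simp
  finally show ?thesis .
qed

lemma vnorm_smult:
  fixes v :: "'a::real_normed_field vec"
  shows "vnorm (c \<cdot>\<^sub>v v) = norm c * vnorm v"
proof -
  have "vnorm (c \<cdot>\<^sub>v v) = L2_set (\<lambda>i. norm c * norm (v $ i)) {..<dim_vec v}"
    unfolding vnorm_def by (rule L2_set_cong) (auto simp: norm_mult)
  then show ?thesis by (simp add: vnorm_def L2_set_right_distrib)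
qed

lemma ray_in_ball0:
  assumes "y \<in> carrier_vec n" "\<rho> > 0"
  shows "\<forall>\<^sub>F t in at_right 0. t \<cdot>\<^sub>v y \<in> ball0 n \<rho>"
proof -
  have "((\<lambda>t. \<bar>t\<bar> * vnorm y) \<longlongrightarrow> \<bar>0\<bar> * vnorm y) (at_right 0)"
    by (intro tendsto_intros)
  then have "\<forall>\<^sub>F t in at_right 0. \<bar>t\<bar> * vnorm y < \<rho>"
    using assms(2) by (intro order_tendstoD) auto
  then show ?thesis using assms(1) by (auto simp: ball0_def vnorm_smult elim: eventually_mono)
qed

lemma entries_le_exists: "\<exists>r>0. entries_le r y"
proof -
  have "entries_le (1 + (\<Sum>i<dim_vec y. \<bar>y $ i\<bar>)) y"
    unfolding entries_le_def
  proof (intro allI impI)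
    fix i assume "i < dim_vec y"
    then have "\<bar>y $ i\<bar> \<le> (\<Sum>i<dim_vec y. \<bar>y $ i\<bar>)" by (intro member_le_sum) auto
    then show "\<bar>y $ i\<bar> \<le> 1 + (\<Sum>i<dim_vec y. \<bar>y $ i\<bar>)" by simp
  qed
  moreover have "0 < 1 + (\<Sum>i<dim_vec y. \<bar>y $ i\<bar>)" by (smt (verit) sum_nonneg abs_ge_zero)
  ultimately show ?thesis by blast
qed

lemma grad_taylor_ray:
  assumes exp: "degree_d_expansion n d E w"
    and W: "\<forall>i\<in>{2..d}. W i \<in> carrier_mat n (n ^ (i - 1)) \<and> w i = vec_of_mat (W i)"
    and y: "y \<in> carrier_vec n" and j: "j < n"
  shows "(\<lambda>t. (grad n E (t \<cdot>\<^sub>v y) - taylor_grad n d W (t \<cdot>\<^sub>v y)) $ j) \<in> O[at_right 0](\<lambda>t. t ^ d)"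
proof -
  obtain K \<delta> where K: "0 \<le> K" "0 < \<delta>" and bd: "\<And>x r j. x \<in> carrier_vec n \<Longrightarrow> 0 < r \<Longrightarrow> r \<le> \<delta> \<Longrightarrow>
      entries_le r x \<Longrightarrow> j < n \<Longrightarrow> \<bar>grad n E x $ j - taylor_grad n d W x $ j\<bar> \<le> K * r ^ d"
    using grad_taylor[OF exp W] by blast
  obtain r where r: "0 < r" "entries_le r y" using entries_le_exists by blast
  have "((\<lambda>t. t * r) \<longlongrightarrow> 0 * r) (at_right 0)" by (intro tendsto_intros)
  then have "\<forall>\<^sub>F t in at_right 0. t * r < \<delta>" using K by (intro order_tendstoD) auto
  then have "\<forall>\<^sub>F t in at_right 0. norm ((grad n E (t \<cdot>\<^sub>v y) - taylor_grad n d W (t \<cdot>\<^sub>v y)) $ j) \<le> (K * r ^ d) * norm (t ^ d)"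
    using eventually_at_right_less[of 0]
  proof eventually_elim
    case (elim t)
    have "entries_le (t * r) (t \<cdot>\<^sub>v y)"
      using r(2) elim by (auto simp: entries_le_def abs_mult)
    then have "\<bar>grad n E (t \<cdot>\<^sub>v y) $ j - taylor_grad n d W (t \<cdot>\<^sub>v y) $ j\<bar> \<le> K * (t * r) ^ d"
      using elim r j y by (intro bd) auto
    then show ?case using j elim by (simp add: grad_def taylor_grad_def power_mult_distrib mult_ac)
  qed
  then show ?thesis by (rule bigoI)
qed

text \<open>Substitution of the gradient as q + \<rho>, where \<rho> is a remainder here and not a
  radius. Every term collected on the right carries a factor linear in \<rho>.\<close>

lemma HJB_expand:
  assumes M: "g x \<in> carrier_mat n m" and f: "f x \<in> carrier_vec n" and HJB: "HJB n \<eta> f g h E x"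
    and q: "q \<in> carrier_vec n"
  defines "\<rho> \<equiv> grad n E x - q"
  shows "q \<bullet> f x - \<eta> / 2 * (\<Sum>a<m. (q \<bullet> (g x *\<^sub>v unit_vec m a))\<^sup>2) + 1/2 * (h x \<bullet> h x)
    = \<eta> / 2 * (\<Sum>a<m. (2 * (q \<bullet> (g x *\<^sub>v unit_vec m a)) + \<rho> \<bullet> (g x *\<^sub>v unit_vec m a)) * (\<rho> \<bullet> (g x *\<^sub>v unit_vec m a))) - \<rho> \<bullet> f x"
proof -
  let ?v = "grad n E x"
  have v: "?v \<in> carrier_vec n" by (simp add: grad_def)
  have vq: "?v \<bullet> u = q \<bullet> u + \<rho> \<bullet> u" if "u \<in> carrier_vec n" for u
    unfolding \<rho>_def using minus_scalar_prod_distrib[OF v q that] by simp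
  have "(?v \<bullet> (g x *\<^sub>v unit_vec m a))\<^sup>2 = (q \<bullet> (g x *\<^sub>v unit_vec m a))\<^sup>2
      + (2 * (q \<bullet> (g x *\<^sub>v unit_vec m a)) + \<rho> \<bullet> (g x *\<^sub>v unit_vec m a)) * (\<rho> \<bullet> (g x *\<^sub>v unit_vec m a))" for a
    using vq[of "g x *\<^sub>v unit_vec m a"] M by (simp add: power2_eq_square algebra_simps)
  then have "?v \<bullet> (g x *\<^sub>v ((g x)\<^sup>T *\<^sub>v ?v)) = (\<Sum>a<m. (q \<bullet> (g x *\<^sub>v unit_vec m a))\<^sup>2)
      + (\<Sum>a<m. (2 * (q \<bullet> (g x *\<^sub>v unit_vec m a)) + \<rho> \<bullet> (g x *\<^sub>v unit_vec m a)) * (\<rho> \<bullet> (g x *\<^sub>v unit_vec m a)))"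
    using quadratic_form_columns[OF M v] by (simp add: sum.distrib)
  then show ?thesis using HJB vq[OF f] unfolding HJB_def by (simp add: algebra_simps)
qed

text \<open>The remainder of the gradient has order t^d. It is multiplied by f, of order t, or by
  the pairing of the gradient with a column of g, also of order t. The gain of one order lets the
  comparison of coefficients reach k = d.\<close>

lemma HJB_residual:
  assumes f: "f = poly_f n l A F" and g: "g = poly_g n m l B G" and h: "h = poly_h r l C H"
    and dims: "system_dims n m r l A B C F G H" and \<rho>: "\<rho> > 0"
    and HJB: "\<forall>x\<in>ball0 n \<rho>. HJB n \<eta> f g h E x" and d: "d \<ge> 2"
    and exp: "degree_d_expansion n d E w"
    and W: "\<forall>i\<in>{2..d}. W i \<in> carrier_mat n (n ^ (i - 1)) \<and> w i = vec_of_mat (W i)"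
    and y: "y \<in> carrier_vec n"
  defines "q \<equiv> \<lambda>t. taylor_grad n d W (t \<cdot>\<^sub>v y)"
  shows "(\<lambda>t. q t \<bullet> f (t \<cdot>\<^sub>v y) - \<eta> / 2 * (\<Sum>a<m. (q t \<bullet> (g (t \<cdot>\<^sub>v y) *\<^sub>v unit_vec m a))\<^sup>2)
      + 1/2 * (h (t \<cdot>\<^sub>v y) \<bullet> h (t \<cdot>\<^sub>v y))) \<in> O[at_right 0](\<lambda>t. t ^ Suc d)" (is "?S \<in> _")
proof -
  have A: "A \<in> carrier_mat n n" and B: "B \<in> carrier_mat n m"
    and F: "\<And>p. p \<ge> 2 \<Longrightarrow> F p \<in> carrier_mat n (n ^ p)" and F0: "\<And>p. p \<ge> 2 \<Longrightarrow> p > l \<Longrightarrow> F p = 0\<^sub>m n (n ^ p)"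
    and G: "\<And>p. p \<ge> 1 \<Longrightarrow> G p \<in> carrier_mat n (m * n ^ p)"
    using dims unfolding system_dims_def by auto
  have W': "W i \<in> carrier_mat n (n ^ (i - 1))" if "i \<in> {2..d}" for i using W that by blast
  define e where "e t = grad n E (t \<cdot>\<^sub>v y) - q t" for t
  let ?g = "\<lambda>t a. g (t \<cdot>\<^sub>v y) *\<^sub>v unit_vec m a"
  have dimf: "f x \<in> carrier_vec n" and dimg: "g x \<in> carrier_mat n m" for x
    unfolding f g poly_f_def poly_g_def using B by (auto intro!: carrier_vecI)
  have dq: "q t \<in> carrier_vec n" for t by (simp add: q_def taylor_grad_def)
  have de: "(\<lambda>t. e t $ j) \<in> O[at_right 0](\<lambda>t. t ^ d)" if "j < n" for j
    unfolding e_def q_def by (rule grad_taylor_ray[OF exp W y that])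
  have qO: "(\<lambda>t. q t $ j) \<in> O[at_right 0](\<lambda>t. t ^ 1)" if "j < n" for j
  proof -
    have r: "q t = vec_sum n (\<lambda>i. (real i / 2 * t ^ (i - 1)) \<cdot>\<^sub>v (W i *\<^sub>v xpow (i - 1) y)) {2..d}" for t
      unfolding q_def by (rule taylor_grad_ray[OF _ y]) (rule W')
    show ?thesis unfolding r
      by (rule vec_sum_power_bigo[OF _ _ that]) (use W'[THEN carrier_matD(1)] in auto)
  qed
  have fO: "(\<lambda>t. f (t \<cdot>\<^sub>v y) $ j) \<in> O[at_right 0](\<lambda>t. t ^ 1)" if "j < n" for j
  proof -
    have r: "f (t \<cdot>\<^sub>v y) = vec_sum n (\<lambda>p. (1 * t ^ p) \<cdot>\<^sub>v ((F(1 := A)) p *\<^sub>v xpow p y)) {1..l + 1}" for t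
      unfolding f by (rule poly_f_ray[OF A F F0 y]) auto
    show ?thesis unfolding r
      by (rule vec_sum_power_bigo[OF _ _ that]) (use A[THEN carrier_matD(1)] F[THEN carrier_matD(1)] in auto)
  qed
  have gO: "(\<lambda>t. ?g t a $ j) \<in> O[at_right 0](\<lambda>t. t ^ 0)" if "j < n" "a < m" for j a
    unfolding g poly_g_ray[OF dims y le_refl that(2)]
    by (rule vec_sum_power_bigo[OF _ _ that(1)]) (use B G[THEN carrier_matD(1)] in auto)
  have eO: "(\<lambda>t. e t \<bullet> f (t \<cdot>\<^sub>v y)) \<in> O[at_right 0](\<lambda>t. t ^ d * t ^ 1)"
    by (rule scalar_prod_bigo[of _ n]) (use dimf de fO in auto)
  have eg: "(\<lambda>t. e t \<bullet> ?g t a) \<in> O[at_right 0](\<lambda>t. t ^ d * t ^ 0)" if "a < m" for a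
    by (rule scalar_prod_bigo[of _ n]) (use dimg[THEN carrier_matD(1)] de gO[OF _ that] in auto)
  have qg: "(\<lambda>t. q t \<bullet> ?g t a) \<in> O[at_right 0](\<lambda>t. t ^ 1 * t ^ 0)" if "a < m" for a
    by (rule scalar_prod_bigo[of _ n]) (use dimg[THEN carrier_matD(1)] qO gO[OF _ that] in auto)
  have "(\<lambda>t. \<eta> / 2 * (\<Sum>a<m. (2 * (q t \<bullet> ?g t a) + e t \<bullet> ?g t a) * (e t \<bullet> ?g t a)) - e t \<bullet> f (t \<cdot>\<^sub>v y))
      \<in> O[at_right 0](\<lambda>t. t ^ 1 * t ^ d)" (is "?R \<in> _")
  proof (rule sum_in_bigo(2))
    have "(\<lambda>t. 2 * (q t \<bullet> ?g t a) + e t \<bullet> ?g t a) \<in> O[at_right 0](\<lambda>t. t ^ 1)" if "a < m" for a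
    proof (rule sum_in_bigo(1))
      show "(\<lambda>t. 2 * (q t \<bullet> ?g t a)) \<in> O[at_right 0](\<lambda>t. t ^ 1)"
        using qg[OF that] by simp
      have "(\<lambda>t. e t \<bullet> ?g t a) \<in> O[at_right 0](\<lambda>t. t ^ d)" using eg[OF that] by simp
      moreover have "(\<lambda>t::real. t ^ d) \<in> O[at_right 0](\<lambda>t. t ^ 1)"
        using d by (intro power_bigo_at_right) simp
      ultimately show "(\<lambda>t. e t \<bullet> ?g t a) \<in> O[at_right 0](\<lambda>t. t ^ 1)" by (rule landau_o.big_trans)
    qed
    then have "(\<lambda>t. \<Sum>a<m. (2 * (q t \<bullet> ?g t a) + e t \<bullet> ?g t a) * (e t \<bullet> ?g t a))
        \<in> O[at_right 0](\<lambda>t. t ^ 1 * t ^ d)"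
      using eg by (intro big_sum_in_bigo landau_o.big.mult) auto
    from landau_o.big.mult[OF bigo_const[of "\<eta> / 2"] this]
    show "(\<lambda>t. \<eta> / 2 * (\<Sum>a<m. (2 * (q t \<bullet> ?g t a) + e t \<bullet> ?g t a) * (e t \<bullet> ?g t a)))
        \<in> O[at_right 0](\<lambda>t. t ^ 1 * t ^ d)" by (simp only: mult_1_left)
    show "(\<lambda>t. e t \<bullet> f (t \<cdot>\<^sub>v y)) \<in> O[at_right 0](\<lambda>t. t ^ 1 * t ^ d)"
      using eO by (simp only: mult.commute)
  qed
  moreover have "\<forall>\<^sub>F t in at_right 0. ?S t = ?R t"
    using ray_in_ball0[OF y \<rho>]
  proof eventually_elim
    case (elim t)
    show ?case unfolding e_def
      by (rule HJB_expand[where f = f, OF dimg dimf _ dq]) (use HJB elim in blast)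
  qed
  ultimately show ?thesis by (simp add: landau_o.big.in_cong)
qed

lemma HJB_coefficients:
  assumes f: "f = poly_f n l A F" and g: "g = poly_g n m l B G" and h: "h = poly_h r l C H"
    and dims: "system_dims n m r l A B C F G H" and \<rho>: "\<rho> > 0"
    and HJB: "\<forall>x\<in>ball0 n \<rho>. HJB n \<eta> f g h E x" and d: "d \<ge> 2"
    and exp: "degree_d_expansion n d E w"
    and W: "\<forall>i\<in>{2..d}. W i \<in> carrier_mat n (n ^ (i - 1)) \<and> w i = vec_of_mat (W i)"
    and y: "y \<in> carrier_vec n" and k: "k \<le> d"
  shows "(\<Sum>(i, p)\<in>{(i, p). 2 \<le> i \<and> 1 \<le> p \<and> i + p = k + 1}.
        real i / 2 * ((W i *\<^sub>v xpow (i - 1) y) \<bullet> ((F(1 := A)) p *\<^sub>v xpow p y)))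
    - \<eta> / 2 * (\<Sum>((i, p), (j, q))\<in>{((i, p), (j, q)). 2 \<le> i \<and> 2 \<le> j \<and> i + j + (p + q) = k + 2}.
        real (i * j) / 4 * (\<Sum>a<m. gain m (G(0 := B)) W y p i a * gain m (G(0 := B)) W y q j a))
    + 1 / 2 * (\<Sum>(p, q)\<in>{(p, q). 1 \<le> p \<and> 1 \<le> q \<and> p + q = k}.
        ((H(1 := C)) p *\<^sub>v xpow p y) \<bullet> ((H(1 := C)) q *\<^sub>v xpow q y)) = 0"
proof -
  have A: "A \<in> carrier_mat n n" and B: "B \<in> carrier_mat n m" and C: "C \<in> carrier_mat r n"
    and F: "\<And>p. p \<ge> 2 \<Longrightarrow> F p \<in> carrier_mat n (n ^ p)" and F0: "\<And>p. p \<ge> 2 \<Longrightarrow> p > l \<Longrightarrow> F p = 0\<^sub>m n (n ^ p)"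
    and H: "\<And>p. p \<ge> 2 \<Longrightarrow> H p \<in> carrier_mat r (n ^ p)" and H0: "\<And>p. p \<ge> 2 \<Longrightarrow> p > l \<Longrightarrow> H p = 0\<^sub>m r (n ^ p)"
    and G: "\<And>p. p \<ge> 1 \<Longrightarrow> G p \<in> carrier_mat n (m * n ^ p)"
    using dims unfolding system_dims_def by auto
  have W': "W i \<in> carrier_mat n (n ^ (i - 1))" if "i \<in> {2..d}" for i using W that by blast
  let ?F = "F(1 := A)" and ?G = "G(0 := B)" and ?H = "H(1 := C)"
  let ?u = "\<lambda>i. W i *\<^sub>v xpow (i - 1) y"
  have rF: "dim_row (?F p) = n" if "p \<ge> 1" for p
    using A[THEN carrier_matD(1)] F[THEN carrier_matD(1), of p] that by auto
  have rH: "dim_row (?H p) = r" if "p \<ge> 1" for p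
    using C[THEN carrier_matD(1)] H[THEN carrier_matD(1), of p] that by auto
  have rG: "dim_row (?G p) = n" for p
    using B[THEN carrier_matD(1)] G[THEN carrier_matD(1), of p] by auto
  have rW: "dim_row (W i) = n" if "i \<in> {2..d}" for i using W'[OF that] by auto
  \<comment> \<open>Since \<open>L\<close> is at least d, the truncated index ranges contain every
    term of degree k \<le> d, so the sets in the conclusion carry no bounds; \<open>N\<close>
    dominates all degrees that occur.\<close>
  define L where "L = l + d"
  define N where "N = 2 * (L + d)"
  define q where "q t = taylor_grad n d W (t \<cdot>\<^sub>v y)" for t
  have qr: "q t = vec_sum n (\<lambda>i. (real i / 2 * t ^ (i - 1)) \<cdot>\<^sub>v ?u i) {2..d}" for t
    unfolding q_def by (rule taylor_grad_ray[OF _ y]) (rule W')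
  have fr: "f (t \<cdot>\<^sub>v y) = vec_sum n (\<lambda>p. (1 * t ^ p) \<cdot>\<^sub>v (?F p *\<^sub>v xpow p y)) {1..L}" for t
    unfolding f by (rule poly_f_ray[OF A F F0 y]) (use d in \<open>auto simp: L_def\<close>)
  have hr: "h (t \<cdot>\<^sub>v y) = vec_sum r (\<lambda>p. (1 * t ^ p) \<cdot>\<^sub>v (?H p *\<^sub>v xpow p y)) {1..L}" for t
    unfolding h poly_h_eq_poly_f by (rule poly_f_ray[OF C H H0 y]) (use d in \<open>auto simp: L_def\<close>)
  have gr: "g (t \<cdot>\<^sub>v y) *\<^sub>v unit_vec m a
      = vec_sum n (\<lambda>p. (1 * t ^ p) \<cdot>\<^sub>v (?G p *\<^sub>v kron_vec (xpow p y) (unit_vec m a))) {..L}" if "a < m" for t a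
    unfolding g by (rule poly_g_ray[OF dims y _ that]) (simp add: L_def)
  let ?I1 = "{2..d} \<times> {1..L}" and ?J = "{2..d} \<times> {..L}" and ?I3 = "{1..L} \<times> {1..L}"
  let ?\<alpha>1 = "\<lambda>(i, p). real i / 2 * (?u i \<bullet> (?F p *\<^sub>v xpow p y))"
  let ?\<alpha>2 = "\<lambda>((i, p), (j, q)). real (i * j) / 4 * (\<Sum>a<m. gain m ?G W y p i a * gain m ?G W y q j a)"
  let ?\<alpha>3 = "\<lambda>(p, q). (?H p *\<^sub>v xpow p y) \<bullet> (?H q *\<^sub>v xpow q y)"
  let ?e1 = "\<lambda>(i, p). i - 1 + p" and ?e2 = "\<lambda>((i, p), (j, q)). (i - 1 + p) + (j - 1 + q)" and ?e3 = "\<lambda>(p, q). p + q :: nat"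
  have s1: "q t \<bullet> f (t \<cdot>\<^sub>v y) = (\<Sum>s\<in>?I1. ?\<alpha>1 s * t ^ ?e1 s)" for t
  proof -
    have "q t \<bullet> f (t \<cdot>\<^sub>v y) = (\<Sum>(i, p)\<in>?I1. (real i / 2 * t ^ (i - 1) * (1 * t ^ p)) * (?u i \<bullet> (?F p *\<^sub>v xpow p y)))"
      unfolding qr fr by (rule vec_sum_scalar_vec_sum) (use rF rW in \<open>auto simp del: fun_upd_apply\<close>)
    also have "\<dots> = (\<Sum>s\<in>?I1. ?\<alpha>1 s * t ^ ?e1 s)"
      by (intro sum.cong refl) (simp only: case_prod_unfold power_add mult_1_left mult_ac)
    finally show ?thesis .
  qed
  have s3: "h (t \<cdot>\<^sub>v y) \<bullet> h (t \<cdot>\<^sub>v y) = (\<Sum>s\<in>?I3. ?\<alpha>3 s * t ^ ?e3 s)" for t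
  proof -
    have "h (t \<cdot>\<^sub>v y) \<bullet> h (t \<cdot>\<^sub>v y) = (\<Sum>(p, q)\<in>?I3. (1 * t ^ p * (1 * t ^ q)) * ((?H p *\<^sub>v xpow p y) \<bullet> (?H q *\<^sub>v xpow q y)))"
      unfolding hr by (rule vec_sum_scalar_vec_sum) (use rH in \<open>auto simp del: fun_upd_apply\<close>)
    also have "\<dots> = (\<Sum>s\<in>?I3. ?\<alpha>3 s * t ^ ?e3 s)"
      by (intro sum.cong refl) (auto simp: power_add)
    finally show ?thesis .
  qed
  let ?\<beta> = "\<lambda>a (i, p). real i / 2 * gain m ?G W y p i a"
  have qg: "q t \<bullet> (g (t \<cdot>\<^sub>v y) *\<^sub>v unit_vec m a) = (\<Sum>s\<in>?J. ?\<beta> a s * t ^ ?e1 s)" if a: "a < m" for t a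
  proof -
    have "q t \<bullet> (g (t \<cdot>\<^sub>v y) *\<^sub>v unit_vec m a) = (\<Sum>(i, p)\<in>?J. (real i / 2 * t ^ (i - 1) * (1 * t ^ p))
        * (?u i \<bullet> (?G p *\<^sub>v kron_vec (xpow p y) (unit_vec m a))))"
      unfolding qr gr[OF a] by (rule vec_sum_scalar_vec_sum) (use rG rW in \<open>auto simp del: fun_upd_apply\<close>)
    also have "\<dots> = (\<Sum>s\<in>?J. ?\<beta> a s * t ^ ?e1 s)"
    proof (intro sum.cong refl)
      fix s assume s: "s \<in> ?J"
      obtain i p where ip: "s = (i, p)" by fastforce
      have "?u i \<bullet> (?G p *\<^sub>v kron_vec (xpow p y) (unit_vec m a)) = gain m ?G W y p i a"
        unfolding gain_def using s ip rG rW by (intro scalar_prod_comm_real) (auto simp del: fun_upd_apply)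
      then show "(case s of (i, p) \<Rightarrow> (real i / 2 * t ^ (i - 1) * (1 * t ^ p))
          * (?u i \<bullet> (?G p *\<^sub>v kron_vec (xpow p y) (unit_vec m a)))) = ?\<beta> a s * t ^ ?e1 s"
        by (simp add: ip power_add)
    qed
    finally show ?thesis .
  qed
  have s2: "(\<Sum>a<m. (q t \<bullet> (g (t \<cdot>\<^sub>v y) *\<^sub>v unit_vec m a))\<^sup>2) = (\<Sum>s\<in>?J \<times> ?J. ?\<alpha>2 s * t ^ ?e2 s)" for t
  proof -
    have "(\<Sum>a<m. (q t \<bullet> (g (t \<cdot>\<^sub>v y) *\<^sub>v unit_vec m a))\<^sup>2)
        = (\<Sum>a<m. \<Sum>(s, s')\<in>?J \<times> ?J. (?\<beta> a s * t ^ ?e1 s) * (?\<beta> a s' * t ^ ?e1 s'))"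
      by (intro sum.cong refl) (simp add: qg power2_eq_square sum_product sum.cartesian_product)
    \<comment> \<open>The sum over the inputs is moved inside, where it forms the sums of products
      of gains that also evaluate \<open>rhs_g_mat\<close>.\<close>
    also have "\<dots> = (\<Sum>(s, s')\<in>?J \<times> ?J. \<Sum>a<m. (?\<beta> a s * t ^ ?e1 s) * (?\<beta> a s' * t ^ ?e1 s'))"
      by (subst sum.swap) (simp add: case_prod_unfold)
    also have "\<dots> = (\<Sum>s\<in>?J \<times> ?J. ?\<alpha>2 s * t ^ ?e2 s)"
    proof (intro sum.cong refl)
      fix z assume "z \<in> ?J \<times> ?J"
      obtain i p j q where z: "z = ((i, p), (j, q))" by (metis surj_pair)
      have "(\<Sum>a<m. (?\<beta> a (i, p) * t ^ ?e1 (i, p)) * (?\<beta> a (j, q) * t ^ ?e1 (j, q)))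
          = (\<Sum>a<m. (real (i * j) / 4 * t ^ ?e2 z) * (gain m ?G W y p i a * gain m ?G W y q j a))"
        by (intro sum.cong refl) (simp add: z power_add)
      also have "\<dots> = ?\<alpha>2 z * t ^ ?e2 z"
        unfolding z sum_distrib_left[symmetric] by (simp only: prod.case mult_ac)
      finally show "(case z of (s, s') \<Rightarrow> \<Sum>a<m. (?\<beta> a s * t ^ ?e1 s) * (?\<beta> a s' * t ^ ?e1 s')) = ?\<alpha>2 z * t ^ ?e2 z"
        unfolding z by simp
    qed
    finally show ?thesis .
  qed
  let ?c1 = "\<lambda>k. \<Sum>s\<in>{s \<in> ?I1. ?e1 s = k}. ?\<alpha>1 s" and ?c2 = "\<lambda>k. \<Sum>s\<in>{s \<in> ?J \<times> ?J. ?e2 s = k}. ?\<alpha>2 s"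
    and ?c3 = "\<lambda>k. \<Sum>s\<in>{s \<in> ?I3. ?e3 s = k}. ?\<alpha>3 s"
  have g1: "(\<Sum>s\<in>?I1. ?\<alpha>1 s * t ^ ?e1 s) = (\<Sum>k\<le>N. ?c1 k * t ^ k)" for t
    by (rule sum_group_degree) (auto simp: N_def)
  have g2: "(\<Sum>s\<in>?J \<times> ?J. ?\<alpha>2 s * t ^ ?e2 s) = (\<Sum>k\<le>N. ?c2 k * t ^ k)" for t
    by (rule sum_group_degree) (auto simp: N_def)
  have g3: "(\<Sum>s\<in>?I3. ?\<alpha>3 s * t ^ ?e3 s) = (\<Sum>k\<le>N. ?c3 k * t ^ k)" for t
    by (rule sum_group_degree) (auto simp: N_def)
  have "(\<lambda>t. \<Sum>k\<le>N. (?c1 k - \<eta> / 2 * ?c2 k + 1 / 2 * ?c3 k) * t ^ k) \<in> O[at_right 0](\<lambda>t. t ^ Suc d)"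
  proof -
    have linear: "(\<Sum>k\<le>N. (a k - e * b k + e' * c k) * t ^ k)
        = (\<Sum>k\<le>N. a k * t ^ k) - e * (\<Sum>k\<le>N. b k * t ^ k) + e' * (\<Sum>k\<le>N. c k * t ^ k)"
      for a b c :: "nat \<Rightarrow> real" and e e' t :: real
      by (simp add: sum_distrib_left sum.distrib sum_subtractf ring_distribs mult.assoc)
    have "(\<Sum>k\<le>N. (?c1 k - \<eta> / 2 * ?c2 k + 1 / 2 * ?c3 k) * t ^ k)
        = q t \<bullet> f (t \<cdot>\<^sub>v y) - \<eta> / 2 * (\<Sum>a<m. (q t \<bullet> (g (t \<cdot>\<^sub>v y) *\<^sub>v unit_vec m a))\<^sup>2)
          + 1/2 * (h (t \<cdot>\<^sub>v y) \<bullet> h (t \<cdot>\<^sub>v y))" for t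
      unfolding s1 s2 s3 g1 g2 g3 by (rule linear)
    then show ?thesis
      using HJB_residual[OF f g h dims \<rho> HJB d exp W y] unfolding q_def by simp
  qed
  then have "?c1 k - \<eta> / 2 * ?c2 k + 1 / 2 * ?c3 k = 0"
    by (rule polynomial_coeff_zero) (use k in \<open>auto simp: N_def\<close>)
  moreover have "{s \<in> ?I1. ?e1 s = k} = {(i, p). 2 \<le> i \<and> 1 \<le> p \<and> i + p = k + 1}"
    using k by (auto simp: L_def)
  moreover have "{s \<in> ?J \<times> ?J. ?e2 s = k} = {((i, p), (j, q)). 2 \<le> i \<and> 2 \<le> j \<and> i + j + (p + q) = k + 2}"
    using k by (auto simp: L_def)
  moreover have "{s \<in> ?I3. ?e3 s = k} = {(p, q). 1 \<le> p \<and> 1 \<le> q \<and> p + q = k}"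
    using k by (auto simp: L_def)
  ultimately show ?thesis by (simp only:)
qed

section \<open>The Riccati equation as the coefficient of degree two\<close>

lemma mat_entry_scalar_prod:
  fixes M :: "real mat"
  assumes "M \<in> carrier_mat n m" "i < n" "j < m"
  shows "unit_vec n i \<bullet> (M *\<^sub>v unit_vec m j) = M $$ (i, j)"
proof -
  have "unit_vec n i \<bullet> (M *\<^sub>v unit_vec m j) = (M *\<^sub>v unit_vec m j) $ i"
    using assms by (intro scalar_prod_left_unit mult_mat_vec_carrier) auto
  also have "\<dots> = row M i \<bullet> unit_vec m j" using assms by simp
  also have "\<dots> = M $$ (i, j)" using assms by (subst scalar_prod_right_unit[of _ m]) auto
  finally show ?thesis .
qed

lemma mat_eqI_scalar_prod:
  fixes M N :: "real mat"
  assumes "M \<in> carrier_mat n m" "N \<in> carrier_mat n m"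
    and "\<And>x y. x \<in> carrier_vec n \<Longrightarrow> y \<in> carrier_vec m \<Longrightarrow> x \<bullet> (M *\<^sub>v y) = x \<bullet> (N *\<^sub>v y)"
  shows "M = N"
proof (rule eq_matI)
  fix i j assume "i < dim_row N" "j < dim_col N"
  then have ij: "i < n" "j < m" using assms by auto
  show "M $$ (i, j) = N $$ (i, j)"
    using assms(3)[of "unit_vec n i" "unit_vec m j"] mat_entry_scalar_prod[OF assms(1) ij]
      mat_entry_scalar_prod[OF assms(2) ij] by simp
qed (use assms in auto)

lemma symmetric_coeff_2_matrix:
  assumes w: "symmetric_coeff n 2 (vec_of_mat W)" and W: "W \<in> carrier_mat n n"
  shows "symmetric_matrix W"
  unfolding symmetric_matrix_def
proof (rule mat_eqI_scalar_prod[of _ n n])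
  fix x y :: "real vec" assume x: "x \<in> carrier_vec n" and y: "y \<in> carrier_vec n"
  have "x \<bullet> (W\<^sup>T *\<^sub>v y) = y \<bullet> (W *\<^sub>v x)"
    using transpose_mult_scalar_prod[OF W, of y x] x y W by (simp add: scalar_prod_comm_real)
  also have "\<dots> = x \<bullet> (W *\<^sub>v y)"
    using symmetric_coeff_2[OF w x y] x y W by (simp add: vec_of_mat_scalar_kron_vec)
  finally show "x \<bullet> (W\<^sup>T *\<^sub>v y) = x \<bullet> (W *\<^sub>v y)" .
qed (use W in auto)

text \<open>Polarization.\<close>

lemma symmetric_quadratic_form_zero:
  fixes Q :: "real mat"
  assumes Q: "Q \<in> carrier_mat n n" "Q\<^sup>T = Q" and zero: "\<And>x. x \<in> carrier_vec n \<Longrightarrow> x \<bullet> (Q *\<^sub>v x) = 0"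
  shows "Q = 0\<^sub>m n n"
proof (rule mat_eqI_scalar_prod[OF Q(1)])
  fix x y :: "real vec" assume x: "x \<in> carrier_vec n" and y: "y \<in> carrier_vec n"
  have Qx: "Q *\<^sub>v x \<in> carrier_vec n" "Q *\<^sub>v y \<in> carrier_vec n" using Q x y by auto
  have "y \<bullet> (Q *\<^sub>v x) = x \<bullet> (Q *\<^sub>v y)"
    using transpose_mult_scalar_prod[OF Q(1), of y x] x y Q Qx by (simp add: scalar_prod_comm_real)
  moreover have "(x + y) \<bullet> (Q *\<^sub>v (x + y)) = x \<bullet> (Q *\<^sub>v x) + x \<bullet> (Q *\<^sub>v y) + (y \<bullet> (Q *\<^sub>v x) + y \<bullet> (Q *\<^sub>v y))"
    using x y Qx Q(1)
    by (simp add: mult_add_distrib_mat_vec[OF Q(1) x y] add_scalar_prod_distrib[of _ n] scalar_prod_add_distrib[of _ n])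
  ultimately have "x \<bullet> (Q *\<^sub>v y) = 0" using zero[of "x + y"] zero[OF x] zero[OF y] x y by simp
  moreover have "0\<^sub>m n n *\<^sub>v y = 0\<^sub>v n" using y by (intro eq_vecI) (auto simp: scalar_prod_lessThan)
  ultimately show "x \<bullet> (Q *\<^sub>v y) = x \<bullet> (0\<^sub>m n n *\<^sub>v y)" using x by simp
qed simp

lemma smult_mat_mult_vec:
  fixes M :: "real mat"
  assumes "M \<in> carrier_mat n m" "y \<in> carrier_vec m"
  shows "(c \<cdot>\<^sub>m M) *\<^sub>v y = c \<cdot>\<^sub>v (M *\<^sub>v y)"
  by (rule eq_vecI) (use assms in \<open>auto simp: scalar_prod_lessThan sum_distrib_left mult.assoc intro!: sum.cong\<close>)

text \<open>The weak form of the Riccati expression. Symmetry of \<open>X\<close> turns every term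
  into an inner product, and later uses of the equation take place there rather than among matrix
  products.\<close>

lemma ARE_bilinear:
  fixes A B C X :: "real mat" and x y :: "real vec" and \<eta> :: real
  assumes A: "A \<in> carrier_mat n n" and B: "B \<in> carrier_mat n m" and C: "C \<in> carrier_mat r n"
    and X: "X \<in> carrier_mat n n" "X\<^sup>T = X" and x: "x \<in> carrier_vec n" and y: "y \<in> carrier_vec n"
  shows "x \<bullet> ((A\<^sup>T * X + X * A + C\<^sup>T * C - \<eta> \<cdot>\<^sub>m (X * B * B\<^sup>T * X)) *\<^sub>v y)
    = (A *\<^sub>v x) \<bullet> (X *\<^sub>v y) + (X *\<^sub>v x) \<bullet> (A *\<^sub>v y) + (C *\<^sub>v x) \<bullet> (C *\<^sub>v y)
      - \<eta> * ((B\<^sup>T *\<^sub>v (X *\<^sub>v x)) \<bullet> (B\<^sup>T *\<^sub>v (X *\<^sub>v y)))"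
proof -
  have c: "A\<^sup>T \<in> carrier_mat n n" "C\<^sup>T \<in> carrier_mat n r" "B\<^sup>T \<in> carrier_mat m n" using A B C by auto
  have t: "x \<bullet> (M\<^sup>T *\<^sub>v v) = (M *\<^sub>v x) \<bullet> v" if "M \<in> carrier_mat a n" "v \<in> carrier_vec a" for M :: "real mat" and v a
    using transpose_mult_scalar_prod[OF that(1), of v x] that x by (simp add: scalar_prod_comm_real)
  have 1: "x \<bullet> ((A\<^sup>T * X) *\<^sub>v y) = (A *\<^sub>v x) \<bullet> (X *\<^sub>v y)"
    using assoc_mult_mat_vec[OF c(1) X(1) y] t[OF A, of "X *\<^sub>v y"] X y by simp
  have 2: "x \<bullet> ((X * A) *\<^sub>v y) = (X *\<^sub>v x) \<bullet> (A *\<^sub>v y)"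
    using assoc_mult_mat_vec[OF X(1) A y] t[OF X(1), of "A *\<^sub>v y"] X A y by simp
  have 3: "x \<bullet> ((C\<^sup>T * C) *\<^sub>v y) = (C *\<^sub>v x) \<bullet> (C *\<^sub>v y)"
    using assoc_mult_mat_vec[OF c(2) C y] t[OF C, of "C *\<^sub>v y"] C y by simp
  have 4: "x \<bullet> ((X * B * B\<^sup>T * X) *\<^sub>v y) = (B\<^sup>T *\<^sub>v (X *\<^sub>v x)) \<bullet> (B\<^sup>T *\<^sub>v (X *\<^sub>v y))"
  proof -
    have cXB: "X * B \<in> carrier_mat n m" using X B by auto
    have cXBB: "X * B * B\<^sup>T \<in> carrier_mat n n" using cXB c by auto
    have Xy: "X *\<^sub>v y \<in> carrier_vec n" using X y by auto
    have BXy: "B\<^sup>T *\<^sub>v (X *\<^sub>v y) \<in> carrier_vec m" using c Xy by auto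
    have "(X * B * B\<^sup>T * X) *\<^sub>v y = X *\<^sub>v (B *\<^sub>v (B\<^sup>T *\<^sub>v (X *\<^sub>v y)))"
      by (simp only: assoc_mult_mat_vec[OF cXBB X(1) y] assoc_mult_mat_vec[OF cXB c(3) Xy]
          assoc_mult_mat_vec[OF X(1) B BXy])
    moreover have "x \<bullet> (X *\<^sub>v (B *\<^sub>v (B\<^sup>T *\<^sub>v (X *\<^sub>v y)))) = (X *\<^sub>v x) \<bullet> (B *\<^sub>v (B\<^sup>T *\<^sub>v (X *\<^sub>v y)))"
      using t[OF X(1), of "B *\<^sub>v (B\<^sup>T *\<^sub>v (X *\<^sub>v y))"] X B BXy by simp
    moreover have "(B\<^sup>T *\<^sub>v (X *\<^sub>v x)) \<bullet> (B\<^sup>T *\<^sub>v (X *\<^sub>v y)) = (X *\<^sub>v x) \<bullet> (B *\<^sub>v (B\<^sup>T *\<^sub>v (X *\<^sub>v y)))"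
      by (rule transpose_mult_scalar_prod[OF B]) (use X B in auto)
    ultimately show ?thesis by simp
  qed
  have d: "A\<^sup>T * X \<in> carrier_mat n n" "X * A \<in> carrier_mat n n" "C\<^sup>T * C \<in> carrier_mat n n"
    "X * B * B\<^sup>T * X \<in> carrier_mat n n"
    using A B C X by auto
  have "(A\<^sup>T * X + X * A + C\<^sup>T * C - \<eta> \<cdot>\<^sub>m (X * B * B\<^sup>T * X)) *\<^sub>v y
      = (A\<^sup>T * X) *\<^sub>v y + (X * A) *\<^sub>v y + (C\<^sup>T * C) *\<^sub>v y - \<eta> \<cdot>\<^sub>v ((X * B * B\<^sup>T * X) *\<^sub>v y)"
  proof -
    have "(\<eta> \<cdot>\<^sub>m (X * B * B\<^sup>T * X)) *\<^sub>v y = \<eta> \<cdot>\<^sub>v ((X * B * B\<^sup>T * X) *\<^sub>v y)"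
      using d(4) y by (rule smult_mat_mult_vec)
    moreover have "A\<^sup>T * X + X * A + C\<^sup>T * C \<in> carrier_mat n n" "A\<^sup>T * X + X * A \<in> carrier_mat n n"
      "\<eta> \<cdot>\<^sub>m (X * B * B\<^sup>T * X) \<in> carrier_mat n n"
      using d by auto
    ultimately show ?thesis
      using d y by (simp only: minus_mult_distrib_mat_vec[of _ n n] add_mult_distrib_mat_vec[of _ n n])
  qed
  also have "x \<bullet> \<dots> = x \<bullet> ((A\<^sup>T * X) *\<^sub>v y) + x \<bullet> ((X * A) *\<^sub>v y) + x \<bullet> ((C\<^sup>T * C) *\<^sub>v y)
      - \<eta> * (x \<bullet> ((X * B * B\<^sup>T * X) *\<^sub>v y))"
  proof -
    have v: "(A\<^sup>T * X) *\<^sub>v y \<in> carrier_vec n" "(X * A) *\<^sub>v y \<in> carrier_vec n" "(C\<^sup>T * C) *\<^sub>v y \<in> carrier_vec n"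
      "(X * B * B\<^sup>T * X) *\<^sub>v y \<in> carrier_vec n"
      by (rule mult_mat_vec_carrier[OF d(1) y] mult_mat_vec_carrier[OF d(2) y]
          mult_mat_vec_carrier[OF d(3) y] mult_mat_vec_carrier[OF d(4) y])+
    show ?thesis using x v
      by (simp only: scalar_prod_minus_distrib[of x n] scalar_prod_add_distrib[of x n]
          scalar_prod_smult_distrib[of x n] add_carrier_vec smult_carrier_vec)
  qed
  finally show ?thesis unfolding 1 2 3 4 .
qed

lemma hinf_ARE_carrier_eq:
  assumes "hinf_ARE n \<eta> A B C X" "A \<in> carrier_mat n n" "B \<in> carrier_mat n m" "C \<in> carrier_mat r n"
    "X \<in> carrier_mat n n" "X\<^sup>T = X" "x \<in> carrier_vec n" "y \<in> carrier_vec n"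
  shows "(A *\<^sub>v x) \<bullet> (X *\<^sub>v y) + (X *\<^sub>v x) \<bullet> (A *\<^sub>v y) + (C *\<^sub>v x) \<bullet> (C *\<^sub>v y)
      = \<eta> * ((B\<^sup>T *\<^sub>v (X *\<^sub>v x)) \<bullet> (B\<^sup>T *\<^sub>v (X *\<^sub>v y)))"
proof -
  have "0\<^sub>m n n *\<^sub>v y = 0\<^sub>v n" using assms(8) by (intro eq_vecI) (auto simp: scalar_prod_lessThan)
  then show ?thesis
    using ARE_bilinear[OF assms(2-8), of \<eta>] assms(1,7) unfolding hinf_ARE_def by simp
qed

lemma hinf_ARE_of_HJB:
  assumes f: "f = poly_f n l A F" and g: "g = poly_g n m l B G" and h: "h = poly_h r l C H"
    and dims: "system_dims n m r l A B C F G H" and \<rho>: "\<rho> > 0"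
    and HJB: "\<forall>x\<in>ball0 n \<rho>. HJB n \<eta> f g h E x" and d: "d \<ge> 2"
    and exp: "degree_d_expansion n d E w"
    and W: "\<forall>i\<in>{2..d}. W i \<in> carrier_mat n (n ^ (i - 1)) \<and> w i = vec_of_mat (W i)"
  shows "W 2 \<in> carrier_mat n n" "symmetric_matrix (W 2)" "hinf_ARE n \<eta> A B C (W 2)"
proof -
  have A: "A \<in> carrier_mat n n" and B: "B \<in> carrier_mat n m" and C: "C \<in> carrier_mat r n"
    using dims unfolding system_dims_def by auto
  have W2: "W 2 \<in> carrier_mat n n" "w 2 = vec_of_mat (W 2)" using bspec[OF W, of 2] d by auto
  have "symmetric_coeff n 2 (w 2)"
    using exp d unfolding degree_d_expansion_def is_symmetrization_def by auto
  then have sym: "symmetric_matrix (W 2)" using W2 symmetric_coeff_2_matrix by simp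
  then have symT: "(W 2)\<^sup>T = W 2" by (simp add: symmetric_matrix_def)
  let ?Q = "A\<^sup>T * W 2 + W 2 * A + C\<^sup>T * C - \<eta> \<cdot>\<^sub>m (W 2 * B * B\<^sup>T * W 2)"
  have cQ: "?Q \<in> carrier_mat n n" using A B C W2 by auto
  have "?Q = 0\<^sub>m n n"
  proof (rule symmetric_quadratic_form_zero[OF cQ])
    \<comment> \<open>The weak form is symmetric in x and y, and this carries over to
      \<open>?Q\<close>; polarization then asks only for diagonal values.\<close>
    show "?Q\<^sup>T = ?Q"
    proof (rule mat_eqI_scalar_prod[of _ n n])
      fix x y :: "real vec" assume x: "x \<in> carrier_vec n" and y: "y \<in> carrier_vec n"
      have "x \<bullet> (?Q\<^sup>T *\<^sub>v y) = y \<bullet> (?Q *\<^sub>v x)"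
        using transpose_mult_scalar_prod[OF cQ, of y x] x y cQ
        by (subst scalar_prod_comm_real) (auto simp del: index_minus_mat)
      also have "\<dots> = x \<bullet> (?Q *\<^sub>v y)"
        unfolding ARE_bilinear[OF A B C W2(1) symT y x] ARE_bilinear[OF A B C W2(1) symT x y]
        using A B C W2(1) x y by (simp add: scalar_prod_comm_real)
      finally show "x \<bullet> (?Q\<^sup>T *\<^sub>v y) = x \<bullet> (?Q *\<^sub>v y)" .
    qed (use cQ in auto)
    fix y :: "real vec" assume y: "y \<in> carrier_vec n"
    have i1: "{(i, p). 2 \<le> i \<and> 1 \<le> p \<and> i + p = 2 + 1} = {(2::nat, 1::nat)}" by auto
    have i2: "{((i, p), (j, q)). 2 \<le> i \<and> 2 \<le> j \<and> i + j + (p + q) = 2 + 2} = {((2::nat, 0::nat), (2::nat, 0::nat))}"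
      by auto
    have i3: "{(p, q). 1 \<le> p \<and> 1 \<le> q \<and> p + q = 2} = {(1::nat, 1::nat)}" by auto
    \<comment> \<open>In degree two each sum has one term, and the identity is half of the quadratic
      form of \<open>?Q\<close> at y.\<close>
    have "(W 2 *\<^sub>v y) \<bullet> (A *\<^sub>v y)
        - \<eta> / 2 * (\<Sum>a<m. gain m (G(0 := B)) W y 0 2 a * gain m (G(0 := B)) W y 0 2 a)
        + 1 / 2 * ((C *\<^sub>v y) \<bullet> (C *\<^sub>v y)) = 0"
      using HJB_coefficients[OF f g h dims \<rho> HJB d exp W y d, unfolded i1 i2 i3] by simp
    moreover have "(\<Sum>a<m. gain m (G(0 := B)) W y 0 2 a * gain m (G(0 := B)) W y 0 2 a)
        = (B\<^sup>T *\<^sub>v (W 2 *\<^sub>v y)) \<bullet> (B\<^sup>T *\<^sub>v (W 2 *\<^sub>v y))"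
      using sum_gain_0[of B n m W 2 2 y G] B W2 y by simp
    moreover have "(A *\<^sub>v y) \<bullet> (W 2 *\<^sub>v y) = (W 2 *\<^sub>v y) \<bullet> (A *\<^sub>v y)"
      using A W2 by (intro scalar_prod_comm_real) auto
    ultimately show "y \<bullet> (?Q *\<^sub>v y) = 0"
      unfolding ARE_bilinear[OF A B C W2(1) symT y y] by simp
  qed
  then show "W 2 \<in> carrier_mat n n" "symmetric_matrix (W 2)" "hinf_ARE n \<eta> A B C (W 2)"
    using W2 sym unfolding hinf_ARE_def by simp_all
qed

section \<open>The coefficient systems from degree three on\<close>

lemma rhs_f_xpow:
  assumes F: "\<And>p. p \<ge> 2 \<Longrightarrow> F p \<in> carrier_mat n (n ^ p)" and y: "y \<in> carrier_vec n"
    and W: "\<And>i. i \<in> {2..k} \<Longrightarrow> W i \<in> carrier_mat n (n ^ (i - 1)) \<and> w i = vec_of_mat (W i) \<and> symmetric_coeff n i (w i)"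
  shows "rhs_f n F w k \<bullet> xpow k y = (\<Sum>(i, p)\<in>{(i, p). 2 \<le> i \<and> 2 \<le> p \<and> i + p = k + 1}.
    real i * ((F p *\<^sub>v xpow p y) \<bullet> (W i *\<^sub>v xpow (i - 1) y)))"
proof -
  have "rhs_f n F w k \<bullet> xpow k y = (\<Sum>s\<in>{(i, p). 2 \<le> i \<and> 2 \<le> p \<and> i + p = k + 1}.
      (\<lambda>(i, p). (lyap i (F p))\<^sup>T *\<^sub>v w i) s \<bullet> xpow k y)"
    unfolding rhs_f_def using y by (intro vec_sum_scalar_left) auto
  also have "\<dots> = (\<Sum>(i, p)\<in>{(i, p). 2 \<le> i \<and> 2 \<le> p \<and> i + p = k + 1}.
    real i * ((F p *\<^sub>v xpow p y) \<bullet> (W i *\<^sub>v xpow (i - 1) y)))"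
  proof (intro sum.cong refl)
    fix s :: "nat \<times> nat" assume s: "s \<in> {(i, p). 2 \<le> i \<and> 2 \<le> p \<and> i + p = k + 1}"
    obtain i p where ip: "s = (i, p)" by fastforce
    then have i: "2 \<le> i" "2 \<le> p" "i + p = k + 1" "i \<in> {2..k}" using s by auto
    have "((lyap i (F p))\<^sup>T *\<^sub>v vec_of_mat (W i)) \<bullet> xpow k y
        = real i * ((F p *\<^sub>v xpow p y) \<bullet> (W i *\<^sub>v xpow (i - 1) y))"
      using W[OF i(4)] i by (intro lyap_transpose_scalar_xpow[OF F y]) auto
    then show "(\<lambda>(i, p). (lyap i (F p))\<^sup>T *\<^sub>v w i) s \<bullet> xpow k y
        = (case s of (i, p) \<Rightarrow> real i * ((F p *\<^sub>v xpow p y) \<bullet> (W i *\<^sub>v xpow (i - 1) y)))"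
      using W[OF i(4)] by (simp add: ip)
  qed
  finally show ?thesis .
qed

lemma rhs_b_xpow:
  assumes B: "B \<in> carrier_mat n m" and y: "y \<in> carrier_vec n"
    and W: "\<And>i. i \<in> {2..k} \<Longrightarrow> W i \<in> carrier_mat n (n ^ (i - 1))"
  shows "rhs_b n B W k \<bullet> xpow k y = (\<Sum>(i, j)\<in>{(i, j). 2 < i \<and> 2 < j \<and> i + j = k + 2}.
    real (i * j) * (\<Sum>a<m. gain m (G(0 := B)) W y 0 i a * gain m (G(0 := B)) W y 0 j a))"
proof -
  have "rhs_b n B W k \<bullet> xpow k y = (\<Sum>s\<in>{(i, j). 2 < i \<and> 2 < j \<and> i + j = k + 2}.
      (\<lambda>(i, j). real (i * j) \<cdot>\<^sub>v vec_of_mat ((W i)\<^sup>T * B * B\<^sup>T * W j)) s \<bullet> xpow k y)"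
    unfolding rhs_b_def using y by (intro vec_sum_scalar_left) auto
  also have "\<dots> = (\<Sum>(i, j)\<in>{(i, j). 2 < i \<and> 2 < j \<and> i + j = k + 2}.
    real (i * j) * (\<Sum>a<m. gain m (G(0 := B)) W y 0 i a * gain m (G(0 := B)) W y 0 j a))"
  proof (intro sum.cong refl)
    fix s :: "nat \<times> nat" assume s: "s \<in> {(i, j). 2 < i \<and> 2 < j \<and> i + j = k + 2}"
    obtain i j where ij: "s = (i, j)" by fastforce
    then have i: "2 < i" "2 < j" "i + j = k + 2" "i \<in> {2..k}" "j \<in> {2..k}" using s by auto
    let ?v = "vec_of_mat ((W i)\<^sup>T * B * B\<^sup>T * W j)"
    have "k = (j - 1) + (i - 1)" using i by simp
    then have "dim_vec ?v = dim_vec (xpow k y)"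
      using W[OF i(4)] W[OF i(5)] y by (simp add: power_add mult.commute)
    then have "(real (i * j) \<cdot>\<^sub>v ?v) \<bullet> xpow k y = real (i * j) * (?v \<bullet> xpow k y)"
      by (rule scalar_prod_smult_left)
    then show "(\<lambda>(i, j). real (i * j) \<cdot>\<^sub>v vec_of_mat ((W i)\<^sup>T * B * B\<^sup>T * W j)) s \<bullet> xpow k y
        = (case s of (i, j) \<Rightarrow> real (i * j) * (\<Sum>a<m. gain m (G(0 := B)) W y 0 i a * gain m (G(0 := B)) W y 0 j a))"
      using vec_of_mat_rhs_b_xpow[OF B W[OF i(4)] W[OF i(5)] y _ _ i(3), of G] i by (simp add: ij)
  qed
  finally show ?thesis .
qed

lemma rhs_h_xpow:
  assumes H: "\<And>p. p \<ge> 1 \<Longrightarrow> H p \<in> carrier_mat r (n ^ p)" and y: "y \<in> carrier_vec n"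
  shows "rhs_h n H k \<bullet> xpow k y = (\<Sum>(p, q)\<in>{(p, q). 1 \<le> p \<and> 1 \<le> q \<and> p + q = k}.
    (H p *\<^sub>v xpow p y) \<bullet> (H q *\<^sub>v xpow q y))"
proof -
  have "rhs_h n H k \<bullet> xpow k y = (\<Sum>s\<in>{(p, q). 1 \<le> p \<and> 1 \<le> q \<and> p + q = k}.
      (\<lambda>(p, q). vec_of_mat ((H p)\<^sup>T * H q)) s \<bullet> xpow k y)"
    unfolding rhs_h_def using y by (intro vec_sum_scalar_left) auto
  also have "\<dots> = (\<Sum>(p, q)\<in>{(p, q). 1 \<le> p \<and> 1 \<le> q \<and> p + q = k}.
    (H p *\<^sub>v xpow p y) \<bullet> (H q *\<^sub>v xpow q y))"
  proof (intro sum.cong refl)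
    fix s :: "nat \<times> nat" assume s: "s \<in> {(p, q). 1 \<le> p \<and> 1 \<le> q \<and> p + q = k}"
    obtain p q where pq: "s = (p, q)" by fastforce
    then have i: "1 \<le> p" "1 \<le> q" "k = q + p" using s by auto
    show "(\<lambda>(p, q). vec_of_mat ((H p)\<^sup>T * H q)) s \<bullet> xpow k y
        = (case s of (p, q) \<Rightarrow> (H p *\<^sub>v xpow p y) \<bullet> (H q *\<^sub>v xpow q y))"
      unfolding pq i(3) prod.case by (rule vec_of_mat_product_xpow[OF H H y]) (use i in auto)
  qed
  finally show ?thesis .
qed

lemma gain_eq_zero:
  assumes "G p = 0\<^sub>m n N" "x \<in> carrier_vec n" "N = m * n ^ p" "dim_row (W i) = n"
  shows "gain m G W x p i a = 0"
proof -
  have "0\<^sub>m n N *\<^sub>v kron_vec (xpow p x) (unit_vec m a) = 0\<^sub>v n"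
    using assms(2,3) by (intro eq_vecI) (auto simp: scalar_prod_lessThan mult.commute)
  then show ?thesis using assms(1,4) by (simp add: gain_def carrier_vecI)
qed

text \<open>The nested sums are flattened to one over (i, p) and (j, q). Beyond p + q = 2 l one of
  p, q exceeds l and its gain vanishes, so the result matches the set of indices that the
  Hamilton-Jacobi-Bellman equation produces.\<close>

lemma rhs_g_xpow:
  assumes G: "\<And>p. G p \<in> carrier_mat n (m * n ^ p)" and G0: "\<And>p. p > l \<Longrightarrow> G p = 0\<^sub>m n (m * n ^ p)"
    and y: "y \<in> carrier_vec n"
    and W: "\<And>i. i \<in> {2..k} \<Longrightarrow> W i \<in> carrier_mat n (n ^ (i - 1))"
  shows "rhs_g n m l G W k \<bullet> xpow k y
    = (\<Sum>((i, p), (j, q))\<in>{((i, p), (j, q)). 2 \<le> i \<and> 2 \<le> j \<and> 1 \<le> p + q \<and> i + j + (p + q) = k + 2}.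
        real (i * j) * (\<Sum>a<m. gain m G W y p i a * gain m G W y q j a))"
proof -
  let ?T = "\<lambda>p q i j. real (i * j) * (\<Sum>a<m. gain m G W y p i a * gain m G W y q j a)"
  let ?P = "\<lambda>s. {(p, q). p + q = s}" and ?I = "\<lambda>s. {(i, j). 2 \<le> i \<and> 2 \<le> j \<and> i + j + s = k + 2}"
  have dy: "dim_vec (xpow k y) = n ^ k" using y by simp
  have P: "finite (?P s)" for s :: nat by (rule finite_subset[of _ "{..s} \<times> {..s}"]) auto
  have I: "finite (?I s)" for s by (rule finite_subset[of _ "{..k + 2} \<times> {..k + 2}"]) auto
  have T: "(real (i * j) \<cdot>\<^sub>v vec_of_mat (rhs_g_mat n m G W k p q i j)) \<bullet> xpow k y = ?T p q i j"
    if "2 \<le> i" "2 \<le> j" "i + j + (p + q) = k + 2" for i j p q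
  proof -
    have i: "i \<in> {2..k}" "j \<in> {2..k}" "k = (k - p) + p" using that by auto
    have "dim_vec (vec_of_mat (rhs_g_mat n m G W k p q i j)) = n ^ p * n ^ (k - p)"
      by (simp add: rhs_g_mat_def)
    also have "\<dots> = n ^ k" using i(3) by (metis add.commute power_add)
    finally show ?thesis
      using vec_of_mat_rhs_g_mat[OF y G G W[OF i(1)] W[OF i(2)] _ _ that(3)] that dy by simp
  qed
  have "rhs_g n m l G W k \<bullet> xpow k y = (\<Sum>s\<in>{1..2 * l}. \<Sum>(p, q)\<in>?P s. \<Sum>(i, j)\<in>?I s.
      (real (i * j) \<cdot>\<^sub>v vec_of_mat (rhs_g_mat n m G W k p q i j)) \<bullet> xpow k y)"
    unfolding rhs_g_def using carrier_vecD[OF y] by (simp add: vec_sum_scalar_left case_prod_unfold)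
  also have "\<dots> = (\<Sum>s\<in>{1..2 * l}. \<Sum>(p, q)\<in>?P s. \<Sum>(i, j)\<in>?I s. ?T p q i j)"
    by (intro sum.cong refl) (use T in \<open>auto intro!: sum.cong\<close>)
  also have "\<dots> = (\<Sum>(s, (p, q), (i, j))\<in>Sigma {1..2 * l} (\<lambda>s. ?P s \<times> ?I s). ?T p q i j)"
  proof -
    have "(\<Sum>s\<in>{1..2 * l}. \<Sum>(p, q)\<in>?P s. \<Sum>(i, j)\<in>?I s. ?T p q i j)
        = (\<Sum>s\<in>{1..2 * l}. \<Sum>((p, q), (i, j))\<in>?P s \<times> ?I s. ?T p q i j)"
      by (intro sum.cong refl) (simp only: sum.cartesian_product case_prod_unfold)
    also have "\<dots> = (\<Sum>(s, (p, q), (i, j))\<in>Sigma {1..2 * l} (\<lambda>s. ?P s \<times> ?I s). ?T p q i j)"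
      using P I by (subst sum.Sigma) (auto simp: case_prod_unfold)
    finally show ?thesis .
  qed
  also have "\<dots> = (\<Sum>((i, p), (j, q))\<in>{((i, p), (j, q)). 2 \<le> i \<and> 2 \<le> j \<and> 1 \<le> p + q \<and> p + q \<le> 2 * l
      \<and> i + j + (p + q) = k + 2}. ?T p q i j)"
    by (rule sum.reindex_bij_witness[of _ "\<lambda>((i, p), (j, q)). (p + q, (p, q), (i, j))"
          "\<lambda>(s, (p, q), (i, j)). ((i, p), (j, q))"]) auto
  also have "\<dots> = (\<Sum>((i, p), (j, q))\<in>{((i, p), (j, q)). 2 \<le> i \<and> 2 \<le> j \<and> 1 \<le> p + q
      \<and> i + j + (p + q) = k + 2}. ?T p q i j)"
  proof (rule sum.mono_neutral_left)
    show "finite {((i, p), (j, q)). 2 \<le> i \<and> 2 \<le> j \<and> 1 \<le> p + q \<and> i + j + (p + q) = k + 2}"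
      by (rule finite_subset[of _ "({..k + 2} \<times> {..k + 2}) \<times> ({..k + 2} \<times> {..k + 2})"]) auto
    show "\<forall>z\<in>{((i, p), (j, q)). 2 \<le> i \<and> 2 \<le> j \<and> 1 \<le> p + q \<and> i + j + (p + q) = k + 2}
        - {((i, p), (j, q)). 2 \<le> i \<and> 2 \<le> j \<and> 1 \<le> p + q \<and> p + q \<le> 2 * l \<and> i + j + (p + q) = k + 2}.
        (\<lambda>((i, p), (j, q)). ?T p q i j) z = 0"
    proof
      fix z :: "(nat \<times> nat) \<times> (nat \<times> nat)"
      assume z: "z \<in> {((i, p), (j, q)). 2 \<le> i \<and> 2 \<le> j \<and> 1 \<le> p + q \<and> i + j + (p + q) = k + 2}
        - {((i, p), (j, q)). 2 \<le> i \<and> 2 \<le> j \<and> 1 \<le> p + q \<and> p + q \<le> 2 * l \<and> i + j + (p + q) = k + 2}"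
      obtain i p j q where zz: "z = ((i, p), (j, q))" by (metis surj_pair)
      have c: "i \<in> {2..k}" "j \<in> {2..k}" "p > l \<or> q > l" using z zz by auto
      have "dim_row (W i) = n" "dim_row (W j) = n" using W c by blast+
      then have "gain m G W y p i a = 0 \<or> gain m G W y q j a = 0" for a
        using c(3) gain_eq_zero[of G p n "m * n ^ p" y m W i a] gain_eq_zero[of G q n "m * n ^ q" y m W j a]
          G0[of p] G0[of q] y by auto
      then have "gain m G W y p i a * gain m G W y q j a = 0" for a by simp
      then show "(\<lambda>((i, p), (j, q)). ?T p q i j) z = 0" by (simp add: zz)
    qed
  qed auto
  finally show ?thesis .
qed

text \<open>The part with \<open>W 2\<close> is the cross term of \<open>w 2\<close> and
  \<open>w k\<close> in the quadratic part of the Hamilton-Jacobi-Bellman equation; having it on the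
  left side is why \<open>rhs_b\<close> runs over i, j > 2.\<close>

lemma lyap_closed_loop_xpow:
  assumes A: "A \<in> carrier_mat n n" and B: "B \<in> carrier_mat n m" and W2: "W 2 \<in> carrier_mat n n"
    and y: "y \<in> carrier_vec n" and k: "k \<ge> 1"
    and W: "W k \<in> carrier_mat n (n ^ (k - 1))" "symmetric_coeff n k (vec_of_mat (W k))"
  shows "((lyap k (A - \<eta> \<cdot>\<^sub>m (B * B\<^sup>T * W 2)))\<^sup>T *\<^sub>v vec_of_mat (W k)) \<bullet> xpow k y
    = real k * ((A *\<^sub>v y) \<bullet> (W k *\<^sub>v xpow (k - 1) y))
      - \<eta> * (real k * (\<Sum>a<m. gain m (G(0 := B)) W y 0 2 a * gain m (G(0 := B)) W y 0 k a))"
proof -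
  let ?M = "A - \<eta> \<cdot>\<^sub>m (B * B\<^sup>T * W 2)" and ?u = "W k *\<^sub>v xpow (k - 1) y"
  have cBB: "B * B\<^sup>T \<in> carrier_mat n n" and cBBW: "B * B\<^sup>T * W 2 \<in> carrier_mat n n" using B W2 by auto
  have M: "?M \<in> carrier_mat n (n ^ 1)" using minus_carrier_mat[OF smult_carrier_mat[OF cBBW]] by simp
  have u: "?u \<in> carrier_vec n" by (rule mult_mat_vec_carrier[OF W(1) xpow_carrier[OF y]])
  have Wy: "W 2 *\<^sub>v y \<in> carrier_vec n" using W2 y by auto
  have BWy: "B\<^sup>T *\<^sub>v (W 2 *\<^sub>v y) \<in> carrier_vec m" using B Wy by auto
  have "?M *\<^sub>v y = A *\<^sub>v y - \<eta> \<cdot>\<^sub>v ((B * B\<^sup>T * W 2) *\<^sub>v y)"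
    unfolding minus_mult_distrib_mat_vec[OF A smult_carrier_mat[OF cBBW] y] smult_mat_mult_vec[OF cBBW y] ..
  also have "(B * B\<^sup>T * W 2) *\<^sub>v y = B *\<^sub>v (B\<^sup>T *\<^sub>v (W 2 *\<^sub>v y))"
    unfolding assoc_mult_mat_vec[OF cBB W2 y] by (rule assoc_mult_mat_vec[OF B _ Wy]) (use B in simp)
  finally have My: "?M *\<^sub>v y = A *\<^sub>v y - \<eta> \<cdot>\<^sub>v (B *\<^sub>v (B\<^sup>T *\<^sub>v (W 2 *\<^sub>v y)))" .
  have v: "A *\<^sub>v y \<in> carrier_vec n" "B *\<^sub>v (B\<^sup>T *\<^sub>v (W 2 *\<^sub>v y)) \<in> carrier_vec n"
    by (rule mult_mat_vec_carrier[OF A y] mult_mat_vec_carrier[OF B BWy])+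
  have "(B *\<^sub>v (B\<^sup>T *\<^sub>v (W 2 *\<^sub>v y))) \<bullet> ?u = ?u \<bullet> (B *\<^sub>v (B\<^sup>T *\<^sub>v (W 2 *\<^sub>v y)))"
    by (rule scalar_prod_comm_real) (simp only: carrier_vecD[OF v(2)] carrier_vecD[OF u])
  also have "\<dots> = (B\<^sup>T *\<^sub>v ?u) \<bullet> (B\<^sup>T *\<^sub>v (W 2 *\<^sub>v y))"
    by (rule transpose_mult_scalar_prod[OF B carrier_vecD[OF u] carrier_vecD[OF BWy], symmetric])
  also have "\<dots> = (B\<^sup>T *\<^sub>v (W 2 *\<^sub>v y)) \<bullet> (B\<^sup>T *\<^sub>v ?u)"
    by (rule scalar_prod_comm_real) simp
  also have "\<dots> = (\<Sum>a<m. gain m (G(0 := B)) W y 0 2 a * gain m (G(0 := B)) W y 0 k a)"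
    using sum_gain_0[of B n m W 2 k y G] B W2 W(1) y by simp
  finally have BB: "(B *\<^sub>v (B\<^sup>T *\<^sub>v (W 2 *\<^sub>v y))) \<bullet> ?u
      = (\<Sum>a<m. gain m (G(0 := B)) W y 0 2 a * gain m (G(0 := B)) W y 0 k a)" .
  have "((lyap k ?M)\<^sup>T *\<^sub>v vec_of_mat (W k)) \<bullet> xpow k y = real k * ((?M *\<^sub>v xpow 1 y) \<bullet> ?u)"
    using k by (intro lyap_transpose_scalar_xpow[OF M y W]) auto
  also have "(?M *\<^sub>v xpow 1 y) \<bullet> ?u = (A *\<^sub>v y) \<bullet> ?u - \<eta> * ((B *\<^sub>v (B\<^sup>T *\<^sub>v (W 2 *\<^sub>v y))) \<bullet> ?u)"
    using v u by (simp add: My minus_scalar_prod_distrib[of _ n])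
  finally show ?thesis unfolding BB by (simp add: algebra_simps)
qed

lemma finite_pairs_sum:
  "finite {(i :: nat, j). a \<le> i \<and> b \<le> j \<and> i + j = N}" "finite {(i :: nat, j). a < i \<and> b < j \<and> i + j = N}"
  by (rule finite_subset[of _ "{..N} \<times> {..N}"]; auto)+

text \<open>Twice the coefficient of t^k, with the terms containing \<open>w k\<close> on one side.
  These are (i, p) = (k, 1) from the drift and, at p = q = 0, the pairs (2, k) and (k, 2) from the
  quadratic part.\<close>

lemma coeff_system_rhs_xpow:
  assumes f: "f = poly_f n l A F" and g: "g = poly_g n m l B G" and h: "h = poly_h r l C H"
    and dims: "system_dims n m r l A B C F G H" and \<rho>: "\<rho> > 0"
    and HJB: "\<forall>x\<in>ball0 n \<rho>. HJB n \<eta> f g h E x" and d: "d \<ge> 2"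
    and exp: "degree_d_expansion n d E w"
    and W: "\<forall>i\<in>{2..d}. W i \<in> carrier_mat n (n ^ (i - 1)) \<and> w i = vec_of_mat (W i)"
    and y: "y \<in> carrier_vec n" and k: "k \<in> {3..d}"
  shows "(- rhs_f n F w k + (\<eta> / 4) \<cdot>\<^sub>v rhs_b n B W k - rhs_h n (H(1 := C)) k
       + (\<eta> / 4) \<cdot>\<^sub>v rhs_g n m l (G(0 := B)) W k) \<bullet> xpow k y
    = ((lyap k (A - \<eta> \<cdot>\<^sub>m (B * B\<^sup>T * W 2)))\<^sup>T *\<^sub>v w k) \<bullet> xpow k y"
proof -
  have A: "A \<in> carrier_mat n n" and B: "B \<in> carrier_mat n m" and C: "C \<in> carrier_mat r n"
    and F: "\<And>p. p \<ge> 2 \<Longrightarrow> F p \<in> carrier_mat n (n ^ p)"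
    and H: "\<And>p. p \<ge> 2 \<Longrightarrow> H p \<in> carrier_mat r (n ^ p)"
    and G: "\<And>p. p \<ge> 1 \<Longrightarrow> G p \<in> carrier_mat n (m * n ^ p)"
    and G0: "\<And>p. p \<ge> 1 \<Longrightarrow> p > l \<Longrightarrow> G p = 0\<^sub>m n (m * n ^ p)"
    using dims unfolding system_dims_def by auto
  have W': "W i \<in> carrier_mat n (n ^ (i - 1))" "w i = vec_of_mat (W i)" "symmetric_coeff n i (w i)"
    if "i \<in> {2..d}" for i
    using W exp that unfolding degree_d_expansion_def is_symmetrization_def by blast+
  have k2: "2 \<in> {2..d}" "k \<in> {2..d}" "k \<le> d" "k \<ge> 3" "k \<ge> 1" using k by auto
  have W2: "W 2 \<in> carrier_mat n n" using W'(1)[OF k2(1)] by simp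
  let ?G = "G(0 := B)" and ?H = "H(1 := C)"
  let ?u = "\<lambda>i. W i *\<^sub>v xpow (i - 1) y"
  let ?T = "\<lambda>p q i j. \<Sum>a<m. gain m ?G W y p i a * gain m ?G W y q j a"
  define fs where "fs = (\<Sum>(i, p)\<in>{(i, p). 2 \<le> i \<and> 2 \<le> p \<and> i + p = k + 1}. real i * ((F p *\<^sub>v xpow p y) \<bullet> ?u i))"
  define bs where "bs = (\<Sum>(i, j)\<in>{(i, j). 2 < i \<and> 2 < j \<and> i + j = k + 2}. real (i * j) * ?T 0 0 i j)"
  define hs where "hs = (\<Sum>(p, q)\<in>{(p, q). 1 \<le> p \<and> 1 \<le> q \<and> p + q = k}. (?H p *\<^sub>v xpow p y) \<bullet> (?H q *\<^sub>v xpow q y))"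
  define gs where "gs = (\<Sum>((i, p), (j, q))\<in>{((i, p), (j, q)). 2 \<le> i \<and> 2 \<le> j \<and> 1 \<le> p + q \<and> i + j + (p + q) = k + 2}.
      real (i * j) * ?T p q i j)"
  have rf: "rhs_f n F w k \<bullet> xpow k y = fs"
    unfolding fs_def by (rule rhs_f_xpow[OF F y]) (use W' k2 in auto)
  have rb: "rhs_b n B W k \<bullet> xpow k y = bs"
    unfolding bs_def by (rule rhs_b_xpow[OF B y]) (use W' k2 in auto)
  have rh: "rhs_h n ?H k \<bullet> xpow k y = hs"
    unfolding hs_def
  proof (rule rhs_h_xpow[OF _ y])
    show "?H p \<in> carrier_mat r (n ^ p)" if "1 \<le> p" for p using C H[of p] that by (cases "p = 1") auto
  qed
  have rg: "rhs_g n m l ?G W k \<bullet> xpow k y = gs"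
    unfolding gs_def
  proof (rule rhs_g_xpow[OF _ _ y])
    show "?G p \<in> carrier_mat n (m * n ^ p)" for p using B G[of p] by (cases "p = 0") auto
    show "?G p = 0\<^sub>m n (m * n ^ p)" if "l < p" for p using G0[of p] that by auto
    show "W i \<in> carrier_mat n (n ^ (i - 1))" if "i \<in> {2..k}" for i using W' that k2 by auto
  qed
  have lhs: "((lyap k (A - \<eta> \<cdot>\<^sub>m (B * B\<^sup>T * W 2)))\<^sup>T *\<^sub>v w k) \<bullet> xpow k y
      = real k * ((A *\<^sub>v y) \<bullet> ?u k) - \<eta> * (real k * ?T 0 0 2 k)"
    unfolding W'(2)[OF k2(2)]
    by (rule lyap_closed_loop_xpow[where G = G, OF A B W2 y k2(5) W'(1)[OF k2(2)]])
      (use W'(2,3)[OF k2(2)] in simp)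
  have T_sym: "?T 0 0 k 2 = ?T 0 0 2 k" by (simp only: mult.commute)
  have S1: "{(i, p). 2 \<le> i \<and> 1 \<le> p \<and> i + p = k + 1} = insert (k, 1) {(i, p). 2 \<le> i \<and> 2 \<le> p \<and> i + p = k + 1}"
    using k2 by auto
  have "(\<Sum>(i, p)\<in>{(i, p). 2 \<le> i \<and> 1 \<le> p \<and> i + p = k + 1}. real i / 2 * (?u i \<bullet> ((F(1 := A)) p *\<^sub>v xpow p y)))
      = real k / 2 * (?u k \<bullet> (A *\<^sub>v y)) + (\<Sum>(i, p)\<in>{(i, p). 2 \<le> i \<and> 2 \<le> p \<and> i + p = k + 1}.
          real i / 2 * (?u i \<bullet> ((F(1 := A)) p *\<^sub>v xpow p y)))"
    unfolding S1 using finite_pairs_sum(1) by (subst sum.insert) auto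
  also have "(\<Sum>(i, p)\<in>{(i, p). 2 \<le> i \<and> 2 \<le> p \<and> i + p = k + 1}.
          real i / 2 * (?u i \<bullet> ((F(1 := A)) p *\<^sub>v xpow p y))) = fs / 2"
    unfolding fs_def sum_divide_distrib
  proof (intro sum.cong refl)
    fix z :: "nat \<times> nat" assume z: "z \<in> {(i, p). 2 \<le> i \<and> 2 \<le> p \<and> i + p = k + 1}"
    obtain i p where ip: "z = (i, p)" by fastforce
    have i: "i \<in> {2..d}" "2 \<le> p" using z ip k2 by auto
    have "?u i \<bullet> (F p *\<^sub>v xpow p y) = (F p *\<^sub>v xpow p y) \<bullet> ?u i"
      using F[OF i(2)] W'(1)[OF i(1)] by (intro scalar_prod_comm_real) auto
    then show "(case z of (i, p) \<Rightarrow> real i / 2 * (?u i \<bullet> ((F(1 := A)) p *\<^sub>v xpow p y)))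
        = (case z of (i, p) \<Rightarrow> real i * ((F p *\<^sub>v xpow p y) \<bullet> ?u i)) / 2"
      using i by (simp add: ip)
  qed
  also have "?u k \<bullet> (A *\<^sub>v y) = (A *\<^sub>v y) \<bullet> ?u k"
    using A W'(1)[OF k2(2)] by (intro scalar_prod_comm_real) auto
  finally have E1: "(\<Sum>(i, p)\<in>{(i, p). 2 \<le> i \<and> 1 \<le> p \<and> i + p = k + 1}. real i / 2 * (?u i \<bullet> ((F(1 := A)) p *\<^sub>v xpow p y)))
      = real k / 2 * ((A *\<^sub>v y) \<bullet> ?u k) + fs / 2" .
  let ?Q = "{((i, p), (j, q)). 2 \<le> i \<and> 2 \<le> j \<and> i + j + (p + q) = k + 2} :: ((nat \<times> nat) \<times> (nat \<times> nat)) set"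
  let ?QA = "{((i, p), (j, q)). 2 \<le> i \<and> 2 \<le> j \<and> p + q = 0 \<and> i + j + (p + q) = k + 2} :: ((nat \<times> nat) \<times> (nat \<times> nat)) set"
  let ?QB = "{((i, p), (j, q)). 2 \<le> i \<and> 2 \<le> j \<and> 1 \<le> p + q \<and> i + j + (p + q) = k + 2} :: ((nat \<times> nat) \<times> (nat \<times> nat)) set"
  let ?t = "\<lambda>((i, p), (j, q)). real (i * j) / 4 * ?T p q i j"
  have fin: "finite ?QA" "finite ?QB"
    by (rule finite_subset[of _ "({..k + 2} \<times> {..k + 2}) \<times> ({..k + 2} \<times> {..k + 2})"]; auto)+
  have un: "?Q = ?QA \<union> ?QB" by auto
  have disj: "?QA \<inter> ?QB = {}" by auto
  have "sum ?t ?Q = sum ?t ?QA + sum ?t ?QB"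
    unfolding un by (rule sum.union_disjoint[OF fin disj])
  also have "sum ?t ?QB = gs / 4"
    unfolding gs_def sum_divide_distrib by (intro sum.cong refl) auto
  also have "sum ?t ?QA = (\<Sum>(i, j)\<in>{(i, j). 2 \<le> i \<and> 2 \<le> j \<and> i + j = k + 2}. real (i * j) / 4 * ?T 0 0 i j)"
    by (rule sum.reindex_bij_witness[of _ "\<lambda>(i, j). ((i, 0), (j, 0))" "\<lambda>((i, p), (j, q)). (i, j)"]) auto
  \<comment> \<open>For k \<ge> 3 the pairs (2, k) and (k, 2) are distinct, so the cross term is
    counted twice.\<close>
  also have "{(i, j). 2 \<le> i \<and> 2 \<le> j \<and> i + j = k + 2} = insert (2, k) (insert (k, 2) {(i, j). 2 < i \<and> 2 < j \<and> i + j = k + 2})"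
    using k2 by auto
  also have "(\<Sum>(i, j)\<in>\<dots>. real (i * j) / 4 * ?T 0 0 i j)
      = real (2 * k) / 4 * ?T 0 0 2 k + (real (k * 2) / 4 * ?T 0 0 k 2
        + (\<Sum>(i, j)\<in>{(i, j). 2 < i \<and> 2 < j \<and> i + j = k + 2}. real (i * j) / 4 * ?T 0 0 i j))"
  proof -
    have f: "finite {(i, j). 2 < i \<and> 2 < j \<and> i + j = k + 2}" by (rule finite_pairs_sum(2))
    then have f2: "finite (insert (k, 2) {(i, j). 2 < i \<and> 2 < j \<and> i + j = k + 2})" by simp
    have n1: "(k, 2) \<notin> {(i, j). 2 < i \<and> 2 < j \<and> i + j = k + 2}"
      and n2: "(2, k) \<notin> insert (k, 2) {(i, j). 2 < i \<and> 2 < j \<and> i + j = k + 2}" using k2 by auto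
    show ?thesis unfolding sum.insert[OF f2 n2] sum.insert[OF f n1] by (simp only: prod.case)
  qed
  also have "(\<Sum>(i, j)\<in>{(i, j). 2 < i \<and> 2 < j \<and> i + j = k + 2}. real (i * j) / 4 * ?T 0 0 i j) = bs / 4"
    unfolding bs_def sum_divide_distrib by (intro sum.cong refl) auto
  finally have E2: "sum ?t ?Q = real (2 * k) / 4 * ?T 0 0 2 k + (real (k * 2) / 4 * ?T 0 0 2 k + bs / 4) + gs / 4"
    unfolding T_sym .
  have "real k / 2 * ((A *\<^sub>v y) \<bullet> ?u k) + fs / 2
      - \<eta> / 2 * (real (2 * k) / 4 * ?T 0 0 2 k + (real (k * 2) / 4 * ?T 0 0 2 k + bs / 4) + gs / 4) + 1 / 2 * hs = 0"
    using HJB_coefficients[OF f g h dims \<rho> HJB d exp W y k2(3)] unfolding E1 E2 hs_def[symmetric] .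
  then have main: "real k * ((A *\<^sub>v y) \<bullet> ?u k) - \<eta> * (real k * ?T 0 0 2 k) = - fs + \<eta> / 4 * bs - hs + \<eta> / 4 * gs"
    by (simp add: algebra_simps)
  have c: "rhs_f n F w k \<in> carrier_vec (n ^ k)" "rhs_b n B W k \<in> carrier_vec (n ^ k)"
    "rhs_h n ?H k \<in> carrier_vec (n ^ k)" "rhs_g n m l ?G W k \<in> carrier_vec (n ^ k)" "xpow k y \<in> carrier_vec (n ^ k)"
    using y by (simp_all add: rhs_f_def rhs_b_def rhs_h_def rhs_g_def)
  have c': "- rhs_f n F w k \<in> carrier_vec (n ^ k)" "(\<eta> / 4) \<cdot>\<^sub>v rhs_b n B W k \<in> carrier_vec (n ^ k)"
    "(\<eta> / 4) \<cdot>\<^sub>v rhs_g n m l ?G W k \<in> carrier_vec (n ^ k)"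
    "- rhs_f n F w k + (\<eta> / 4) \<cdot>\<^sub>v rhs_b n B W k \<in> carrier_vec (n ^ k)"
    "- rhs_f n F w k + (\<eta> / 4) \<cdot>\<^sub>v rhs_b n B W k - rhs_h n ?H k \<in> carrier_vec (n ^ k)"
    using c by simp_all
  have "(- rhs_f n F w k + (\<eta> / 4) \<cdot>\<^sub>v rhs_b n B W k - rhs_h n ?H k + (\<eta> / 4) \<cdot>\<^sub>v rhs_g n m l ?G W k) \<bullet> xpow k y
      = - (rhs_f n F w k \<bullet> xpow k y) + \<eta> / 4 * (rhs_b n B W k \<bullet> xpow k y) - rhs_h n ?H k \<bullet> xpow k y
        + \<eta> / 4 * (rhs_g n m l ?G W k \<bullet> xpow k y)"
    using c by (simp only: add_scalar_prod_distrib[OF c'(5) c'(3) c(5)] minus_scalar_prod_distrib[OF c'(4) c(3) c(5)]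
        add_scalar_prod_distrib[OF c'(1) c'(2) c(5)] smult_scalar_prod_distrib[OF c(2) c(5)]
        smult_scalar_prod_distrib[OF c(4) c(5)] uminus_scalar_prod[OF c(1) c(5)])
  then show ?thesis unfolding rf rb rh rg lhs main .
qed

text \<open>The hypothesis \<open>id\<close> equates polynomials, not vectors. The difference of
  \<open>wt\<close> and \<open>w k\<close> is therefore tested on Kronecker powers only, and the two
  may differ as vectors.\<close>

lemma coeff_system_symmetrization:
  assumes id: "\<And>y. y \<in> carrier_vec n \<Longrightarrow>
      (- rhs_f n F w k + (\<eta> / 4) \<cdot>\<^sub>v rhs_b n B W k - rhs_h n (H(1 := C)) k
       + (\<eta> / 4) \<cdot>\<^sub>v rhs_g n m l (G(0 := B)) W k) \<bullet> xpow k y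
    = ((lyap k M)\<^sup>T *\<^sub>v w k) \<bullet> xpow k y"
    and M: "M = A - \<eta> \<cdot>\<^sub>m (B * B\<^sup>T * W 2)" "M \<in> carrier_mat n n" "hurwitz M" and k: "k > 0"
    and w: "symmetric_coeff n k (w k)"
  shows "\<exists>wt. coeff_system n m l \<eta> A B C F G H w W k wt"
    "coeff_system n m l \<eta> A B C F G H w W k wt \<Longrightarrow> is_symmetrization n k wt (w k)"
proof -
  let ?r = "- rhs_f n F w k + (\<eta> / 4) \<cdot>\<^sub>v rhs_b n B W k - rhs_h n (H(1 := C)) k
       + (\<eta> / 4) \<cdot>\<^sub>v rhs_g n m l (G(0 := B)) W k"
  have "?r \<in> carrier_vec (n ^ k)" by (simp add: rhs_f_def rhs_b_def rhs_h_def rhs_g_def)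
  from lyap_transpose_solvable[OF M(2,3) k this]
  show "\<exists>wt. coeff_system n m l \<eta> A B C F G H w W k wt"
    unfolding coeff_system_def M(1) by blast
  assume "coeff_system n m l \<eta> A B C F G H w W k wt"
  then have wt: "wt \<in> carrier_vec (n ^ k)" "(lyap k M)\<^sup>T *\<^sub>v wt = ?r"
    unfolding coeff_system_def M(1) by auto
  have wk: "w k \<in> carrier_vec (n ^ k)" using w unfolding symmetric_coeff_def by blast
  have L: "lyap k M \<in> carrier_mat (n ^ k) (n ^ k)"
    using lyap_carrier[OF M(2), of k] k by (cases k) (simp_all add: mult.commute)
  have "w k \<bullet> xpow k x = wt \<bullet> xpow k x" if x: "x \<in> carrier_vec n" for x
  proof -
    have "(wt - w k) \<bullet> xpow k x = 0"
    proof (rule lyap_xpow_zero[OF M(2,3) k _ _ x])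
      show "dim_vec (wt - w k) = n ^ k" using wk by simp
      fix y :: "real vec" assume y: "y \<in> carrier_vec n"
      have cy: "xpow k y \<in> carrier_vec (n ^ k)" using y by simp
      have Ly: "lyap k M *\<^sub>v xpow k y \<in> carrier_vec (n ^ k)" using L cy by (rule mult_mat_vec_carrier)
      have "wt \<bullet> (lyap k M *\<^sub>v xpow k y) = ((lyap k M)\<^sup>T *\<^sub>v wt) \<bullet> xpow k y"
        by (rule transpose_mult_scalar_prod[OF L carrier_vecD[OF wt(1)] carrier_vecD[OF cy], symmetric])
      also have "\<dots> = ((lyap k M)\<^sup>T *\<^sub>v w k) \<bullet> xpow k y" unfolding wt(2) by (rule id[OF y])
      also have "\<dots> = w k \<bullet> (lyap k M *\<^sub>v xpow k y)"
        by (rule transpose_mult_scalar_prod[OF L carrier_vecD[OF wk] carrier_vecD[OF cy]])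
      finally show "(wt - w k) \<bullet> (lyap k M *\<^sub>v xpow k y) = 0"
        by (simp add: minus_scalar_prod_distrib[OF wt(1) wk Ly])
    qed
    then show ?thesis
      using minus_scalar_prod_distrib[OF wt(1) wk xpow_carrier[OF x]] by simp
  qed
  then show "is_symmetrization n k wt (w k)" using w unfolding is_symmetrization_def by blast
qed

section \<open>The attenuation level\<close>

lemma vnorm_nonneg [simp]: "0 \<le> vnorm v"
  by (simp add: vnorm_def)

lemma vnorm_triangle:
  assumes "dim_vec u = dim_vec v"
  shows "vnorm (u + v) \<le> vnorm u + vnorm v"
proof -
  have "vnorm (u + v) \<le> L2_set (\<lambda>i. norm (u $ i) + norm (v $ i)) {..<dim_vec v}"
    unfolding vnorm_def using assms by (simp, intro L2_set_mono) (auto intro: norm_triangle_ineq)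
  also have "\<dots> \<le> vnorm u + vnorm v"
    unfolding vnorm_def assms by (rule L2_set_triangle_ineq)
  finally show ?thesis .
qed

lemma vnorm_eq_0_iff: "vnorm v = 0 \<longleftrightarrow> v = 0\<^sub>v (dim_vec v)"
  by (auto simp: vnorm_def L2_set_eq_0_iff vec_eq_iff)

lemma entry_le_vnorm: "i < dim_vec v \<Longrightarrow> norm (v $ i) \<le> vnorm v"
  unfolding vnorm_def by (rule member_le_L2_set) auto

lemma vnorm_le_sum: "vnorm v \<le> (\<Sum>i<dim_vec v. norm (v $ i))"
  unfolding vnorm_def by (rule L2_set_le_sum) auto

lemma vnorm_sq_sum: "(vnorm v)\<^sup>2 = (\<Sum>i<dim_vec v. (norm (v $ i))\<^sup>2)"
  by (simp add: vnorm_def L2_set_def sum_nonneg)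

lemma sum_lessThan_add:
  fixes f :: "nat \<Rightarrow> 'b::comm_monoid_add"
  shows "(\<Sum>i<a + b. f i) = (\<Sum>i<a. f i) + (\<Sum>i<b. f (a + i))"
  by (induction b) (simp_all add: add.assoc)

lemma vnorm_append_sq: "(vnorm (u @\<^sub>v v))\<^sup>2 = (vnorm u)\<^sup>2 + (vnorm v)\<^sup>2"
  by (simp add: vnorm_sq_sum sum_lessThan_add)

lemma vnorm_mult_mat_vec_le:
  fixes M :: "'a::real_normed_field mat"
  shows "\<exists>c\<ge>0. \<forall>v. dim_vec v = dim_col M \<longrightarrow> vnorm (M *\<^sub>v v) \<le> c * vnorm v"
proof (intro exI conjI allI impI)
  let ?c = "\<Sum>i<dim_row M. \<Sum>j<dim_col M. norm (M $$ (i, j))"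
  show "0 \<le> ?c" by (intro sum_nonneg) auto
  fix v :: "'a vec" assume v: "dim_vec v = dim_col M"
  have "norm ((M *\<^sub>v v) $ i) \<le> (\<Sum>j<dim_col M. norm (M $$ (i, j))) * vnorm v" if i: "i < dim_row M" for i
  proof -
    have "norm ((M *\<^sub>v v) $ i) \<le> (\<Sum>j<dim_col M. norm (M $$ (i, j) * v $ j))"
      using i v by (simp add: scalar_prod_lessThan norm_sum)
    also have "\<dots> \<le> (\<Sum>j<dim_col M. norm (M $$ (i, j)) * vnorm v)"
      using v by (intro sum_mono) (auto simp: norm_mult entry_le_vnorm intro!: mult_left_mono)
    finally show ?thesis by (simp add: sum_distrib_right)
  qed
  then have "(\<Sum>i<dim_row M. norm ((M *\<^sub>v v) $ i)) \<le> (\<Sum>i<dim_row M. (\<Sum>j<dim_col M. norm (M $$ (i, j))) * vnorm v)"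
    by (intro sum_mono) auto
  moreover have "vnorm (M *\<^sub>v v) \<le> (\<Sum>i<dim_row M. norm ((M *\<^sub>v v) $ i))"
    using vnorm_le_sum[of "M *\<^sub>v v"] by simp
  ultimately show "vnorm (M *\<^sub>v v) \<le> ?c * vnorm v" by (simp add: sum_distrib_right)
qed

text \<open>\<open>spectral_norm\<close> is a supremum of reals, so it is meaningful only once the
  set is bounded; a crude bound by the entries of \<open>M\<close> provides that. Scaling v to
  length one does the rest.\<close>

lemma vnorm_mult_le_spectral_norm:
  assumes v: "v \<in> carrier_vec (dim_col M)"
  shows "vnorm (M *\<^sub>v v) \<le> spectral_norm M * vnorm v"
proof -
  obtain c where c: "c \<ge> 0" "\<And>v. dim_vec v = dim_col M \<Longrightarrow> vnorm (M *\<^sub>v v) \<le> c * vnorm v"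
    using vnorm_mult_mat_vec_le[of M] by blast
  let ?S = "{v \<in> carrier_vec (dim_col M). vnorm v \<le> 1}"
  have bdd: "bdd_above ((\<lambda>v. vnorm (M *\<^sub>v v)) ` ?S)"
  proof (rule bdd_aboveI2)
    fix v :: "complex vec" assume "v \<in> ?S"
    then show "vnorm (M *\<^sub>v v) \<le> c" using c(2)[of v] mult_left_mono[OF _ c(1), of "vnorm v" 1] by auto
  qed
  show ?thesis
  proof (cases "vnorm v = 0")
    case True
    then show ?thesis using c(2)[of v] v by simp
  next
    case False
    then have pos: "0 < vnorm v" using vnorm_nonneg[of v] by linarith
    let ?u = "complex_of_real (1 / vnorm v) \<cdot>\<^sub>v v"
    have "?u \<in> ?S" using v pos by (simp add: vnorm_smult norm_divide)
    then have "vnorm (M *\<^sub>v ?u) \<le> spectral_norm M"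
      unfolding spectral_norm_def by (intro cSUP_upper bdd)
    moreover have "M *\<^sub>v ?u = complex_of_real (1 / vnorm v) \<cdot>\<^sub>v (M *\<^sub>v v)"
      using v by (intro mult_mat_vec[of _ "dim_row M" "dim_col M"]) auto
    ultimately show ?thesis using pos by (simp add: vnorm_smult norm_divide field_simps)
  qed
qed

text \<open>Off the spectrum the option value is a genuine two-sided inverse, the resolvent. The
  field is arbitrary because complex resolvents appear in the transfer matrix and a real one in the
  Lyapunov equation for the instability argument.\<close>

lemma inverse_of_not_eigenvalue:
  fixes K :: "'a::field mat"
  assumes K: "K \<in> carrier_mat N N" and s: "\<not> eigenvalue K s"
  defines "R \<equiv> the (mat_inverse (s \<cdot>\<^sub>m 1\<^sub>m N - K))"
  shows "R \<in> carrier_mat N N" "\<And>v. v \<in> carrier_vec N \<Longrightarrow> R *\<^sub>v (s \<cdot>\<^sub>v v - K *\<^sub>v v) = v"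
    "\<And>v. v \<in> carrier_vec N \<Longrightarrow> s \<cdot>\<^sub>v (R *\<^sub>v v) - K *\<^sub>v (R *\<^sub>v v) = v"
proof -
  let ?X = "s \<cdot>\<^sub>m 1\<^sub>m N - K"
  have X: "?X \<in> carrier_mat N N" using K by (intro minus_carrier_mat) 
  have Xv: "?X *\<^sub>v v = s \<cdot>\<^sub>v v - K *\<^sub>v v" if v: "v \<in> carrier_vec N" for v
  proof -
    have "(s \<cdot>\<^sub>m 1\<^sub>m N) *\<^sub>v v = s \<cdot>\<^sub>v v"
      using v by (intro eq_vecI) (auto simp: scalar_prod_smult_left)
    then show ?thesis using K v by (simp add: minus_mult_distrib_mat_vec[of _ N N])
  qed
  have "det ?X \<noteq> 0"
  proof
    assume "det ?X = 0"
    then obtain v where v: "v \<in> carrier_vec N" "v \<noteq> 0\<^sub>v N" "?X *\<^sub>v v = 0\<^sub>v N"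
      using det_0_iff_vec_prod_zero_field[OF X] by blast
    have "K *\<^sub>v v = s \<cdot>\<^sub>v v"
    proof (rule eq_vecI)
      fix i assume "i < dim_vec (s \<cdot>\<^sub>v v)"
      then have i: "i < N" using v by simp
      have "(s \<cdot>\<^sub>v v - K *\<^sub>v v) $ i = 0" using v(3) Xv[OF v(1)] i by simp
      then show "(K *\<^sub>v v) $ i = (s \<cdot>\<^sub>v v) $ i" using i K v(1) by simp
    qed (use K v in auto)
    then have "eigenvalue K s" using K v unfolding eigenvalue_def eigenvector_def by auto
    then show False using s by simp
  qed
  then have "?X \<in> Units (ring_mat TYPE('a) N ())" by (rule det_non_zero_imp_unit[OF X])
  then have "mat_inverse ?X \<noteq> None" using mat_inverse(1)[OF X, where b = "()"] by blast
  then have "mat_inverse ?X = Some R" by (simp add: R_def)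
  from mat_inverse(2)[OF X this] have R: "R \<in> carrier_mat N N" "?X * R = 1\<^sub>m N" "R * ?X = 1\<^sub>m N" by auto
  show "R \<in> carrier_mat N N" by (rule R(1))
  show "R *\<^sub>v (s \<cdot>\<^sub>v v - K *\<^sub>v v) = v" if v: "v \<in> carrier_vec N" for v
    using assoc_mult_mat_vec[OF R(1) X v] v by (simp add: R(3) Xv)
  show "s \<cdot>\<^sub>v (R *\<^sub>v v) - K *\<^sub>v (R *\<^sub>v v) = v" if v: "v \<in> carrier_vec N" for v
    using assoc_mult_mat_vec[OF X R(1) v] v R(1) by (simp add: R(2) Xv[of "R *\<^sub>v v"])
qed

lemma smult_vec_shift:
  fixes x y :: "'a::comm_ring_1 vec"
  assumes "x \<in> carrier_vec N" "y \<in> carrier_vec N"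
  shows "a \<cdot>\<^sub>v x - y = ((a + e) \<cdot>\<^sub>v x - y) + (- e) \<cdot>\<^sub>v x"
  by (rule eq_vecI) (use assms in \<open>auto simp: algebra_simps\<close>)

text \<open>Evaluating the transfer matrix slightly to the right of \<open>\<mu>\<close> and passing to the limit covers
  the boundary case \<open>Re \<mu> = 0\<close>, which the supremum defining the norm does not see.\<close>

lemma hinf_norm_bound:
  fixes \<mu> :: complex
  assumes P: "P \<in> carrier_mat N N" and Q: "Q \<in> carrier_mat N a" and R: "R \<in> carrier_mat b N"
    and S: "S \<in> carrier_mat b a"
    and h: "hurwitz P" and norm: "hinf_norm P Q R S < ereal \<gamma>" and \<mu>: "0 \<le> Re \<mu>"
    and z: "z \<in> carrier_vec N" and w: "w \<in> carrier_vec a"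
    and eq: "\<mu> \<cdot>\<^sub>v z = map_mat complex_of_real P *\<^sub>v z + map_mat complex_of_real Q *\<^sub>v w"
  shows "vnorm (map_mat complex_of_real R *\<^sub>v z + map_mat complex_of_real S *\<^sub>v w) \<le> \<gamma> * vnorm w"
proof -
  let ?c = "map_mat complex_of_real"
  let ?y = "?c R *\<^sub>v z + ?c S *\<^sub>v w"
  have c: "?c P \<in> carrier_mat N N" "?c Q \<in> carrier_mat N a" "?c R \<in> carrier_mat b N" "?c S \<in> carrier_mat b a"
    using P Q R S by auto
  have dP: "dim_row P = N" using P by auto
  have noev: "\<not> eigenvalue (?c P) s" if "0 \<le> Re s" for s using h that unfolding hurwitz_def by force
  define K where "K s = the (mat_inverse (s \<cdot>\<^sub>m 1\<^sub>m N - ?c P))" for s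
  note K = inverse_of_not_eigenvalue[OF c(1) noev, folded K_def]
  obtain k where k: "k \<ge> 0" "\<And>v. dim_vec v = N \<Longrightarrow> vnorm (K \<mu> *\<^sub>v v) \<le> k * vnorm v"
    using vnorm_mult_mat_vec_le[of "K \<mu>"] K(1)[OF \<mu>] by auto
  obtain k' where k': "k' \<ge> 0" "\<And>v. dim_vec v = N \<Longrightarrow> vnorm (?c R *\<^sub>v v) \<le> k' * vnorm v"
    using vnorm_mult_mat_vec_le[of "?c R"] R by auto
  have main: "vnorm ?y \<le> \<gamma> * vnorm w + e * (k' * (2 * k * vnorm z))" if e: "0 < e" "e * k \<le> 1 / 2" for e :: real
  proof -
    let ?e = "complex_of_real e"
    let ?s = "\<mu> + ?e"
    have s: "0 < Re ?s" "0 \<le> Re ?s" using \<mu> e by auto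
    define x where "x = K ?s *\<^sub>v z"
    have x: "x \<in> carrier_vec N" using K(1)[OF s(2)] z by (simp add: x_def mult_mat_vec_carrier)
    have sx: "?s \<cdot>\<^sub>v x - ?c P *\<^sub>v x = z" unfolding x_def by (rule K(3)[OF s(2) z])
    have Px: "?c P *\<^sub>v x \<in> carrier_vec N" "?c P *\<^sub>v z \<in> carrier_vec N" "?c Q *\<^sub>v w \<in> carrier_vec N"
      using mult_mat_vec_carrier[OF c(1) x] mult_mat_vec_carrier[OF c(1) z] mult_mat_vec_carrier[OF c(2) w] by auto
    \<comment> \<open>The shifted resolvent is bounded through the one at \<mu>: x =
      \<open>K \<mu>\<close> (z - e x) gives |x| \<le> k |z| + e k |x|, and e k \<le> 1 / 2 absorbs
      the last term.\<close>
    have "x = K \<mu> *\<^sub>v (\<mu> \<cdot>\<^sub>v x - ?c P *\<^sub>v x)" using K(2)[OF \<mu> x] by simp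
    also have "\<mu> \<cdot>\<^sub>v x - ?c P *\<^sub>v x = z + (- ?e) \<cdot>\<^sub>v x"
      using smult_vec_shift[OF x Px(1), of \<mu> ?e] unfolding sx .
    finally have b1: "vnorm x \<le> k * vnorm (z + (- ?e) \<cdot>\<^sub>v x)" using k(2)[of "z + (- ?e) \<cdot>\<^sub>v x"] x by simp
    have b2: "vnorm (z + (- ?e) \<cdot>\<^sub>v x) \<le> vnorm z + e * vnorm x"
      using vnorm_triangle[of z "(- ?e) \<cdot>\<^sub>v x"] z x e by (simp add: vnorm_smult)
    have "vnorm x \<le> k * vnorm z + (e * k) * vnorm x"
      using order_trans[OF b1 mult_left_mono[OF b2 k(1)]] by (simp add: algebra_simps)
    also have "(e * k) * vnorm x \<le> 1 / 2 * vnorm x" using e by (intro mult_right_mono) auto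
    finally have xb: "vnorm x \<le> 2 * k * vnorm z" by simp
    have "K ?s *\<^sub>v (?c Q *\<^sub>v w) = z + (- ?e) \<cdot>\<^sub>v x"
    proof -
      \<comment> \<open>Replacing \<mu> by \<open>?s\<close> changes the state equation by e z, so
        the response to w at the shifted point is z - e x.\<close>
      have "?c Q *\<^sub>v w = (?s \<cdot>\<^sub>v z - ?c P *\<^sub>v z) + (- ?e) \<cdot>\<^sub>v z"
      proof (rule eq_vecI)
        fix i assume "i < dim_vec ((?s \<cdot>\<^sub>v z - ?c P *\<^sub>v z) + (- ?e) \<cdot>\<^sub>v z)"
        then have i: "i < N" using z by simp
        have "(\<mu> \<cdot>\<^sub>v z) $ i = (?c P *\<^sub>v z + ?c Q *\<^sub>v w) $ i" using eq by simp
        then have "\<mu> * z $ i = (?c P *\<^sub>v z) $ i + (?c Q *\<^sub>v w) $ i"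
          using i z carrier_matD[OF P] carrier_matD[OF Q] by (simp del: index_mult_mat_vec)
        then show "(?c Q *\<^sub>v w) $ i = ((?s \<cdot>\<^sub>v z - ?c P *\<^sub>v z) + (- ?e) \<cdot>\<^sub>v z) $ i"
          using i z carrier_matD[OF P] by (simp add: algebra_simps del: index_mult_mat_vec)
      qed (use z carrier_matD[OF Q] in simp)
      also have "K ?s *\<^sub>v \<dots> = K ?s *\<^sub>v (?s \<cdot>\<^sub>v z - ?c P *\<^sub>v z) + K ?s *\<^sub>v ((- ?e) \<cdot>\<^sub>v z)"
        using z Px by (intro mult_add_distrib_mat_vec[OF K(1)[OF s(2)]]) auto
      also have "K ?s *\<^sub>v ((- ?e) \<cdot>\<^sub>v z) = (- ?e) \<cdot>\<^sub>v x"
        unfolding x_def by (rule mult_mat_vec[OF K(1)[OF s(2)] z])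
      finally show ?thesis unfolding K(2)[OF s(2) z] .
    qed
    then have "?c R *\<^sub>v (K ?s *\<^sub>v (?c Q *\<^sub>v w)) = ?c R *\<^sub>v z + (- ?e) \<cdot>\<^sub>v (?c R *\<^sub>v x)"
      using mult_add_distrib_mat_vec[OF c(3) z, of "(- ?e) \<cdot>\<^sub>v x"] mult_mat_vec[OF c(3) x] x by simp
    moreover have "transfer_matrix P Q R S ?s *\<^sub>v w = ?c R *\<^sub>v (K ?s *\<^sub>v (?c Q *\<^sub>v w)) + ?c S *\<^sub>v w"
    proof -
      have RK: "?c R * K ?s \<in> carrier_mat b N" using c(3) K(1)[OF s(2)] by (rule mult_carrier_mat)
      have RKQ: "?c R * K ?s * ?c Q \<in> carrier_mat b a" using RK c(2) by (rule mult_carrier_mat)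
      have "transfer_matrix P Q R S ?s = ?c R * K ?s * ?c Q + ?c S"
        unfolding transfer_matrix_def K_def dP ..
      then show ?thesis
        by (simp only: add_mult_distrib_mat_vec[OF RKQ c(4) w] assoc_mult_mat_vec[OF RK c(2) w]
            assoc_mult_mat_vec[OF c(3) K(1)[OF s(2)] Px(3)])
    qed
    \<comment> \<open>The output at the shifted point misses the wanted one by e R x, which tends to
      0 with e because x is bounded.\<close>
    ultimately have T: "transfer_matrix P Q R S ?s *\<^sub>v w + ?e \<cdot>\<^sub>v (?c R *\<^sub>v x) = ?y"
    proof -
      assume 1: "?c R *\<^sub>v (K ?s *\<^sub>v (?c Q *\<^sub>v w)) = ?c R *\<^sub>v z + (- ?e) \<cdot>\<^sub>v (?c R *\<^sub>v x)"
        and 2: "transfer_matrix P Q R S ?s *\<^sub>v w = ?c R *\<^sub>v (K ?s *\<^sub>v (?c Q *\<^sub>v w)) + ?c S *\<^sub>v w"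
      show ?thesis unfolding 2 1
        using R S by (intro eq_vecI) (auto simp del: index_mult_mat_vec)
    qed
    have dT: "dim_row (transfer_matrix P Q R S ?s) = b" "dim_col (transfer_matrix P Q R S ?s) = a"
      using S Q R by (auto simp: transfer_matrix_def)
    have "ereal (spectral_norm (transfer_matrix P Q R S ?s)) \<le> hinf_norm P Q R S"
      unfolding hinf_norm_def using s by (intro SUP_upper) auto
    then have "ereal (spectral_norm (transfer_matrix P Q R S ?s)) < ereal \<gamma>"
      using norm by (rule order_le_less_trans)
    then have "spectral_norm (transfer_matrix P Q R S ?s) * vnorm w \<le> \<gamma> * vnorm w"
      by (intro mult_right_mono) auto
    then have Tw: "vnorm (transfer_matrix P Q R S ?s *\<^sub>v w) \<le> \<gamma> * vnorm w"
      using vnorm_mult_le_spectral_norm[of w "transfer_matrix P Q R S ?s"] w dT by simp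
    have "vnorm ?y \<le> vnorm (transfer_matrix P Q R S ?s *\<^sub>v w) + vnorm (?e \<cdot>\<^sub>v (?c R *\<^sub>v x))"
      unfolding T[symmetric] using dT R by (intro vnorm_triangle) auto
    also have "vnorm (?e \<cdot>\<^sub>v (?c R *\<^sub>v x)) \<le> e * (k' * (2 * k * vnorm z))"
    proof -
      have "vnorm (?c R *\<^sub>v x) \<le> k' * vnorm x" using k'(2)[of x] x by simp
      also have "\<dots> \<le> k' * (2 * k * vnorm z)" using xb k'(1) by (rule mult_left_mono)
      finally show ?thesis using e by (simp add: vnorm_smult mult_left_mono)
    qed
    finally show ?thesis using Tw by simp
  qed
  have "\<forall>\<^sub>F e in at_right 0. e * k < 1 / 2"
  proof -
    have "((\<lambda>e. e * k) \<longlongrightarrow> 0 * k) (at_right 0)" by (intro tendsto_intros)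
    then show ?thesis by (intro order_tendstoD) auto
  qed
  then have "\<forall>\<^sub>F e in at_right 0. vnorm ?y \<le> \<gamma> * vnorm w + e * (k' * (2 * k * vnorm z))"
    using eventually_at_right_less[of 0] by eventually_elim (rule main, auto)
  moreover have "((\<lambda>e. \<gamma> * vnorm w + e * (k' * (2 * k * vnorm z))) \<longlongrightarrow> \<gamma> * vnorm w + 0 * (k' * (2 * k * vnorm z))) (at_right 0)"
    by (intro tendsto_intros)
  ultimately have "vnorm ?y \<le> \<gamma> * vnorm w + 0 * (k' * (2 * k * vnorm z))"
    by (intro tendsto_lowerbound[OF _ _ trivial_limit_at_right_real])
  then show ?thesis by simp
qed

section \<open>Complex vectors as pairs of real vectors and the gain inequality\<close>

definition complex_vec :: "real vec \<Rightarrow> real vec \<Rightarrow> complex vec" where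
  "complex_vec a b = vec (dim_vec a) (\<lambda>i. Complex (a $ i) (b $ i))"

lemma complex_vec_carrier [simp]: "a \<in> carrier_vec n \<Longrightarrow> complex_vec a b \<in> carrier_vec n"
  by (simp add: complex_vec_def)

lemma mult_complex_vec:
  assumes "M \<in> carrier_mat r n" "a \<in> carrier_vec n" "b \<in> carrier_vec n"
  shows "map_mat complex_of_real M *\<^sub>v complex_vec a b = complex_vec (M *\<^sub>v a) (M *\<^sub>v b)"
  by (rule eq_vecI) (use assms in \<open>auto simp: complex_vec_def scalar_prod_lessThan complex_eq_iff\<close>)

lemma complex_vec_add:
  assumes "a \<in> carrier_vec n" "b \<in> carrier_vec n" "p \<in> carrier_vec n" "q \<in> carrier_vec n"
  shows "complex_vec a b + complex_vec p q = complex_vec (a + p) (b + q)"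
  by (rule eq_vecI) (use assms in \<open>auto simp: complex_vec_def complex_eq_iff\<close>)

lemma smult_complex_vec:
  assumes "a \<in> carrier_vec n" "b \<in> carrier_vec n"
  shows "Complex \<alpha> \<omega> \<cdot>\<^sub>v complex_vec a b = complex_vec (\<alpha> \<cdot>\<^sub>v a - \<omega> \<cdot>\<^sub>v b) (\<alpha> \<cdot>\<^sub>v b + \<omega> \<cdot>\<^sub>v a)"
  by (rule eq_vecI) (use assms in \<open>auto simp: complex_vec_def complex_eq_iff\<close>)

lemma vnorm_complex_vec_sq:
  assumes "a \<in> carrier_vec n" "b \<in> carrier_vec n"
  shows "(vnorm (complex_vec a b))\<^sup>2 = a \<bullet> a + b \<bullet> b"
proof -
  have "(vnorm (complex_vec a b))\<^sup>2 = (\<Sum>i<n. (a $ i)\<^sup>2 + (b $ i)\<^sup>2)"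
    using assms by (simp add: vnorm_sq_sum complex_vec_def cmod_power2)
  then show ?thesis using assms by (simp add: scalar_prod_lessThan sum.distrib power2_eq_square)
qed

lemma vnorm_uminus: "vnorm (- v) = vnorm v"
  by (auto simp: vnorm_def intro: L2_set_cong)

lemma scalar_prod_self_nonneg: "0 \<le> (a :: real vec) \<bullet> a"
  by (simp add: scalar_prod_lessThan sum_nonneg)

lemma scalar_prod_self_eq_0:
  assumes "a \<in> carrier_vec n" "(a :: real vec) \<bullet> a = 0"
  shows "a = 0\<^sub>v n"
proof (rule eq_vecI)
  fix i assume i: "i < dim_vec (0\<^sub>v n :: real vec)"
  have "(\<Sum>i<n. a $ i * a $ i) = 0" using assms by (simp add: scalar_prod_lessThan)
  then have "\<forall>i\<in>{..<n}. a $ i * a $ i = 0" by (subst (asm) sum_nonneg_eq_0_iff) auto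
  then show "a $ i = 0\<^sub>v n $ i" using i by simp
qed (use assms in simp)

lemma complex_vec_zero_iff:
  assumes "a \<in> carrier_vec n" "b \<in> carrier_vec n"
  shows "complex_vec a b = 0\<^sub>v n \<longleftrightarrow> a = 0\<^sub>v n \<and> b = 0\<^sub>v n"
  using assms by (auto simp: complex_vec_def vec_eq_iff complex_eq_iff)

lemma zero_mult_vec [simp]: "dim_vec v = c \<Longrightarrow> 0\<^sub>m r c *\<^sub>v v = (0\<^sub>v r :: 'a::semiring_0 vec)"
  by (rule eq_vecI) (auto simp: scalar_prod_lessThan)

lemma mult_zero_vec [simp]: "M \<in> carrier_mat r c \<Longrightarrow> M *\<^sub>v 0\<^sub>v c = (0\<^sub>v r :: 'a::semiring_0 vec)"
  by (rule eq_vecI) (auto simp: scalar_prod_lessThan)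

text \<open>The disturbance \<open>w\<^sub>1 = u\<close>, \<open>w\<^sub>2 = - C v\<close> hides the plant from the controller: its state and
  output stay zero, so that the closed loop maps \<open>(u, - C v)\<close> to \<open>(C v, 0)\<close>.\<close>

lemma attenuation_gain:
  assumes A: "A \<in> carrier_mat n n" and B: "B \<in> carrier_mat n m" and C: "C \<in> carrier_mat r n"
    and g: "g \<in> attenuation_levels n m r A B C" and \<mu>: "0 \<le> Re \<mu>"
    and v: "v \<in> carrier_vec n" and u: "u \<in> carrier_vec m"
    and eq: "\<mu> \<cdot>\<^sub>v v = map_mat complex_of_real A *\<^sub>v v + map_mat complex_of_real B *\<^sub>v u"
  shows "(vnorm (map_mat complex_of_real C *\<^sub>v v))\<^sup>2
      \<le> (max g 0)\<^sup>2 * ((vnorm u)\<^sup>2 + (vnorm (map_mat complex_of_real C *\<^sub>v v))\<^sup>2)"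
    "u = 0\<^sub>v m \<Longrightarrow> map_mat complex_of_real C *\<^sub>v v = 0\<^sub>v r \<Longrightarrow> v = 0\<^sub>v n"
proof -
  let ?c = "map_mat complex_of_real"
  from g obtain q KA KB KC KD where K: "KA \<in> carrier_mat q q" "KB \<in> carrier_mat q r" "KC \<in> carrier_mat m q"
      "KD \<in> carrier_mat m r"
    and hur: "hurwitz (cl_A A B C KA KB KC KD)"
    and norm: "hinf_norm (cl_A A B C KA KB KC KD) (cl_B m q B KB KD) (cl_C r q C KC KD) (cl_D m r KD) < ereal g"
    unfolding attenuation_levels_def by blast
  let ?P = "cl_A A B C KA KB KC KD" and ?Q = "cl_B m q B KB KD" and ?R = "cl_C r q C KC KD" and ?S = "cl_D m r KD"
  have cP: "?P \<in> carrier_mat (n + q) (n + q)" using A B C K unfolding cl_A_def by (intro four_block_carrier_mat) auto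
  have cQ: "?Q \<in> carrier_mat (n + q) (m + r)" using B K unfolding cl_B_def by (intro four_block_carrier_mat) auto
  have cR: "?R \<in> carrier_mat (r + m) (n + q)" using C K unfolding cl_C_def by (intro four_block_carrier_mat) auto
  have cS: "?S \<in> carrier_mat (r + m) (m + r)" using K unfolding cl_D_def by (intro four_block_carrier_mat) auto
  have cc: "?c A \<in> carrier_mat n n" "?c B \<in> carrier_mat n m" "?c C \<in> carrier_mat r n"
    "?c KA \<in> carrier_mat q q" "?c KB \<in> carrier_mat q r" "?c KC \<in> carrier_mat m q" "?c KD \<in> carrier_mat m r"
    using A B C K by auto
  let ?y = "?c C *\<^sub>v v"
  let ?k = "?c KD *\<^sub>v ?y"
  have y: "?y \<in> carrier_vec r" using cc(3) v by (rule mult_mat_vec_carrier)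
  have k: "?k \<in> carrier_vec m" using cc(7) y by (rule mult_mat_vec_carrier)
  have Bk: "?c B *\<^sub>v ?k \<in> carrier_vec n" using cc(2) k by (rule mult_mat_vec_carrier)
  have KBy: "?c KB *\<^sub>v ?y \<in> carrier_vec q" using cc(5) y by (rule mult_mat_vec_carrier)
  have Av: "?c A *\<^sub>v v \<in> carrier_vec n" using cc(1) v by (rule mult_mat_vec_carrier)
  have Bu: "?c B *\<^sub>v u \<in> carrier_vec n" using cc(2) u by (rule mult_mat_vec_carrier)
  let ?z = "v @\<^sub>v 0\<^sub>v q" and ?w = "u @\<^sub>v (- ?y)"
  have z: "?z \<in> carrier_vec (n + q)" and w: "?w \<in> carrier_vec (m + r)" using v u y by auto
  have neg: "M *\<^sub>v (- x) = - (M *\<^sub>v x)" if "M \<in> carrier_mat a b" "x \<in> carrier_vec b" for M :: "complex mat" and x a b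
    using that by (intro eq_vecI) (auto simp: scalar_prod_lessThan sum_negf)
  have BK: "?c (B * KD) = ?c B * ?c KD" by (rule of_real_hom.mat_hom_mult[OF B K(4)])
  have BKy: "?c (B * KD) *\<^sub>v ?y = ?c B *\<^sub>v ?k" unfolding BK by (rule assoc_mult_mat_vec[OF cc(2) cc(7) y])
  have cBK: "?c (B * KD) \<in> carrier_mat n r" using B K by auto
  have Pz: "?c ?P *\<^sub>v ?z = (?c A *\<^sub>v v + ?c B *\<^sub>v ?k) @\<^sub>v (?c KB *\<^sub>v ?y)"
  proof -
    have blocks: "A + B * KD * C \<in> carrier_mat n n" "B * KC \<in> carrier_mat n q" "KB * C \<in> carrier_mat q n"
      using A B C K by auto
    have "?c ?P *\<^sub>v ?z = (?c (A + B * KD * C) *\<^sub>v v + ?c (B * KC) *\<^sub>v 0\<^sub>v q)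
        @\<^sub>v (?c (KB * C) *\<^sub>v v + ?c KA *\<^sub>v 0\<^sub>v q)"
      unfolding cl_A_def map_four_block_mat[OF blocks K(1)]
      by (rule four_block_mat_mult_vec) (use blocks K v in auto)
    moreover have "?c (A + B * KD * C) *\<^sub>v v = ?c A *\<^sub>v v + ?c B *\<^sub>v ?k"
    proof -
      have "?c (A + B * KD * C) = ?c A + ?c (B * KD * C)" using A B C K by (intro eq_matI) auto
      also have "?c (B * KD * C) = ?c (B * KD) * ?c C"
        by (rule of_real_hom.mat_hom_mult[of _ n r]) (use B C K in auto)
      also have "(?c A + \<dots>) *\<^sub>v v = ?c A *\<^sub>v v + (?c (B * KD) * ?c C) *\<^sub>v v"
        by (rule add_mult_distrib_mat_vec[OF cc(1) mult_carrier_mat[OF cBK cc(3)] v])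
      also have "(?c (B * KD) * ?c C) *\<^sub>v v = ?c (B * KD) *\<^sub>v ?y"
        by (rule assoc_mult_mat_vec[OF cBK cc(3) v])
      finally show ?thesis unfolding BKy .
    qed
    moreover have "?c (KB * C) *\<^sub>v v = ?c KB *\<^sub>v ?y"
      unfolding of_real_hom.mat_hom_mult[OF K(2) C] by (rule assoc_mult_mat_vec[OF cc(5) cc(3) v])
    moreover have "?c (B * KC) *\<^sub>v 0\<^sub>v q = 0\<^sub>v n" "?c KA *\<^sub>v 0\<^sub>v q = 0\<^sub>v q"
      using B K by (auto intro!: mult_zero_vec)
    ultimately show ?thesis using Av Bk KBy by simp
  qed
  have Qw: "?c ?Q *\<^sub>v ?w = (?c B *\<^sub>v u + - (?c B *\<^sub>v ?k)) @\<^sub>v (- (?c KB *\<^sub>v ?y))"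
  proof -
    have blocks: "B * KD \<in> carrier_mat n r" "0\<^sub>m q m \<in> carrier_mat q m"
      using B K by auto
    have "?c ?Q *\<^sub>v ?w = (?c B *\<^sub>v u + ?c (B * KD) *\<^sub>v (- ?y)) @\<^sub>v (?c (0\<^sub>m q m) *\<^sub>v u + ?c KB *\<^sub>v (- ?y))"
      unfolding cl_B_def map_four_block_mat[OF B blocks K(2)]
      by (rule four_block_mat_mult_vec) (use blocks B K u y in auto)
    moreover have "?c (0\<^sub>m q m) = 0\<^sub>m q m" by (rule eq_matI) auto
    ultimately show ?thesis
      using u KBy by (simp add: neg[OF cBK y] neg[OF cc(5) y] BKy)
  qed
  have state: "\<mu> \<cdot>\<^sub>v ?z = ?c ?P *\<^sub>v ?z + ?c ?Q *\<^sub>v ?w"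
  proof -
    have "?c ?P *\<^sub>v ?z + ?c ?Q *\<^sub>v ?w
        = ((?c A *\<^sub>v v + ?c B *\<^sub>v ?k) + (?c B *\<^sub>v u + - (?c B *\<^sub>v ?k))) @\<^sub>v (?c KB *\<^sub>v ?y + - (?c KB *\<^sub>v ?y))"
      unfolding Pz Qw by (rule append_vec_add[of _ n _ _ q]) (use Av Bk Bu KBy in auto)
    \<comment> \<open>The feedthrough of the measurement through \<open>KD\<close> cancels against
      the response to the disturbance - C v.\<close>
    also have "(?c A *\<^sub>v v + ?c B *\<^sub>v ?k) + (?c B *\<^sub>v u + - (?c B *\<^sub>v ?k)) = \<mu> \<cdot>\<^sub>v v"
      unfolding eq using A B by (intro eq_vecI) (auto simp del: index_mult_mat_vec)
    also have "?c KB *\<^sub>v ?y + - (?c KB *\<^sub>v ?y) = 0\<^sub>v q"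
      using K by (intro eq_vecI) (auto simp del: index_mult_mat_vec)
    also have "(\<mu> \<cdot>\<^sub>v v) @\<^sub>v 0\<^sub>v q = \<mu> \<cdot>\<^sub>v ?z"
      using v by (intro eq_vecI) auto
    finally show ?thesis ..
  qed
  have out: "?c ?R *\<^sub>v ?z + ?c ?S *\<^sub>v ?w = ?y @\<^sub>v 0\<^sub>v m"
  proof -
    have b1: "0\<^sub>m r q \<in> carrier_mat r q" "KD * C \<in> carrier_mat m n" using C K by auto
    have "?c ?R *\<^sub>v ?z = (?c C *\<^sub>v v + ?c (0\<^sub>m r q) *\<^sub>v 0\<^sub>v q) @\<^sub>v (?c (KD * C) *\<^sub>v v + ?c KC *\<^sub>v 0\<^sub>v q)"
      unfolding cl_C_def map_four_block_mat[OF C b1 K(3)]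
      by (rule four_block_mat_mult_vec) (use C K v in auto)
    moreover have "?c (KD * C) *\<^sub>v v = ?k"
      unfolding of_real_hom.mat_hom_mult[OF K(4) C] by (rule assoc_mult_mat_vec[OF cc(7) cc(3) v])
    moreover have "?c (0\<^sub>m r q) = 0\<^sub>m r q" by (rule eq_matI) auto
    ultimately have R: "?c ?R *\<^sub>v ?z = ?y @\<^sub>v ?k"
      using mult_zero_vec[OF cc(6)] y k by simp
    have b2: "0\<^sub>m r m \<in> carrier_mat r m" "0\<^sub>m r r \<in> carrier_mat r r" "0\<^sub>m m m \<in> carrier_mat m m" by auto
    have "?c ?S *\<^sub>v ?w = (?c (0\<^sub>m r m) *\<^sub>v u + ?c (0\<^sub>m r r) *\<^sub>v (- ?y)) @\<^sub>v (?c (0\<^sub>m m m) *\<^sub>v u + ?c KD *\<^sub>v (- ?y))"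
      unfolding cl_D_def map_four_block_mat[OF b2 K(4)]
      by (rule four_block_mat_mult_vec) (use K u y in auto)
    moreover have "?c (0\<^sub>m a b) = 0\<^sub>m a b" for a b by (rule eq_matI) auto
    ultimately have S: "?c ?S *\<^sub>v ?w = 0\<^sub>v r @\<^sub>v (- ?k)"
      using u y k C by (simp add: neg[OF cc(7) y])
    have "?c ?R *\<^sub>v ?z + ?c ?S *\<^sub>v ?w = (?y + 0\<^sub>v r) @\<^sub>v (?k + - ?k)"
      unfolding R S by (rule append_vec_add[of _ r _ _ m]) (use y k in auto)
    also have "?y + 0\<^sub>v r = ?y" using y by simp
    also have "?k + - ?k = 0\<^sub>v m" using K by (intro eq_vecI) (auto simp del: index_mult_mat_vec)
    finally show ?thesis .
  qed
  have "vnorm (?y @\<^sub>v 0\<^sub>v m) \<le> g * vnorm ?w"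
    using hinf_norm_bound[OF cP cQ cR cS hur norm \<mu> z w state] unfolding out .
  \<comment> \<open>With \<open>max g 0\<close> in place of \<open>g\<close>, bounds such as g < 1
    and g < \<gamma> pass to squares without a proof that a level is positive.\<close>
  also have "\<dots> \<le> max g 0 * vnorm ?w" by (intro mult_right_mono) auto
  finally have "(vnorm (?y @\<^sub>v 0\<^sub>v m))\<^sup>2 \<le> (max g 0 * vnorm ?w)\<^sup>2" by (intro power_mono) auto
  moreover have "vnorm (- ?y) = vnorm ?y" by (rule vnorm_uminus)
  moreover have "vnorm (0\<^sub>v m :: complex vec) = 0" by (simp add: vnorm_eq_0_iff)
  ultimately show "(vnorm ?y)\<^sup>2 \<le> (max g 0)\<^sup>2 * ((vnorm u)\<^sup>2 + (vnorm ?y)\<^sup>2)"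
    by (simp add: vnorm_append_sq power_mult_distrib)
  assume u0: "u = 0\<^sub>v m" and y0: "?y = 0\<^sub>v r"
  show "v = 0\<^sub>v n"
  proof (rule ccontr)
    assume nz: "v \<noteq> 0\<^sub>v n"
    \<comment> \<open>Without disturbance \<open>?z\<close> would be an eigenvector of the closed
      loop for \<mu>, against the Hurwitz property. In effect this is the Popov-Belevitch-Hautus
      test for detectability.\<close>
    have "?c ?Q *\<^sub>v ?w = 0\<^sub>v (n + q)"
    proof -
      have "?w = 0\<^sub>v (m + r)" unfolding u0 y0 by (rule eq_vecI) auto
      then show ?thesis using cQ by (simp add: mult_zero_vec)
    qed
    then have "?c ?P *\<^sub>v ?z = \<mu> \<cdot>\<^sub>v ?z" using state cP z by (simp add: mult_mat_vec_carrier)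
    moreover have "?z \<noteq> 0\<^sub>v (n + q)"
    proof
      assume "?z = 0\<^sub>v (n + q)"
      also have "0\<^sub>v (n + q) = 0\<^sub>v n @\<^sub>v 0\<^sub>v q" by (rule eq_vecI) auto
      finally show False using append_vec_eq[OF v zero_carrier_vec] nz by simp
    qed
    ultimately have "eigenvalue (?c ?P) \<mu>"
      unfolding eigenvalue_def eigenvector_def using cP z by (intro exI[of _ ?z]) auto
    then show False using hur \<mu> unfolding hurwitz_def by fastforce
  qed
qed

text \<open>The gain inequality for v = a + i b and u = p + i q at \<mu> = \<alpha> + i \<omega>, in
  the form that can be combined with the real Riccati equation.\<close>

lemma attenuation_gain_real:
  assumes A: "A \<in> carrier_mat n n" and B: "B \<in> carrier_mat n m" and C: "C \<in> carrier_mat r n"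
    and g: "g \<in> attenuation_levels n m r A B C" and \<alpha>: "0 \<le> \<alpha>"
    and ab: "a \<in> carrier_vec n" "b \<in> carrier_vec n" and pq: "p \<in> carrier_vec m" "q \<in> carrier_vec m"
    and eq: "\<alpha> \<cdot>\<^sub>v a - \<omega> \<cdot>\<^sub>v b = A *\<^sub>v a + B *\<^sub>v p" "\<alpha> \<cdot>\<^sub>v b + \<omega> \<cdot>\<^sub>v a = A *\<^sub>v b + B *\<^sub>v q"
  defines "y \<equiv> (C *\<^sub>v a) \<bullet> (C *\<^sub>v a) + (C *\<^sub>v b) \<bullet> (C *\<^sub>v b)"
  shows "y \<le> (max g 0)\<^sup>2 * (p \<bullet> p + q \<bullet> q + y)"
    "p \<bullet> p + q \<bullet> q = 0 \<Longrightarrow> y = 0 \<Longrightarrow> a = 0\<^sub>v n \<and> b = 0\<^sub>v n"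
proof -
  let ?c = "map_mat complex_of_real"
  let ?v = "complex_vec a b" and ?u = "complex_vec p q"
  have c: "C *\<^sub>v a \<in> carrier_vec r" "C *\<^sub>v b \<in> carrier_vec r" "A *\<^sub>v a \<in> carrier_vec n" "A *\<^sub>v b \<in> carrier_vec n"
    "B *\<^sub>v p \<in> carrier_vec n" "B *\<^sub>v q \<in> carrier_vec n"
    using A B C ab pq by (auto intro: mult_mat_vec_carrier)
  have Cv: "?c C *\<^sub>v ?v = complex_vec (C *\<^sub>v a) (C *\<^sub>v b)" by (rule mult_complex_vec[OF C ab])
  have "Complex \<alpha> \<omega> \<cdot>\<^sub>v ?v = ?c A *\<^sub>v ?v + ?c B *\<^sub>v ?u"
    unfolding smult_complex_vec[OF ab] mult_complex_vec[OF A ab] mult_complex_vec[OF B pq]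
      complex_vec_add[OF c(3) c(4) c(5) c(6)] eq ..
  note gain = attenuation_gain[OF A B C g _ _ _ this]
  have ny: "(vnorm (?c C *\<^sub>v ?v))\<^sup>2 = y" unfolding Cv y_def by (rule vnorm_complex_vec_sq[OF c(1) c(2)])
  have nu: "(vnorm ?u)\<^sup>2 = p \<bullet> p + q \<bullet> q" by (rule vnorm_complex_vec_sq[OF pq])
  show "y \<le> (max g 0)\<^sup>2 * (p \<bullet> p + q \<bullet> q + y)"
    using gain(1) \<alpha> ab pq unfolding ny nu by simp
  assume "p \<bullet> p + q \<bullet> q = 0" "y = 0"
  then have "vnorm ?u = 0" "vnorm (?c C *\<^sub>v ?v) = 0" using ny nu by auto
  then have "?u = 0\<^sub>v m" "?c C *\<^sub>v ?v = 0\<^sub>v r"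
    using pq C by (simp_all add: vnorm_eq_0_iff complex_vec_def)
  then have "?v = 0\<^sub>v n" using gain(2) \<alpha> ab pq by simp
  then show "a = 0\<^sub>v n \<and> b = 0\<^sub>v n" using complex_vec_zero_iff[OF ab] by simp
qed

section \<open>Spectra of the plant and of the closed loop\<close>

lemma hurwitzI:
  assumes M: "M \<in> carrier_mat n n"
    and no: "\<And>a b \<alpha> \<omega>. a \<in> carrier_vec n \<Longrightarrow> b \<in> carrier_vec n \<Longrightarrow> 0 \<le> \<alpha> \<Longrightarrow>
      M *\<^sub>v a = \<alpha> \<cdot>\<^sub>v a - \<omega> \<cdot>\<^sub>v b \<Longrightarrow> M *\<^sub>v b = \<alpha> \<cdot>\<^sub>v b + \<omega> \<cdot>\<^sub>v a \<Longrightarrow> a = 0\<^sub>v n \<and> b = 0\<^sub>v n"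
  shows "hurwitz M"
  unfolding hurwitz_def eigenvalue_real_pair[OF M]
proof (intro allI impI)
  fix z assume "\<exists>a b. a \<in> carrier_vec n \<and> b \<in> carrier_vec n \<and> (a \<noteq> 0\<^sub>v n \<or> b \<noteq> 0\<^sub>v n) \<and>
       M *\<^sub>v a = Re z \<cdot>\<^sub>v a - Im z \<cdot>\<^sub>v b \<and> M *\<^sub>v b = Re z \<cdot>\<^sub>v b + Im z \<cdot>\<^sub>v a"
  then obtain a b where ab: "a \<in> carrier_vec n" "b \<in> carrier_vec n" "a \<noteq> 0\<^sub>v n \<or> b \<noteq> 0\<^sub>v n"
    "M *\<^sub>v a = Re z \<cdot>\<^sub>v a - Im z \<cdot>\<^sub>v b" "M *\<^sub>v b = Re z \<cdot>\<^sub>v b + Im z \<cdot>\<^sub>v a" by blast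
  show "Re z < 0"
  proof (rule ccontr)
    assume "\<not> Re z < 0"
    then have "a = 0\<^sub>v n \<and> b = 0\<^sub>v n" using no[OF ab(1,2) _ ab(4,5)] by simp
    then show False using ab(3) by simp
  qed
qed

text \<open>Exhibits the closed loop as the plant driven by the feedback input - \<eta> B^T X y,
  which is what the gain inequality is applied to.\<close>

lemma closed_loop_mult_vec:
  fixes A B X :: "real mat"
  assumes A: "A \<in> carrier_mat n n" and B: "B \<in> carrier_mat n m" and X: "X \<in> carrier_mat n n" and y: "y \<in> carrier_vec n"
  shows "(A - \<eta> \<cdot>\<^sub>m (B * B\<^sup>T * X)) *\<^sub>v y = A *\<^sub>v y + B *\<^sub>v (- \<eta> \<cdot>\<^sub>v (B\<^sup>T *\<^sub>v (X *\<^sub>v y)))"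
proof -
  have cBB: "B * B\<^sup>T \<in> carrier_mat n n" and cBBX: "B * B\<^sup>T * X \<in> carrier_mat n n" using B X by auto
  have Xy: "X *\<^sub>v y \<in> carrier_vec n" using X y by (rule mult_mat_vec_carrier)
  have BXy: "B\<^sup>T *\<^sub>v (X *\<^sub>v y) \<in> carrier_vec m" using B Xy by (intro mult_mat_vec_carrier[of _ m n]) auto
  have "(A - \<eta> \<cdot>\<^sub>m (B * B\<^sup>T * X)) *\<^sub>v y = A *\<^sub>v y - \<eta> \<cdot>\<^sub>v ((B * B\<^sup>T * X) *\<^sub>v y)"
    unfolding minus_mult_distrib_mat_vec[OF A smult_carrier_mat[OF cBBX] y] smult_mat_mult_vec[OF cBBX y] ..
  also have "(B * B\<^sup>T * X) *\<^sub>v y = B *\<^sub>v (B\<^sup>T *\<^sub>v (X *\<^sub>v y))"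
    unfolding assoc_mult_mat_vec[OF cBB X y] by (rule assoc_mult_mat_vec[OF B _ Xy]) (use B in simp)
  also have "A *\<^sub>v y - \<eta> \<cdot>\<^sub>v (B *\<^sub>v (B\<^sup>T *\<^sub>v (X *\<^sub>v y))) = A *\<^sub>v y + B *\<^sub>v (- \<eta> \<cdot>\<^sub>v (B\<^sup>T *\<^sub>v (X *\<^sub>v y)))"
    unfolding mult_mat_vec[OF B BXy] using A B by (intro eq_vecI) (auto simp del: index_mult_mat_vec)
  finally show ?thesis .
qed

text \<open>Here \<open>a + i b\<close> is an eigenvector of the closed loop for the eigenvalue \<open>\<alpha> + i \<omega>\<close>.\<close>

lemma ARE_closed_loop_balance:
  assumes A: "A \<in> carrier_mat n n" and B: "B \<in> carrier_mat n m" and C: "C \<in> carrier_mat r n"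
    and X: "X \<in> carrier_mat n n" "X\<^sup>T = X" and ARE: "hinf_ARE n \<eta> A B C X"
    and ab: "a \<in> carrier_vec n" "b \<in> carrier_vec n"
    and eq: "(A - \<eta> \<cdot>\<^sub>m (B * B\<^sup>T * X)) *\<^sub>v a = \<alpha> \<cdot>\<^sub>v a - \<omega> \<cdot>\<^sub>v b" "(A - \<eta> \<cdot>\<^sub>m (B * B\<^sup>T * X)) *\<^sub>v b = \<alpha> \<cdot>\<^sub>v b + \<omega> \<cdot>\<^sub>v a"
  shows "2 * \<alpha> * (a \<bullet> (X *\<^sub>v a) + b \<bullet> (X *\<^sub>v b)) + ((C *\<^sub>v a) \<bullet> (C *\<^sub>v a) + (C *\<^sub>v b) \<bullet> (C *\<^sub>v b))
      + \<eta> * ((B\<^sup>T *\<^sub>v (X *\<^sub>v a)) \<bullet> (B\<^sup>T *\<^sub>v (X *\<^sub>v a)) + (B\<^sup>T *\<^sub>v (X *\<^sub>v b)) \<bullet> (B\<^sup>T *\<^sub>v (X *\<^sub>v b))) = 0"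
proof -
  let ?M = "A - \<eta> \<cdot>\<^sub>m (B * B\<^sup>T * X)"
  \<comment> \<open>In terms of the closed loop matrix the quadratic term changes sign: M^T X + X M
    + C^T C + \<eta> X B B^T X = 0.\<close>
  have one: "2 * ((?M *\<^sub>v x) \<bullet> (X *\<^sub>v x)) + (C *\<^sub>v x) \<bullet> (C *\<^sub>v x)
      + \<eta> * ((B\<^sup>T *\<^sub>v (X *\<^sub>v x)) \<bullet> (B\<^sup>T *\<^sub>v (X *\<^sub>v x))) = 0" if x: "x \<in> carrier_vec n" for x
  proof -
    let ?z = "B\<^sup>T *\<^sub>v (X *\<^sub>v x)"
    have Xx: "X *\<^sub>v x \<in> carrier_vec n" using X(1) x by (rule mult_mat_vec_carrier)
    have z: "?z \<in> carrier_vec m" using B Xx by (intro mult_mat_vec_carrier[of _ m n]) auto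
    have Ax: "A *\<^sub>v x \<in> carrier_vec n" using A x by (rule mult_mat_vec_carrier)
    have z': "- \<eta> \<cdot>\<^sub>v ?z \<in> carrier_vec m" using z by simp
    have Bz: "B *\<^sub>v (- \<eta> \<cdot>\<^sub>v ?z) \<in> carrier_vec n" using B z' by (rule mult_mat_vec_carrier)
    have "(?M *\<^sub>v x) \<bullet> (X *\<^sub>v x) = (A *\<^sub>v x) \<bullet> (X *\<^sub>v x) + (B *\<^sub>v (- \<eta> \<cdot>\<^sub>v ?z)) \<bullet> (X *\<^sub>v x)"
      unfolding closed_loop_mult_vec[OF A B X(1) x] by (rule add_scalar_prod_distrib[OF Ax Bz Xx])
    also have "(B *\<^sub>v (- \<eta> \<cdot>\<^sub>v ?z)) \<bullet> (X *\<^sub>v x) = (X *\<^sub>v x) \<bullet> (B *\<^sub>v (- \<eta> \<cdot>\<^sub>v ?z))"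
      using Bz Xx by (intro scalar_prod_comm_real) (simp only: carrier_vecD)
    also have "\<dots> = ?z \<bullet> (- \<eta> \<cdot>\<^sub>v ?z)"
      by (rule transpose_mult_scalar_prod[OF B carrier_vecD[OF Xx] carrier_vecD[OF z'], symmetric])
    also have "\<dots> = - \<eta> * (?z \<bullet> ?z)" by simp
    finally have 1: "(?M *\<^sub>v x) \<bullet> (X *\<^sub>v x) = (A *\<^sub>v x) \<bullet> (X *\<^sub>v x) - \<eta> * (?z \<bullet> ?z)" by simp
    have "(X *\<^sub>v x) \<bullet> (A *\<^sub>v x) = (A *\<^sub>v x) \<bullet> (X *\<^sub>v x)"
      using Ax Xx by (intro scalar_prod_comm_real) (simp only: carrier_vecD)
    then show ?thesis
      using hinf_ARE_carrier_eq[OF ARE A B C X x x] 1 by simp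
  qed
  have c: "X *\<^sub>v a \<in> carrier_vec n" "X *\<^sub>v b \<in> carrier_vec n"
    using mult_mat_vec_carrier[OF X(1) ab(1)] mult_mat_vec_carrier[OF X(1) ab(2)] by auto
  \<comment> \<open>The rotation by \<omega> couples a and b; symmetry of X makes its two
    contributions cancel.\<close>
  have sym: "b \<bullet> (X *\<^sub>v a) = a \<bullet> (X *\<^sub>v b)"
  proof -
    have "b \<bullet> (X *\<^sub>v a) = (X\<^sup>T *\<^sub>v b) \<bullet> a"
      by (rule transpose_mult_scalar_prod[OF X(1) carrier_vecD[OF ab(2)] carrier_vecD[OF ab(1)], symmetric])
    also have "\<dots> = a \<bullet> (X *\<^sub>v b)"
      unfolding X(2) using ab c by (intro scalar_prod_comm_real) (simp only: carrier_vecD)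
    finally show ?thesis .
  qed
  have "(\<alpha> \<cdot>\<^sub>v a - \<omega> \<cdot>\<^sub>v b) \<bullet> (X *\<^sub>v a) = \<alpha> * (a \<bullet> (X *\<^sub>v a)) - \<omega> * (b \<bullet> (X *\<^sub>v a))"
    using ab c by (simp add: minus_scalar_prod_distrib[of _ n])
  moreover have "(\<alpha> \<cdot>\<^sub>v b + \<omega> \<cdot>\<^sub>v a) \<bullet> (X *\<^sub>v b) = \<alpha> * (b \<bullet> (X *\<^sub>v b)) + \<omega> * (a \<bullet> (X *\<^sub>v b))"
    using ab c by (simp add: add_scalar_prod_distrib[of _ n])
  ultimately show ?thesis
    using one[OF ab(1)] one[OF ab(2)] unfolding eq sym by (simp add: algebra_simps)
qed

text \<open>For \<eta> > 0 and \<alpha> \<ge> 0 all terms of the balance are nonnegative, hence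
  zero. Output and feedback input vanish on the eigenvector, and detectability makes the eigenvector
  zero.\<close>

lemma closed_loop_hurwitz_pos:
  assumes A: "A \<in> carrier_mat n n" and B: "B \<in> carrier_mat n m" and C: "C \<in> carrier_mat r n"
    and g: "g \<in> attenuation_levels n m r A B C" and \<eta>: "\<eta> > 0"
    and X: "pos_semidef n X" "symmetric_matrix X" and ARE: "hinf_ARE n \<eta> A B C X"
  shows "hurwitz (A - \<eta> \<cdot>\<^sub>m (B * B\<^sup>T * X))" (is "hurwitz ?M")
proof (rule hurwitzI)
  have cX: "X \<in> carrier_mat n n" "X\<^sup>T = X" and psd: "\<And>x. x \<in> carrier_vec n \<Longrightarrow> 0 \<le> x \<bullet> (X *\<^sub>v x)"
    using X unfolding pos_semidef_def symmetric_matrix_def by auto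
  show "?M \<in> carrier_mat n n" using B cX by (intro minus_carrier_mat smult_carrier_mat) auto
  fix a b :: "real vec" and \<alpha> \<omega> :: real
  assume ab: "a \<in> carrier_vec n" "b \<in> carrier_vec n" and \<alpha>: "0 \<le> \<alpha>"
    and eq: "?M *\<^sub>v a = \<alpha> \<cdot>\<^sub>v a - \<omega> \<cdot>\<^sub>v b" "?M *\<^sub>v b = \<alpha> \<cdot>\<^sub>v b + \<omega> \<cdot>\<^sub>v a"
  let ?p = "- \<eta> \<cdot>\<^sub>v (B\<^sup>T *\<^sub>v (X *\<^sub>v a))" and ?q = "- \<eta> \<cdot>\<^sub>v (B\<^sup>T *\<^sub>v (X *\<^sub>v b))"
  let ?P = "(B\<^sup>T *\<^sub>v (X *\<^sub>v a)) \<bullet> (B\<^sup>T *\<^sub>v (X *\<^sub>v a)) + (B\<^sup>T *\<^sub>v (X *\<^sub>v b)) \<bullet> (B\<^sup>T *\<^sub>v (X *\<^sub>v b))"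
  let ?Y = "(C *\<^sub>v a) \<bullet> (C *\<^sub>v a) + (C *\<^sub>v b) \<bullet> (C *\<^sub>v b)"
  have "0 \<le> 2 * \<alpha> * (a \<bullet> (X *\<^sub>v a) + b \<bullet> (X *\<^sub>v b))" using \<alpha> psd ab by simp
  moreover have "0 \<le> ?Y" "0 \<le> \<eta> * ?P" using \<eta> by (simp_all add: scalar_prod_self_nonneg)
  ultimately have "?Y = 0" "\<eta> * ?P = 0"
    using ARE_closed_loop_balance[OF A B C cX ARE ab eq] by linarith+
  moreover have "?p \<bullet> ?p + ?q \<bullet> ?q = \<eta> * (\<eta> * ?P)" by (simp add: algebra_simps)
  moreover have "?p \<in> carrier_vec m" "?q \<in> carrier_vec m" using B by (auto intro!: carrier_vecI)
  ultimately show "a = 0\<^sub>v n \<and> b = 0\<^sub>v n"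
    using attenuation_gain_real(2)[OF A B C g \<alpha> ab, of ?p ?q \<omega>] eq
    unfolding closed_loop_mult_vec[OF A B cX(1) ab(1)] closed_loop_mult_vec[OF A B cX(1) ab(2)] by simp
qed

text \<open>With zero input the gain inequality reads |C v|^2 \<le> g^2 |C v|^2. For g < 1 the
  output vanishes, and detectability gives v = 0.\<close>

lemma plant_hurwitz:
  assumes A: "A \<in> carrier_mat n n" and B: "B \<in> carrier_mat n m" and C: "C \<in> carrier_mat r n"
    and g: "g \<in> attenuation_levels n m r A B C" "g < 1"
  shows "hurwitz A"
proof (rule hurwitzI[OF A])
  fix a b :: "real vec" and \<alpha> \<omega> :: real
  assume ab: "a \<in> carrier_vec n" "b \<in> carrier_vec n" and \<alpha>: "0 \<le> \<alpha>"
    and eq: "A *\<^sub>v a = \<alpha> \<cdot>\<^sub>v a - \<omega> \<cdot>\<^sub>v b" "A *\<^sub>v b = \<alpha> \<cdot>\<^sub>v b + \<omega> \<cdot>\<^sub>v a"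
  let ?Y = "(C *\<^sub>v a) \<bullet> (C *\<^sub>v a) + (C *\<^sub>v b) \<bullet> (C *\<^sub>v b)"
  have B0: "B *\<^sub>v 0\<^sub>v m = 0\<^sub>v n" by (rule mult_zero_vec[OF B])
  have eq': "\<alpha> \<cdot>\<^sub>v a - \<omega> \<cdot>\<^sub>v b = A *\<^sub>v a + B *\<^sub>v 0\<^sub>v m" "\<alpha> \<cdot>\<^sub>v b + \<omega> \<cdot>\<^sub>v a = A *\<^sub>v b + B *\<^sub>v 0\<^sub>v m"
    unfolding B0 eq[symmetric] using A by (auto intro!: carrier_vecI right_zero_vec[symmetric])
  note gain = attenuation_gain_real[OF A B C g(1) \<alpha> ab zero_carrier_vec zero_carrier_vec eq']
  have "(max g 0)\<^sup>2 < 1" using g(2) by (simp add: power_less_one_iff abs_square_less_1)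
  moreover have "0 \<le> ?Y" by (simp add: scalar_prod_self_nonneg)
  moreover have "?Y \<le> (max g 0)\<^sup>2 * ?Y" using gain(1) by simp
  ultimately have "?Y = 0"
    using mult_strict_right_mono[of "(max g 0)\<^sup>2" 1 ?Y] by fastforce
  then show "a = 0\<^sub>v n \<and> b = 0\<^sub>v n" using gain(2) by simp
qed

text \<open>At \<alpha> = 0 the form of \<open>X\<close> drops out of the balance, leaving |C v|^2 =
  - \<eta> P with P = |B^T X v|^2, while the feedback input has |u|^2 = \<eta>^2 P. If P were
  positive, the gain inequality would become 1 \<le> g'(1 - \<eta>) = g' / \<gamma>^2, although g' <
  \<gamma>^2 for the squared level g'.\<close>

lemma closed_loop_no_imaginary_eigenvalue:
  assumes A: "A \<in> carrier_mat n n" and B: "B \<in> carrier_mat n m" and C: "C \<in> carrier_mat r n"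
    and g: "g \<in> attenuation_levels n m r A B C" "g < \<gamma>" and \<gamma>: "0 < \<gamma>" "\<gamma> < 1"
    and \<eta>: "\<eta> = 1 - 1 / \<gamma>\<^sup>2"
    and X: "X \<in> carrier_mat n n" "X\<^sup>T = X" and ARE: "hinf_ARE n \<eta> A B C X"
    and ab: "a \<in> carrier_vec n" "b \<in> carrier_vec n"
    and eq: "(A - \<eta> \<cdot>\<^sub>m (B * B\<^sup>T * X)) *\<^sub>v a = 0 \<cdot>\<^sub>v a - \<omega> \<cdot>\<^sub>v b"
      "(A - \<eta> \<cdot>\<^sub>m (B * B\<^sup>T * X)) *\<^sub>v b = 0 \<cdot>\<^sub>v b + \<omega> \<cdot>\<^sub>v a"
  shows "a = 0\<^sub>v n \<and> b = 0\<^sub>v n"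
proof -
  let ?p = "- \<eta> \<cdot>\<^sub>v (B\<^sup>T *\<^sub>v (X *\<^sub>v a))" and ?q = "- \<eta> \<cdot>\<^sub>v (B\<^sup>T *\<^sub>v (X *\<^sub>v b))"
  define P where "P = (B\<^sup>T *\<^sub>v (X *\<^sub>v a)) \<bullet> (B\<^sup>T *\<^sub>v (X *\<^sub>v a)) + (B\<^sup>T *\<^sub>v (X *\<^sub>v b)) \<bullet> (B\<^sup>T *\<^sub>v (X *\<^sub>v b))"
  define Y where "Y = (C *\<^sub>v a) \<bullet> (C *\<^sub>v a) + (C *\<^sub>v b) \<bullet> (C *\<^sub>v b)"
  define g' where "g' = (max g 0)\<^sup>2"
  have pq: "?p \<in> carrier_vec m" "?q \<in> carrier_vec m" using B by (auto intro!: carrier_vecI)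
  have PP: "?p \<bullet> ?p + ?q \<bullet> ?q = \<eta>\<^sup>2 * P" by (simp add: P_def algebra_simps power2_eq_square)
  have P0: "0 \<le> P" by (simp add: P_def scalar_prod_self_nonneg)
  have "Y + \<eta> * P = 0" using ARE_closed_loop_balance[OF A B C X ARE ab eq] by (simp add: Y_def P_def)
  then have Y: "Y = - \<eta> * P" by simp
  note gain = attenuation_gain_real[OF A B C g(1) order_refl ab pq, of \<omega>, folded Y_def,
      OF eq(1)[unfolded closed_loop_mult_vec[OF A B X(1) ab(1)], symmetric]
         eq(2)[unfolded closed_loop_mult_vec[OF A B X(1) ab(2)], symmetric], unfolded PP, folded g'_def]
  have "P = 0"
  proof (rule ccontr)
    assume "P \<noteq> 0"
    then have Ppos: "0 < P" using P0 by simp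
    have g'\<gamma>: "g' < \<gamma>\<^sup>2" using g(2) \<gamma>(1) unfolding g'_def by (intro power_strict_mono) auto
    have \<eta>': "- \<eta> = (1 - \<gamma>\<^sup>2) / \<gamma>\<^sup>2" using \<gamma> by (simp add: \<eta> field_simps)
    have pos: "0 < (1 - \<gamma>\<^sup>2) / \<gamma>\<^sup>2" using \<gamma> by (simp add: power_less_one_iff abs_square_less_1)
    have "- \<eta> * P \<le> g' * (\<eta>\<^sup>2 * P + - \<eta> * P)" using gain(1) unfolding Y .
    also have "\<dots> = - \<eta> * P * (g' * (1 - \<eta>))" by (simp add: algebra_simps power2_eq_square)
    finally have "1 \<le> g' * (1 - \<eta>)"
      using Ppos pos \<eta>' by (metis mult_pos_pos mult_le_cancel_left1 not_less)
    also have "1 - \<eta> = 1 / \<gamma>\<^sup>2" by (simp add: \<eta>)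
    finally show False using g'\<gamma> \<gamma> by (simp add: field_simps)
  qed
  then show ?thesis using gain(2) Y by simp
qed

section \<open>Instability and linearization\<close>

lemma abs_scalar_prod_le_vnorm:
  fixes u v :: "real vec"
  assumes "dim_vec u = dim_vec v"
  shows "\<bar>u \<bullet> v\<bar> \<le> vnorm u * vnorm v"
proof -
  have "\<bar>u \<bullet> v\<bar> \<le> (\<Sum>i<dim_vec v. \<bar>u $ i\<bar> * \<bar>v $ i\<bar>)"
    unfolding scalar_prod_lessThan using sum_abs[of "\<lambda>i. u $ i * v $ i" "{..<dim_vec v}"]
    by (simp add: abs_mult)
  also have "\<dots> \<le> vnorm u * vnorm v"
    using L2_set_mult_ineq[of "\<lambda>i. \<bar>u $ i\<bar>" "\<lambda>i. \<bar>v $ i\<bar>" "{..<dim_vec v}"] assms by (simp add: vnorm_def)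
  finally show ?thesis .
qed

lemma scalar_prod_self_vnorm: "(v :: real vec) \<bullet> v = (vnorm v)\<^sup>2"
  unfolding vnorm_sq_sum scalar_prod_lessThan by (simp add: power2_eq_square)

text \<open>The shift \<open>\<beta>\<close> makes the Lyapunov equation solvable without any assumption on sums of
  eigenvalues of \<open>M\<close>.\<close>

lemma shifted_lyapunov_equation:
  fixes M :: "real mat"
  assumes M: "M \<in> carrier_mat n n" and \<alpha>: "0 < \<alpha>"
  shows "\<exists>\<beta> P. 0 < \<beta> \<and> \<beta> < \<alpha> \<and> P \<in> carrier_mat n n \<and> (\<forall>x\<in>carrier_vec n. \<forall>y\<in>carrier_vec n.
    y \<bullet> (P *\<^sub>v (M *\<^sub>v x)) + (M *\<^sub>v y) \<bullet> (P *\<^sub>v x) = 2 * \<beta> * (y \<bullet> (P *\<^sub>v x)) + y \<bullet> x)"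
proof -
  let ?L = "lyap 2 M"
  have L: "?L \<in> carrier_mat (n ^ 2) (n ^ 2)" using lyap_carrier[OF M, of 2] by (simp add: power2_eq_square)
  then have LT: "?L\<^sup>T \<in> carrier_mat (n ^ 2) (n ^ 2)" by simp
  \<comment> \<open>The spectrum is finite, so some s = 2 \<beta> in the open interval avoids
    it.\<close>
  have "infinite {0<..<2 * \<alpha>}" using \<alpha> by (simp add: infinite_Ioo)
  then have "infinite ({0<..<2 * \<alpha>} - spectrum ?L\<^sup>T)"
    using card_finite_spectrum(1)[OF LT] by (rule Diff_infinite_finite[rotated])
  then obtain s where s: "0 < s" "s < 2 * \<alpha>" "s \<notin> spectrum ?L\<^sup>T"
    by (metis DiffD1 DiffD2 finite.emptyI greaterThanLessThan_iff ex_in_conv)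
  then have "\<not> eigenvalue ?L\<^sup>T s" by (simp add: spectrum_def)
  note R = inverse_of_not_eigenvalue[OF LT this]
  let ?I = "vec_of_mat (1\<^sub>m n) :: real vec"
  have cI: "- ?I \<in> carrier_vec (n ^ 2)" by (intro carrier_vecI) (simp add: power2_eq_square)
  \<comment> \<open>The vector p is vec[P] for the solution of P M + M^T P = s P + I, rewritten as a
    resolvent of the transposed Kronecker sum.\<close>
  define p where "p = the (mat_inverse (s \<cdot>\<^sub>m 1\<^sub>m (n ^ 2) - ?L\<^sup>T)) *\<^sub>v (- ?I)"
  have p: "p \<in> carrier_vec (n ^ 2)" unfolding p_def by (rule mult_mat_vec_carrier[OF R(1) cI])
  have Lp: "s \<cdot>\<^sub>v p - ?L\<^sup>T *\<^sub>v p = - ?I" unfolding p_def by (rule R(3)[OF cI])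
  define P where "P = mat n n (\<lambda>(i, j). p $ (i + n * j))"
  have P: "P \<in> carrier_mat n n" by (simp add: P_def)
  have pP: "vec_of_mat P = p"
  proof (rule eq_vecI)
    fix i assume "i < dim_vec p"
    then have i: "i < n * n" using p by (simp add: power2_eq_square)
    then show "vec_of_mat P $ i = p $ i"
      by (simp add: vec_of_mat_def P_def less_mult_imp_div_less mod_less_of_less_mult add.commute)
  qed (use p in \<open>simp add: P_def power2_eq_square\<close>)
  have V: "p \<bullet> kron_vec x y = y \<bullet> (P *\<^sub>v x)" if "x \<in> carrier_vec n" "y \<in> carrier_vec n" for x y
    using vec_of_mat_scalar_kron_vec[of x P y] that P by (simp add: pP)
  have "y \<bullet> (P *\<^sub>v (M *\<^sub>v x)) + (M *\<^sub>v y) \<bullet> (P *\<^sub>v x) = s * (y \<bullet> (P *\<^sub>v x)) + y \<bullet> x"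
    if x: "x \<in> carrier_vec n" and y: "y \<in> carrier_vec n" for x y
  proof -
    have c: "M *\<^sub>v x \<in> carrier_vec n" "M *\<^sub>v y \<in> carrier_vec n" using M x y by auto
    have k: "kron_vec x y \<in> carrier_vec (n ^ 2)" using kron_vec_carrier[OF x y] by (simp add: power2_eq_square)
    have "?L *\<^sub>v kron_vec x y = vec_sum (n ^ 2) (\<lambda>i. kron_vecs ([x, y][i := M *\<^sub>v ([x, y] ! i)])) {..<2}"
    proof -
      have "lyap (length [x, y]) M *\<^sub>v kron_vecs [x, y]
          = vec_sum (n ^ length [x, y]) (\<lambda>i. kron_vecs ([x, y][i := M *\<^sub>v ([x, y] ! i)])) {..<length [x, y]}"
        by (rule lyap_mult_kron_vecs[OF M]) (use x y in auto)
      then show ?thesis by (simp add: numeral_2_eq_2)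
    qed
    also have "p \<bullet> \<dots> = (\<Sum>i<2. p \<bullet> kron_vecs ([x, y][i := M *\<^sub>v ([x, y] ! i)]))"
    proof (rule vec_sum_scalar_right)
      fix i :: nat assume "i \<in> {..<2}"
      then consider "i = 0" | "i = 1" by force
      then show "dim_vec (kron_vecs ([x, y][i := M *\<^sub>v ([x, y] ! i)])) = n ^ 2"
        using x y carrier_matD[OF M] by cases (auto simp: power2_eq_square)
    qed
    also have "\<dots> = p \<bullet> kron_vec (M *\<^sub>v x) y + p \<bullet> kron_vec x (M *\<^sub>v y)"
      by (simp add: numeral_2_eq_2)
    finally have 1: "p \<bullet> (?L *\<^sub>v kron_vec x y) = y \<bullet> (P *\<^sub>v (M *\<^sub>v x)) + (M *\<^sub>v y) \<bullet> (P *\<^sub>v x)"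
      using V x y c by simp
    have "?L\<^sup>T *\<^sub>v p = s \<cdot>\<^sub>v p + ?I"
    proof (rule eq_vecI)
      fix i assume "i < dim_vec (s \<cdot>\<^sub>v p + ?I)"
      then have i: "i < n ^ 2" by (simp add: power2_eq_square)
      have "(s \<cdot>\<^sub>v p - ?L\<^sup>T *\<^sub>v p) $ i = (- ?I) $ i" unfolding Lp ..
      then have "s * p $ i - (?L\<^sup>T *\<^sub>v p) $ i = - (?I $ i)"
        using i p L by (simp add: power2_eq_square del: index_mult_mat_vec)
      then show "(?L\<^sup>T *\<^sub>v p) $ i = (s \<cdot>\<^sub>v p + ?I) $ i"
        using i p by (simp add: power2_eq_square del: index_mult_mat_vec)
    qed (use L in \<open>simp add: power2_eq_square\<close>)
    moreover have "(?L\<^sup>T *\<^sub>v p) \<bullet> kron_vec x y = p \<bullet> (?L *\<^sub>v kron_vec x y)"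
      by (rule transpose_mult_scalar_prod[OF L carrier_vecD[OF p] carrier_vecD[OF k]])
    moreover have "(s \<cdot>\<^sub>v p + ?I) \<bullet> kron_vec x y = s * (p \<bullet> kron_vec x y) + ?I \<bullet> kron_vec x y"
      using add_scalar_prod_distrib[of "s \<cdot>\<^sub>v p" "n ^ 2" ?I "kron_vec x y"] p k cI
      by (simp add: smult_scalar_prod_distrib[OF p k])
    moreover have "?I \<bullet> kron_vec x y = y \<bullet> x"
      using vec_of_mat_scalar_kron_vec[of x "1\<^sub>m n" y] x y by simp
    ultimately show ?thesis using 1 V[OF x y] by simp
  qed
  then show ?thesis using s P by (intro exI[of _ "s / 2"] exI[of _ P]) auto
qed

text \<open>Solutions of the nonlinear equation are given for t \<ge> 0 only, with a one-sided
  derivative at 0, so carrier and derivative are demanded only on \<open>S\<close> and within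
  \<open>S\<close>.\<close>

lemma bilinear_has_derivative_within:
  fixes X :: "real \<Rightarrow> real vec"
  assumes P: "P \<in> carrier_mat n n" and X: "\<And>s. s \<in> S \<Longrightarrow> X s \<in> carrier_vec n" and t: "t \<in> S"
    and X': "X' \<in> carrier_vec n"
    and d: "\<And>i. i < n \<Longrightarrow> ((\<lambda>s. X s $ i) has_real_derivative X' $ i) (at t within S)"
  shows "((\<lambda>s. X s \<bullet> (P *\<^sub>v X s)) has_real_derivative X' \<bullet> (P *\<^sub>v X t) + X t \<bullet> (P *\<^sub>v X')) (at t within S)"
proof -
  have e: "u \<bullet> (P *\<^sub>v v) = (\<Sum>i<n. \<Sum>j<n. P $$ (i, j) * (u $ i * v $ j))"
    if "u \<in> carrier_vec n" "v \<in> carrier_vec n" for u v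
    using that P by (simp add: scalar_prod_lessThan sum_distrib_left mult_ac)
  have "((\<lambda>s. \<Sum>i<n. \<Sum>j<n. P $$ (i, j) * (X s $ i * X s $ j)) has_real_derivative
      (\<Sum>i<n. \<Sum>j<n. P $$ (i, j) * (X' $ i * X t $ j + X' $ j * X t $ i))) (at t within S)"
    by (intro DERIV_sum DERIV_cmult DERIV_mult d) auto
  then have "((\<lambda>s. X s \<bullet> (P *\<^sub>v X s)) has_real_derivative
      (\<Sum>i<n. \<Sum>j<n. P $$ (i, j) * (X' $ i * X t $ j + X' $ j * X t $ i))) (at t within S)"
    by (rule has_field_derivative_transform_within[of _ _ _ _ 1]) (use t e X in auto)
  moreover have "(\<Sum>i<n. \<Sum>j<n. P $$ (i, j) * (X' $ i * X t $ j + X' $ j * X t $ i))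
      = X' \<bullet> (P *\<^sub>v X t) + X t \<bullet> (P *\<^sub>v X')"
  proof -
    have "(\<Sum>i<n. \<Sum>j<n. P $$ (i, j) * (X' $ i * X t $ j + X' $ j * X t $ i))
        = (\<Sum>i<n. \<Sum>j<n. P $$ (i, j) * (X' $ i * X t $ j) + P $$ (i, j) * (X t $ i * X' $ j))"
      by (intro sum.cong refl) (simp add: distrib_left mult.commute)
    then show ?thesis unfolding e[OF X' X[OF t]] e[OF X[OF t] X'] by (simp only: sum.distrib)
  qed
  ultimately show ?thesis by simp
qed

text \<open>The integrating factor exp (- 2 \<beta> t) makes the product nondecreasing.\<close>

lemma exponential_growth:
  fixes V V' :: "real \<Rightarrow> real"
  assumes d: "\<And>t. 0 \<le> t \<Longrightarrow> (V has_real_derivative V' t) (at t within {0..})"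
    and ge: "\<And>t. 0 \<le> t \<Longrightarrow> 2 * \<beta> * V t \<le> V' t" and t: "0 \<le> t"
  shows "V 0 \<le> exp (- 2 * \<beta> * t) * V t"
proof -
  let ?h = "\<lambda>t. exp (- 2 * \<beta> * t) * V t"
  have dh: "(?h has_real_derivative exp (- 2 * \<beta> * s) * (V' s - 2 * \<beta> * V s)) (at s within {0..})" if "0 \<le> s" for s
    by (rule derivative_eq_intros d[OF that] refl | simp add: algebra_simps)+
  have "?h 0 \<le> ?h t"
  proof (rule DERIV_nonneg_imp_increasing_open[OF t])
    fix s assume s: "0 < s" "s < t"
    have "at s within {0..} = at s" using s by (intro at_within_interior) simp
    then show "\<exists>y. (?h has_real_derivative y) (at s) \<and> 0 \<le> y"
      using dh[of s] ge[of s] s by (intro exI[of _ "exp (- 2 * \<beta> * s) * (V' s - 2 * \<beta> * V s)"]) auto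
    next
    have "continuous_on {0..} ?h"
      using dh by (intro DERIV_continuous_on) auto
    then show "continuous_on {0..t} ?h" by (rule continuous_on_subset) auto
  qed
  then show ?thesis by simp
qed

text \<open>Chetaev's instability argument with V(x) = x . P x, where P may be indefinite. Along the
  linear flow V' = 2 \<beta> V + |x|^2, and near the origin the second-order error is at most |x|^2.
  A solution starting where V > 0 then keeps V above its initial value, whereas asymptotic stability
  sends it to the origin.\<close>

lemma linearization_not_unstable:
  assumes M: "M \<in> carrier_mat n n" and ab: "a \<in> carrier_vec n" "b \<in> carrier_vec n" and \<alpha>: "0 < \<alpha>"
    and eq: "M *\<^sub>v a = \<alpha> \<cdot>\<^sub>v a - \<omega> \<cdot>\<^sub>v b" "M *\<^sub>v b = \<alpha> \<cdot>\<^sub>v b + \<omega> \<cdot>\<^sub>v a"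
    and \<phi>: "\<And>x. x \<in> carrier_vec n \<Longrightarrow> \<phi> x \<in> carrier_vec n"
    and lin: "0 \<le> K" "0 < \<delta>" "\<And>x. x \<in> ball0 n \<delta> \<Longrightarrow> x \<noteq> 0\<^sub>v n \<Longrightarrow> vnorm (\<phi> x - M *\<^sub>v x) \<le> K * (vnorm x)\<^sup>2"
    and stable: "asymptotically_stable n \<phi>"
  shows "a = 0\<^sub>v n \<and> b = 0\<^sub>v n"
proof (rule ccontr)
  assume nz: "\<not> ?thesis"
  obtain \<beta> P where \<beta>: "0 < \<beta>" "\<beta> < \<alpha>" and P: "P \<in> carrier_mat n n"
    and eqP: "\<And>x y. x \<in> carrier_vec n \<Longrightarrow> y \<in> carrier_vec n \<Longrightarrow>
      y \<bullet> (P *\<^sub>v (M *\<^sub>v x)) + (M *\<^sub>v y) \<bullet> (P *\<^sub>v x) = 2 * \<beta> * (y \<bullet> (P *\<^sub>v x)) + y \<bullet> x"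
    using shifted_lyapunov_equation[OF M \<alpha>] by blast
  let ?V = "\<lambda>x. x \<bullet> (P *\<^sub>v x)"
  have cP: "P *\<^sub>v x \<in> carrier_vec n" "M *\<^sub>v x \<in> carrier_vec n" if "x \<in> carrier_vec n" for x
    using P M that by auto
  have Plin: "P *\<^sub>v (x + y) = P *\<^sub>v x + P *\<^sub>v y" if "x \<in> carrier_vec n" "y \<in> carrier_vec n" for x y
    using mult_add_distrib_mat_vec[OF P that] .
  \<comment> \<open>The shifted Lyapunov equation on the span of a and b. Since \<beta> < \<alpha>,
    \<open>?V\<close> is positive at a or at b, which provides the starting direction.\<close>
  have VV: "2 * (\<alpha> - \<beta>) * (?V a + ?V b) = a \<bullet> a + b \<bullet> b"
  proof -
    have Pm: "P *\<^sub>v (c \<cdot>\<^sub>v x) = c \<cdot>\<^sub>v (P *\<^sub>v x)" if "x \<in> carrier_vec n" for c x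
      using mult_mat_vec[OF P that] .
    have "P *\<^sub>v (\<alpha> \<cdot>\<^sub>v a - \<omega> \<cdot>\<^sub>v b) = \<alpha> \<cdot>\<^sub>v (P *\<^sub>v a) - \<omega> \<cdot>\<^sub>v (P *\<^sub>v b)"
      using ab Pm[OF ab(1)] Pm[OF ab(2)] by (subst mult_minus_distrib_mat_vec[OF P]) auto
    moreover have "P *\<^sub>v (\<alpha> \<cdot>\<^sub>v b + \<omega> \<cdot>\<^sub>v a) = \<alpha> \<cdot>\<^sub>v (P *\<^sub>v b) + \<omega> \<cdot>\<^sub>v (P *\<^sub>v a)"
      using ab Pm[OF ab(1)] Pm[OF ab(2)] by (subst Plin) auto
    ultimately have "a \<bullet> (P *\<^sub>v (M *\<^sub>v a)) + (M *\<^sub>v a) \<bullet> (P *\<^sub>v a) = 2 * \<alpha> * ?V a - \<omega> * (a \<bullet> (P *\<^sub>v b) + b \<bullet> (P *\<^sub>v a))"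
      and "b \<bullet> (P *\<^sub>v (M *\<^sub>v b)) + (M *\<^sub>v b) \<bullet> (P *\<^sub>v b) = 2 * \<alpha> * ?V b + \<omega> * (a \<bullet> (P *\<^sub>v b) + b \<bullet> (P *\<^sub>v a))"
      unfolding eq using ab cP[OF ab(1)] cP[OF ab(2)]
      by (simp_all add: scalar_prod_minus_distrib[of _ n] scalar_prod_add_distrib[of _ n]
          minus_scalar_prod_distrib[of _ n] add_scalar_prod_distrib[of _ n] algebra_simps)
    then show ?thesis using eqP[OF ab(1) ab(1)] eqP[OF ab(2) ab(2)] by (simp add: algebra_simps)
  qed
  have "0 < a \<bullet> a + b \<bullet> b"
    using nz scalar_prod_self_eq_0[OF ab(1)] scalar_prod_self_eq_0[OF ab(2)] scalar_prod_self_nonneg[of a]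
      scalar_prod_self_nonneg[of b] by (smt (verit))
  then have "0 < 2 * (\<alpha> - \<beta>) * (?V a + ?V b)" by (simp only: VV)
  then have "0 < ?V a + ?V b" by (rule zero_less_mult_pos) (use \<beta> in simp)
  then obtain v where v: "v \<in> carrier_vec n" "0 < ?V v" using ab by (metis add_nonpos_nonpos not_less)
  obtain c where c: "c \<ge> 0" "\<And>v. dim_vec v = n \<Longrightarrow> vnorm (P *\<^sub>v v) \<le> c * vnorm v"
    using vnorm_mult_mat_vec_le[of P] P by auto
  have growth: "2 * \<beta> * ?V x \<le> \<phi> x \<bullet> (P *\<^sub>v x) + x \<bullet> (P *\<^sub>v \<phi> x)"
    if x: "x \<in> carrier_vec n" "vnorm x < \<delta>" "2 * c * K * vnorm x \<le> 1" for x
  proof (cases "x = 0\<^sub>v n")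
    \<comment> \<open>The estimate \<open>lin\<close> leaves out the origin, where both sides
      vanish.\<close>
    case True
    then show ?thesis using P \<phi>[OF x(1)] mult_zero_vec[OF P] cP[OF \<phi>[OF x(1)]] by simp
  next
    case False
    let ?e = "\<phi> x - M *\<^sub>v x"
    have e: "?e \<in> carrier_vec n" using \<phi>[OF x(1)] cP[OF x(1)] by simp
    have en: "vnorm ?e \<le> K * (vnorm x)\<^sup>2" using lin(3)[of x] x False by (simp add: ball0_def)
    have \<phi>e: "\<phi> x = M *\<^sub>v x + ?e" using \<phi>[OF x(1)] M x(1) by (intro eq_vecI) (auto simp del: index_mult_mat_vec)
    have sum: "\<phi> x \<bullet> (P *\<^sub>v x) + x \<bullet> (P *\<^sub>v \<phi> x) = 2 * \<beta> * ?V x + (vnorm x)\<^sup>2 + (?e \<bullet> (P *\<^sub>v x) + x \<bullet> (P *\<^sub>v ?e))"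
    proof -
      have "(M *\<^sub>v x + ?e) \<bullet> (P *\<^sub>v x) = (M *\<^sub>v x) \<bullet> (P *\<^sub>v x) + ?e \<bullet> (P *\<^sub>v x)"
        by (rule add_scalar_prod_distrib[OF cP(2)[OF x(1)] e cP(1)[OF x(1)]])
      moreover have "x \<bullet> (P *\<^sub>v (M *\<^sub>v x + ?e)) = x \<bullet> (P *\<^sub>v (M *\<^sub>v x)) + x \<bullet> (P *\<^sub>v ?e)"
        unfolding Plin[OF cP(2)[OF x(1)] e]
        by (rule scalar_prod_add_distrib[OF x(1) cP(1)[OF cP(2)[OF x(1)]] cP(1)[OF e]])
      ultimately show ?thesis
        using eqP[OF x(1) x(1)] unfolding \<phi>e[symmetric] scalar_prod_self_vnorm by simp
    qed
    have b1: "\<bar>?e \<bullet> (P *\<^sub>v x)\<bar> \<le> vnorm ?e * (c * vnorm x)"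
    proof -
      have "\<bar>?e \<bullet> (P *\<^sub>v x)\<bar> \<le> vnorm ?e * vnorm (P *\<^sub>v x)"
        using carrier_vecD[OF e] carrier_vecD[OF cP(1)[OF x(1)]] by (intro abs_scalar_prod_le_vnorm) (simp only:)
      also have "\<dots> \<le> vnorm ?e * (c * vnorm x)" using c(2)[of x] x(1) by (intro mult_left_mono) auto
      finally show ?thesis .
    qed
    have b2: "\<bar>x \<bullet> (P *\<^sub>v ?e)\<bar> \<le> vnorm x * (c * vnorm ?e)"
    proof -
      have "\<bar>x \<bullet> (P *\<^sub>v ?e)\<bar> \<le> vnorm x * vnorm (P *\<^sub>v ?e)"
        using carrier_vecD[OF x(1)] carrier_vecD[OF cP(1)[OF e]] by (intro abs_scalar_prod_le_vnorm) (simp only:)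
      also have "\<dots> \<le> vnorm x * (c * vnorm ?e)" using c(2)[OF carrier_vecD[OF e]] by (intro mult_left_mono) auto
      finally show ?thesis .
    qed
    have "\<bar>?e \<bullet> (P *\<^sub>v x)\<bar> + \<bar>x \<bullet> (P *\<^sub>v ?e)\<bar> \<le> 2 * c * vnorm x * vnorm ?e"
      using b1 b2 by (simp add: algebra_simps)
    also have "\<dots> \<le> 2 * c * vnorm x * (K * (vnorm x)\<^sup>2)"
      using en c(1) by (intro mult_left_mono mult_nonneg_nonneg) auto
    also have "\<dots> = (2 * c * K * vnorm x) * (vnorm x)\<^sup>2" by (simp add: algebra_simps)
    also have "\<dots> \<le> 1 * (vnorm x)\<^sup>2" using x(3) by (intro mult_right_mono) auto
    finally show ?thesis unfolding sum by linarith
  qed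
  \<comment> \<open>In this ball the error 2 c K |x| |x|^2 is absorbed by the term |x|^2 of the
    Lyapunov equation; adding 1 keeps the denominator positive.\<close>
  define \<epsilon> where "\<epsilon> = min \<delta> (1 / (2 * c * K + 1))"
  have D: "0 < 2 * c * K + 1" using c(1) lin(1) by (simp add: add_nonneg_pos)
  have \<epsilon>: "0 < \<epsilon>" using lin(2) D by (simp add: \<epsilon>_def)
  have small: "vnorm x < \<delta>" "2 * c * K * vnorm x \<le> 1" if "vnorm x < \<epsilon>" for x :: "real vec"
  proof -
    show "vnorm x < \<delta>" using that by (simp add: \<epsilon>_def)
    have "vnorm x < 1 / (2 * c * K + 1)" using that by (simp add: \<epsilon>_def)
    then have "vnorm x * (2 * c * K + 1) < 1" using D by (simp add: pos_less_divide_eq)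
    then have "2 * c * K * vnorm x + vnorm x < 1" by (simp add: algebra_simps)
    then show "2 * c * K * vnorm x \<le> 1" using vnorm_nonneg[of x] by linarith
  qed
  note stable' = stable[unfolded asymptotically_stable_def]
  obtain \<delta>1 where \<delta>1: "0 < \<delta>1" "\<forall>x0\<in>ball0 n \<delta>1. (\<exists>x. solves_ode n \<phi> x0 x) \<and>
      (\<forall>x. solves_ode n \<phi> x0 x \<longrightarrow> (\<forall>t\<ge>0. vnorm (x t) < \<epsilon>))"
    using stable'[THEN conjunct1, THEN spec, THEN mp, OF \<epsilon>] by (elim exE conjE) (rule that)
  obtain \<delta>2 where \<delta>2: "0 < \<delta>2" "\<forall>x0\<in>ball0 n \<delta>2. \<forall>x. solves_ode n \<phi> x0 x \<longrightarrow> ((\<lambda>t. vnorm (x t)) \<longlongrightarrow> 0) at_top"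
    using stable'[THEN conjunct2] by (elim exE conjE) (rule that)
  have "\<forall>\<^sub>F t in at_right 0. t \<cdot>\<^sub>v v \<in> ball0 n \<delta>1 \<and> t \<cdot>\<^sub>v v \<in> ball0 n \<delta>2 \<and> 0 < t"
    using ray_in_ball0[OF v(1) \<delta>1(1)] ray_in_ball0[OF v(1) \<delta>2(1)] eventually_at_right_less[of 0]
    by eventually_elim simp
  then obtain t0 where t0: "t0 \<cdot>\<^sub>v v \<in> ball0 n \<delta>1" "t0 \<cdot>\<^sub>v v \<in> ball0 n \<delta>2" "0 < t0"
    using eventually_happens'[OF trivial_limit_at_right_real] by blast
  obtain x where ode: "solves_ode n \<phi> (t0 \<cdot>\<^sub>v v) x" and xe: "\<And>t. t \<ge> 0 \<Longrightarrow> vnorm (x t) < \<epsilon>"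
    using bspec[OF \<delta>1(2) t0(1)] by blast
  have xc: "x t \<in> carrier_vec n" if "t \<ge> 0" for t using ode that unfolding solves_ode_def by blast
  have x0: "x 0 = t0 \<cdot>\<^sub>v v" using ode unfolding solves_ode_def by blast
  have dV: "((\<lambda>s. ?V (x s)) has_real_derivative \<phi> (x t) \<bullet> (P *\<^sub>v x t) + x t \<bullet> (P *\<^sub>v \<phi> (x t))) (at t within {0..})"
    if "0 \<le> t" for t
    by (rule bilinear_has_derivative_within[OF P]) (use that xc \<phi> ode in \<open>auto simp: solves_ode_def\<close>)
  have V0: "0 < ?V (x 0)"
  proof -
    have "?V (x 0) = t0 * (t0 * ?V v)"
      unfolding x0 mult_mat_vec[OF P v(1)] using v(1) cP(1)[OF v(1)] by simp
    then show ?thesis using t0(3) v(2) by simp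
  qed
  have grow: "?V (x 0) \<le> ?V (x t)" if "0 \<le> t" for t
  proof -
    have "?V (x 0) \<le> exp (- 2 * \<beta> * t) * ?V (x t)"
      by (rule exponential_growth[OF dV _ that]) (use growth small xe xc in auto)
    moreover have "0 < ?V (x t)" using calculation V0 by (metis exp_gt_zero less_le_trans zero_less_mult_pos)
    moreover have "exp (- 2 * \<beta> * t) \<le> 1" using \<beta> that by simp
    ultimately show ?thesis using mult_right_mono[of "exp (- 2 * \<beta> * t)" 1 "?V (x t)"] by linarith
  qed
  \<comment> \<open>Attractivity forces V along the solution, bounded by c |x|^2, below any positive
    value.\<close>
  have "((\<lambda>t. c * (vnorm (x t))\<^sup>2) \<longlongrightarrow> c * 0\<^sup>2) at_top"
    by (intro tendsto_intros bspec[OF \<delta>2(2) t0(2), rule_format, OF ode])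
  moreover have "\<forall>\<^sub>F t in at_top. ?V (x 0) \<le> c * (vnorm (x t))\<^sup>2"
    using eventually_ge_at_top[of 0]
  proof eventually_elim
    case (elim t)
    have "?V (x t) \<le> vnorm (x t) * vnorm (P *\<^sub>v x t)"
      using abs_scalar_prod_le_vnorm[of "x t" "P *\<^sub>v x t"] carrier_vecD[OF xc[OF elim]] carrier_vecD[OF cP(1)[OF xc[OF elim]]]
      by simp
    also have "\<dots> \<le> vnorm (x t) * (c * vnorm (x t))"
      using c(2)[OF carrier_vecD[OF xc[OF elim]]] by (intro mult_left_mono) auto
    finally show ?case using grow[OF elim] by (simp add: power2_eq_square mult_ac)
  qed
  ultimately have "?V (x 0) \<le> c * 0\<^sup>2" by (intro tendsto_lowerbound) auto
  then show False using V0 by simp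
qed

section \<open>Linearization of the closed loop at the origin\<close>

definition at_origin :: "nat \<Rightarrow> real vec filter" where
  "at_origin n = (INF \<delta>\<in>{0<..}. principal (ball0 n \<delta> - {0\<^sub>v n}))"

lemma eventually_at_origin:
  "eventually P (at_origin n) \<longleftrightarrow> (\<exists>\<delta>>0. \<forall>x\<in>ball0 n \<delta>. x \<noteq> 0\<^sub>v n \<longrightarrow> P x)"
proof -
  have "\<exists>c\<in>{0<..}. principal (ball0 n c - {0\<^sub>v n}) \<le> inf (principal (ball0 n a - {0\<^sub>v n})) (principal (ball0 n b - {0\<^sub>v n}))"
    if "a \<in> {0<..}" "b \<in> {0<..}" for a b :: real
    using that by (intro bexI[of _ "min a b"]) (auto simp: ball0_def)
  then have "eventually P (at_origin n) \<longleftrightarrow> (\<exists>\<delta>\<in>{0<..}. eventually P (principal (ball0 n \<delta> - {0\<^sub>v n})))"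
    unfolding at_origin_def by (intro eventually_INF_base) auto
  then show ?thesis by (auto simp: eventually_principal)
qed

text \<open>The punctured balls make \<open>vnorm x\<close> positive, so that it can serve as the
  radius in the gradient estimate \<open>grad_taylor\<close>.\<close>

lemma eventually_at_origin_small: "r > 0 \<Longrightarrow> \<forall>\<^sub>F x in at_origin n. x \<in> carrier_vec n \<and> 0 < vnorm x \<and> vnorm x < r"
  unfolding eventually_at_origin
proof (intro exI[of _ r] conjI ballI impI)
  fix x assume "x \<in> ball0 n r" "x \<noteq> 0\<^sub>v n"
  then show "x \<in> carrier_vec n" "vnorm x < r" by (auto simp: ball0_def)
  then have "vnorm x \<noteq> 0" using \<open>x \<noteq> 0\<^sub>v n\<close> by (simp add: vnorm_eq_0_iff)
  then show "0 < vnorm x" using vnorm_nonneg[of x] by linarith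
qed simp

lemma eventually_at_origin_unit: "\<forall>\<^sub>F x in at_origin n. x \<in> carrier_vec n \<and> 0 < vnorm x \<and> vnorm x < 1"
  by (rule eventually_at_origin_small) simp

lemma vnorm_power_bigo: "m \<le> p \<Longrightarrow> (\<lambda>x. vnorm x ^ p) \<in> O[at_origin n](\<lambda>x. vnorm x ^ m)"
proof (rule bigoI[of _ 1])
  assume "m \<le> p"
  then show "\<forall>\<^sub>F x in at_origin n. norm (vnorm x ^ p) \<le> 1 * norm (vnorm x ^ m)"
    using eventually_at_origin_unit[of n]
    by (auto elim!: eventually_mono intro!: power_decreasing)
qed

lemma entries_le_vnorm: "entries_le (vnorm x) x"
  unfolding entries_le_def using entry_le_vnorm[of _ x] by simp

lemma scalar_prod_xpow_bigo: "(\<lambda>x. c \<bullet> xpow p x) \<in> O[at_origin n](\<lambda>x. vnorm x ^ p)"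
proof (rule bigoI)
  show "\<forall>\<^sub>F x in at_origin n. norm (c \<bullet> xpow p x) \<le> (\<Sum>j<n ^ p. \<bar>c $ j\<bar>) * norm (vnorm x ^ p)"
    using eventually_at_origin_unit[of n]
  proof eventually_elim
    case (elim x)
    have "entries_le (vnorm x ^ p) (xpow p x)" by (intro entries_le_xpow entries_le_vnorm) simp
    from abs_scalar_prod_le[OF this, of "n ^ p" c] show ?case using carrier_vecD[of x n] elim by simp
  qed
qed

lemma scalar_prod_kron_xpow_bigo:
  assumes "a < m"
  shows "(\<lambda>x. c \<bullet> kron_vec (xpow p x) (unit_vec m a)) \<in> O[at_origin n](\<lambda>x. vnorm x ^ p)"
proof (rule bigoI)
  show "\<forall>\<^sub>F x in at_origin n. norm (c \<bullet> kron_vec (xpow p x) (unit_vec m a)) \<le> (\<Sum>j<n ^ p * m. \<bar>c $ j\<bar>) * norm (vnorm x ^ p)"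
    using eventually_at_origin_unit[of n]
  proof eventually_elim
    case (elim x)
    have "entries_le (vnorm x ^ p * 1) (kron_vec (xpow p x) (unit_vec m a))"
      using assms by (intro entries_le_kron_vec entries_le_xpow entries_le_vnorm entries_le_unit_vec) auto
    from abs_scalar_prod_le[OF this, of "n ^ p * m" c] show ?case using carrier_vecD[of x n] elim by simp
  qed
qed

lemma poly_f_linearization:
  assumes A: "A \<in> carrier_mat n n" and F: "\<And>p. p \<ge> 2 \<Longrightarrow> F p \<in> carrier_mat n (n ^ p)" and j: "j < n"
  shows "(\<lambda>x. poly_f n l A F x $ j - (A *\<^sub>v x) $ j) \<in> O[at_origin n](\<lambda>x. vnorm x ^ 2)"
proof -
  have "(\<lambda>x. \<Sum>p\<in>{2..l}. row (F p) j \<bullet> xpow p x) \<in> O[at_origin n](\<lambda>x. vnorm x ^ 2)"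
    by (intro big_sum_in_bigo landau_o.big_trans[OF scalar_prod_xpow_bigo vnorm_power_bigo]) auto
  moreover have "poly_f n l A F x $ j - (A *\<^sub>v x) $ j = (\<Sum>p\<in>{2..l}. row (F p) j \<bullet> xpow p x)" for x
    using A F[THEN carrier_matD(1)] j by (simp add: poly_f_def vec_sum_def)
  ultimately show ?thesis by simp
qed

lemma poly_g_linearization:
  assumes dims: "system_dims n m r l A B C F G H" and a: "a < m" and j: "j < n"
  shows "(\<lambda>x. (poly_g n m l B G x *\<^sub>v unit_vec m a) $ j - (B *\<^sub>v unit_vec m a) $ j) \<in> O[at_origin n](\<lambda>x. vnorm x ^ 1)"
proof -
  have B: "dim_row B = n" and G: "\<And>p. p \<ge> 1 \<Longrightarrow> dim_row (G p) = n"
    using dims unfolding system_dims_def by auto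
  let ?t = "\<lambda>x p. row (G p) j \<bullet> kron_vec (xpow p x) (unit_vec m a)"
  have "(\<lambda>x. \<Sum>p\<in>{1..l}. ?t x p) \<in> O[at_origin n](\<lambda>x. vnorm x ^ 1)"
    by (intro big_sum_in_bigo landau_o.big_trans[OF scalar_prod_kron_xpow_bigo[OF a] vnorm_power_bigo]) auto
  moreover have "\<forall>\<^sub>F x in at_origin n. (poly_g n m l B G x *\<^sub>v unit_vec m a) $ j - (B *\<^sub>v unit_vec m a) $ j = (\<Sum>p\<in>{1..l}. ?t x p)"
    using eventually_at_origin_unit[of n]
  proof eventually_elim
    case (elim x)
    \<comment> \<open>The expansion along rays at t = 1 separates the constant term \<open>B\<close>
      from the rest.\<close>
    have "poly_g n m l B G (1 \<cdot>\<^sub>v x) *\<^sub>v unit_vec m a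
      = vec_sum n (\<lambda>p. (1 * 1 ^ p) \<cdot>\<^sub>v ((G(0 := B)) p *\<^sub>v kron_vec (xpow p x) (unit_vec m a))) {..l}"
      using elim by (intro poly_g_ray[OF dims _ _ a]) auto
    then have "(poly_g n m l B G x *\<^sub>v unit_vec m a) $ j
        = (\<Sum>p\<le>l. ((G(0 := B)) p *\<^sub>v kron_vec (xpow p x) (unit_vec m a)) $ j)"
      using j by (simp add: vec_sum_def)
    also have "\<dots> = (B *\<^sub>v unit_vec m a) $ j + (\<Sum>p\<in>{1..l}. ((G(0 := B)) p *\<^sub>v kron_vec (xpow p x) (unit_vec m a)) $ j)"
      using sum.atLeast_Suc_atMost[of 0 l "\<lambda>p. ((G(0 := B)) p *\<^sub>v kron_vec (xpow p x) (unit_vec m a)) $ j"]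
      by (simp add: atLeast0AtMost kron_vec_one_left)
    also have "(\<Sum>p\<in>{1..l}. ((G(0 := B)) p *\<^sub>v kron_vec (xpow p x) (unit_vec m a)) $ j) = (\<Sum>p\<in>{1..l}. ?t x p)"
      using G j by (intro sum.cong refl) auto
    finally show ?case by simp
  qed
  ultimately show ?thesis by (simp add: landau_o.big.in_cong)
qed

lemma grad_linearization:
  fixes W :: "nat \<Rightarrow> real mat"
  assumes exp: "degree_d_expansion n d E w" and d: "d \<ge> 2"
    and W: "W 2 \<in> carrier_mat n n" "w 2 = vec_of_mat (W 2)" and j: "j < n"
  shows "(\<lambda>x. grad n E x $ j - (W 2 *\<^sub>v x) $ j) \<in> O[at_origin n](\<lambda>x. vnorm x ^ 2)"
proof -
  \<comment> \<open>Lowering the degree to two leaves the linear part of the gradient with an error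
    of second order.\<close>
  have exp2: "degree_d_expansion n 2 E w"
    using exp d unfolding degree_d_expansion_def by force
  have "\<forall>i\<in>{2..2 :: nat}. W i \<in> carrier_mat n (n ^ (i - 1)) \<and> w i = vec_of_mat (W i)" using W by simp
  from grad_taylor[OF exp2 this] obtain K \<delta> where K: "0 \<le> K" "0 < \<delta>"
    and bd: "\<And>x r j. x \<in> carrier_vec n \<Longrightarrow> 0 < r \<Longrightarrow> r \<le> \<delta> \<Longrightarrow> entries_le r x \<Longrightarrow> j < n \<Longrightarrow>
      \<bar>grad n E x $ j - taylor_grad n 2 W x $ j\<bar> \<le> K * r\<^sup>2" by blast
  have t: "taylor_grad n 2 W x $ j = (W 2 *\<^sub>v x) $ j" for x
    using j W by (simp add: taylor_grad_def vec_sum_def)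
  show ?thesis
  proof (rule bigoI)
    show "\<forall>\<^sub>F x in at_origin n. norm (grad n E x $ j - (W 2 *\<^sub>v x) $ j) \<le> K * norm (vnorm x ^ 2)"
      using eventually_at_origin_small[of \<delta> n, OF K(2)]
    proof eventually_elim
      case (elim x)
      then show ?case using bd[of x "vnorm x" j] entries_le_vnorm[of x] j by (simp add: t)
    qed
  qed
qed

text \<open>The difference is (u - u0) g + u0 (g - g0), of orders 2 + 0 and 1 + 1. A first-order
  error of g suffices because the gradient itself vanishes to first order.\<close>

lemma product_linearization:
  fixes u u0 g g0 :: "'a \<Rightarrow> real"
  assumes "(\<lambda>x. u x - u0 x) \<in> O[F](\<lambda>x. N x ^ 2)" "u0 \<in> O[F](\<lambda>x. N x ^ 1)"
    and "(\<lambda>x. g x - g0 x) \<in> O[F](\<lambda>x. N x ^ 1)" "g \<in> O[F](\<lambda>_. 1)"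
  shows "(\<lambda>x. u x * g x - u0 x * g0 x) \<in> O[F](\<lambda>x. N x ^ 2)"
proof -
  have "(\<lambda>x. (u x - u0 x) * g x + u0 x * (g x - g0 x)) \<in> O[F](\<lambda>x. N x ^ 2)"
  proof (rule sum_in_bigo(1))
    show "(\<lambda>x. (u x - u0 x) * g x) \<in> O[F](\<lambda>x. N x ^ 2)"
      using landau_o.big.mult[OF assms(1,4)] by simp
    show "(\<lambda>x. u0 x * (g x - g0 x)) \<in> O[F](\<lambda>x. N x ^ 2)"
      using landau_o.big.mult[OF assms(2,3)] by (simp add: power2_eq_square)
  qed
  then show ?thesis by (simp add: algebra_simps)
qed

text \<open>Written over columns, g g^T times the gradient is a sum of products to which the product
  estimate applies twice.\<close>

lemma gram_mult_vec_entry: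
  fixes M :: "real mat"
  assumes M: "M \<in> carrier_mat n m" and v: "v \<in> carrier_vec n" and j: "j < n"
  shows "(M *\<^sub>v (M\<^sup>T *\<^sub>v v)) $ j = (\<Sum>a<m. (v \<bullet> (M *\<^sub>v unit_vec m a)) * (M *\<^sub>v unit_vec m a) $ j)"
proof -
  have z: "M\<^sup>T *\<^sub>v v \<in> carrier_vec m" using M v by (intro mult_mat_vec_carrier[of _ m n]) auto
  have "(M *\<^sub>v (M\<^sup>T *\<^sub>v v)) $ j = (\<Sum>a<m. M $$ (j, a) * (M\<^sup>T *\<^sub>v v) $ a)"
  proof -
    have "(M *\<^sub>v u) $ j = (\<Sum>a<m. M $$ (j, a) * u $ a)" if "u \<in> carrier_vec m" for u
      using M that j by (simp add: scalar_prod_lessThan)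
    from this[OF z] show ?thesis .
  qed
  also have "\<dots> = (\<Sum>a<m. (v \<bullet> (M *\<^sub>v unit_vec m a)) * (M *\<^sub>v unit_vec m a) $ j)"
  proof (intro sum.cong refl)
    fix a assume a: "a \<in> {..<m}"
    have "(M\<^sup>T *\<^sub>v v) $ a = (M\<^sup>T *\<^sub>v v) \<bullet> unit_vec m a" using z a by (simp add: scalar_prod_right_unit)
    also have "\<dots> = v \<bullet> (M *\<^sub>v unit_vec m a)"
      by (rule transpose_mult_scalar_prod[OF M carrier_vecD[OF v]]) simp
    finally have "(M\<^sup>T *\<^sub>v v) $ a = v \<bullet> (M *\<^sub>v unit_vec m a)" .
    moreover have "(M *\<^sub>v unit_vec m a) $ j = M $$ (j, a)"
      using M a j by (simp add: scalar_prod_right_unit[of _ m])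
    ultimately show "M $$ (j, a) * (M\<^sup>T *\<^sub>v v) $ a = (v \<bullet> (M *\<^sub>v unit_vec m a)) * (M *\<^sub>v unit_vec m a) $ j"
      by (simp add: mult.commute)
  qed
  finally show ?thesis .
qed

text \<open>A quadratic error is what the instability argument requires. The drift has it directly;
  in the feedback term it comes from the second-order error of the gradient and from the first-order
  error of g multiplied by the first-order vector W_2 x.\<close>

lemma closed_loop_linearization:
  fixes \<eta> :: real and W :: "nat \<Rightarrow> real mat"
  assumes dims: "system_dims n m r l A B C F G H"
    and exp: "degree_d_expansion n d E w" and d: "d \<ge> 2"
    and W: "W 2 \<in> carrier_mat n n" "w 2 = vec_of_mat (W 2)"
  defines "\<phi> \<equiv> closed_loop_field n \<eta> (poly_f n l A F) (poly_g n m l B G) E"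
    and "M \<equiv> A - \<eta> \<cdot>\<^sub>m (B * B\<^sup>T * W 2)"
  shows "\<exists>K \<delta>. 0 \<le> K \<and> 0 < \<delta> \<and> (\<forall>x\<in>ball0 n \<delta>. x \<noteq> 0\<^sub>v n \<longrightarrow> vnorm (\<phi> x - M *\<^sub>v x) \<le> K * (vnorm x)\<^sup>2)"
proof -
  have A: "A \<in> carrier_mat n n" and B: "B \<in> carrier_mat n m"
    and F: "\<And>p. p \<ge> 2 \<Longrightarrow> F p \<in> carrier_mat n (n ^ p)"
    using dims unfolding system_dims_def by auto
  let ?g = "\<lambda>x a. poly_g n m l B G x *\<^sub>v unit_vec m a" and ?b = "\<lambda>a. B *\<^sub>v unit_vec m a"
  have cg: "poly_g n m l B G x \<in> carrier_mat n m" for x using B by (auto simp: poly_g_def)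
  have cgr: "grad n E x \<in> carrier_vec n" for x by (simp add: grad_def)
  have g1: "(\<lambda>x. ?g x a $ j - ?b a $ j) \<in> O[at_origin n](\<lambda>x. vnorm x ^ 1)" if "a < m" "j < n" for a j
    by (rule poly_g_linearization[OF dims that])
  have gO: "(\<lambda>x. ?g x a $ j) \<in> O[at_origin n](\<lambda>_. 1)" if "a < m" "j < n" for a j
  proof -
    have "(\<lambda>x. vnorm x ^ 1) \<in> O[at_origin n](\<lambda>x. vnorm x ^ 0)" by (rule vnorm_power_bigo) simp
    then have "(\<lambda>x. ?g x a $ j - ?b a $ j) \<in> O[at_origin n](\<lambda>_. 1)"
      using landau_o.big_trans[OF g1[OF that]] by simp
    from sum_in_bigo(1)[OF this bigo_const[of "?b a $ j"]] show ?thesis by simp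
  qed
  have WO: "(\<lambda>x. (W 2 *\<^sub>v x) $ i) \<in> O[at_origin n](\<lambda>x. vnorm x ^ 1)" if "i < n" for i
    using scalar_prod_xpow_bigo[of "row (W 2) i" 1 n] that W by simp
  have v: "(\<lambda>x. grad n E x \<bullet> ?g x a - (W 2 *\<^sub>v x) \<bullet> ?b a) \<in> O[at_origin n](\<lambda>x. vnorm x ^ 2)" if a: "a < m" for a
  proof -
    have "(\<lambda>x. \<Sum>i<n. grad n E x $ i * ?g x a $ i - (W 2 *\<^sub>v x) $ i * ?b a $ i) \<in> O[at_origin n](\<lambda>x. vnorm x ^ 2)"
      by (intro big_sum_in_bigo product_linearization grad_linearization[where W = W, OF exp d W] WO g1[OF a] gO[OF a]) auto
    moreover have "grad n E x \<bullet> ?g x a - (W 2 *\<^sub>v x) \<bullet> ?b a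
        = (\<Sum>i<n. grad n E x $ i * ?g x a $ i - (W 2 *\<^sub>v x) $ i * ?b a $ i)" for x
    proof -
      have "dim_vec (?g x a) = n" "dim_vec (?b a) = n" using cg[of x] B by auto
      then show ?thesis unfolding scalar_prod_lessThan by (simp only: sum_subtractf)
    qed
    ultimately show ?thesis by simp
  qed
  have vO: "(\<lambda>x. (W 2 *\<^sub>v x) \<bullet> ?b a) \<in> O[at_origin n](\<lambda>x. vnorm x ^ 1)" for a
  proof -
    have "(\<lambda>x. \<Sum>i<n. (W 2 *\<^sub>v x) $ i * ?b a $ i) \<in> O[at_origin n](\<lambda>x. vnorm x ^ 1 * 1)"
      by (intro big_sum_in_bigo landau_o.big.mult WO bigo_const) auto
    then show ?thesis using B by (simp add: scalar_prod_lessThan[of _ "?b a"])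
  qed
  have lin: "(\<lambda>x. (\<phi> x - M *\<^sub>v x) $ j) \<in> O[at_origin n](\<lambda>x. vnorm x ^ 2)" if j: "j < n" for j
  proof -
    let ?T = "\<lambda>x. \<Sum>a<m. (grad n E x \<bullet> ?g x a) * ?g x a $ j - ((W 2 *\<^sub>v x) \<bullet> ?b a) * ?b a $ j"
    have "?T \<in> O[at_origin n](\<lambda>x. vnorm x ^ 2)"
      by (intro big_sum_in_bigo product_linearization v vO g1 gO) (use j in auto)
    then have "(\<lambda>x. \<eta> * ?T x) \<in> O[at_origin n](\<lambda>x. 1 * vnorm x ^ 2)"
      by (intro landau_o.big.mult bigo_const)
    then have "(\<lambda>x. (poly_f n l A F x $ j - (A *\<^sub>v x) $ j) - \<eta> * ?T x) \<in> O[at_origin n](\<lambda>x. vnorm x ^ 2)"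
      by (intro sum_in_bigo(2) poly_f_linearization[OF A F j]) auto
    moreover have "\<forall>\<^sub>F x in at_origin n. (\<phi> x - M *\<^sub>v x) $ j
        = (poly_f n l A F x $ j - (A *\<^sub>v x) $ j) - \<eta> * ?T x"
      using eventually_at_origin_unit[of n]
    proof eventually_elim
      case (elim x)
      then have x: "x \<in> carrier_vec n" by simp
      let ?G = "poly_g n m l B G x" and ?v = "grad n E x" and ?u = "W 2 *\<^sub>v x"
      have u: "?u \<in> carrier_vec n" using W(1) x by (rule mult_mat_vec_carrier)
      have z: "?G *\<^sub>v (?G\<^sup>T *\<^sub>v ?v) \<in> carrier_vec n" "B\<^sup>T *\<^sub>v ?u \<in> carrier_vec m"
        using cg[of x] B by (auto intro!: carrier_vecI)
      have dz: "dim_vec (?G *\<^sub>v (?G\<^sup>T *\<^sub>v ?v)) = n" using z(1) by (rule carrier_vecD)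
      have df: "dim_vec (poly_f n l A F x) = n" by (simp add: poly_f_def)
      have "\<phi> x $ j = poly_f n l A F x $ j - \<eta> * (?G *\<^sub>v (?G\<^sup>T *\<^sub>v ?v)) $ j"
        unfolding \<phi>_def closed_loop_field_def
        using j by (simp only: index_minus_vec(1) index_smult_vec dz)
      moreover have "M *\<^sub>v x = A *\<^sub>v x + (- \<eta>) \<cdot>\<^sub>v (B *\<^sub>v (B\<^sup>T *\<^sub>v ?u))"
        unfolding M_def closed_loop_mult_vec[OF A B W(1) x] mult_mat_vec[OF B z(2)] ..
      then have "(M *\<^sub>v x) $ j = (A *\<^sub>v x) $ j - \<eta> * (B *\<^sub>v (B\<^sup>T *\<^sub>v ?u)) $ j"
        using j A B by (simp del: index_mult_mat_vec(1))
      moreover have "(\<phi> x - M *\<^sub>v x) $ j = \<phi> x $ j - (M *\<^sub>v x) $ j"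
      proof -
        have "dim_vec (M *\<^sub>v x) = n" using B W by (simp add: M_def)
        then show ?thesis using j by (simp only: index_minus_vec(1))
      qed
      ultimately show ?case
        unfolding gram_mult_vec_entry[OF cg cgr j] gram_mult_vec_entry[OF B u j]
        by (simp add: sum_subtractf algebra_simps)
    qed
    ultimately show ?thesis by (simp add: landau_o.big.in_cong)
  qed
  have "(\<lambda>x. \<Sum>j<n. \<bar>(\<phi> x - M *\<^sub>v x) $ j\<bar>) \<in> O[at_origin n](\<lambda>x. vnorm x ^ 2)"
    using lin by (intro big_sum_in_bigo) auto
  then obtain K where K: "0 < K" "\<forall>\<^sub>F x in at_origin n. norm (\<Sum>j<n. \<bar>(\<phi> x - M *\<^sub>v x) $ j\<bar>) \<le> K * norm (vnorm x ^ 2)"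
    by (rule landau_o.bigE)
  then obtain \<delta> where \<delta>: "\<delta> > 0" "\<forall>x\<in>ball0 n \<delta>. x \<noteq> 0\<^sub>v n \<longrightarrow> norm (\<Sum>j<n. \<bar>(\<phi> x - M *\<^sub>v x) $ j\<bar>) \<le> K * norm (vnorm x ^ 2)"
    unfolding eventually_at_origin by blast
  have "vnorm (\<phi> x - M *\<^sub>v x) \<le> K * (vnorm x)\<^sup>2" if "x \<in> ball0 n \<delta>" "x \<noteq> 0\<^sub>v n" for x
  proof -
    have "dim_vec (\<phi> x - M *\<^sub>v x) = n" using B W by (simp add: M_def)
    then have "vnorm (\<phi> x - M *\<^sub>v x) \<le> (\<Sum>j<n. \<bar>(\<phi> x - M *\<^sub>v x) $ j\<bar>)"
      using vnorm_le_sum[of "\<phi> x - M *\<^sub>v x"] by simp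
    also have "\<dots> \<le> K * (vnorm x)\<^sup>2" using \<delta>(2) that by (auto dest!: bspec)
    finally show ?thesis .
  qed
  then show ?thesis using K(1) \<delta>(1) by (intro exI[of _ K] exI[of _ \<delta>]) auto
qed

section \<open>Semidefiniteness, uniqueness and assembly\<close>

lemma energy_nonneg:
  assumes "is_future_energy n m \<gamma> \<eta> f g h D E" "\<eta> > 0" "x \<in> D"
  shows "0 \<le> E x"
proof -
  \<comment> \<open>The energy is an attained cost, so for \<eta> > 0 it inherits the sign of the
    running cost of one trajectory.\<close>
  from assms obtain u z where "ereal (E x) = cost \<eta> h u z"
    unfolding is_future_energy_def admissible_costs_def by blast
  moreover have "0 \<le> cost \<eta> h u z"
  proof -
    have "0 \<le> set_lebesgue_integral lborel {0..} (\<lambda>t. (vnorm (u t))\<^sup>2 / \<eta>)"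
      unfolding set_lebesgue_integral_def using assms(2) by (intro integral_nonneg_AE) auto
    then show ?thesis unfolding cost_def by (intro ereal_0_le_mult add_nonneg_nonneg) auto
  qed
  ultimately show ?thesis by (metis ereal_less_eq(5))
qed

text \<open>The quotient E (t x) / t^2 tends to half of the quadratic form as t decreases to
  0.\<close>

lemma quadratic_part_nonneg:
  assumes exp: "degree_d_expansion n d E w" and d: "d \<ge> 2"
    and W: "W \<in> carrier_mat n n" "w 2 = vec_of_mat W"
    and nonneg: "\<And>x. x \<in> ball0 n \<rho> \<Longrightarrow> 0 \<le> E x" and \<rho>: "\<rho> > 0" and x: "x \<in> carrier_vec n"
  shows "0 \<le> x \<bullet> (W *\<^sub>v x)"
proof -
  from exp obtain c where ps: "power_series_at_0 n E c" and c0: "c 0 = 0\<^sub>v 1" "c 1 = 0\<^sub>v n"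
    and sym: "is_symmetrization n 2 (c 2) (w 2)"
    using d unfolding degree_d_expansion_def by auto
  from ps obtain R where c: "\<And>i. c i \<in> carrier_vec (n ^ i)" and R: "R > 0"
    and E: "\<And>x. x \<in> carrier_vec n \<Longrightarrow> (\<forall>j<n. \<bar>x $ j\<bar> < R) \<Longrightarrow> (\<lambda>i. 1/2 * (c i \<bullet> xpow i x)) sums E x"
    unfolding power_series_at_0_def by blast
  obtain s where s: "0 < s" "entries_le s x" using entries_le_exists by blast
  let ?a = "\<lambda>i. 1/2 * (c i \<bullet> xpow i x)"
  have a01: "?a 0 = 0" "?a 1 = 0" unfolding c0 using x by (auto simp: scalar_prod_lessThan)
  \<comment> \<open>Divided by t^2, the expansion along the ray is a power series in t whose
    constant term is the coefficient of degree two; |t| < R / s keeps t x in the cube of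
    convergence.\<close>
  have "((\<lambda>t. E (t \<cdot>\<^sub>v x) / t\<^sup>2) \<longlongrightarrow> ?a (0 + 2)) (at 0)"
  proof (rule powser_limit_0_strong[of "R / s"])
    show "0 < R / s" using R s by simp
    fix t :: real assume t: "t \<noteq> 0" "norm t < R / s"
    have "\<forall>j<n. \<bar>(t \<cdot>\<^sub>v x) $ j\<bar> < R"
    proof (intro allI impI)
      fix j assume j: "j < n"
      have "\<bar>t\<bar> * \<bar>x $ j\<bar> \<le> \<bar>t\<bar> * s" using s j x by (intro mult_left_mono) (auto simp: entries_le_def)
      also have "\<dots> < R" using t s by (simp add: pos_less_divide_eq)
      finally show "\<bar>(t \<cdot>\<^sub>v x) $ j\<bar> < R" using j x by (simp add: abs_mult)
    qed
    then have "(\<lambda>i. 1/2 * (c i \<bullet> xpow i (t \<cdot>\<^sub>v x))) sums E (t \<cdot>\<^sub>v x)" using x by (intro E) auto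
    moreover have "1/2 * (c i \<bullet> xpow i (t \<cdot>\<^sub>v x)) = ?a i * t ^ i" for i
      using c[of i] xpow_carrier[OF x, of i] by (simp add: xpow_smult)
    ultimately have "(\<lambda>i. ?a i * t ^ i) sums E (t \<cdot>\<^sub>v x)" by simp
    then have "(\<lambda>i. ?a (i + 2) * t ^ (i + 2)) sums (E (t \<cdot>\<^sub>v x) - (\<Sum>i<2. ?a i * t ^ i))"
      by (rule sums_split_initial_segment)
    moreover have "(\<Sum>i<2. ?a i * t ^ i) = 0"
      using a01 by (simp add: numeral_2_eq_2)
    ultimately have "(\<lambda>i. ?a (i + 2) * t ^ (i + 2) / t\<^sup>2) sums (E (t \<cdot>\<^sub>v x) / t\<^sup>2)"
      using sums_divide by fastforce
    moreover have "?a (i + 2) * t ^ (i + 2) / t\<^sup>2 = ?a (i + 2) * t ^ i" for i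
      unfolding power_add using t(1) by simp
    ultimately show "(\<lambda>i. ?a (i + 2) * t ^ i) sums (E (t \<cdot>\<^sub>v x) / t\<^sup>2)"
      by (simp only:)
  qed
  then have "((\<lambda>t. E (t \<cdot>\<^sub>v x) / t\<^sup>2) \<longlongrightarrow> ?a 2) (at_right 0)"
    unfolding filterlim_at_split add_0 by blast
  moreover have "\<forall>\<^sub>F t in at_right 0. 0 \<le> E (t \<cdot>\<^sub>v x) / t\<^sup>2"
    using ray_in_ball0[OF x \<rho>] by eventually_elim (simp add: nonneg)
  ultimately have "0 \<le> ?a 2"
    by (intro tendsto_lowerbound[OF _ _ trivial_limit_at_right_real])
  moreover have "c 2 \<bullet> xpow 2 x = w 2 \<bullet> xpow 2 x"
    using sym x unfolding is_symmetrization_def by simp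
  moreover have "w 2 \<bullet> xpow 2 x = x \<bullet> (W *\<^sub>v x)"
    using W x by (simp add: xpow_Suc numeral_2_eq_2 vec_of_mat_scalar_kron_vec)
  ultimately show ?thesis by simp
qed

text \<open>For D = X - Y, subtracting the two equations gives M_X^T D + D M_Y = 0. The closed loop
  matrix of X on the left and that of Y on the right are chosen so that the mixed quadratic terms
  cancel, leaving a homogeneous Sylvester equation with Hurwitz coefficients.\<close>

lemma ARE_stabilizing_unique:
  assumes A: "A \<in> carrier_mat n n" and B: "B \<in> carrier_mat n m" and C: "C \<in> carrier_mat r n"
    and X: "X \<in> carrier_mat n n" "X\<^sup>T = X" "hinf_ARE n \<eta> A B C X" "hurwitz (A - \<eta> \<cdot>\<^sub>m (B * B\<^sup>T * X))"
    and Y: "Y \<in> carrier_mat n n" "Y\<^sup>T = Y" "hinf_ARE n \<eta> A B C Y" "hurwitz (A - \<eta> \<cdot>\<^sub>m (B * B\<^sup>T * Y))"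
  shows "X = Y"
proof (rule mat_eqI_scalar_prod[OF X(1) Y(1)])
  let ?MX = "A - \<eta> \<cdot>\<^sub>m (B * B\<^sup>T * X)" and ?MY = "A - \<eta> \<cdot>\<^sub>m (B * B\<^sup>T * Y)"
  have M: "?MX \<in> carrier_mat n n" "?MY \<in> carrier_mat n n"
    using B X(1) Y(1) by (auto intro!: minus_carrier_mat smult_carrier_mat)
  have D: "X - Y \<in> carrier_mat n n" using Y by (intro minus_carrier_mat)
  have Dv: "u \<bullet> ((X - Y) *\<^sub>v v) = u \<bullet> (X *\<^sub>v v) - u \<bullet> (Y *\<^sub>v v)"
    if u: "u \<in> carrier_vec n" and v: "v \<in> carrier_vec n" for u v
    unfolding minus_mult_distrib_mat_vec[OF X(1) Y(1) v]
    by (rule scalar_prod_minus_distrib[OF u]) (use X Y v in auto)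
  have tr: "u \<bullet> (S *\<^sub>v v) = (S *\<^sub>v u) \<bullet> v" if "S \<in> carrier_mat n n" "S\<^sup>T = S" "u \<in> carrier_vec n" "v \<in> carrier_vec n"
    for S :: "real mat" and u v
    using transpose_mult_scalar_prod[OF that(1) carrier_vecD[OF that(3)] carrier_vecD[OF that(4)]] that(2) by simp
  fix x y :: "real vec" assume x: "x \<in> carrier_vec n" and y: "y \<in> carrier_vec n"
  have "x \<bullet> ((X - Y) *\<^sub>v y) = 0"
  proof (rule sylvester_zero[OF M(1) X(4) M(2) Y(4) D _ x y])
    fix x y :: "real vec" assume x: "x \<in> carrier_vec n" and y: "y \<in> carrier_vec n"
    let ?bX = "\<lambda>v. B\<^sup>T *\<^sub>v (X *\<^sub>v v)" and ?bY = "\<lambda>v. B\<^sup>T *\<^sub>v (Y *\<^sub>v v)"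
    have c: "X *\<^sub>v v \<in> carrier_vec n" "Y *\<^sub>v v \<in> carrier_vec n" "A *\<^sub>v v \<in> carrier_vec n"
      "?bX v \<in> carrier_vec m" "?bY v \<in> carrier_vec m" if "v \<in> carrier_vec n" for v
      using A B X(1) Y(1) that by (auto intro!: carrier_vecI)
    have Bt: "(B *\<^sub>v (- \<eta> \<cdot>\<^sub>v z)) \<bullet> v = - \<eta> * (z \<bullet> (B\<^sup>T *\<^sub>v v))" "v \<bullet> (B *\<^sub>v (- \<eta> \<cdot>\<^sub>v z)) = - \<eta> * ((B\<^sup>T *\<^sub>v v) \<bullet> z)"
      if z: "z \<in> carrier_vec m" and v: "v \<in> carrier_vec n" for z v
    proof -
      have z': "- \<eta> \<cdot>\<^sub>v z \<in> carrier_vec m" using z by simp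
      have Bv: "B\<^sup>T *\<^sub>v v \<in> carrier_vec m" using B by (auto intro!: carrier_vecI)
      have "v \<bullet> (B *\<^sub>v (- \<eta> \<cdot>\<^sub>v z)) = (B\<^sup>T *\<^sub>v v) \<bullet> (- \<eta> \<cdot>\<^sub>v z)"
        by (rule transpose_mult_scalar_prod[OF B carrier_vecD[OF v] carrier_vecD[OF z'], symmetric])
      then show 1: "v \<bullet> (B *\<^sub>v (- \<eta> \<cdot>\<^sub>v z)) = - \<eta> * ((B\<^sup>T *\<^sub>v v) \<bullet> z)"
        by (simp only: scalar_prod_smult_distrib[OF Bv z])
      have "(B *\<^sub>v (- \<eta> \<cdot>\<^sub>v z)) \<bullet> v = v \<bullet> (B *\<^sub>v (- \<eta> \<cdot>\<^sub>v z))"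
        using B v by (intro scalar_prod_comm_real) simp
      also note 1
      also have "(B\<^sup>T *\<^sub>v v) \<bullet> z = z \<bullet> (B\<^sup>T *\<^sub>v v)"
        by (rule scalar_prod_comm_real) (simp only: carrier_vecD[OF Bv] carrier_vecD[OF z])
      finally show "(B *\<^sub>v (- \<eta> \<cdot>\<^sub>v z)) \<bullet> v = - \<eta> * (z \<bullet> (B\<^sup>T *\<^sub>v v))" .
    qed
    have cB: "B *\<^sub>v z \<in> carrier_vec n" if "z \<in> carrier_vec m" for z using B that by (rule mult_mat_vec_carrier)
    have cz: "- \<eta> \<cdot>\<^sub>v ?bX x \<in> carrier_vec m" "- \<eta> \<cdot>\<^sub>v ?bY y \<in> carrier_vec m" using c[OF x] c[OF y] by auto
    have MXx: "?MX *\<^sub>v x \<in> carrier_vec n" and MYy: "?MY *\<^sub>v y \<in> carrier_vec n"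
      using mult_mat_vec_carrier[OF M(1) x] mult_mat_vec_carrier[OF M(2) y] .
    have L: "(?MX *\<^sub>v x) \<bullet> v = (A *\<^sub>v x) \<bullet> v - \<eta> * (?bX x \<bullet> (B\<^sup>T *\<^sub>v v))" if v: "v \<in> carrier_vec n" for v
      unfolding closed_loop_mult_vec[OF A B X(1) x]
        add_scalar_prod_distrib[OF c(3)[OF x] cB[OF cz(1)] v] Bt(1)[OF c(4)[OF x] v] by simp
    have Rr: "v \<bullet> (?MY *\<^sub>v y) = v \<bullet> (A *\<^sub>v y) - \<eta> * ((B\<^sup>T *\<^sub>v v) \<bullet> ?bY y)" if v: "v \<in> carrier_vec n" for v
      unfolding closed_loop_mult_vec[OF A B Y(1) y]
        scalar_prod_add_distrib[OF v c(3)[OF y] cB[OF cz(2)]] Bt(2)[OF c(5)[OF y] v] by simp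
    show "(?MX *\<^sub>v x) \<bullet> ((X - Y) *\<^sub>v y) + x \<bullet> ((X - Y) *\<^sub>v (?MY *\<^sub>v y)) = 0"
      unfolding Dv[OF MXx y] Dv[OF x MYy] tr[OF X(1,2) x MYy] tr[OF Y(1,2) x MYy]
        L[OF c(1)[OF y]] L[OF c(2)[OF y]] Rr[OF c(1)[OF x]] Rr[OF c(2)[OF x]]
      using hinf_ARE_carrier_eq[OF X(3) A B C X(1,2) x y] hinf_ARE_carrier_eq[OF Y(3) A B C Y(1,2) x y]
      by (simp add: algebra_simps)
  qed
  then show "x \<bullet> (X *\<^sub>v y) = x \<bullet> (Y *\<^sub>v y)" using Dv[OF x y] by simp
qed

text \<open>The optimal level is an infimum, so \<gamma> > \<gamma>0 yields an actual level strictly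
  below \<gamma>; strictness is what the small gain argument consumes.\<close>

lemma attenuation_level_below:
  assumes "ereal \<gamma>0 = optimal_level n m r A B C" "\<gamma>0 < \<gamma>"
  shows "\<exists>g\<in>attenuation_levels n m r A B C. g < \<gamma>"
proof -
  have "(INF \<gamma>\<in>attenuation_levels n m r A B C. ereal \<gamma>) < ereal \<gamma>"
    using assms unfolding optimal_level_def by (metis ereal_less_eq(3) less_le_not_le)
  then show ?thesis by (auto simp: INF_less_iff)
qed

text \<open>Uniqueness of \<open>W 2\<close> among semidefinite solutions is asserted for \<gamma> >
  1. For \<eta> < 0 there can be others: with A = -1, B = 1, C = c the Riccati equation c^2 - 2 x +
  |\<eta>| x^2 = 0 has two positive roots when 0 < |\<eta>| c^2 < 1.\<close>

theorem theorem2: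
  fixes n m r l d :: nat
    and A B C :: "real mat" and F G H :: "nat \<Rightarrow> real mat"
    and \<gamma> \<gamma>0 \<eta> \<rho> :: real
    and E :: "real vec \<Rightarrow> real" and w :: "nat \<Rightarrow> real vec" and W :: "nat \<Rightarrow> real mat"
    and f h :: "real vec \<Rightarrow> real vec" and g :: "real vec \<Rightarrow> real mat"
  assumes f: "f = poly_f n l A F" and g: "g = poly_g n m l B G" and h: "h = poly_h r l C H"
    and dims: "system_dims n m r l A B C F G H"
    and \<gamma>0: "ereal \<gamma>0 = optimal_level n m r A B C"
    and \<gamma>: "\<gamma> > \<gamma>0" "\<gamma>0 \<ge> 0" "\<gamma> \<noteq> 1"
    and \<eta>: "\<eta> = 1 - 1 / \<gamma>\<^sup>2"
    and \<rho>: "\<rho> > 0"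
    and energy: "is_future_energy n m \<gamma> \<eta> f g h (ball0 n \<rho>) E"
    and HJB: "\<forall>x\<in>ball0 n \<rho>. HJB n \<eta> f g h E x"
    and zero: "E (0\<^sub>v n) = 0"
    and stable: "asymptotically_stable n (closed_loop_field n \<eta> f g E)"
    and d: "d \<ge> 2"
    and expansion: "degree_d_expansion n d E w"
    and W: "\<forall>i\<in>{2..d}. W i \<in> carrier_mat n (n ^ (i - 1)) \<and> w i = vec_of_mat (W i)"
  shows "w 2 = vec_of_mat (W 2)
    \<and> symmetric_matrix (W 2) \<and> pos_semidef n (W 2) \<and> hinf_ARE n \<eta> A B C (W 2)
    \<and> (\<gamma> > 1 \<longrightarrow> (\<forall>X. symmetric_matrix X \<and> pos_semidef n X \<and> hinf_ARE n \<eta> A B C X \<longrightarrow> X = W 2))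
    \<and> (\<forall>k\<in>{3..d}. (\<exists>wt. coeff_system n m l \<eta> A B C F G H w W k wt)
         \<and> (\<forall>wt. coeff_system n m l \<eta> A B C F G H w W k wt \<longrightarrow> is_symmetrization n k wt (w k)))"
proof -
  have A: "A \<in> carrier_mat n n" and B: "B \<in> carrier_mat n m" and C: "C \<in> carrier_mat r n"
    using dims unfolding system_dims_def by auto
  note W2 = hinf_ARE_of_HJB[OF f g h dims \<rho> HJB d expansion W]
  have w2: "w 2 = vec_of_mat (W 2)" using bspec[OF W, of 2] d by simp
  have W2T: "(W 2)\<^sup>T = W 2" using W2(2) by (simp add: symmetric_matrix_def)
  obtain g0 where g0: "g0 \<in> attenuation_levels n m r A B C" "g0 < \<gamma>"
    using attenuation_level_below[OF \<gamma>0 \<gamma>(1)] by blast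
  let ?M = "A - \<eta> \<cdot>\<^sub>m (B * B\<^sup>T * W 2)"
  have M: "?M \<in> carrier_mat n n"
    using B W2(1) by (intro minus_carrier_mat smult_carrier_mat) auto
  have \<gamma>pos: "0 < \<gamma>" using \<gamma> by simp
  have psd_hurwitz: "pos_semidef n (W 2) \<and> hurwitz ?M"
  proof (cases "\<gamma> > 1")
    case True
    then have \<eta>pos: "0 < \<eta>" by (simp add: \<eta> one_less_power)
    have "pos_semidef n (W 2)"
      unfolding pos_semidef_def
      using W2(1) quadratic_part_nonneg[where w = w, OF expansion d W2(1) w2 energy_nonneg[OF energy \<eta>pos] \<rho>] by blast
    then show ?thesis using closed_loop_hurwitz_pos[OF A B C g0(1) \<eta>pos _ W2(2,3)] by blast
  next
    case False
    then have \<gamma>1: "\<gamma> < 1" using \<gamma>(3) by simp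
    have \<eta>neg: "\<eta> \<le> 0" using \<gamma>1 \<gamma>pos by (simp add: \<eta> power_le_one)
    have hA: "hurwitz A" using plant_hurwitz[OF A B C g0(1)] g0(2) \<gamma>1 by simp
    \<comment> \<open>For \<eta> \<le> 0 the quadratic term has the sign of - C^T C, so the Riccati
      equation is a Lyapunov inequality for the Hurwitz matrix A itself.\<close>
    have "0 \<le> x \<bullet> (W 2 *\<^sub>v x)" if x: "x \<in> carrier_vec n" for x
    proof (rule lyapunov_nonneg[OF A hA W2(1) _ x])
      fix x :: "real vec" assume x: "x \<in> carrier_vec n"
      have Ax: "A *\<^sub>v x \<in> carrier_vec n" using A x by (rule mult_mat_vec_carrier)
      have "x \<bullet> (W 2 *\<^sub>v (A *\<^sub>v x)) = (W 2 *\<^sub>v x) \<bullet> (A *\<^sub>v x)"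
        using transpose_mult_scalar_prod[OF W2(1) carrier_vecD[OF x] carrier_vecD[OF Ax]] unfolding W2T by simp
      moreover have "\<eta> * ((B\<^sup>T *\<^sub>v (W 2 *\<^sub>v x)) \<bullet> (B\<^sup>T *\<^sub>v (W 2 *\<^sub>v x))) \<le> 0"
        using \<eta>neg by (intro mult_nonpos_nonneg scalar_prod_self_nonneg)
      ultimately show "(A *\<^sub>v x) \<bullet> (W 2 *\<^sub>v x) + x \<bullet> (W 2 *\<^sub>v (A *\<^sub>v x)) \<le> 0"
        using hinf_ARE_carrier_eq[OF W2(3) A B C W2(1) W2T x x] scalar_prod_self_nonneg[of "C *\<^sub>v x"] by linarith
    qed
    then have psd: "pos_semidef n (W 2)" unfolding pos_semidef_def using W2(1) by blast
    have "hurwitz ?M"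
    proof (rule hurwitzI[OF M])
      fix a b :: "real vec" and \<alpha> \<omega> :: real
      assume ab: "a \<in> carrier_vec n" "b \<in> carrier_vec n" and \<alpha>: "0 \<le> \<alpha>"
        and eq: "?M *\<^sub>v a = \<alpha> \<cdot>\<^sub>v a - \<omega> \<cdot>\<^sub>v b" "?M *\<^sub>v b = \<alpha> \<cdot>\<^sub>v b + \<omega> \<cdot>\<^sub>v a"
      show "a = 0\<^sub>v n \<and> b = 0\<^sub>v n"
      proof (cases "\<alpha> = 0")
        case True
        show ?thesis
          by (rule closed_loop_no_imaginary_eigenvalue[OF A B C g0 \<gamma>pos \<gamma>1 \<eta> W2(1) W2T W2(3) ab
                eq[unfolded True]])
      next
        case False
        then have \<alpha>pos: "0 < \<alpha>" using \<alpha> by simp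
        obtain K \<delta> where K: "0 \<le> K" "0 < \<delta>" "\<forall>x\<in>ball0 n \<delta>. x \<noteq> 0\<^sub>v n \<longrightarrow>
            vnorm (closed_loop_field n \<eta> f g E x - ?M *\<^sub>v x) \<le> K * (vnorm x)\<^sup>2"
          using closed_loop_linearization[where \<eta> = \<eta> and W = W, OF dims expansion d W2(1) w2] unfolding f g by blast
        have "closed_loop_field n \<eta> f g E x \<in> carrier_vec n" for x
          using B by (intro carrier_vecI) (simp add: closed_loop_field_def g poly_g_def)
        then show ?thesis
          using linearization_not_unstable[OF M ab \<alpha>pos eq _ K(1,2) _ stable] K(3) by blast
      qed
    qed
    with psd show ?thesis by blast
  qed
  have unique: "X = W 2" if "\<gamma> > 1" "symmetric_matrix X" "pos_semidef n X" "hinf_ARE n \<eta> A B C X" for X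
  proof -
    have \<eta>pos: "0 < \<eta>" using that(1) by (simp add: \<eta> one_less_power)
    have X: "X \<in> carrier_mat n n" "X\<^sup>T = X"
      using that(2,3) by (auto simp: pos_semidef_def symmetric_matrix_def)
    \<comment> \<open>Any semidefinite solution is stabilizing by the argument used for
      \<open>W 2\<close>, so uniqueness of stabilizing solutions applies.\<close>
    show ?thesis
      using ARE_stabilizing_unique[OF A B C X that(4) closed_loop_hurwitz_pos[OF A B C g0(1) \<eta>pos that(3,2,4)]
          W2(1) W2T W2(3)] psd_hurwitz by blast
  qed
  have "(\<exists>wt. coeff_system n m l \<eta> A B C F G H w W k wt)
         \<and> (\<forall>wt. coeff_system n m l \<eta> A B C F G H w W k wt \<longrightarrow> is_symmetrization n k wt (w k))"
    if k: "k \<in> {3..d}" for k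
  proof -
    have "k \<in> {2..d}" "k > 0" using k by auto
    then have "symmetric_coeff n k (w k)"
      using expansion unfolding degree_d_expansion_def is_symmetrization_def by blast
    then show ?thesis
      using coeff_system_symmetrization[OF coeff_system_rhs_xpow[OF f g h dims \<rho> HJB d expansion W _ k] refl M _ \<open>k > 0\<close>]
        psd_hurwitz by blast
  qed
  then show ?thesis using w2 W2 psd_hurwitz unique by blast
qed

end
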